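(* Let $\rho$ be a Riemannian metric on the 2-torus $\mathbb{T}^2$ whose geodesic flow, with Hamiltonian $H$, has a first integral $F_4$ that is a homogeneous polynomial of degree $4$ in the momenta, written in normalized semi-geodesic coordinates. Let $\Omega_e\subset\mathbb{T}^2$ be an elliptic region for $F_4$. Then the following alternative holds: either the metric $\rho$ is flat on $\Omega_e$, or $F_4$ is reducible on $\Omega_e$, that is, it can be expressed on $\Omega_e$ as $$F_4=k_1F_2^2+2k_2HF_2+4k_3H^2,$$ where $F_2$ is a polynomial of degree $2$ in the momenta which is a first integral of the geodesic flow on $\Omega_e$, and $k_1,k_2,k_3$ are constants.
   Context: All objects are smooth. $\mathbb{T}^2=\mathbb{R}^2/\Gamma$, $\Gamma$ a lattice; $H:T^*\mathbb{T}^2\to\mathbb{R}$ is half the squared norm of the momentum. A first integral over an open set $\Omega$ is a function $F$ on $T^*\Omega$ with $\{F,H\}=0$. Normalized semi-geodesic coordinates (standing assumption; it is known that they exist): using a regular Liouville torus $L$ of the geodesic flow (a common level set of $F_n$ and $H$ on which $dF_n,dH$ are independent) that projects diffeomorphically onto $\mathbb{T}^2$, one has global coordinates $(t,x)$ on the covering plane, with conjugate momenta $(p_1,p_2)$, such that the curves $\{t=\text{const}\}$ are the geodesics of $L$ and $$ds^2=g^2(t,x)\,dt^2+dx^2,\quad g>0,\qquad H=\tfrac12\Big(\tfrac{p_1^2}{g^2}+p_2^2\Big).$$ The integral is written $F_n=\sum_{k=0}^n a_k(t,x)\frac{p_1^{n-k}}{g^{n-k}}p_2^k$ and is normalized so that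 $a_{n-1}\equiv g$ and $a_n\equiv 1$. For $n=4$, with $U=(a_0,a_1,a_2,a_3)^T$ and $a_4=1$, the condition $\{F_4,H\}=0$ becomes $U_t+A(U)U_x=0$ with $$A(U)=\begin{pmatrix}0&0&0&a_1\\ a_3&0&0&2a_2-4a_0\\ 0&a_3&0&3a_3-3a_1\\ 0&0&a_3&4a_4-2a_2\end{pmatrix}.$$ Elliptic region: a (nonempty) connected component $\Omega_e$ of the set of points of $\mathbb{T}^2$ at which the eigenvalues of $A(U)$ are distinct and two of them are non-real complex conjugates (the other two are then necessarily real). *)

theory Defs
  imports "HOL-Analysis.Analysis" "Jordan_Normal_Form.Char_Poly"
begin

type_synonym plane = "real \<times> real"

subsection \<open>Smooth maps\<close>

primrec Ck_on :: "nat \<Rightarrow> 'a::real_normed_vector set \<Rightarrow> ('a \<Rightarrow> 'b::real_normed_vector) \<Rightarrow> bool" where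
  "Ck_on 0 S f \<longleftrightarrow> continuous_on S f"
| "Ck_on (Suc k) S f \<longleftrightarrow> (\<forall>z\<in>S. f differentiable (at z)) \<and>
     (\<forall>v. Ck_on k S (\<lambda>z. frechet_derivative f (at z) v))"

text \<open>Only meant for open \<open>S\<close>: the derivatives are taken in the whole space.\<close>

definition smooth_on :: "'a::real_normed_vector set \<Rightarrow> ('a \<Rightarrow> 'b::real_normed_vector) \<Rightarrow> bool" where
  "smooth_on S f \<longleftrightarrow> (\<forall>k. Ck_on k S f)"

subsection \<open>The torus\<close>

definition is_lattice :: "plane set \<Rightarrow> bool" where
  "is_lattice \<Gamma> \<longleftrightarrow> (\<exists>u v. u \<noteq> v \<and> independent {u, v} \<and>
     \<Gamma> = {of_int m *\<^sub>R u + of_int n *\<^sub>R v |m n. True})"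

definition torus_proj :: "plane set \<Rightarrow> plane \<Rightarrow> plane set" where
  "torus_proj \<Gamma> q = (\<lambda>\<gamma>. q + \<gamma>) ` \<Gamma>"

text \<open>The quotient topology on the set of cosets of \<open>\<Gamma>\<close>.\<close>

definition torus :: "plane set \<Rightarrow> plane set topology" where
  "torus \<Gamma> = topology (\<lambda>W. W \<subseteq> range (torus_proj \<Gamma>) \<and> open (torus_proj \<Gamma> -` W))"

lemma istopology_torus: "istopology (\<lambda>W. W \<subseteq> range (torus_proj \<Gamma>) \<and> open (torus_proj \<Gamma> -` W))"
  unfolding istopology_def
proof (rule conjI)
  show "\<forall>S T. S \<subseteq> range (torus_proj \<Gamma>) \<and> open (torus_proj \<Gamma> -` S) \<longrightarrow>
      T \<subseteq> range (torus_proj \<Gamma>) \<and> open (torus_proj \<Gamma> -` T) \<longrightarrow>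
      S \<inter> T \<subseteq> range (torus_proj \<Gamma>) \<and> open (torus_proj \<Gamma> -` (S \<inter> T))"
    by (metis le_infI1 open_Int vimage_Int)
  show "\<forall>K. (\<forall>W\<in>K. W \<subseteq> range (torus_proj \<Gamma>) \<and> open (torus_proj \<Gamma> -` W)) \<longrightarrow>
      \<Union> K \<subseteq> range (torus_proj \<Gamma>) \<and> open (torus_proj \<Gamma> -` \<Union> K)"
    by (metis Sup_least open_UN vimage_Union)
qed

lemma openin_torus:
  "openin (torus \<Gamma>) W \<longleftrightarrow> W \<subseteq> range (torus_proj \<Gamma>) \<and> open (torus_proj \<Gamma> -` W)"
  unfolding torus_def topology_inverse'[OF istopology_torus] by (rule refl)

lemma topspace_torus: "topspace (torus \<Gamma>) = range (torus_proj \<Gamma>)"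
proof (rule antisym)
  show "topspace (torus \<Gamma>) \<subseteq> range (torus_proj \<Gamma>)"
    using openin_torus[of \<Gamma> "topspace (torus \<Gamma>)"] openin_topspace by blast
  have "torus_proj \<Gamma> -` range (torus_proj \<Gamma>) = UNIV"
    by blast
  then have "openin (torus \<Gamma>) (range (torus_proj \<Gamma>))"
    unfolding openin_torus by (metis open_UNIV subset_refl)
  then show "range (torus_proj \<Gamma>) \<subseteq> topspace (torus \<Gamma>)"
    by (rule openin_subset)
qed

lemma quotient_map_torus_proj: "quotient_map euclidean (torus \<Gamma>) (torus_proj \<Gamma>)"
  unfolding quotient_map_def topspace_torus openin_torus
  by (simp only: topspace_euclidean open_openin[symmetric] vimage_def UNIV_I simp_thms) blast

text \<open>Objects on the torus, or on an open subset of it, are represented by \<open>\<Gamma>\<close>-periodic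
  objects on the plane, or on the full preimage of the subset.  The cotangent bundle of the plane
  is \<open>plane \<times> plane\<close>; the covector \<open>p\<close> acts on the tangent vector \<open>v\<close> by \<open>inner p v\<close>.\<close>

definition periodic_metric :: "plane set \<Rightarrow> (plane \<Rightarrow> plane \<Rightarrow> plane \<Rightarrow> real) \<Rightarrow> bool" where
  "periodic_metric \<Gamma> \<rho> \<longleftrightarrow> (\<forall>q. \<forall>\<gamma>\<in>\<Gamma>. \<rho> (q + \<gamma>) = \<rho> q)"

definition periodic_on :: "plane set \<Rightarrow> plane set \<Rightarrow> (plane \<times> plane \<Rightarrow> real) \<Rightarrow> bool" where
  "periodic_on \<Gamma> S F \<longleftrightarrow> (\<forall>q\<in>S. \<forall>\<gamma>\<in>\<Gamma>. \<forall>p. F (q + \<gamma>, p) = F (q, p))"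

subsection \<open>Metrics, geodesic flows and first integrals\<close>

definition riemannian_metric :: "(plane \<Rightarrow> plane \<Rightarrow> plane \<Rightarrow> real) \<Rightarrow> bool" where
  "riemannian_metric \<rho> \<longleftrightarrow>
     (\<forall>q. bilinear (\<rho> q) \<and> (\<forall>v w. \<rho> q v w = \<rho> q w v) \<and> (\<forall>v. v \<noteq> 0 \<longrightarrow> 0 < \<rho> q v v)) \<and>
     (\<forall>v w. smooth_on UNIV (\<lambda>q. \<rho> q v w))"

definition sharp :: "(plane \<Rightarrow> plane \<Rightarrow> plane \<Rightarrow> real) \<Rightarrow> plane \<Rightarrow> plane \<Rightarrow> plane" where
  "sharp \<rho> q p = (THE w. \<forall>v. \<rho> q w v = inner p v)"

definition hamiltonian :: "(plane \<Rightarrow> plane \<Rightarrow> plane \<Rightarrow> real) \<Rightarrow> plane \<times> plane \<Rightarrow> real" where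
  "hamiltonian \<rho> = (\<lambda>(q, p). \<rho> q (sharp \<rho> q p) (sharp \<rho> q p) / 2)"

definition poisson :: "(plane \<times> plane \<Rightarrow> real) \<Rightarrow> (plane \<times> plane \<Rightarrow> real) \<Rightarrow> plane \<times> plane \<Rightarrow> real" where
  "poisson F G z = (\<Sum>e\<in>Basis.
     frechet_derivative F (at z) (e, 0) * frechet_derivative G (at z) (0, e) -
     frechet_derivative F (at z) (0, e) * frechet_derivative G (at z) (e, 0))"

definition first_integral_on ::
  "(plane \<Rightarrow> plane \<Rightarrow> plane \<Rightarrow> real) \<Rightarrow> plane set \<Rightarrow> (plane \<times> plane \<Rightarrow> real) \<Rightarrow> bool" where
  "first_integral_on \<rho> S F \<longleftrightarrow> smooth_on (S \<times> UNIV) F \<and>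
     (\<forall>z\<in>S \<times> UNIV. poisson F (hamiltonian \<rho>) z = 0)"

definition hom_poly_on :: "nat \<Rightarrow> plane set \<Rightarrow> (plane \<times> plane \<Rightarrow> real) \<Rightarrow> bool" where
  "hom_poly_on n S F \<longleftrightarrow> (\<exists>c. (\<forall>k\<le>n. smooth_on S (c k)) \<and>
     (\<forall>q\<in>S. \<forall>p1 p2. F (q, (p1, p2)) = (\<Sum>k\<le>n. c k q * p1 ^ (n - k) * p2 ^ k)))"

text \<open>Flatness: every point has a neighbourhood isometric to an open subset of the Euclidean
  plane.\<close>

definition flat_on :: "(plane \<Rightarrow> plane \<Rightarrow> plane \<Rightarrow> real) \<Rightarrow> plane set \<Rightarrow> bool" where
  "flat_on \<rho> S \<longleftrightarrow> (\<forall>q\<in>S. \<exists>V (\<psi> :: plane \<Rightarrow> plane). open V \<and> q \<in> V \<and> V \<subseteq> S \<and>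
     smooth_on V \<psi> \<and> inj_on \<psi> V \<and>
     (\<forall>z\<in>V. \<forall>v w. inner (frechet_derivative \<psi> (at z) v) (frechet_derivative \<psi> (at z) w) = \<rho> z v w))"

subsection \<open>Normalized semi-geodesic coordinates\<close>

definition diffeo_plane :: "(plane \<Rightarrow> plane) \<Rightarrow> bool" where
  "diffeo_plane \<Phi> \<longleftrightarrow> bij \<Phi> \<and> smooth_on UNIV \<Phi> \<and> smooth_on UNIV (inv_into UNIV \<Phi>)"

text \<open>A regular Liouville torus projecting diffeomorphically onto the torus is the graph of a
  periodic covector field \<open>\<xi>\<close>.  The graph is compact, connected and of dimension two, so by
  regularity it is a whole connected component of the common level set.\<close>

definition liouville_graph ::
  "plane set \<Rightarrow> (plane \<Rightarrow> plane \<Rightarrow> plane \<Rightarrow> real) \<Rightarrow> (plane \<times> plane \<Rightarrow> real) \<Rightarrow> (plane \<Rightarrow> plane) \<Rightarrow> bool" where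
  "liouville_graph \<Gamma> \<rho> F \<xi> \<longleftrightarrow> smooth_on UNIV \<xi> \<and> (\<forall>q. \<forall>\<gamma>\<in>\<Gamma>. \<xi> (q + \<gamma>) = \<xi> q) \<and>
     (\<exists>f h. \<forall>q. F (q, \<xi> q) = f \<and> hamiltonian \<rho> (q, \<xi> q) = h) \<and>
     (\<forall>q \<alpha> \<beta>. (\<forall>w. \<alpha> * frechet_derivative F (at (q, \<xi> q)) w +
                      \<beta> * frechet_derivative (hamiltonian \<rho>) (at (q, \<xi> q)) w = 0) \<longrightarrow>
              \<alpha> = 0 \<and> \<beta> = 0)"

text \<open>\<open>\<Phi> = (t, x)\<close> are the coordinates; \<open>g\<close> and the \<open>a k\<close> are functions of \<open>(t, x)\<close>.
  The projections of the orbits on the Liouville torus have velocity \<open>sharp \<rho> q (\<xi> q)\<close>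
  (Hamilton's equation), so the condition on \<open>\<xi>\<close> says that they are the curves \<open>t = const\<close>.
  The conjugate momenta of \<open>p\<close> are the \<open>P\<close> with \<open>p = adjoint (d\<Phi>) P\<close>.\<close>

definition normalized_semigeodesic ::
  "plane set \<Rightarrow> (plane \<Rightarrow> plane \<Rightarrow> plane \<Rightarrow> real) \<Rightarrow> nat \<Rightarrow> (plane \<times> plane \<Rightarrow> real) \<Rightarrow>
   (plane \<Rightarrow> plane) \<Rightarrow> (plane \<Rightarrow> real) \<Rightarrow> (nat \<Rightarrow> plane \<Rightarrow> real) \<Rightarrow> bool" where
  "normalized_semigeodesic \<Gamma> \<rho> n F \<Phi> g a \<longleftrightarrow>
     diffeo_plane \<Phi> \<and>
     smooth_on UNIV g \<and> (\<forall>k\<le>n. smooth_on UNIV (a k)) \<and>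
     (\<exists>\<xi>. liouville_graph \<Gamma> \<rho> F \<xi> \<and>
          (\<forall>q. fst (frechet_derivative \<Phi> (at q) (sharp \<rho> q (\<xi> q))) = 0)) \<and>
     (\<forall>y. 0 < g y) \<and>
     (\<forall>q v w. let d = frechet_derivative \<Phi> (at q) in
        \<rho> q v w = (g (\<Phi> q))\<^sup>2 * fst (d v) * fst (d w) + snd (d v) * snd (d w)) \<and>
     (\<forall>q p1 p2. F (q, adjoint (frechet_derivative \<Phi> (at q)) (p1, p2)) =
        (\<Sum>k\<le>n. a k (\<Phi> q) * (p1 ^ (n - k) / g (\<Phi> q) ^ (n - k)) * p2 ^ k)) \<and>
     (\<forall>y. a (n - 1) y = g y) \<and> (\<forall>y. a n y = 1)"

subsection \<open>Elliptic regions\<close>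

definition hydro_matrix :: "(nat \<Rightarrow> real) \<Rightarrow> complex mat" where
  "hydro_matrix U = map_mat complex_of_real (mat_of_rows_list 4
     [[0,   0,   0,   U 1],
      [U 3, 0,   0,   2 * U 2 - 4 * U 0],
      [0,   U 3, 0,   3 * U 3 - 3 * U 1],
      [0,   0,   U 3, 4 * U 4 - 2 * U 2]])"

definition elliptic_matrix :: "complex mat \<Rightarrow> bool" where
  "elliptic_matrix A \<longleftrightarrow> card {l. eigenvalue A l} = dim_row A \<and>
     (\<exists>l. l \<notin> \<real> \<and> eigenvalue A l \<and> eigenvalue A (cnj l))"

definition elliptic_set :: "plane set \<Rightarrow> (plane \<Rightarrow> plane) \<Rightarrow> (nat \<Rightarrow> plane \<Rightarrow> real) \<Rightarrow> plane set set" where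
  "elliptic_set \<Gamma> \<Phi> a =
     torus_proj \<Gamma> ` {q. elliptic_matrix (hydro_matrix (\<lambda>k. a k (\<Phi> q)))}"

definition elliptic_region ::
  "plane set \<Rightarrow> (plane \<Rightarrow> plane) \<Rightarrow> (nat \<Rightarrow> plane \<Rightarrow> real) \<Rightarrow> plane set set \<Rightarrow> bool" where
  "elliptic_region \<Gamma> \<Phi> a \<Omega> \<longleftrightarrow>
     \<Omega> \<in> connected_components_of (subtopology (torus \<Gamma>) (elliptic_set \<Gamma> \<Phi> a))"

end

theory Submission
  imports Defs
begin

text \<open>The eigenvalues of \<open>A(U)\<close> correspond to the critical points of \<open>F\<^sub>4\<close> on the unit cospheres, and the
  critical values are Riemann invariants; they are periodic because translations of the lattice
  preserve the coframe \<open>(g dt, dx)\<close> up to a common sign.  A critical value is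
  infinite at the zeros of the complex function \<open>(a\<^sub>0 - a\<^sub>2 + 1) + \<i> (a\<^sub>1 - a\<^sub>3)\<close>; it solves a system of
  Cauchy-Riemann type on the torus, so it has no zero or vanishes identically.  If it vanishes
  identically, then \<open>H\<close> divides \<open>F\<^sub>4\<close> and \<open>F\<^sub>2 = F\<^sub>4 / (2 H)\<close> is an integral.

  Otherwise let \<open>M\<close> be the maximum over the torus of the imaginary parts of the critical values.  If
  \<open>M = 0\<close>, the value at a complex critical point is a real constant \<open>c\<close> on \<open>\<Omega>\<^sub>e\<close>, it is also the
  value at the conjugate point, and \<open>F\<^sub>4 - 4 c H\<^sup>2\<close> is \<open>1 - c\<close> times the square of a quadratic form.

  If \<open>M > 0\<close>, the strong maximum principle shows that the imaginary part of a complex invariant is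
  identically \<open>M\<close>, so this invariant is constant and the whole torus is elliptic.  The remaining two
  invariants are real, and the gradient of a real one satisfies a Riccati equation along its
  characteristics.  At a maximum of a suitable weighted gradient this forces the gradient to
  vanish, unless a third derivative on the cosphere vanishes, which would make the critical values
  real.  So all invariants are constant, hence \<open>U\<close> is constant and the metric is flat.\<close>

section \<open>Smooth functions\<close>

text \<open>Compactness turns the local equations into rigidity. Maxima are taken over the critical
  points above the whole torus, since a supremum over an elliptic region alone could be approached
  only at its boundary. The case of an infinite critical value has to be split off before any
  maximum is formed, because otherwise the critical values are not continuous on the compact set of
  critical points.

  That the exceptional function Z has no isolated zero is proved by energy. If w is a regularised d
  arg Z, the form d(H w) has mean zero over a period, and the equation for Z turns it into the
  Dirichlet density of log |Z| up to a bounded error.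

  Roots are differentiated only once: the x-derivative of a critical value is explicit in the root,
  so second derivatives of the invariants still exist. Moreover the coordinates live on the covering
  plane, where the lattice must first be shown to act by translations; the common sign cannot be -1,
  because a point reflection has a fixed point.\<close>

lemma Ck_on_cong:
  assumes "open S" "\<And>z. z \<in> S \<Longrightarrow> f z = g z" "Ck_on k S f"
  shows "Ck_on k S g"
  using assms(2,3)
proof (induction k arbitrary: f g)
  case 0
  have "continuous_on S f \<longleftrightarrow> continuous_on S g" by (rule continuous_on_cong[OF refl 0(1)])
  then show ?case using 0(2) by simp
next
  case (Suc k)
  have df: "(f has_derivative frechet_derivative f (at z)) (at z)" if "z \<in> S" for z
    using Suc.prems(2) that by (simp add: frechet_derivative_works)
  have *: "(g has_derivative frechet_derivative f (at z)) (at z)" if z: "z \<in> S" for z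
    by (rule has_derivative_transform_within_open[OF df[OF z] assms(1) z]) (rule Suc.prems(1))
  have eq: "frechet_derivative f (at z) v = frechet_derivative g (at z) v" if "z \<in> S" for z v
    using frechet_derivative_at[OF *[OF that]] by simp
  have "Ck_on k S (\<lambda>z. frechet_derivative g (at z) v)" for v
    by (rule Suc.IH[of "\<lambda>z. frechet_derivative f (at z) v"]) (use Suc.prems(2) eq in simp_all)
  then show ?case
    using * unfolding Ck_on.simps differentiable_def by blast
qed

lemma Ck_on_Suc: "Ck_on (Suc k) S f \<Longrightarrow> Ck_on k S f"
proof (induction k arbitrary: f)
  case 0
  then show ?case
    by (auto intro!: continuous_at_imp_continuous_on differentiable_imp_continuous_within)
next
  case (Suc k)
  show ?case
    unfolding Ck_on.simps(2)[of k]
  proof (intro conjI ballI allI)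
    fix z v
    show "f differentiable at z" if "z \<in> S" using Suc.prems that by simp
    show "Ck_on k S (\<lambda>z. frechet_derivative f (at z) v)"
      by (rule Suc.IH) (use Suc.prems in simp)
  qed
qed

lemma smooth_on_cong:
  "open S \<Longrightarrow> (\<And>z. z \<in> S \<Longrightarrow> f z = g z) \<Longrightarrow> smooth_on S f \<Longrightarrow> smooth_on S g"
  unfolding smooth_on_def using Ck_on_cong by blast

lemma Ck_on_subset: "Ck_on k S f \<Longrightarrow> T \<subseteq> S \<Longrightarrow> Ck_on k T f"
proof (induction k arbitrary: f)
  case 0 then show ?case by (auto intro: continuous_on_subset)
next
  case (Suc k) then show ?case by auto
qed

lemma smooth_on_subset: "smooth_on S f \<Longrightarrow> T \<subseteq> S \<Longrightarrow> smooth_on T f"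
  unfolding smooth_on_def using Ck_on_subset by blast

lemma smooth_on_differentiable: "smooth_on S f \<Longrightarrow> z \<in> S \<Longrightarrow> f differentiable (at z)"
  unfolding smooth_on_def by (metis Ck_on.simps(2))

lemma smooth_on_has_derivative:
  "smooth_on S f \<Longrightarrow> z \<in> S \<Longrightarrow> (f has_derivative frechet_derivative f (at z)) (at z)"
  using smooth_on_differentiable frechet_derivative_works by blast

lemma smooth_on_frechet: "smooth_on S f \<Longrightarrow> smooth_on S (\<lambda>z. frechet_derivative f (at z) v)"
  unfolding smooth_on_def by (metis Ck_on.simps(2))

lemma smooth_on_continuous: "smooth_on S f \<Longrightarrow> continuous_on S f"
  unfolding smooth_on_def by (metis Ck_on.simps(1))

text \<open>It is enough to exhibit a candidate derivative: by uniqueness it agrees with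
  \<open>frechet_derivative\<close> on the open set and passes its regularity on. The inductions for
  sums, products, inverses and roots below go through this rule.\<close>

lemma Ck_on_SucI:
  assumes "open S" "\<And>z. z \<in> S \<Longrightarrow> (f has_derivative f' z) (at z)"
    and "\<And>v. Ck_on k S (\<lambda>z. f' z v)"
  shows "Ck_on (Suc k) S f"
  unfolding Ck_on.simps
proof (intro conjI ballI allI)
  fix v
  show "Ck_on k S (\<lambda>z. frechet_derivative f (at z) v)"
    by (rule Ck_on_cong[OF assms(1) _ assms(3)[of v]])
       (use frechet_derivative_at[OF assms(2)] in auto)
qed (use assms(2) in \<open>auto simp: differentiable_def\<close>)

lemma Ck_on_const: "open S \<Longrightarrow> Ck_on k S (\<lambda>z. c)"
proof (induction k arbitrary: c)
  case (Suc k)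
  show ?case by (rule Ck_on_SucI[where f' = "\<lambda>z v. 0"]) (use Suc in auto)
qed simp

lemma Ck_on_add: "open S \<Longrightarrow> Ck_on k S f \<Longrightarrow> Ck_on k S g \<Longrightarrow> Ck_on k S (\<lambda>z. f z + g z)"
proof (induction k arbitrary: f g)
  case 0 then show ?case by (auto intro: continuous_on_add)
next
  case (Suc k)
  show ?case
    by (rule Ck_on_SucI[where f' = "\<lambda>z v. frechet_derivative f (at z) v + frechet_derivative g (at z) v"])
       (use Suc in \<open>auto intro!: has_derivative_add simp: frechet_derivative_works[symmetric]\<close>)
qed

lemma Ck_on_mult:
  fixes f g :: "'a::real_normed_vector \<Rightarrow> real"
  shows "open S \<Longrightarrow> Ck_on k S f \<Longrightarrow> Ck_on k S g \<Longrightarrow> Ck_on k S (\<lambda>z. f z * g z)"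
proof (induction k arbitrary: f g)
  case 0 then show ?case by (auto intro: continuous_on_mult)
next
  case (Suc k)
  have fg: "Ck_on k S f" "Ck_on k S g" using Suc.prems Ck_on_Suc by blast+
  show ?case
    by (rule Ck_on_SucI[where f' = "\<lambda>z v. f z * frechet_derivative g (at z) v + frechet_derivative f (at z) v * g z"])
       (use Suc fg in \<open>auto intro!: has_derivative_mult Ck_on_add simp: frechet_derivative_works[symmetric]\<close>)
qed

lemma Ck_on_inverse:
  fixes f :: "'a::real_normed_vector \<Rightarrow> real"
  assumes "open S" "\<And>z. z \<in> S \<Longrightarrow> f z \<noteq> 0"
  shows "Ck_on k S f \<Longrightarrow> Ck_on k S (\<lambda>z. inverse (f z))"
proof (induction k)
  case 0 then show ?case using assms by (auto intro: continuous_on_inverse)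
next
  case (Suc k)
  have inv: "Ck_on k S (\<lambda>z. inverse (f z))" using Suc Ck_on_Suc by blast
  have "Ck_on k S (\<lambda>z. -1 * (inverse (f z) * frechet_derivative f (at z) v * inverse (f z)))" for v
    by (intro Ck_on_mult Ck_on_const assms inv) (use Suc.prems in simp)
  then show ?case
    by (intro Ck_on_SucI[where f' = "\<lambda>z v. - (inverse (f z) * frechet_derivative f (at z) v * inverse (f z))"])
       (use Suc assms in \<open>auto intro!: has_derivative_inverse simp: frechet_derivative_works[symmetric]\<close>)
qed

lemma Ck_on_sqrt:
  fixes f :: "'a::real_normed_vector \<Rightarrow> real"
  assumes "open S" "\<And>z. z \<in> S \<Longrightarrow> f z > 0"
  shows "Ck_on k S f \<Longrightarrow> Ck_on k S (\<lambda>z. sqrt (f z))"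
proof (induction k)
  case 0 then show ?case using assms by (auto intro: continuous_on_real_sqrt)
next
  case (Suc k)
  have sq: "Ck_on k S (\<lambda>z. sqrt (f z))" using Suc Ck_on_Suc by blast
  have "Ck_on k S (\<lambda>z. inverse 2 * (inverse (sqrt (f z)) * frechet_derivative f (at z) v))" for v
    by (intro Ck_on_mult Ck_on_const assms Ck_on_inverse sq) (use Suc.prems assms(2) in \<open>auto simp: less_imp_neq[symmetric]\<close>)
  moreover have "((\<lambda>z. sqrt (f z)) has_derivative
      (\<lambda>v. inverse 2 * (inverse (sqrt (f z)) * frechet_derivative f (at z) v))) (at z)" if "z \<in> S" for z
  proof -
    have "(f has_derivative frechet_derivative f (at z)) (at z)"
      using Suc.prems that by (simp add: frechet_derivative_works[symmetric])
    from has_derivative_real_sqrt[OF assms(2)[OF that] this]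
    show ?thesis by (simp add: field_simps)
  qed
  ultimately show ?case
    by (intro Ck_on_SucI[OF assms(1)]) auto
qed

lemma smooth_on_ln:
  fixes f :: "'a::real_normed_vector \<Rightarrow> real"
  assumes "open S" "\<And>z. z \<in> S \<Longrightarrow> f z > 0" "smooth_on S f"
  shows "smooth_on S (\<lambda>z. ln (f z))"
  unfolding smooth_on_def
proof
  fix k
  have ck: "Ck_on k S f" for k using assms(3) by (simp add: smooth_on_def)
  show "Ck_on k S (\<lambda>z. ln (f z))"
  proof (cases k)
    case 0
    have "f z \<noteq> 0" if "z \<in> S" for z using assms(2)[OF that] by simp
    then show ?thesis using 0 assms smooth_on_continuous by (auto intro!: continuous_on_ln)
  next
    case (Suc j)
    have "Ck_on j S (\<lambda>z. frechet_derivative f (at z) v * inverse (f z))" for v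
      by (intro Ck_on_mult assms Ck_on_inverse ck)
         (use ck[of "Suc j"] assms(2) in \<open>auto simp: less_imp_neq[symmetric]\<close>)
    then show ?thesis unfolding Suc
      by (intro Ck_on_SucI[where f' = "\<lambda>z v. frechet_derivative f (at z) v * inverse (f z)"] assms)
         (use assms smooth_on_has_derivative in \<open>auto intro!: derivative_eq_intros simp: field_simps\<close>)
  qed
qed

lemma smooth_on_const [intro]: "open S \<Longrightarrow> smooth_on S (\<lambda>z. c)"
  and smooth_on_add [intro]:
    "open S \<Longrightarrow> smooth_on S f \<Longrightarrow> smooth_on S g \<Longrightarrow> smooth_on S (\<lambda>z. f z + g z)"
  by (simp_all add: smooth_on_def Ck_on_const Ck_on_add)

lemma smooth_on_mult [intro]:
  fixes f g :: "'a::real_normed_vector \<Rightarrow> real"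
  shows "open S \<Longrightarrow> smooth_on S f \<Longrightarrow> smooth_on S g \<Longrightarrow> smooth_on S (\<lambda>z. f z * g z)"
  by (simp add: smooth_on_def Ck_on_mult)

lemma smooth_on_diff [intro]:
  fixes f g :: "'a::real_normed_vector \<Rightarrow> real"
  assumes "open S" "smooth_on S f" "smooth_on S g"
  shows "smooth_on S (\<lambda>z. f z - g z)"
  using smooth_on_add[OF assms(1,2) smooth_on_mult[OF assms(1) smooth_on_const[OF assms(1), of "-1"] assms(3)]]
  by simp

lemma smooth_on_divide [intro]:
  fixes f g :: "'a::real_normed_vector \<Rightarrow> real"
  assumes "open S" "smooth_on S f" "smooth_on S g" "\<And>z. z \<in> S \<Longrightarrow> g z \<noteq> 0"
  shows "smooth_on S (\<lambda>z. f z / g z)"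
  using assms by (simp add: smooth_on_def divide_inverse Ck_on_mult Ck_on_inverse)

lemma smooth_on_sqrt [intro]:
  fixes f :: "'a::real_normed_vector \<Rightarrow> real"
  assumes "open S" "smooth_on S f" "\<And>z. z \<in> S \<Longrightarrow> f z > 0"
  shows "smooth_on S (\<lambda>z. sqrt (f z))"
  using assms by (simp add: smooth_on_def Ck_on_sqrt)

lemma smooth_on_power [intro]:
  fixes f :: "'a::real_normed_vector \<Rightarrow> real"
  shows "open S \<Longrightarrow> smooth_on S f \<Longrightarrow> smooth_on S (\<lambda>z. f z ^ n)"
  by (induction n) (auto simp: smooth_on_def Ck_on_const Ck_on_mult)

lemma smooth_on_linear:
  assumes "open S" "bounded_linear f"
  shows "smooth_on S f"
  unfolding smooth_on_def
proof
  fix k show "Ck_on k S f"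
  proof (cases k)
    case 0 then show ?thesis using assms(2) by (simp add: linear_continuous_on)
  next
    case (Suc j)
    show ?thesis unfolding Suc
      by (rule Ck_on_SucI[where f' = "\<lambda>z. f"])
         (use assms in \<open>auto intro: bounded_linear_imp_has_derivative Ck_on_const\<close>)
  qed
qed

lemma smooth_on_compose_linear:
  assumes S: "open S" and f: "smooth_on S f" and L: "bounded_linear L"
  shows "smooth_on S (\<lambda>z. L (f z))"
  unfolding smooth_on_def
proof
  fix k show "Ck_on k S (\<lambda>z. L (f z))"
    using f
  proof (induction k arbitrary: f)
    case 0
    then show ?case using L by (auto intro: bounded_linear.continuous_on smooth_on_continuous)
  next
    case (Suc k)
    have "((\<lambda>z. L (f z)) has_derivative (\<lambda>v. L (frechet_derivative f (at z) v))) (at z)" if "z \<in> S" for z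
      by (rule bounded_linear.has_derivative[OF L smooth_on_has_derivative[OF Suc.prems that]])
    then show ?case
      by (rule Ck_on_SucI[OF S]) (use Suc.IH[OF smooth_on_frechet[OF Suc.prems]] in auto)
  qed
qed

lemma smooth_on_fst:
  fixes f :: "'a::real_normed_vector \<Rightarrow> 'c::real_normed_vector"
  assumes "open S" "smooth_on S f"
  shows "smooth_on (S \<times> (UNIV :: 'b::real_normed_vector set)) (\<lambda>z. f (fst z))"
  unfolding smooth_on_def
proof
  fix k
  have o: "open (S \<times> (UNIV :: 'b set))" using assms by (intro open_Times) auto
  show "Ck_on k (S \<times> (UNIV :: 'b set)) (\<lambda>z. f (fst z))"
    using assms(2)
  proof (induction k arbitrary: f)
    case 0
    then show ?case
      by (auto intro!: continuous_on_compose2[OF smooth_on_continuous[OF 0]] continuous_intros)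
  next
    case (Suc k)
    have "((\<lambda>z::'a \<times> 'b. f (fst z)) has_derivative (\<lambda>v. frechet_derivative f (at (fst z)) (fst v))) (at z)"
      if "z \<in> S \<times> UNIV" for z
      using that by (intro has_derivative_compose[OF has_derivative_fst[OF has_derivative_ident]]
                           smooth_on_has_derivative[OF Suc.prems]) auto
    then show ?case
      by (rule Ck_on_SucI[OF o]) (use Suc.IH[OF smooth_on_frechet[OF Suc.prems]] in auto)
  qed
qed

section \<open>Partial derivatives in the plane\<close>

text \<open>The whole derivative is recorded by its two partial values, so the calculus rules yield
  explicit values directly. The target is a general normed space because root branches are
  complex.\<close>

definition has_pd :: "(plane \<Rightarrow> 'b::real_normed_vector) \<Rightarrow> 'b \<Rightarrow> 'b \<Rightarrow> plane \<Rightarrow> bool" where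
  "has_pd f A B y \<longleftrightarrow> (f has_derivative (\<lambda>w. fst w *\<^sub>R A + snd w *\<^sub>R B)) (at y)"

definition d1 :: "(plane \<Rightarrow> 'b::real_normed_vector) \<Rightarrow> plane \<Rightarrow> 'b" where
  "d1 f y = frechet_derivative f (at y) (1, 0)"

definition d2 :: "(plane \<Rightarrow> 'b::real_normed_vector) \<Rightarrow> plane \<Rightarrow> 'b" where
  "d2 f y = frechet_derivative f (at y) (0, 1)"

lemma has_pd_unique: "has_pd f A B y \<Longrightarrow> has_pd f A' B' y \<Longrightarrow> A = A' \<and> B = B'"
proof -
  assume "has_pd f A B y" "has_pd f A' B' y"
  then have "(\<lambda>w. fst w *\<^sub>R A + snd w *\<^sub>R B) = (\<lambda>w. fst w *\<^sub>R A' + snd w *\<^sub>R B')"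
    unfolding has_pd_def by (rule has_derivative_unique)
  from fun_cong[OF this, of "(1,0)"] fun_cong[OF this, of "(0,1)"] show ?thesis by simp
qed

lemma has_pd_d: "has_pd f A B y \<Longrightarrow> d1 f y = A \<and> d2 f y = B"
proof -
  assume "has_pd f A B y"
  then have "(\<lambda>w. fst w *\<^sub>R A + snd w *\<^sub>R B) = frechet_derivative f (at y)"
    unfolding has_pd_def by (rule frechet_derivative_at)
  from fun_cong[OF this, of "(1,0)"] fun_cong[OF this, of "(0,1)"] show ?thesis
    by (simp add: d1_def d2_def)
qed

lemma frechet_plane:
  assumes "f differentiable (at (y::plane))"
  shows "frechet_derivative f (at y) w = fst w *\<^sub>R d1 f y + snd w *\<^sub>R d2 f y"
proof -
  have l: "linear (frechet_derivative f (at y))"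
    using assms by (simp add: linear_frechet_derivative)
  have "frechet_derivative f (at y) w =
      frechet_derivative f (at y) (fst w *\<^sub>R (1,0) + snd w *\<^sub>R (0,1))"
    by (simp add: prod_eq_iff)
  also have "\<dots> = fst w *\<^sub>R d1 f y + snd w *\<^sub>R d2 f y"
    unfolding linear_add[OF l] linear_scale[OF l] d1_def d2_def ..
  finally show ?thesis .
qed

lemma differentiable_has_pd:
  "f differentiable (at y) \<Longrightarrow> has_pd f (d1 f y) (d2 f y) y"
  unfolding has_pd_def frechet_plane[symmetric]
  by (simp add: frechet_derivative_works[symmetric])

lemma smooth_has_pd: "smooth_on S f \<Longrightarrow> y \<in> S \<Longrightarrow> has_pd f (d1 f y) (d2 f y) y"
  by (rule differentiable_has_pd[OF smooth_on_differentiable])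

lemma smooth_d1 [intro]: "smooth_on S f \<Longrightarrow> smooth_on S (d1 f)"
  and smooth_d2 [intro]: "smooth_on S f \<Longrightarrow> smooth_on S (d2 f)"
  using smooth_on_frechet[of S f "(1,0)"] smooth_on_frechet[of S f "(0,1)"]
  by (simp_all add: d1_def[abs_def] d2_def[abs_def])

lemma has_pd_eq: "has_pd f A B y \<Longrightarrow> A = A' \<Longrightarrow> B = B' \<Longrightarrow> has_pd f A' B' y"
  by simp

lemma has_pd_isCont: "has_pd f A B y \<Longrightarrow> isCont f y"
  unfolding has_pd_def by (rule has_derivative_continuous)

lemma has_pd_const: "has_pd (\<lambda>y. c) 0 0 y"
  by (simp add: has_pd_def)

lemma has_pd_add: "has_pd f A B y \<Longrightarrow> has_pd g C D y \<Longrightarrow> has_pd (\<lambda>y. f y + g y) (A + C) (B + D) y"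
  unfolding has_pd_def by (auto intro!: derivative_eq_intros simp: algebra_simps)

lemma has_pd_diff: "has_pd f A B y \<Longrightarrow> has_pd g C D y \<Longrightarrow> has_pd (\<lambda>y. f y - g y) (A - C) (B - D) y"
  unfolding has_pd_def by (auto intro!: derivative_eq_intros simp: algebra_simps)

lemma has_pd_minus: "has_pd f A B y \<Longrightarrow> has_pd (\<lambda>y. - f y) (- A) (- B) y"
  unfolding has_pd_def by (auto intro!: derivative_eq_intros simp: algebra_simps)

lemma has_pd_mult:
  fixes f g :: "plane \<Rightarrow> 'b::real_normed_field"
  shows "has_pd f A B y \<Longrightarrow> has_pd g C D y \<Longrightarrow>
    has_pd (\<lambda>y. f y * g y) (A * g y + f y * C) (B * g y + f y * D) y"
  unfolding has_pd_def
  by (auto intro!: derivative_eq_intros simp: algebra_simps)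

lemma has_pd_power:
  fixes f :: "plane \<Rightarrow> 'b::real_normed_field"
  shows "has_pd f A B y \<Longrightarrow> has_pd (\<lambda>y. f y ^ n) (of_nat n * f y ^ (n - 1) * A) (of_nat n * f y ^ (n - 1) * B) y"
  unfolding has_pd_def
  by (auto intro!: derivative_eq_intros simp: algebra_simps)

lemma has_pd_divide:
  fixes f g :: "plane \<Rightarrow> 'b::real_normed_field"
  shows "has_pd f A B y \<Longrightarrow> has_pd g C D y \<Longrightarrow> g y \<noteq> 0 \<Longrightarrow>
    has_pd (\<lambda>y. f y / g y) ((A * g y - f y * C) / (g y)\<^sup>2) ((B * g y - f y * D) / (g y)\<^sup>2) y"
  unfolding has_pd_def
  by (rule derivative_eq_intros | assumption)+
     (auto simp: scaleR_conv_of_real field_simps power2_eq_square)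

lemma has_pd_linear:
  assumes "bounded_linear L" "has_pd f A B y"
  shows "has_pd (\<lambda>y. L (f y)) (L A) (L B) y"
proof -
  interpret bounded_linear L by fact
  show ?thesis using has_derivative[OF assms(2)[unfolded has_pd_def]]
    by (simp add: has_pd_def add scaleR)
qed

lemmas has_pd_Re = has_pd_linear[OF bounded_linear_Re]
  and has_pd_Im = has_pd_linear[OF bounded_linear_Im]
  and has_pd_cnj = has_pd_linear[OF bounded_linear_cnj]

lemma has_pd_of_real:
  "has_pd f A B y \<Longrightarrow> has_pd (\<lambda>y. complex_of_real (f y)) (complex_of_real A) (complex_of_real B) y"
  by (rule has_pd_linear[OF bounded_linear_of_real])

lemma has_pd_chain_real:
  assumes "has_pd f A B y" "(h has_real_derivative h') (at (f y))"
  shows "has_pd (\<lambda>y. h (f y)) (h' * A) (h' * B) y"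
  using has_derivative_compose[OF assms(1)[unfolded has_pd_def] assms(2)[unfolded has_field_derivative_def]]
  by (simp add: has_pd_def algebra_simps)

lemma has_pd_transform:
  assumes "has_pd f A B y" "open S" "y \<in> S" "\<And>z. z \<in> S \<Longrightarrow> f z = g z"
  shows "has_pd g A B y"
  using assms has_derivative_transform_within_open unfolding has_pd_def by blast

lemma has_pd_line:
  assumes "has_pd f A B (y + \<tau> *\<^sub>R w)"
  shows "((\<lambda>\<tau>. f (y + \<tau> *\<^sub>R w)) has_vector_derivative (fst w *\<^sub>R A + snd w *\<^sub>R B)) (at \<tau>)"
proof -
  have "((\<lambda>\<tau>. y + \<tau> *\<^sub>R w) has_derivative (\<lambda>h. h *\<^sub>R w)) (at \<tau>)"
    by (auto intro!: derivative_eq_intros)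
  from has_derivative_compose[OF this assms[unfolded has_pd_def]]
  show ?thesis by (simp add: has_vector_derivative_def scaleR_add_right)
qed

lemma has_pd_line_real:
  fixes f :: "plane \<Rightarrow> real"
  assumes "has_pd f A B (y + \<tau> *\<^sub>R w)"
  shows "((\<lambda>\<tau>. f (y + \<tau> *\<^sub>R w)) has_real_derivative (fst w * A + snd w * B)) (at \<tau>)"
  using has_pd_line[OF assms] by (simp add: has_real_derivative_iff_has_vector_derivative)

text \<open>Both mixed derivatives are limits of the same second difference quotient.\<close>

lemma mixed_difference:
  fixes f :: "plane \<Rightarrow> real"
  assumes f: "smooth_on UNIV f" and h: "h > 0"
  obtains \<xi> \<eta> where "0 < \<xi>" "\<xi> < h" "0 < \<eta>" "\<eta> < h"
    "f (a + h, b + h) - f (a + h, b) - f (a, b + h) + f (a, b) = h * h * d2 (d1 f) (a + \<xi>, b + \<eta>)"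
proof -
  have D1: "((\<lambda>\<tau>. f (\<tau>, c)) has_real_derivative d1 f (\<tau>, c)) (at \<tau>)" for \<tau> c
    using has_pd_line_real[of f _ _ "(0,c)" \<tau> "(1,0)", OF smooth_has_pd[OF f]] by simp
  have D2: "((\<lambda>\<tau>. d1 f (c, \<tau>)) has_real_derivative d2 (d1 f) (c, \<tau>)) (at \<tau>)" for \<tau> c
    using has_pd_line_real[of "d1 f" _ _ "(c,0)" \<tau> "(0,1)", OF smooth_has_pd[OF smooth_d1[OF f]]] by simp
  obtain \<xi> where \<xi>: "a < \<xi>" "\<xi> < a + h"
    "(f (a + h, b + h) - f (a + h, b)) - (f (a, b + h) - f (a, b)) = (a + h - a) * (d1 f (\<xi>, b + h) - d1 f (\<xi>, b))"
    using MVT2[of a "a + h" "\<lambda>\<tau>. f (\<tau>, b + h) - f (\<tau>, b)" "\<lambda>\<tau>. d1 f (\<tau>, b + h) - d1 f (\<tau>, b)"] h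
      DERIV_diff[OF D1 D1] by auto
  obtain \<eta> where \<eta>: "b < \<eta>" "\<eta> < b + h"
    "d1 f (\<xi>, b + h) - d1 f (\<xi>, b) = (b + h - b) * d2 (d1 f) (\<xi>, \<eta>)"
    using MVT2[of b "b + h" "\<lambda>\<tau>. d1 f (\<xi>, \<tau>)" "\<lambda>\<tau>. d2 (d1 f) (\<xi>, \<tau>)"] h D2 by auto
  show ?thesis
    using that[of "\<xi> - a" "\<eta> - b"] \<xi> \<eta> by (simp add: algebra_simps)
qed

lemma mixed_difference':
  fixes f :: "plane \<Rightarrow> real"
  assumes f: "smooth_on UNIV f" and h: "h > 0"
  obtains \<xi> \<eta> where "0 < \<xi>" "\<xi> < h" "0 < \<eta>" "\<eta> < h"
    "f (a + h, b + h) - f (a + h, b) - f (a, b + h) + f (a, b) = h * h * d1 (d2 f) (a + \<xi>, b + \<eta>)"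
proof -
  have D2: "((\<lambda>\<tau>. f (c, \<tau>)) has_real_derivative d2 f (c, \<tau>)) (at \<tau>)" for \<tau> c
    using has_pd_line_real[of f _ _ "(c,0)" \<tau> "(0,1)", OF smooth_has_pd[OF f]] by simp
  have D1: "((\<lambda>\<tau>. d2 f (\<tau>, c)) has_real_derivative d1 (d2 f) (\<tau>, c)) (at \<tau>)" for \<tau> c
    using has_pd_line_real[of "d2 f" _ _ "(0,c)" \<tau> "(1,0)", OF smooth_has_pd[OF smooth_d2[OF f]]] by simp
  obtain \<eta> where \<eta>: "b < \<eta>" "\<eta> < b + h"
    "(f (a + h, b + h) - f (a, b + h)) - (f (a + h, b) - f (a, b)) = (b + h - b) * (d2 f (a + h, \<eta>) - d2 f (a, \<eta>))"
    using MVT2[of b "b + h" "\<lambda>\<tau>. f (a + h, \<tau>) - f (a, \<tau>)" "\<lambda>\<tau>. d2 f (a + h, \<tau>) - d2 f (a, \<tau>)"] h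
      DERIV_diff[OF D2 D2] by auto
  obtain \<xi> where \<xi>: "a < \<xi>" "\<xi> < a + h"
    "d2 f (a + h, \<eta>) - d2 f (a, \<eta>) = (a + h - a) * d1 (d2 f) (\<xi>, \<eta>)"
    using MVT2[of a "a + h" "\<lambda>\<tau>. d2 f (\<tau>, \<eta>)" "\<lambda>\<tau>. d1 (d2 f) (\<tau>, \<eta>)"] h D1 by auto
  show ?thesis
    using that[of "\<xi> - a" "\<eta> - b"] \<xi> \<eta> by (simp add: algebra_simps)
qed

lemma d1_d2_commute:
  fixes f :: "plane \<Rightarrow> real"
  assumes f: "smooth_on UNIV f"
  shows "d1 (d2 f) y = d2 (d1 f) y"
proof (rule ccontr)
  obtain a b where y: "y = (a, b)" by (cases y)
  define A B where "A = d1 (d2 f)" and "B = d2 (d1 f)"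
  have c: "continuous_on UNIV A" "continuous_on UNIV B"
    unfolding A_def B_def using f by (auto intro!: smooth_on_continuous)
  assume "d1 (d2 f) y \<noteq> d2 (d1 f) y"
  then have e: "\<bar>A y - B y\<bar> / 2 > 0" by (simp add: A_def B_def)
  have "isCont A y" "isCont B y" using c by (metis UNIV_I continuous_on_eq_continuous_at open_UNIV)+
  from this(1)[unfolded continuous_at_eps_delta, rule_format, OF e]
       this(2)[unfolded continuous_at_eps_delta, rule_format, OF e]
  obtain r s where rs: "r > 0" "s > 0" "\<And>z. dist z y < r \<Longrightarrow> dist (A z) (A y) < \<bar>A y - B y\<bar> / 2"
    "\<And>z. dist z y < s \<Longrightarrow> dist (B z) (B y) < \<bar>A y - B y\<bar> / 2"
    by blast
  \<comment> \<open>Side of a square on which both mixed derivatives stay within half the assumed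
    gap of their values at \<open>y\<close>; points of the square have distance below
    \<open>2 * h\<close> from that corner.\<close>
  define h where "h = min r s / 2"
  have h: "h > 0" using rs by (simp add: h_def)
  obtain \<xi> \<eta> where 1: "0 < \<xi>" "\<xi> < h" "0 < \<eta>" "\<eta> < h"
    "f (a + h, b + h) - f (a + h, b) - f (a, b + h) + f (a, b) = h * h * B (a + \<xi>, b + \<eta>)"
    unfolding B_def by (rule mixed_difference[OF f h])
  obtain \<xi>' \<eta>' where 2: "0 < \<xi>'" "\<xi>' < h" "0 < \<eta>'" "\<eta>' < h"
    "f (a + h, b + h) - f (a + h, b) - f (a, b + h) + f (a, b) = h * h * A (a + \<xi>', b + \<eta>')"
    unfolding A_def by (rule mixed_difference'[OF f h])
  have d: "dist (a + u, b + v) y < 2 * h" if "0 < u" "u < h" "0 < v" "v < h" for u v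
  proof -
    have "dist (a + u, b + v) y \<le> \<bar>u\<bar> + \<bar>v\<bar>"
      by (simp add: y dist_Pair_Pair dist_real_def sqrt_sum_squares_le_sum_abs)
    then show ?thesis using that by simp
  qed
  have "A (a + \<xi>', b + \<eta>') = B (a + \<xi>, b + \<eta>)" using 1 2 h by simp
  moreover have "dist (B (a + \<xi>, b + \<eta>)) (B y) < \<bar>A y - B y\<bar> / 2"
    using rs(4) d[OF 1(1-4)] by (simp add: h_def)
  moreover have "dist (A (a + \<xi>', b + \<eta>')) (A y) < \<bar>A y - B y\<bar> / 2"
    using rs(3) d[OF 2(1-4)] by (simp add: h_def)
  ultimately show False by (simp add: dist_real_def abs_if split: if_splits)
qed

section \<open>A strong maximum principle\<close>

text \<open>A positive second derivative would make \<open>g'\<close> positive just to the right of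
  the critical point 0, and \<open>g\<close> would rise above its maximum there.\<close>

lemma second_derivative_nonpos_at_max:
  fixes g :: "real \<Rightarrow> real"
  assumes e: "e > 0" and g: "\<And>\<tau>. \<bar>\<tau>\<bar> < e \<Longrightarrow> (g has_real_derivative g' \<tau>) (at \<tau>)"
    and g': "(g' has_real_derivative c) (at 0)"
    and mx: "\<And>\<tau>. \<bar>\<tau>\<bar> < e \<Longrightarrow> g \<tau> \<le> g 0"
  shows "g' 0 = 0 \<and> c \<le> 0"
proof
  show 0: "g' 0 = 0"
    by (rule DERIV_local_max[OF g[of 0] e]) (use e mx in auto)
  show "c \<le> 0"
  proof (rule ccontr)
    assume "\<not> c \<le> 0"
    then obtain d where d: "d > 0" "\<And>h. h > 0 \<Longrightarrow> h < d \<Longrightarrow> g' 0 < g' (0 + h)"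
      using DERIV_pos_inc_right[OF g'] by auto
    define h where "h = min d e / 2"
    have h: "0 < h" "h < d" "h < e" using d e by (auto simp: h_def)
    obtain z where z: "0 < z" "z < h" "g h - g 0 = (h - 0) * g' z"
      using MVT2[of 0 h g g'] h g by auto
    have "g' z > 0" using d(2)[of z] z h 0 by simp
    then have "h * g' z > 0" using h by simp
    then have "g h > g 0" using z by simp
    then show False using mx[of h] h by simp
  qed
qed

lemma plane_interior_max:
  fixes \<phi> :: "plane \<Rightarrow> real"
  assumes S: "open S" "y \<in> S" and p: "\<And>z. z \<in> S \<Longrightarrow> has_pd \<phi> (p1 z) (p2 z) z"
    and p1: "has_pd p1 a11 a12 y" and p2: "has_pd p2 a12 a22 y"
    and mx: "\<And>z. z \<in> S \<Longrightarrow> \<phi> z \<le> \<phi> y"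
  shows "p1 y = 0" "p2 y = 0" "w1\<^sup>2 * a11 + 2 * w1 * w2 * a12 + w2\<^sup>2 * a22 \<le> 0"
proof -
  have *: "w1 * p1 y + w2 * p2 y = 0 \<and> w1\<^sup>2 * a11 + 2 * w1 * w2 * a12 + w2\<^sup>2 * a22 \<le> 0" for w1 w2
  proof -
    define w where "w = (w1, w2)"
    obtain r where r: "r > 0" "ball y r \<subseteq> S" using S open_contains_ball by blast
    define e where "e = r / (norm w + 1)"
    have e: "e > 0" using r by (simp add: e_def add_nonneg_pos)
    have inS: "y + \<tau> *\<^sub>R w \<in> S" if "\<bar>\<tau>\<bar> < e" for \<tau>
    proof -
      have "\<bar>\<tau>\<bar> * norm w \<le> \<bar>\<tau>\<bar> * (norm w + 1)" by (simp add: mult_left_mono)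
      also have "\<dots> < r" using that by (simp add: e_def pos_less_divide_eq add_nonneg_pos)
      finally show ?thesis using r(2) by (auto simp: dist_norm)
    qed
    have "(\<lambda>\<tau>. w1 * p1 (y + \<tau> *\<^sub>R w) + w2 * p2 (y + \<tau> *\<^sub>R w)) 0 = 0 \<and>
      (w1 * (w1 * a11 + w2 * a12) + w2 * (w1 * a12 + w2 * a22)) \<le> 0"
    proof (rule second_derivative_nonpos_at_max[OF e])
      show "((\<lambda>\<tau>. \<phi> (y + \<tau> *\<^sub>R w)) has_real_derivative w1 * p1 (y + \<tau> *\<^sub>R w) + w2 * p2 (y + \<tau> *\<^sub>R w)) (at \<tau>)"
        if "\<bar>\<tau>\<bar> < e" for \<tau>
        using has_pd_line_real[OF p[OF inS[OF that]]] by (simp add: w_def)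
      show "\<phi> (y + \<tau> *\<^sub>R w) \<le> \<phi> (y + 0 *\<^sub>R w)" if "\<bar>\<tau>\<bar> < e" for \<tau>
        using mx[OF inS[OF that]] by simp
      have "((\<lambda>\<tau>. p1 (y + \<tau> *\<^sub>R w)) has_real_derivative (w1 * a11 + w2 * a12)) (at 0)"
        "((\<lambda>\<tau>. p2 (y + \<tau> *\<^sub>R w)) has_real_derivative (w1 * a12 + w2 * a22)) (at 0)"
        using has_pd_line_real[of p1 a11 a12 y 0 w] has_pd_line_real[of p2 a12 a22 y 0 w] p1 p2
        by (simp_all add: w_def zero_prod_def[symmetric])
      from DERIV_add[OF DERIV_cmult[OF this(1), of w1] DERIV_cmult[OF this(2), of w2]]
      show "((\<lambda>\<tau>. w1 * p1 (y + \<tau> *\<^sub>R w) + w2 * p2 (y + \<tau> *\<^sub>R w)) has_real_derivative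
        (w1 * (w1 * a11 + w2 * a12) + w2 * (w1 * a12 + w2 * a22))) (at 0)" .
    qed
    then show ?thesis by (simp add: algebra_simps power2_eq_square)
  qed
  show "p1 y = 0" using *[of 1 0] by simp
  show "p2 y = 0" using *[of 0 1] by simp
  show "w1\<^sup>2 * a11 + 2 * w1 * w2 * a12 + w2\<^sup>2 * a22 \<le> 0" using * by blast
qed

text \<open>Let S be the symmetric matrix of the form in \<open>(d, e)\<close>; its trace is
  \<open>1 + \<alpha>^2 + \<beta>^2\<close> and its determinant \<open>\<beta>^2\<close>. By
  Cayley-Hamilton tr S * S - det S = S^2, which is the sum of squares in the proof, so the least
  eigenvalue is at least det S / tr S.\<close>

lemma elliptic_form_lower_bound:
  fixes \<alpha> \<beta> d e :: real
  assumes "\<bar>\<alpha>\<bar> \<le> A" "\<bar>\<beta>\<bar> \<le> A" "\<beta>\<^sup>2 \<ge> B"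
  shows "B * (d\<^sup>2 + e\<^sup>2) \<le> (1 + 2 * A\<^sup>2) * ((d + \<alpha> * e)\<^sup>2 + \<beta>\<^sup>2 * e\<^sup>2)"
proof -
  have q: "(d + \<alpha> * e)\<^sup>2 + \<beta>\<^sup>2 * e\<^sup>2 \<ge> 0" by simp
  have "\<alpha>\<^sup>2 \<le> A\<^sup>2" "\<beta>\<^sup>2 \<le> A\<^sup>2" using assms by (auto simp: abs_le_square_iff[symmetric])
  then have "(1 + \<alpha>\<^sup>2 + \<beta>\<^sup>2) * ((d + \<alpha> * e)\<^sup>2 + \<beta>\<^sup>2 * e\<^sup>2) \<le> (1 + 2 * A\<^sup>2) * ((d + \<alpha> * e)\<^sup>2 + \<beta>\<^sup>2 * e\<^sup>2)"
    by (intro mult_right_mono q) auto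
  moreover have "(1 + \<alpha>\<^sup>2 + \<beta>\<^sup>2) * ((d + \<alpha> * e)\<^sup>2 + \<beta>\<^sup>2 * e\<^sup>2) - \<beta>\<^sup>2 * (d\<^sup>2 + e\<^sup>2)
      = (d + \<alpha> * e)\<^sup>2 + (\<alpha> * d + (\<alpha>\<^sup>2 + \<beta>\<^sup>2) * e)\<^sup>2"
    by (simp add: algebra_simps power2_eq_square)
  moreover have "B * (d\<^sup>2 + e\<^sup>2) \<le> \<beta>\<^sup>2 * (d\<^sup>2 + e\<^sup>2)" using assms by (intro mult_right_mono) auto
  ultimately show ?thesis
    by (smt (verit) zero_le_power2)
qed

text \<open>Hopf's argument: on an annulus that touches the maximum set from outside, adding a small
  multiple of \<open>exp (- \<kappa> |y - z|\<^sup>2)\<close> to \<open>v\<close> produces an interior maximum.\<close>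

lemma strong_maximum_principle:
  fixes v :: "plane \<Rightarrow> real"
  assumes \<rho>: "\<rho> > 0"
    and v: "\<And>y. y \<in> ball y0 \<rho> \<Longrightarrow> has_pd v (v1 y) (v2 y) y"
    and v1: "\<And>y. y \<in> ball y0 \<rho> \<Longrightarrow> has_pd v1 (v11 y) (v12 y) y"
    and v2: "\<And>y. y \<in> ball y0 \<rho> \<Longrightarrow> has_pd v2 (v12 y) (v22 y) y"
    and A: "\<And>y. y \<in> ball y0 \<rho> \<Longrightarrow> \<bar>\<alpha> y\<bar> \<le> A" "\<And>y. y \<in> ball y0 \<rho> \<Longrightarrow> \<bar>\<beta> y\<bar> \<le> A"
    and B: "B > 0" "\<And>y. y \<in> ball y0 \<rho> \<Longrightarrow> B \<le> (\<beta> y)\<^sup>2"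
    and K: "\<And>y. y \<in> ball y0 \<rho> \<Longrightarrow>
        \<bar>v11 y + 2 * \<alpha> y * v12 y + ((\<alpha> y)\<^sup>2 + (\<beta> y)\<^sup>2) * v22 y\<bar> \<le> K * (\<bar>v1 y\<bar> + \<bar>v2 y\<bar>)"
    and M: "\<And>y. y \<in> ball y0 \<rho> \<Longrightarrow> v y \<le> M" "v y0 = M"
    and z: "z \<in> ball y0 (\<rho> / 2)"
  shows "v z = M"
proof (rule ccontr)
  assume "v z \<noteq> M"
  have in_ball: "y \<in> ball y0 \<rho>" if "dist z y < \<rho> / 2" for y
    using that z dist_triangle[of y0 y z] by simp
  have vz: "v z < M" using \<open>v z \<noteq> M\<close> M(1)[of z] in_ball[of z] \<rho> by fastforce
  have contv: "continuous_on (ball y0 \<rho>) v"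
    by (intro continuous_at_imp_continuous_on ballI has_pd_isCont[OF v])
  \<comment> \<open>Any radius strictly between the distance to \<open>y0\<close> and
    \<open>\<rho> / 2\<close> serves: the disc about \<open>z\<close> then has \<open>y0\<close>
    inside and stays within the domain.\<close>
  define \<rho>' where "\<rho>' = (dist z y0 + \<rho> / 2) / 2"
  have \<rho>': "dist z y0 < \<rho>'" "\<rho>' < \<rho> / 2" using z by (auto simp: \<rho>'_def dist_commute)
  have cb: "cball z \<rho>' \<subseteq> ball y0 \<rho>" using in_ball \<rho>'(2) by force
  define E where "E = {y \<in> cball z \<rho>'. v y = M}"
  have "compact E"
  proof -
    have "closed {y \<in> cball z \<rho>'. v y = M}"
      by (intro continuous_closed_preimage_constant continuous_on_subset[OF contv cb]) auto
    then show ?thesis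
      unfolding E_def by (rule compact_eq_bounded_closed[THEN iffD2, OF conjI, rotated])
        (auto intro: bounded_subset[OF bounded_cball])
  qed
  moreover have "y0 \<in> E" using M \<rho>' by (simp add: E_def)
  moreover have "continuous_on E (dist z)" by (intro continuous_intros)
  ultimately obtain y1 where y1: "y1 \<in> E" "\<And>y. y \<in> E \<Longrightarrow> dist z y1 \<le> dist z y"
    using continuous_attains_inf[of E "dist z"] by blast
  define R where "R = dist z y1"
  have R0: "R > 0" using y1 vz by (auto simp: R_def E_def)
  have R1: "R < \<rho>'" using y1(2)[OF \<open>y0 \<in> E\<close>] \<rho>' by (simp add: R_def)
  have vlt: "v y < M" if "dist z y < R" for y
  proof -
    have "y \<in> cball z \<rho>'" using that R1 by simp
    moreover have "y \<notin> E" using y1(2)[of y] that by (auto simp: R_def)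
    ultimately have "v y \<noteq> M" "y \<in> ball y0 \<rho>" using cb by (auto simp: E_def)
    then show ?thesis using M(1)[of y] by simp
  qed
  define T where "T = 1 + 2 * A\<^sup>2"
  have T: "T > 0" by (simp add: T_def add_pos_nonneg)
  \<comment> \<open>Large enough that on the annulus, at distance at least \<open>R / 2\<close> from
    \<open>z\<close>, the second-order gain of the barrier beats both the trace of the operator,
    bounded by \<open>T\<close>, and the first-order terms, bounded by
    \<open>\<bar>K\<bar> * \<rho>\<close>.\<close>
  define \<kappa> where "\<kappa> = (2 * T + 2 * \<bar>K\<bar> * \<rho> + 1) * T / (B * R\<^sup>2)"
  have \<kappa>: "\<kappa> > 0" using T B R0 \<rho> by (auto simp: \<kappa>_def intro!: divide_pos_pos mult_pos_pos add_nonneg_pos)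
  have \<kappa>2: "\<kappa> * B * R\<^sup>2 = (2 * T + 2 * \<bar>K\<bar> * \<rho> + 1) * T"
    using B R0 by (simp add: \<kappa>_def)
  define n where "n = (\<lambda>y::plane. (fst y - fst z)\<^sup>2 + (snd y - snd z)\<^sup>2)"
  have n: "n y = (dist z y)\<^sup>2" for y
    by (simp add: n_def dist_prod_def dist_real_def power2_commute)
  define h where "h = (\<lambda>y. exp (- \<kappa> * n y))"
  have hpos: "h y > 0" and hle: "h y \<le> 1" for y using \<kappa> by (auto simp: h_def n)
  \<comment> \<open>Value of the barrier on the circle through the nearest maximum point
    \<open>y1\<close>. The perturbation \<open>h - c\<close> vanishes there and is negative on the
    outer circle; on the inner circle it is at most 1, and \<epsilon> is half the gap of
    \<open>v\<close> below \<open>M\<close>.\<close>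
  define c where "c = exp (- \<kappa> * R\<^sup>2)"
  obtain ym where ym: "dist z ym \<le> R / 2" "\<And>y. dist z y \<le> R / 2 \<Longrightarrow> v y \<le> v ym"
  proof -
    have "cball z (R/2) \<subseteq> ball y0 \<rho>" using cb R1 R0 by force
    from continuous_attains_sup[OF compact_cball _ continuous_on_subset[OF contv this]] R0
    show ?thesis using that by auto
  qed
  define \<epsilon> where "\<epsilon> = (M - v ym) / 2"
  have \<epsilon>: "\<epsilon> > 0" using vlt[of ym] ym R0 by (simp add: \<epsilon>_def)
  define \<phi> where "\<phi> = (\<lambda>y. v y + \<epsilon> * (h y - c))"
  define D where "D = cball z \<rho>' - ball z (R / 2)"
  have "compact D" unfolding D_def by (intro compact_diff) auto
  moreover have "y1 \<in> D" using y1 R0 by (auto simp: D_def E_def R_def)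
  moreover have "continuous_on D \<phi>"
    unfolding \<phi>_def h_def n_def
    by (intro continuous_intros continuous_on_subset[OF contv]) (use cb in \<open>auto simp: D_def\<close>)
  ultimately obtain y where y: "y \<in> D" "\<And>u. u \<in> D \<Longrightarrow> \<phi> u \<le> \<phi> y"
    using continuous_attains_sup[of D \<phi>] by blast
  have "\<phi> y1 = M" using y1 by (simp add: \<phi>_def h_def c_def n R_def E_def)
  then have \<phi>y: "\<phi> y \<ge> M" using y(2)[OF \<open>y1 \<in> D\<close>] by simp
  have "dist z y \<noteq> R / 2"
  proof
    assume "dist z y = R / 2"
    then have "v y \<le> v ym" using ym by simp
    moreover have "h y - c \<le> 1" using hle[of y] by (simp add: c_def algebra_simps add_increasing2)
    then have "\<epsilon> * (h y - c) \<le> \<epsilon> * 1" using \<epsilon> by (intro mult_left_mono) auto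
    ultimately have "\<phi> y \<le> v ym + \<epsilon>" by (simp add: \<phi>_def)
    then show False using \<phi>y \<epsilon> by (simp add: \<epsilon>_def field_simps)
  qed
  moreover have "dist z y \<noteq> \<rho>'"
  proof
    assume eq: "dist z y = \<rho>'"
    have "h y < c" unfolding h_def c_def n eq using R1 R0 \<kappa> by (simp add: power_strict_mono)
    then have "\<epsilon> * (h y - c) < 0" using \<epsilon> by (simp add: mult_less_0_iff)
    moreover have "v y \<le> M" using M(1)[of y] subsetD[OF cb, of y] eq by simp
    ultimately show False using \<phi>y by (simp add: \<phi>_def)
  qed
  ultimately have dy: "R / 2 < dist z y" "dist z y < \<rho>'" using y(1) by (auto simp: D_def)
  define S where "S = ball z \<rho>' - cball z (R / 2)"
  have S: "open S" "y \<in> S" "S \<subseteq> D" "S \<subseteq> ball y0 \<rho>"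
    using dy cb by (auto simp: S_def D_def)
  define u1 u2 where "u1 = (\<lambda>y::plane. fst y - fst z)" and "u2 = (\<lambda>y::plane. snd y - snd z)"
  have pu: "has_pd u1 1 0 y" "has_pd u2 0 1 y" for y
    unfolding has_pd_def u1_def u2_def by (auto intro!: derivative_eq_intros)
  have ph: "has_pd h (- 2 * \<kappa> * u1 y * h y) (- 2 * \<kappa> * u2 y * h y) y" for y
  proof -
    have pn: "has_pd (\<lambda>y. u1 y ^ 2 + u2 y ^ 2) (2 * u1 y) (2 * u2 y) y"
      by (rule has_pd_eq[OF has_pd_add[OF has_pd_power[OF pu(1)] has_pd_power[OF pu(2)]]]) auto
    have "has_pd (\<lambda>y. exp (- \<kappa> * (u1 y ^ 2 + u2 y ^ 2)))
      (- \<kappa> * exp (- \<kappa> * (u1 y ^ 2 + u2 y ^ 2)) * (2 * u1 y))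
      (- \<kappa> * exp (- \<kappa> * (u1 y ^ 2 + u2 y ^ 2)) * (2 * u2 y)) y"
      by (rule has_pd_chain_real[OF pn]) (auto intro!: derivative_eq_intros)
    then show ?thesis by (simp add: h_def n_def u1_def u2_def algebra_simps)
  qed
  have p\<phi>: "has_pd \<phi> (v1 y + \<epsilon> * (- 2 * \<kappa> * u1 y * h y)) (v2 y + \<epsilon> * (- 2 * \<kappa> * u2 y * h y)) y"
    if "y \<in> S" for y
    unfolding \<phi>_def
    by (rule has_pd_eq[OF has_pd_add[OF v has_pd_mult[OF has_pd_const has_pd_diff[OF ph has_pd_const]]]])
       (use that S in auto)
  have yb: "y \<in> ball y0 \<rho>" using S by auto
  have p1: "has_pd (\<lambda>y. v1 y + \<epsilon> * (- 2 * \<kappa> * u1 y * h y))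
      (v11 y + \<epsilon> * (h y * (4 * \<kappa>\<^sup>2 * (u1 y)\<^sup>2 - 2 * \<kappa>))) (v12 y + \<epsilon> * (h y * (4 * \<kappa>\<^sup>2 * u1 y * u2 y))) y"
    by (rule has_pd_eq[OF has_pd_add[OF v1[OF yb] has_pd_mult[OF has_pd_const
          has_pd_mult[OF has_pd_mult[OF has_pd_const pu(1)] ph]]]])
       (auto simp: algebra_simps power2_eq_square)
  have p2: "has_pd (\<lambda>y. v2 y + \<epsilon> * (- 2 * \<kappa> * u2 y * h y))
      (v12 y + \<epsilon> * (h y * (4 * \<kappa>\<^sup>2 * u1 y * u2 y))) (v22 y + \<epsilon> * (h y * (4 * \<kappa>\<^sup>2 * (u2 y)\<^sup>2 - 2 * \<kappa>))) y"
    by (rule has_pd_eq[OF has_pd_add[OF v2[OF yb] has_pd_mult[OF has_pd_const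
          has_pd_mult[OF has_pd_mult[OF has_pd_const pu(2)] ph]]]])
       (auto simp: algebra_simps power2_eq_square)
  have mx: "\<phi> u \<le> \<phi> y" if "u \<in> S" for u by (rule y(2)) (use that S in blast)
  note crit = plane_interior_max[OF S(1,2) p\<phi> p1 p2 mx]
  define a b d e H where "a = \<alpha> y" "b = \<beta> y" "d = u1 y" "e = u2 y" "H = h y"
  note defs = a_b_d_e_H_def
  have H: "H > 0" using hpos by (simp add: defs)
  \<comment> \<open>At a critical point of \<phi> the gradient of \<open>v\<close> is minus that of
    the barrier term, so the lower-order bound becomes explicit in the barrier as well.\<close>
  have g1: "v1 y = \<epsilon> * (2 * \<kappa> * d * H)" and g2: "v2 y = \<epsilon> * (2 * \<kappa> * e * H)"
    using crit(1,2) by (simp_all add: defs)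
  have "(1\<^sup>2 * (v11 y + \<epsilon> * (H * (4 * \<kappa>\<^sup>2 * d\<^sup>2 - 2 * \<kappa>))) + 2 * 1 * a * (v12 y + \<epsilon> * (H * (4 * \<kappa>\<^sup>2 * d * e))) +
        a\<^sup>2 * (v22 y + \<epsilon> * (H * (4 * \<kappa>\<^sup>2 * e\<^sup>2 - 2 * \<kappa>)))) +
       (0\<^sup>2 * (v11 y + \<epsilon> * (H * (4 * \<kappa>\<^sup>2 * d\<^sup>2 - 2 * \<kappa>))) + 2 * 0 * b * (v12 y + \<epsilon> * (H * (4 * \<kappa>\<^sup>2 * d * e))) +
        b\<^sup>2 * (v22 y + \<epsilon> * (H * (4 * \<kappa>\<^sup>2 * e\<^sup>2 - 2 * \<kappa>)))) \<le> 0"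
    unfolding defs by (intro add_nonpos_nonpos crit(3)) auto
  \<comment> \<open>The second derivative tests in the directions \<open>(1, a)\<close> and
    \<open>(0, b)\<close> add up to the principal part of the operator.\<close>
  then have L: "(v11 y + 2 * a * v12 y + (a\<^sup>2 + b\<^sup>2) * v22 y) +
      \<epsilon> * H * (4 * \<kappa>\<^sup>2 * ((d + a * e)\<^sup>2 + b\<^sup>2 * e\<^sup>2) - 2 * \<kappa> * (1 + a\<^sup>2 + b\<^sup>2)) \<le> 0"
    by (simp add: algebra_simps power2_eq_square)
  have "- (K * (\<bar>v1 y\<bar> + \<bar>v2 y\<bar>)) \<le> v11 y + 2 * a * v12 y + (a\<^sup>2 + b\<^sup>2) * v22 y"
    using K[OF yb] unfolding defs by linarith
  moreover have "\<bar>v1 y\<bar> + \<bar>v2 y\<bar> = \<epsilon> * H * (2 * \<kappa> * (\<bar>d\<bar> + \<bar>e\<bar>))"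
    unfolding g1 g2 using \<epsilon> \<kappa> H by (simp add: abs_mult algebra_simps)
  ultimately have "\<epsilon> * H * (4 * \<kappa>\<^sup>2 * ((d + a * e)\<^sup>2 + b\<^sup>2 * e\<^sup>2) - 2 * \<kappa> * (1 + a\<^sup>2 + b\<^sup>2)
      - K * (2 * \<kappa> * (\<bar>d\<bar> + \<bar>e\<bar>))) \<le> 0"
    using L by (simp add: algebra_simps)
  then have "4 * \<kappa>\<^sup>2 * ((d + a * e)\<^sup>2 + b\<^sup>2 * e\<^sup>2) - 2 * \<kappa> * (1 + a\<^sup>2 + b\<^sup>2)
      - K * (2 * \<kappa> * (\<bar>d\<bar> + \<bar>e\<bar>)) \<le> 0"
    using \<epsilon> H by (simp add: mult_le_0_iff)
  then have "2 * \<kappa> * (2 * \<kappa> * ((d + a * e)\<^sup>2 + b\<^sup>2 * e\<^sup>2) - (1 + a\<^sup>2 + b\<^sup>2) - K * (\<bar>d\<bar> + \<bar>e\<bar>)) \<le> 0"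
    by (simp add: algebra_simps power2_eq_square)
  then have fin: "2 * \<kappa> * ((d + a * e)\<^sup>2 + b\<^sup>2 * e\<^sup>2) \<le> (1 + a\<^sup>2 + b\<^sup>2) + K * (\<bar>d\<bar> + \<bar>e\<bar>)"
    using \<kappa> by (simp add: mult_le_0_iff)
  have ab: "\<bar>a\<bar> \<le> A" "\<bar>b\<bar> \<le> A" "b\<^sup>2 \<ge> B" using A B yb by (auto simp: defs)
  have "a\<^sup>2 \<le> A\<^sup>2" "b\<^sup>2 \<le> A\<^sup>2" using ab by (auto simp: abs_le_square_iff[symmetric])
  then have t1: "1 + a\<^sup>2 + b\<^sup>2 \<le> T" by (simp add: T_def)
  have nd: "d\<^sup>2 + e\<^sup>2 = (dist z y)\<^sup>2" using n[of y] by (simp add: n_def defs u1_def u2_def)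
  have "\<bar>d\<bar> \<le> dist z y" "\<bar>e\<bar> \<le> dist z y"
    using nd by (auto intro!: abs_le_square_iff[THEN iffD2, of _ "dist z y", simplified]) (smt (verit) zero_le_power2)+
  then have de: "\<bar>d\<bar> + \<bar>e\<bar> \<le> \<rho>" using dy \<rho>' by simp
  have "K * (\<bar>d\<bar> + \<bar>e\<bar>) \<le> \<bar>K\<bar> * \<rho>"
    using de by (intro mult_mono) auto
  with fin t1 have f2: "2 * \<kappa> * ((d + a * e)\<^sup>2 + b\<^sup>2 * e\<^sup>2) \<le> T + \<bar>K\<bar> * \<rho>" by simp
  have "(R/2)\<^sup>2 \<le> d\<^sup>2 + e\<^sup>2" unfolding nd using dy R0 by (intro power_mono) auto
  then have "2 * \<kappa> * (B * (R/2)\<^sup>2) \<le> 2 * \<kappa> * (B * (d\<^sup>2 + e\<^sup>2))" using \<kappa> B by (intro mult_left_mono) auto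
  also have "\<dots> \<le> 2 * \<kappa> * (T * ((d + a * e)\<^sup>2 + b\<^sup>2 * e\<^sup>2))"
    using elliptic_form_lower_bound[OF ab, of d e] \<kappa> by (intro mult_left_mono) (auto simp: T_def)
  also have "\<dots> = T * (2 * \<kappa> * ((d + a * e)\<^sup>2 + b\<^sup>2 * e\<^sup>2))" by simp
  also have "\<dots> \<le> T * (T + \<bar>K\<bar> * \<rho>)" using f2 T by (intro mult_left_mono) auto
  finally have "\<kappa> * B * R\<^sup>2 \<le> 2 * (T * (T + \<bar>K\<bar> * \<rho>))" by (simp add: power2_eq_square algebra_simps)
  then show False unfolding \<kappa>2 using T by (simp add: algebra_simps)
qed

section \<open>Zeros of solutions of a Cauchy-Riemann type system on the torus\<close>

lemma smooth_on_compose_right: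
  assumes f: "smooth_on UNIV f" and L: "bounded_linear L"
  shows "smooth_on UNIV (\<lambda>z. f (L z))"
  unfolding smooth_on_def
proof
  fix k show "Ck_on k UNIV (\<lambda>z. f (L z))"
    using f
  proof (induction k arbitrary: f)
    case 0
    then show ?case
      using L by (auto intro!: continuous_on_compose2[OF smooth_on_continuous[OF 0] linear_continuous_on[OF L]])
  next
    case (Suc k)
    have "((\<lambda>z. f (L z)) has_derivative (\<lambda>v. frechet_derivative f (at (L z)) (L v))) (at z)" for z
      by (rule has_derivative_compose[OF bounded_linear_imp_has_derivative[OF L]
               smooth_on_has_derivative[OF Suc.prems]]) simp
    then show ?case
      by (rule Ck_on_SucI[OF open_UNIV]) (use Suc.IH[OF smooth_on_frechet[OF Suc.prems]] in auto)
  qed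
qed

lemma integral_periodic:
  fixes f :: "real \<Rightarrow> real"
  assumes f: "continuous_on UNIV f" and per: "\<And>x. f (x + 1) = f x"
  shows "integral {c..c + 1} f = integral {0..1} f"
proof -
  have io: "f integrable_on {a..b}" for a b
    by (rule integrable_continuous_real[OF continuous_on_subset[OF f]]) auto
  \<comment> \<open>The base point lies to the left of both 0 and \<open>c\<close>, so the
    fundamental theorem applies at interior points whichever of the two is smaller.\<close>
  define F where "F = (\<lambda>x. integral {min 0 c - 1..x} f)"
  have dF: "(F has_real_derivative f x) (at x)" if "min 0 c - 1 < x" for x
  proof -
    have "(F has_real_derivative f x) (at x within {min 0 c - 1..x + 1})"
      unfolding F_def
      by (rule integral_has_real_derivative) (use that in \<open>auto intro: continuous_on_subset[OF f]\<close>)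
    then show ?thesis using that at_within_interior[of x "{min 0 c - 1..x + 1}"] by simp
  qed
  have dG: "((\<lambda>x. F (x + 1) - F x) has_real_derivative 0) (at x)" if "min 0 c - 1 < x" for x
  proof -
    have "(F has_real_derivative f (x + 1)) (at (x + 1))" using dF that by simp
    from DERIV_diff[OF this[unfolded DERIV_shift] dF[OF that]] per show ?thesis by simp
  qed
  have "F (c + 1) - F c = F (0 + 1) - F 0"
  proof (cases c "0::real" rule: linorder_cases)
    case less
    have "F (0 + 1) - F 0 = F (c + 1) - F c"
      by (rule DERIV_isconst_end[OF less, of "\<lambda>x. F (x + 1) - F x"])
         (use less in \<open>auto intro!: DERIV_isCont[OF dG] dG continuous_at_imp_continuous_on\<close>)
    then show ?thesis ..
  next
    case greater
    show ?thesis
      by (rule DERIV_isconst_end[OF greater, of "\<lambda>x. F (x + 1) - F x"])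
         (use greater in \<open>auto intro!: DERIV_isCont[OF dG] dG continuous_at_imp_continuous_on\<close>)
  qed simp
  moreover have "F (x + 1) - F x = integral {x..x + 1} f" if "min 0 c \<le> x" for x
    using Henstock_Kurzweil_Integration.integral_combine[of "min 0 c - 1" x "x + 1" f] io that by (simp add: F_def)
  from this[of c] this[of 0] have "F (c + 1) - F c = integral {c..c + 1} f" "F (0 + 1) - F 0 = integral {0..0 + 1} f"
    by simp_all
  ultimately show ?thesis by simp
qed

lemma integral_shift_scale:
  fixes f :: "real \<Rightarrow> real"
  assumes "continuous_on UNIV f" "m > 0" "a \<le> b"
  shows "integral {a..b} (\<lambda>x. f (m * x + c)) = integral {m * a + c..m * b + c} f / m"
proof -
  have "(f has_integral integral {m * a + c..m * b + c} f) (cbox (m * a + c) (m * b + c))"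
    unfolding cbox_interval
    by (rule integrable_integral[OF integrable_continuous_real[OF continuous_on_subset[OF assms(1)]]]) simp
  note i = has_integral_affinity'[OF this assms(2), of c]
  have "(m * a + c - c) /\<^sub>R m = a" "(m * b + c - c) /\<^sub>R m = b" using assms(2) by auto
  with i have "((\<lambda>x. f (m * x + c)) has_integral integral {m * a + c..m * b + c} f /\<^sub>R m) {a..b}"
    by (simp only: cbox_interval DIM_real power_one_right real_scaleR_def)
  then have "((\<lambda>x. f (m * x + c)) has_integral integral {m * a + c..m * b + c} f / m) {a..b}"
    by (simp only: real_scaleR_def divide_inverse mult.commute)
  then show ?thesis by (rule integral_unique)
qed

lemma integral_mono_set:
  fixes f :: "real \<Rightarrow> real"
  assumes "continuous_on UNIV f" "\<And>x. f x \<ge> 0" "{a..b} \<subseteq> {c..d}"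
  shows "integral {a..b} f \<le> integral {c..d} f"
  by (rule integral_subset_le)
     (use assms in \<open>auto intro!: integrable_continuous_real continuous_on_subset[OF assms(1)]\<close>)

section \<open>Integrals of periodic functions over the unit square\<close>

definition square_integral :: "(plane \<Rightarrow> real) \<Rightarrow> real" where
  "square_integral f = integral {0..1} (\<lambda>m. integral {0..1} (\<lambda>n. f (m, n)))"

lemma continuous_on_slice:
  assumes "continuous_on UNIV f"
  shows "continuous_on S (\<lambda>n. f (m, n))" "continuous_on S (\<lambda>n. f (n, m))"
  by (auto intro!: continuous_on_compose2[OF assms] continuous_intros)

lemma continuous_on_slice_integral:
  fixes f :: "plane \<Rightarrow> real"
  assumes "continuous_on UNIV f"
  shows "continuous_on S (\<lambda>m. integral {a..b} (\<lambda>n. f (m, n)))"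
proof -
  have "continuous_on UNIV (\<lambda>m. integral (cbox a b) (\<lambda>n. f (m, n)))"
    by (rule integral_continuous_on_param)
       (auto intro!: continuous_on_compose2[OF assms] continuous_intros simp: split_def)
  then show ?thesis by (auto intro: continuous_on_subset)
qed

lemma slice_integrable:
  fixes f :: "plane \<Rightarrow> real"
  assumes "continuous_on UNIV f"
  shows "(\<lambda>n. f (m, n)) integrable_on {a..b}"
    "(\<lambda>m. integral {a..b} (\<lambda>n. f (m, n))) integrable_on {c..d}"
  by (intro integrable_continuous_real continuous_on_slice continuous_on_slice_integral assms)+

lemma square_integral_add:
  assumes "continuous_on UNIV f" "continuous_on UNIV g"
  shows "square_integral (\<lambda>y. f y + g y) = square_integral f + square_integral g"
  unfolding square_integral_def
  by (simp add: integral_add slice_integrable assms)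

lemma square_integral_cmult:
  "square_integral (\<lambda>y. c * f y) = c * square_integral f"
  unfolding square_integral_def by simp

lemma square_integral_const: "square_integral (\<lambda>y. c) = c"
  unfolding square_integral_def by simp

lemma square_integral_mono:
  assumes "continuous_on UNIV f" "continuous_on UNIV g"
    and "\<And>y. y \<in> {0..1} \<times> {0..1} \<Longrightarrow> f y \<le> g y"
  shows "square_integral f \<le> square_integral g"
  unfolding square_integral_def
  by (intro integral_le slice_integrable assms) (use assms in auto)

lemma square_integral_d2:
  assumes f: "smooth_on UNIV f" and per: "\<And>m n. f (m, n + 1) = f (m, n)"
  shows "square_integral (d2 f) = 0"
proof -
  have "integral {0..1} (\<lambda>n. d2 f (m, n)) = 0" for m
  proof -
    have "((\<lambda>n. f (m, n)) has_real_derivative d2 f (m, n)) (at n)" for n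
      using has_pd_line_real[of f _ _ "(m,0)" n "(0,1)", OF smooth_has_pd[OF f]] by simp
    then have "((\<lambda>n. d2 f (m, n)) has_integral f (m, 1) - f (m, 0)) {0..1}"
      by (intro fundamental_theorem_of_calculus)
         (auto simp: has_real_derivative_iff_has_vector_derivative[symmetric] intro: has_field_derivative_at_within)
    then show ?thesis using per[of m 0] by (simp add: integral_unique)
  qed
  then show ?thesis by (simp add: square_integral_def)
qed

lemma square_integral_d1:
  assumes f: "smooth_on UNIV f" and per: "\<And>m n. f (m + 1, n) = f (m, n)"
  shows "square_integral (d1 f) = 0"
proof -
  have "integral {0..1} (\<lambda>m. d1 f (m, n)) = 0" for n
  proof -
    have "((\<lambda>m. f (m, n)) has_real_derivative d1 f (m, n)) (at m)" for m
      using has_pd_line_real[of f _ _ "(0,n)" m "(1,0)", OF smooth_has_pd[OF f]] by simp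
    then have "((\<lambda>m. d1 f (m, n)) has_integral f (1, n) - f (0, n)) {0..1}"
      by (intro fundamental_theorem_of_calculus)
         (auto simp: has_real_derivative_iff_has_vector_derivative[symmetric] intro: has_field_derivative_at_within)
    then show ?thesis using per[of 0 n] by (simp add: integral_unique)
  qed
  moreover have "square_integral (d1 f) = integral {0..1} (\<lambda>n. integral {0..1} (\<lambda>m. d1 f (m, n)))"
    unfolding square_integral_def
    using integral_swap_continuous[of "0::real" "0::real" 1 1 "\<lambda>m n. d1 f (m, n)"]
      continuous_on_subset[OF smooth_on_continuous[OF smooth_d1[OF f]]]
    by (simp add: cbox_interval split_def)
  ultimately show ?thesis by simp
qed

lemma periodic_int:
  assumes "\<And>y. f (y + c) = f (y::plane)"
  shows "f (y + of_int k *\<^sub>R c) = f y"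
proof -
  have nat: "f (y + of_nat j *\<^sub>R c) = f y" for y j
    by (induction j arbitrary: y) (simp_all add: scaleR_add_left add.assoc[symmetric] assms)
  show ?thesis
  proof (cases "k \<ge> 0")
    case True then show ?thesis using nat[of y "nat k"] by simp
  next
    case False
    have "f (y + of_int k *\<^sub>R c) = f ((y + of_int k *\<^sub>R c) + of_nat (nat (- k)) *\<^sub>R c)" by (rule nat[symmetric])
    also have "(y + of_int k *\<^sub>R c) + of_nat (nat (- k)) *\<^sub>R c = y + (of_int k + of_nat (nat (- k))) *\<^sub>R c"
      by (simp only: scaleR_add_left add.assoc)
    also have "\<dots> = y" using False by simp
    finally show ?thesis .
  qed
qed

lemma has_pd_shift:
  assumes "\<And>y. f (y + c) = f y" "has_pd f A B (y + c)"
  shows "has_pd f A B y"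
proof -
  have "((\<lambda>y. y + c) has_derivative (\<lambda>h. h)) (at y)" by (auto intro!: derivative_eq_intros)
  from has_derivative_compose[OF this assms(2)[unfolded has_pd_def]] assms(1)
  show ?thesis by (simp add: has_pd_def)
qed

lemma d_periodic:
  assumes "smooth_on UNIV f" "\<And>y. f (y + c) = f y"
  shows "d1 f (y + c) = d1 f y" "d2 f (y + c) = d2 f y"
  using has_pd_shift[OF assms(2) smooth_has_pd[OF assms(1)], of y]
    has_pd_unique[OF _ smooth_has_pd[OF assms(1)], of _ _ y] by auto

text \<open>The function \<open>log |Z|\<close> would have finite Dirichlet energy.  At a zero this is impossible: on
  the cone of segments from the zero to a small segment around a point with \<open>Z \<noteq> 0\<close>, it decays at
  least like \<open>log \<rho>\<close>, which costs energy of order \<open>log (1 / \<rho>)\<close>.\<close>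

lemma log_energy_unbounded:
  fixes A B :: "plane \<Rightarrow> real"
  assumes sm: "smooth_on UNIV A" "smooth_on UNIV B"
    and perA: "\<And>y. A (y + (1, 0)) = A y" "\<And>y. A (y + (0, 1)) = A y"
    and perB: "\<And>y. B (y + (1, 0)) = B y" "\<And>y. B (y + (0, 1)) = B y"
    and energy: "\<And>\<delta> h. 0 < \<delta> \<Longrightarrow> h = (\<lambda>y. ln ((A y)\<^sup>2 + (B y)\<^sup>2 + \<delta>) / 2) \<Longrightarrow>
        square_integral (\<lambda>y. (d1 h y)\<^sup>2 + (d2 h y)\<^sup>2) \<le> C"
    and z0: "A z0 = 0" "B z0 = 0"
  shows "A z = 0 \<and> B z = 0"
proof (rule ccontr)
  assume nz: "\<not> (A z = 0 \<and> B z = 0)"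
  define m0 n0 where "m0 = fst z0" and "n0 = snd z0"
  \<comment> \<open>An integer shift in the first coordinate alone brings the point with nonzero
    value to horizontal distance \<open>e1\<close> in (0, 1] from the zero. Ceiling minus one,
    rather than floor, excludes \<open>e1 = 0\<close>, by which one later divides.\<close>
  define k where "k = \<lceil>fst z - m0\<rceil> - 1"
  define z1 where "z1 = z + of_int (- k) *\<^sub>R (1, 0)"
  have z1: "A z1 = A z" "B z1 = B z" unfolding z1_def
    by (rule periodic_int, rule perA, rule periodic_int, rule perB)
  define e1 e2 where "e1 = fst z1 - m0" and "e2 = snd z1 - n0"
  have "e1 = fst z - m0 - of_int k" by (simp add: e1_def z1_def)
  then have e1: "0 < e1" "e1 \<le> 1" unfolding k_def by linarith+
  \<comment> \<open>Coordinates on the cone with vertex \<open>z0\<close> over a vertical segment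
    starting at \<open>z1\<close>: \<rho> runs along the rays, \<tau> across them, and the Jacobian
    is \<open>\<rho> * e1\<close>.\<close>
  define c where "c = (\<lambda>\<rho> \<tau>. (m0 + \<rho> * e1, n0 + \<rho> * (e2 + \<tau>)))"
  have c_line: "c \<rho> \<tau> = z0 + \<rho> *\<^sub>R (e1, e2 + \<tau>)" for \<rho> \<tau>
    by (simp add: c_def m0_def n0_def prod_eq_iff)
  have c10: "c 1 0 = z1" by (simp add: c_def e1_def e2_def)
  define N0 where "N0 = (\<lambda>y. (A y)\<^sup>2 + (B y)\<^sup>2)"
  have contN: "continuous_on UNIV N0"
    unfolding N0_def by (intro continuous_intros smooth_on_continuous sm)
  have N1: "N0 z1 > 0" using nz z1 by (simp add: N0_def sum_power2_gt_zero_iff)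
  obtain \<eta> where \<eta>: "0 < \<eta>" "\<eta> \<le> 1" "\<And>\<tau>. 0 \<le> \<tau> \<Longrightarrow> \<tau> \<le> \<eta> \<Longrightarrow> N0 (c 1 \<tau>) \<ge> N0 z1 / 2"
  proof -
    have "isCont (\<lambda>\<tau>. N0 (c 1 \<tau>)) 0"
      unfolding c_def
      by (intro continuous_on_interior[of UNIV] continuous_on_compose2[OF contN] continuous_intros) auto
    moreover have "N0 z1 / 2 > 0" using N1 by simp
    ultimately obtain s where s: "s > 0" "\<And>\<tau>. dist \<tau> 0 < s \<Longrightarrow> dist (N0 (c 1 \<tau>)) (N0 (c 1 0)) < N0 z1 / 2"
      unfolding continuous_at_eps_delta by blast
    have "N0 (c 1 \<tau>) \<ge> N0 z1 / 2" if "0 \<le> \<tau>" "\<tau> \<le> min 1 (s/2)" for \<tau>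
      using s(2)[of \<tau>] that s(1) c10 by (auto simp: dist_real_def abs_if split: if_splits)
    then show ?thesis using that[of "min 1 (s/2)"] s(1) by auto
  qed
  \<comment> \<open>Both functions vanish at the vertex, so by the mean value theorem along the rays
    they are bounded by a multiple of \<rho>, uniformly in \<tau>.\<close>
  obtain G where G: "\<And>\<rho> \<tau>. \<rho> \<in> {0..1} \<Longrightarrow> \<tau> \<in> {0..1} \<Longrightarrow> N0 (c \<rho> \<tau>) \<le> G * \<rho>\<^sup>2" "G > 0"
  proof -
    have bd: "\<exists>K. \<forall>\<rho>\<in>{0..1}. \<forall>\<tau>\<in>{0..1}. \<bar>f (c \<rho> \<tau>)\<bar> \<le> K * \<rho>"
      if f: "smooth_on UNIV f" "f z0 = 0" for f
    proof -
      define j where "j = (\<lambda>p. e1 * d1 f (c (fst p) (snd p)) + (e2 + snd p) * d2 f (c (fst p) (snd p)))"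
      have "continuous_on ({0..1} \<times> {0..1}) (\<lambda>p. \<bar>j p\<bar>)"
        unfolding j_def c_def
        by (intro continuous_intros continuous_on_compose2[OF smooth_on_continuous[OF smooth_d1[OF f(1)]]]
             continuous_on_compose2[OF smooth_on_continuous[OF smooth_d2[OF f(1)]]]) auto
      moreover have "compact ({0..1::real} \<times> {0..1::real})" by (intro compact_Times) auto
      ultimately have "\<exists>p\<in>{0..1} \<times> {0..1}. \<forall>q\<in>{0..1} \<times> {0..1}. \<bar>j q\<bar> \<le> \<bar>j p\<bar>"
        by (intro continuous_attains_sup) auto
      then obtain p where p: "\<And>q. q \<in> {0..1} \<times> {0..1} \<Longrightarrow> \<bar>j q\<bar> \<le> \<bar>j p\<bar>"
        by blast
      have "\<bar>f (c \<rho> \<tau>)\<bar> \<le> \<bar>j p\<bar> * \<rho>" if rt: "\<rho> \<in> {0..1}" "\<tau> \<in> {0..1}" for \<rho> \<tau>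
      proof (cases "\<rho> = 0")
        case True then show ?thesis using f(2) by (simp add: c_line zero_prod_def[symmetric])
      next
        case False
        have d: "((\<lambda>\<rho>. f (c \<rho> \<tau>)) has_real_derivative j (\<rho>, \<tau>)) (at \<rho>)" for \<rho>
          using has_pd_line_real[OF smooth_has_pd[OF f(1)], of z0 \<rho> "(e1, e2 + \<tau>)"]
          by (simp add: c_line j_def)
        obtain x where x: "0 < x" "x < \<rho>" "f (c \<rho> \<tau>) - f (c 0 \<tau>) = (\<rho> - 0) * j (x, \<tau>)"
          using MVT2[of 0 \<rho> "\<lambda>\<rho>. f (c \<rho> \<tau>)" "\<lambda>x. j (x, \<tau>)"] d False rt by auto
        have "\<bar>j (x, \<tau>)\<bar> \<le> \<bar>j p\<bar>" using x rt by (intro p) auto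
        moreover have "f (c \<rho> \<tau>) = \<rho> * j (x, \<tau>)" using x f(2) by (simp add: c_line zero_prod_def[symmetric])
        ultimately show ?thesis using x by (simp add: abs_mult mult.commute mult_left_mono)
      qed
      then show ?thesis by blast
    qed
    obtain K1 K2 where K: "\<forall>\<rho>\<in>{0..1}. \<forall>\<tau>\<in>{0..1}. \<bar>A (c \<rho> \<tau>)\<bar> \<le> K1 * \<rho>"
      "\<forall>\<rho>\<in>{0..1}. \<forall>\<tau>\<in>{0..1}. \<bar>B (c \<rho> \<tau>)\<bar> \<le> K2 * \<rho>"
      using bd[OF sm(1) z0(1)] bd[OF sm(2) z0(2)] by blast
    have "N0 (c \<rho> \<tau>) \<le> (K1\<^sup>2 + K2\<^sup>2 + 1) * \<rho>\<^sup>2" if "\<rho> \<in> {0..1}" "\<tau> \<in> {0..1}" for \<rho> \<tau>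
    proof -
      have "\<bar>A (c \<rho> \<tau>)\<bar>\<^sup>2 \<le> (K1 * \<rho>)\<^sup>2" "\<bar>B (c \<rho> \<tau>)\<bar>\<^sup>2 \<le> (K2 * \<rho>)\<^sup>2"
        using K that by (intro power_mono abs_ge_zero; blast)+
      then have "N0 (c \<rho> \<tau>) \<le> (K1 * \<rho>)\<^sup>2 + (K2 * \<rho>)\<^sup>2 + \<rho>\<^sup>2"
        unfolding N0_def by (simp add: add_increasing2 add_mono)
      then show ?thesis by (simp add: power_mult_distrib distrib_right)
    qed
    then show ?thesis using that[of "K1\<^sup>2 + K2\<^sup>2 + 1"] by (simp add: add_nonneg_pos)
  qed
  define L where "L = e1\<^sup>2 + (\<bar>e2\<bar> + 1)\<^sup>2"
  have L: "L \<ge> 0" by (simp add: L_def)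
  \<comment> \<open>Lower bound for the part of the increase of the logarithm along a ray that does
    not depend on the inner radius.\<close>
  define \<kappa>0 where "\<kappa>0 = ln (N0 z1 / 2) / 2 - ln (G + 1) / 2"
  have key: "\<eta> * (\<kappa>0 + ln (1 / \<rho>0) / 2) \<le> L / 2 * (C / e1)" if \<rho>0: "0 < \<rho>0" "\<rho>0 < 1" for \<rho>0
  proof -
    \<comment> \<open>The regularisation is matched to the inner radius,
      \<open>\<delta> = \<rho>0^2\<close>, so the logarithm is cut off at the scale where the rays
      begin.\<close>
    define h where "h = (\<lambda>y. ln ((A y)\<^sup>2 + (B y)\<^sup>2 + \<rho>0\<^sup>2) / 2)"
    have pos: "(A y)\<^sup>2 + (B y)\<^sup>2 + \<rho>0\<^sup>2 > 0" for y using \<rho>0 by (simp add: add_nonneg_pos)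
    have smh: "smooth_on UNIV h"
      unfolding h_def using pos
      by (intro smooth_on_divide smooth_on_ln smooth_on_add smooth_on_power smooth_on_const sm open_UNIV) auto
    have perh: "h (y + (1, 0)) = h y" "h (y + (0, 1)) = h y" for y
      by (simp_all add: h_def perA perB)
    define k where "k = (\<lambda>y. (d1 h y)\<^sup>2 + (d2 h y)\<^sup>2)"
    have conth: "continuous_on S (d1 h)" "continuous_on S (d2 h)" for S
      using smooth_on_continuous[OF smooth_d1[OF smh]] smooth_on_continuous[OF smooth_d2[OF smh]]
      by (auto intro: continuous_on_subset)
    have contk: "continuous_on S k" for S unfolding k_def by (intro continuous_intros conth)
    have k0: "k y \<ge> 0" for y by (simp add: k_def)
    have perk: "k (y + (1, 0)) = k y" "k (y + (0, 1)) = k y" for y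
      by (simp_all add: k_def d_periodic[of h "(1,0)"] d_periodic[of h "(0,1)"] smh perh)
    define K where "K = (\<lambda>m. integral {0..1} (\<lambda>n. k (m, n)))"
    have IK: "integral {0..1} K \<le> C"
      using energy[of "\<rho>0\<^sup>2" h] \<rho>0 by (simp add: h_def k_def K_def square_integral_def)
    have contK: "continuous_on S K" for S
      unfolding K_def by (rule continuous_on_slice_integral[OF contk])
    have K0: "K m \<ge> 0" for m
      unfolding K_def by (intro integral_nonneg slice_integrable[OF contk]) (auto simp: k0)
    have perK: "K (m + 1) = K m" for m
      unfolding K_def using perk(1)[of "(m, _)"] by simp
    have contc: "continuous_on S (\<lambda>p. f (c (fst p) (snd p)))" if "continuous_on UNIV f" for S and f :: "plane \<Rightarrow> real"
      unfolding c_def by (intro continuous_on_compose2[OF that] continuous_intros) auto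
    have contck: "continuous_on S (\<lambda>p. fst p * k (c (fst p) (snd p)))" for S
      by (intro continuous_intros contc contk)
    have radial: "\<kappa>0 + ln (1 / \<rho>0) / 2 \<le> L / 2 * integral {\<rho>0..1} (\<lambda>\<rho>. \<rho> * k (c \<rho> \<tau>))"
      if \<tau>: "0 \<le> \<tau>" "\<tau> \<le> \<eta>" for \<tau>
    proof -
      define j where "j = (\<lambda>\<rho>. e1 * d1 h (c \<rho> \<tau>) + (e2 + \<tau>) * d2 h (c \<rho> \<tau>))"
      have d: "((\<lambda>\<rho>. h (c \<rho> \<tau>)) has_real_derivative j \<rho>) (at \<rho>)" for \<rho>
        using has_pd_line_real[OF smooth_has_pd[OF smh], of z0 \<rho> "(e1, e2 + \<tau>)"]
        by (simp add: c_line j_def)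
      have i1: "(j has_integral (h (c 1 \<tau>) - h (c \<rho>0 \<tau>))) {\<rho>0..1}"
        using d \<rho>0 by (intro fundamental_theorem_of_calculus)
         (auto simp: has_real_derivative_iff_has_vector_derivative[symmetric] intro: has_field_derivative_at_within)
      have ik: "(\<lambda>\<rho>. \<rho> * k (c \<rho> \<tau>)) integrable_on {\<rho>0..1}"
        by (intro integrable_continuous_real, unfold c_def)
           (intro continuous_intros continuous_on_compose2[OF contk[of UNIV]], auto)
      have "((\<lambda>\<rho>. inverse \<rho>) has_integral (ln 1 - ln \<rho>0)) {\<rho>0..1}"
        using \<rho>0 by (intro fundamental_theorem_of_calculus)
          (auto simp: has_real_derivative_iff_has_vector_derivative[symmetric] divide_inverse
             intro!: derivative_eq_intros)
      then have i2: "((\<lambda>\<rho>. L / 2 * (\<rho> * k (c \<rho> \<tau>)) + inverse \<rho> / 2) has_integral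
          (L / 2 * integral {\<rho>0..1} (\<lambda>\<rho>. \<rho> * k (c \<rho> \<tau>)) + (ln 1 - ln \<rho>0) / 2)) {\<rho>0..1}"
        by (intro has_integral_add has_integral_mult_right has_integral_divide integrable_integral[OF ik])
      \<comment> \<open>From \<open>2 * \<rho> * j \<le> \<rho>^2 * j^2 + 1\<close>. The second term
        integrates to only half of \<open>ln (1 / \<rho>0)\<close>, so the energy has to pay for the
        other half of the increase.\<close>
      have jle: "j \<rho> \<le> L / 2 * (\<rho> * k (c \<rho> \<tau>)) + inverse \<rho> / 2" if "\<rho> \<in> {\<rho>0..1}" for \<rho>
      proof -
        have \<rho>: "\<rho> > 0" using that \<rho>0 by auto
        define p q where "p = d1 h (c \<rho> \<tau>)" and "q = d2 h (c \<rho> \<tau>)"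
        have "(e1 * p + (e2 + \<tau>) * q)\<^sup>2 \<le> (e1\<^sup>2 + (e2 + \<tau>)\<^sup>2) * (p\<^sup>2 + q\<^sup>2)"
          using zero_le_power2[of "e1 * q - (e2 + \<tau>) * p"] by (simp add: algebra_simps power2_eq_square)
        also have "(e2 + \<tau>)\<^sup>2 \<le> (\<bar>e2\<bar> + 1)\<^sup>2" using \<tau> \<eta> by (intro abs_le_square_iff[THEN iffD1]) auto
        then have "(e1\<^sup>2 + (e2 + \<tau>)\<^sup>2) * (p\<^sup>2 + q\<^sup>2) \<le> L * (p\<^sup>2 + q\<^sup>2)"
          unfolding L_def by (intro mult_right_mono) auto
        finally have j2: "(j \<rho>)\<^sup>2 \<le> L * k (c \<rho> \<tau>)" by (simp add: j_def k_def p_def q_def)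
        have "0 \<le> (\<rho> * j \<rho> - 1)\<^sup>2" by simp
        then have "2 * \<rho> * j \<rho> \<le> \<rho>\<^sup>2 * (j \<rho>)\<^sup>2 + 1" by (simp add: power2_eq_square algebra_simps)
        also have "\<dots> \<le> \<rho>\<^sup>2 * (L * k (c \<rho> \<tau>)) + 1" using j2 by (simp add: mult_left_mono)
        finally have "2 * \<rho> * j \<rho> \<le> 2 * \<rho> * (L / 2 * (\<rho> * k (c \<rho> \<tau>)) + inverse \<rho> / 2)"
          using \<rho> by (simp add: algebra_simps power2_eq_square)
        then show ?thesis using \<rho> by simp
      qed
      have "h (c 1 \<tau>) - h (c \<rho>0 \<tau>) \<le> L / 2 * integral {\<rho>0..1} (\<lambda>\<rho>. \<rho> * k (c \<rho> \<tau>)) + (ln 1 - ln \<rho>0) / 2"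
        by (rule has_integral_le[OF i1 i2 jle])
      moreover have "h (c 1 \<tau>) \<ge> ln (N0 z1 / 2) / 2"
        using \<eta>(3)[OF \<tau>] N1 \<rho>0 unfolding h_def N0_def[symmetric]
        by (simp add: N0_def add_nonneg_pos add_increasing2 ln_mono)
      moreover have "h (c \<rho>0 \<tau>) \<le> ln ((G + 1) * \<rho>0\<^sup>2) / 2"
      proof -
        have "N0 (c \<rho>0 \<tau>) + \<rho>0\<^sup>2 \<le> (G + 1) * \<rho>0\<^sup>2" using G(1)[of \<rho>0 \<tau>] \<rho>0 \<tau> \<eta> by (simp add: algebra_simps)
        then show ?thesis unfolding h_def N0_def[symmetric] using pos[of "c \<rho>0 \<tau>"] \<rho>0 G(2)
          by (simp add: N0_def ln_mono)
      qed
      moreover have "ln ((G + 1) * \<rho>0\<^sup>2) = ln (G + 1) + 2 * ln \<rho>0"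
        using G(2) \<rho>0 by (simp add: ln_mult ln_realpow)
      ultimately show ?thesis
        using \<rho>0 unfolding \<kappa>0_def by (simp add: ln_div field_simps)
    qed
    have ieta: "(\<lambda>\<tau>. integral {\<rho>0..1} (\<lambda>\<rho>. \<rho> * k (c \<rho> \<tau>))) integrable_on {0..\<eta>}"
      using slice_integrable(2)[of "\<lambda>p. snd p * k (c (snd p) (fst p))" \<rho>0 1 0 \<eta>]
        continuous_on_compose2[OF contck[of UNIV], of UNIV "\<lambda>p. (snd p, fst p)"] continuous_on_swap
      by (simp add: prod.swap_def[abs_def] case_prod_unfold continuous_on_Pair continuous_on_fst continuous_on_snd)
    have "\<eta> * (\<kappa>0 + ln (1 / \<rho>0) / 2) = integral {0..\<eta>} (\<lambda>\<tau>. \<kappa>0 + ln (1 / \<rho>0) / 2)"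
      using \<eta> by simp
    also have "\<dots> \<le> integral {0..\<eta>} (\<lambda>\<tau>. L / 2 * integral {\<rho>0..1} (\<lambda>\<rho>. \<rho> * k (c \<rho> \<tau>)))"
      by (rule integral_le[OF integrable_const_ivl integrable_cmul[OF ieta, of "L / 2", unfolded real_scaleR_def]])
         (use radial in auto)
    also have "\<dots> = L / 2 * integral {0..\<eta>} (\<lambda>\<tau>. integral {\<rho>0..1} (\<lambda>\<rho>. \<rho> * k (c \<rho> \<tau>)))"
      by simp
    also have "integral {0..\<eta>} (\<lambda>\<tau>. integral {\<rho>0..1} (\<lambda>\<rho>. \<rho> * k (c \<rho> \<tau>))) =
        integral {\<rho>0..1} (\<lambda>\<rho>. integral {0..\<eta>} (\<lambda>\<tau>. \<rho> * k (c \<rho> \<tau>)))"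
      using integral_swap_continuous[of \<rho>0 0 1 \<eta> "\<lambda>\<rho> \<tau>. \<rho> * k (c \<rho> \<tau>)"] contck
      by (simp add: cbox_interval split_def)
    also have "L / 2 * \<dots> \<le> L / 2 * integral {\<rho>0..1} (\<lambda>\<rho>. K (e1 * \<rho> + m0))"
    proof (intro mult_left_mono integral_le)
      show "(\<lambda>\<rho>. integral {0..\<eta>} (\<lambda>\<tau>. \<rho> * k (c \<rho> \<tau>))) integrable_on {\<rho>0..1}"
        using slice_integrable(2)[OF contck] by simp
      show "(\<lambda>\<rho>. K (e1 * \<rho> + m0)) integrable_on {\<rho>0..1}"
        by (intro integrable_continuous_real continuous_on_compose2[OF contK[of UNIV]] continuous_intros) auto
      show "L / 2 \<ge> 0" using L by simp
      fix \<rho> assume "\<rho> \<in> {\<rho>0..1}"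
      then have \<rho>: "\<rho> > 0" "\<rho> \<le> 1" using \<rho>0 by auto
      define f where "f = (\<lambda>n. k (m0 + \<rho> * e1, n))"
      have contf: "continuous_on S f" for S unfolding f_def by (rule continuous_on_slice[OF contk])
      \<comment> \<open>The factor \<rho> is absorbed by the substitution; the resulting vertical
        segment has length \<open>\<rho> * \<eta> \<le> 1\<close> and so fits into one
        period.\<close>
      have "integral {0..\<eta>} (\<lambda>\<tau>. \<rho> * k (c \<rho> \<tau>)) = \<rho> * integral {0..\<eta>} (\<lambda>\<tau>. f (\<rho> * \<tau> + (n0 + \<rho> * e2)))"
        by (simp add: f_def c_def algebra_simps)
      also have "\<dots> = integral {n0 + \<rho> * e2..\<rho> * \<eta> + (n0 + \<rho> * e2)} f"
        using integral_shift_scale[OF contf \<rho>(1), of 0 \<eta> "n0 + \<rho> * e2"] \<rho> \<eta> by simp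
      also have "\<dots> \<le> integral {n0 + \<rho> * e2..n0 + \<rho> * e2 + 1} f"
        using \<rho> \<eta> mult_le_one[of \<rho> \<eta>] by (intro integral_mono_set contf) (auto simp: f_def k0)
      also have "\<dots> = integral {0..1} f"
        by (rule integral_periodic[OF contf]) (use perk(2)[of "(m0 + \<rho> * e1, _)"] in \<open>simp add: f_def\<close>)
      also have "\<dots> = K (e1 * \<rho> + m0)" by (simp add: K_def f_def algebra_simps)
      finally show "integral {0..\<eta>} (\<lambda>\<tau>. \<rho> * k (c \<rho> \<tau>)) \<le> K (e1 * \<rho> + m0)" .
    qed
    also have "integral {\<rho>0..1} (\<lambda>\<rho>. K (e1 * \<rho> + m0)) = integral {e1 * \<rho>0 + m0..e1 * 1 + m0} K / e1"
      using \<rho>0 by (intro integral_shift_scale contK e1) auto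
    also have "integral {e1 * \<rho>0 + m0..e1 * 1 + m0} K \<le> integral {m0..m0 + 1} K"
      using e1 \<rho>0 by (intro integral_mono_set contK K0) auto
    also have "integral {m0..m0 + 1} K = integral {0..1} K"
      by (rule integral_periodic[OF contK perK])
    also note IK
    finally show ?thesis using L e1 by (simp add: mult_left_mono divide_right_mono)
  qed
  \<comment> \<open>With \<open>\<rho>0 = exp (- 2 * X)\<close> the logarithmic term equals
    \<open>X\<close>, chosen beyond what the fixed energy bound allows.\<close>
  define X where "X = \<bar>L / 2 * (C / e1) / \<eta> - \<kappa>0\<bar> + 1"
  have "X > 0" unfolding X_def by (simp add: add_nonneg_pos)
  then have "0 < exp (- 2 * X)" "exp (- 2 * X) < 1" by auto
  from key[OF this] have "\<eta> * (\<kappa>0 + X) \<le> L / 2 * (C / e1)"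
    by (simp add: ln_div)
  then have "\<kappa>0 + X \<le> L / 2 * (C / e1) / \<eta>" using \<eta> by (simp only: pos_le_divide_eq mult.commute)
  then show False unfolding X_def by linarith
qed


text \<open>In the basis of periods the function is 1-periodic in each variable, so its partial
  derivatives have mean zero there; \<open>det\<close> makes the original partial derivatives
  constant combinations of them.\<close>

lemma square_integral_d_linear:
  assumes f: "smooth_on UNIV f" and per: "\<And>y. f (y + u) = f y" "\<And>y. f (y + v) = f y"
    and det: "fst u * snd v - snd u * fst v \<noteq> 0"
  shows "square_integral (\<lambda>p. d1 f (fst p *\<^sub>R u + snd p *\<^sub>R v)) = 0"
    and "square_integral (\<lambda>p. d2 f (fst p *\<^sub>R u + snd p *\<^sub>R v)) = 0"
proof -
  define L where "L = (\<lambda>p::plane. fst p *\<^sub>R u + snd p *\<^sub>R v)"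
  have L: "bounded_linear L"
    unfolding L_def by (intro bounded_linear_add bounded_linear_scaleR_left[THEN bounded_linear_compose] bounded_linear_fst bounded_linear_snd)
  define F where "F = (\<lambda>p. f (L p))"
  have F: "smooth_on UNIV F" unfolding F_def by (rule smooth_on_compose_right[OF f L])
  have pd: "has_pd F (fst u * d1 f (L p) + snd u * d2 f (L p)) (fst v * d1 f (L p) + snd v * d2 f (L p)) p" for p
    using has_derivative_compose[OF bounded_linear_imp_has_derivative[OF L] smooth_has_pd[OF f, unfolded has_pd_def], of p UNIV]
    by (simp add: has_pd_def F_def L_def algebra_simps)
  have dF: "d1 F p = fst u * d1 f (L p) + snd u * d2 f (L p)" "d2 F p = fst v * d1 f (L p) + snd v * d2 f (L p)" for p
    using has_pd_d[OF pd] by auto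
  have "F (m + 1, n) = F (m, n)" "F (m, n + 1) = F (m, n)" for m n
    using per(1)[of "L (m, n)"] per(2)[of "L (m, n)"] by (simp_all add: F_def L_def algebra_simps)
  then have 0: "square_integral (d1 F) = 0" "square_integral (d2 F) = 0"
    by (simp_all add: square_integral_d1 square_integral_d2 F)
  have c: "continuous_on UNIV (d1 F)" "continuous_on UNIV (d2 F)"
    using F by (auto intro!: smooth_on_continuous)
  define D where "D = fst u * snd v - snd u * fst v"
  have "d1 f (L p) = (snd v / D) * d1 F p + (- snd u / D) * d2 F p"
    "d2 f (L p) = (- fst v / D) * d1 F p + (fst u / D) * d2 F p" for p
    using det unfolding dF D_def by (simp_all add: divide_simps) (simp_all add: algebra_simps)
  note eq = this
  have "square_integral (\<lambda>p. x * d1 F p + y * d2 F p) = 0" for x y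
    by (subst square_integral_add) (auto simp: square_integral_cmult 0 intro!: continuous_on_mult_left c)
  then have "square_integral (\<lambda>p. d1 f (L p)) = 0" "square_integral (\<lambda>p. d2 f (L p)) = 0"
    unfolding eq by blast+
  then show "square_integral (\<lambda>p. d1 f (fst p *\<^sub>R u + snd p *\<^sub>R v)) = 0"
    and "square_integral (\<lambda>p. d2 f (fst p *\<^sub>R u + snd p *\<^sub>R v)) = 0"
    by (simp_all add: L_def)
qed

text \<open>With Z = A + iB the hypotheses read Z_t + i g Z_x = 4 i g_x Z. Then
  \<open>(ht, hx)\<close> is the gradient of the regularised log |Z| and \<open>(w1, w2)\<close> the
  regularised d arg Z; the equation rotates one into the other up to a multiple of g_x. The right
  side is the density of d(H w) plus an error free of Z. In the constant 12, a share of 8 comes from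
  absorbing the mixed term and 4 from the lower bound on the Jacobian.\<close>

lemma log_energy_density:
  fixes g gx A B At Ax Bt Bx \<delta> :: real
  assumes g: "g > 0" and \<delta>: "\<delta> > 0"
    and At: "At = g * Bx - 4 * gx * B" and Bt: "Bt = - g * Ax + 4 * gx * A"
    and N: "N = A\<^sup>2 + B\<^sup>2 + \<delta>"
    and ht: "ht = (A * At + B * Bt) / N" and hx: "hx = (A * Ax + B * Bx) / N"
    and w1: "w1 = (A * Bt - B * At) / N" and w2: "w2 = (A * Bx - B * Ax) / N"
    and H: "H \<ge> 0" "2 * \<delta> * H \<le> A\<^sup>2 + B\<^sup>2"
  shows "ht\<^sup>2 / g + g * hx\<^sup>2 / 2 \<le>
    ht * w2 - hx * w1 + H * (2 * \<delta> * (At * Bx - Ax * Bt) / N\<^sup>2) + 12 * gx\<^sup>2 / g"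
proof -
  define q where "q = A\<^sup>2 + B\<^sup>2"
  have Np: "N > 0" and q: "q \<ge> 0" "q \<le> N" using \<delta> by (simp_all add: N q_def add_nonneg_pos)
  define k where "k = 4 * gx * q / N"
  have ht': "ht = g * w2" unfolding ht w2 At Bt by (simp add: algebra_simps)
  have w1': "w1 = - g * hx + k" unfolding w1 hx k_def At Bt q_def
    by (simp add: algebra_simps add_divide_distrib diff_divide_distrib power2_eq_square)
  have "ht\<^sup>2 / g = ht * w2" using g unfolding ht' by (simp add: power2_eq_square)
  then have e1: "ht * w2 - hx * w1 = ht\<^sup>2 / g + g * hx\<^sup>2 - k * hx"
    unfolding w1' by (simp add: algebra_simps power2_eq_square)
  have "0 \<le> (g * hx - k)\<^sup>2 / (2 * g)" using g by simp
  also have "\<dots> = g * hx\<^sup>2 / 2 - k * hx + k\<^sup>2 / (2 * g)"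
    using g by (simp add: power2_eq_square field_simps)
  finally have e2: "k * hx \<le> g * hx\<^sup>2 / 2 + k\<^sup>2 / (2 * g)" by simp
  have qN: "(q / N)\<^sup>2 \<le> 1" using q Np by (intro power_le_one) (auto simp: divide_le_eq_1)
  have "k\<^sup>2 = 16 * gx\<^sup>2 * (q / N)\<^sup>2" by (simp add: k_def power_mult_distrib power_divide)
  also have "\<dots> \<le> 16 * gx\<^sup>2 * 1" by (intro mult_left_mono qN) auto
  finally have "k\<^sup>2 / (2 * g) \<le> 16 * gx\<^sup>2 / (2 * g)" using g by (intro divide_right_mono) auto
  then have e3: "k\<^sup>2 / (2 * g) \<le> 8 * gx\<^sup>2 / g" using g by simp
  \<comment> \<open>The Jacobian determinant of Z is nonnegative up to a term quadratic in Z: after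
    the derivatives in t are eliminated, it completes to two squares.\<close>
  have "At * Bx - Ax * Bt + 4 * gx\<^sup>2 * q / g = ((g * Bx - 2 * gx * B)\<^sup>2 + (g * Ax - 2 * gx * A)\<^sup>2) / g"
    unfolding At Bt q_def using g by (simp add: field_simps power2_eq_square)
  also have "\<dots> \<ge> 0" using g by simp
  finally have J: "- (4 * gx\<^sup>2 * q / g) \<le> At * Bx - Ax * Bt" by simp
  have "H * (2 * \<delta> * (- (4 * gx\<^sup>2 * q / g)) / N\<^sup>2) \<le> H * (2 * \<delta> * (At * Bx - Ax * Bt) / N\<^sup>2)"
    using J H \<delta> by (intro mult_left_mono divide_right_mono) auto
  moreover have "H * (2 * \<delta> * (4 * gx\<^sup>2 * q / g) / N\<^sup>2) \<le> 4 * gx\<^sup>2 / g"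
  proof -
    have "H * (2 * \<delta> * (4 * gx\<^sup>2 * q / g) / N\<^sup>2) = (2 * \<delta> * H) * (4 * gx\<^sup>2 * q / g / N\<^sup>2)" by simp
    also have "\<dots> \<le> q * (4 * gx\<^sup>2 * q / g / N\<^sup>2)"
      using H(2) g q by (intro mult_right_mono) (auto simp: q_def[symmetric])
    also have "\<dots> = 4 * gx\<^sup>2 / g * (q / N)\<^sup>2" by (simp add: power2_eq_square)
    also have "\<dots> \<le> 4 * gx\<^sup>2 / g * 1" using g by (intro mult_left_mono qN) auto
    finally show ?thesis by simp
  qed
  ultimately have e4: "- (4 * gx\<^sup>2 / g) \<le> H * (2 * \<delta> * (At * Bx - Ax * Bt) / N\<^sup>2)" by simp
  have "12 * gx\<^sup>2 / g = 8 * gx\<^sup>2 / g + 4 * gx\<^sup>2 / g" using g by (simp add: field_simps)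
  then show ?thesis using e1 e2 e3 e4 by linarith
qed

text \<open>The energy density is exact up to a bounded error and the exact part has mean zero over
  a period, so the energy of log |Z| is bounded independently of \<delta>. A zero of a solution that
  is not identically zero would make it unbounded.\<close>

lemma cauchy_riemann_zero_free:
  fixes g A B :: "plane \<Rightarrow> real"
  assumes sm: "smooth_on UNIV g" "smooth_on UNIV A" "smooth_on UNIV B" and g: "\<And>y. g y > 0"
    and At: "\<And>y. d1 A y = g y * d2 B y - 4 * d2 g y * B y"
    and Bt: "\<And>y. d1 B y = - g y * d2 A y + 4 * d2 g y * A y"
    and perA: "\<And>y. A (y + u) = A y" "\<And>y. A (y + v) = A y"
    and perB: "\<And>y. B (y + u) = B y" "\<And>y. B (y + v) = B y"
    and det: "fst u * snd v - snd u * fst v \<noteq> 0"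
    and z0: "A z0 = 0" "B z0 = 0"
  shows "A z = 0 \<and> B z = 0"
proof -
  define L where "L = (\<lambda>p::plane. fst p *\<^sub>R u + snd p *\<^sub>R v)"
  have L: "bounded_linear L"
    unfolding L_def by (intro bounded_linear_add bounded_linear_scaleR_left[THEN bounded_linear_compose] bounded_linear_fst bounded_linear_snd)
  have contL: "continuous_on S L" for S using L by (rule linear_continuous_on)
  have surjL: "\<exists>p. L p = y" for y
  proof -
    define D where "D = fst u * snd v - snd u * fst v"
    define p where "p = ((snd v * fst y - fst v * snd y) / D, (fst u * snd y - snd u * fst y) / D)"
    have "L p = y" using det unfolding p_def L_def D_def
      by (simp add: prod_eq_iff divide_simps) (simp add: algebra_simps)
    then show ?thesis by blast
  qed
  have cg: "continuous_on UNIV (\<lambda>p. g (L p))" "continuous_on UNIV (\<lambda>p. d2 g (L p))"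
    using continuous_on_compose2[OF smooth_on_continuous[OF sm(1)] contL]
      continuous_on_compose2[OF smooth_on_continuous[OF smooth_d2[OF sm(1)]] contL] by auto
  have sq: "compact ({0..1::real} \<times> {0..1::real})" "{0..1::real} \<times> {0..1::real} \<noteq> {}"
    by (auto intro!: compact_Times)
  obtain pm where pm: "\<And>p. p \<in> {0..1} \<times> {0..1} \<Longrightarrow> g (L pm) \<le> g (L p)"
    using continuous_attains_inf[OF sq continuous_on_subset[OF cg(1)]] by blast
  obtain pM where pM: "\<And>p. p \<in> {0..1} \<times> {0..1} \<Longrightarrow> g (L p) \<le> g (L pM)"
    using continuous_attains_sup[OF sq continuous_on_subset[OF cg(1)]] by blast
  have cq: "continuous_on UNIV (\<lambda>p. 12 * (d2 g (L p))\<^sup>2 / g (L p))"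
    using g by (intro continuous_intros cg) (simp add: less_imp_neq[symmetric])
  obtain pq where pq: "\<And>p. p \<in> {0..1} \<times> {0..1} \<Longrightarrow> 12 * (d2 g (L p))\<^sup>2 / g (L p) \<le> 12 * (d2 g (L pq))\<^sup>2 / g (L pq)"
    using continuous_attains_sup[OF sq continuous_on_subset[OF cq]] by blast
  define E where "E = 12 * (d2 g (L pq))\<^sup>2 / g (L pq)"
  \<comment> \<open>\<open>c0\<close> bounds the energy density below by the squared gradient over a
    period, and \<open>C2\<close> controls the distortion by the change of variables
    \<open>L\<close> to the unit square.\<close>
  define c0 where "c0 = min (1 / g (L pM)) (g (L pm) / 2)"
  have c0: "c0 > 0" using g by (simp add: c0_def)
  define C2 where "C2 = (fst u)\<^sup>2 + (snd u)\<^sup>2 + (fst v)\<^sup>2 + (snd v)\<^sup>2"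
  have C2: "C2 \<ge> 0" by (simp add: C2_def)
  have perL: "f (L (y + (1, 0))) = f (L y)" "f (L (y + (0, 1))) = f (L y)"
    if "\<And>y. f (y + u) = f y" "\<And>y. f (y + v) = f y" for f :: "plane \<Rightarrow> real" and y
    using that(1)[of "L y"] that(2)[of "L y"] by (simp_all add: L_def algebra_simps)
  obtain p0 where p0: "L p0 = z0" using surjL by blast
  obtain pz where pz: "L pz = z" using surjL by blast
  have "A (L pz) = 0 \<and> B (L pz) = 0"
  proof (rule log_energy_unbounded[of "\<lambda>p. A (L p)" "\<lambda>p. B (L p)" "C2 * (E / c0)" p0])
    show "smooth_on UNIV (\<lambda>p. A (L p))" "smooth_on UNIV (\<lambda>p. B (L p))"
      by (rule smooth_on_compose_right[OF _ L], rule sm)+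
    show "A (L (y + (1, 0))) = A (L y)" "A (L (y + (0, 1))) = A (L y)"
      "B (L (y + (1, 0))) = B (L y)" "B (L (y + (0, 1))) = B (L y)" for y
      by (simp_all only: perL[OF perA] perL[OF perB])
    show "A (L p0) = 0" "B (L p0) = 0" using z0 p0 by simp_all
    fix \<delta> :: real and hL :: "plane \<Rightarrow> real"
    assume \<delta>: "0 < \<delta>" and hL: "hL = (\<lambda>p. ln ((A (L p))\<^sup>2 + (B (L p))\<^sup>2 + \<delta>) / 2)"
    define N where "N = (\<lambda>y. (A y)\<^sup>2 + (B y)\<^sup>2 + \<delta>)"
    define h where "h = (\<lambda>y. ln (N y) / 2)"
    \<comment> \<open>Subtracting the constant makes \<open>H\<close> equal to half of
      \<open>ln (1 + |Z|^2 / \<delta>)\<close>. It is then nonnegative and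
      \<open>2 * \<delta> * H\<close> is at most \<open>|Z|^2\<close>, which is what the curl of
      \<open>w\<close>, proportional to \<delta>, requires.\<close>
    define H where "H = (\<lambda>y. h y - ln \<delta> / 2)"
    define w1 where "w1 = (\<lambda>y. (A y * d1 B y - B y * d1 A y) / N y)"
    define w2 where "w2 = (\<lambda>y. (A y * d2 B y - B y * d2 A y) / N y)"
    have N: "N y > 0" for y using \<delta> by (simp add: N_def add_nonneg_pos)
    then have N0: "N y \<noteq> 0" for y by (simp add: less_imp_neq[symmetric])
    have smN: "smooth_on UNIV N"
      unfolding N_def by (intro smooth_on_add smooth_on_power smooth_on_const sm open_UNIV)
    have smh: "smooth_on UNIV h"
      unfolding h_def by (intro smooth_on_divide smooth_on_ln smooth_on_const smN open_UNIV N) auto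
    have smH: "smooth_on UNIV H"
      unfolding H_def by (intro smooth_on_diff smh smooth_on_const open_UNIV)
    have smw: "smooth_on UNIV w1" "smooth_on UNIV w2"
      unfolding w1_def w2_def
      by (intro smooth_on_divide smooth_on_diff smooth_on_mult smooth_d1 smooth_d2 sm smN open_UNIV N0)+
    define X Y where "X = (\<lambda>y. H y * w2 y)" and "Y = (\<lambda>y. H y * w1 y)"
    have smX: "smooth_on UNIV X" and smY: "smooth_on UNIV Y"
      unfolding X_def Y_def by (intro smooth_on_mult smH smw open_UNIV)+
    note dper = d_periodic[OF sm(2) perA(1)] d_periodic[OF sm(2) perA(2)]
      d_periodic[OF sm(3) perB(1)] d_periodic[OF sm(3) perB(2)]
    have perX: "X (y + u) = X y" "X (y + v) = X y" and perY: "Y (y + u) = Y y" "Y (y + v) = Y y" for y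
      by (simp_all add: X_def Y_def H_def h_def N_def w1_def w2_def perA perB dper)
    note pA = smooth_has_pd[OF sm(2) UNIV_I] and pB = smooth_has_pd[OF sm(3) UNIV_I]
    have pN: "has_pd N (2 * (A y * d1 A y + B y * d1 B y)) (2 * (A y * d2 A y + B y * d2 B y)) y" for y
      unfolding N_def
      by (rule has_pd_eq[OF has_pd_add[OF has_pd_add[OF has_pd_power[OF pA] has_pd_power[OF pB]] has_pd_const]])
         (auto simp: algebra_simps)
    have dh: "d1 h y = (A y * d1 A y + B y * d1 B y) / N y" "d2 h y = (A y * d2 A y + B y * d2 B y) / N y" for y
    proof -
      have "has_pd h (1 / (2 * N y) * (2 * (A y * d1 A y + B y * d1 B y))) (1 / (2 * N y) * (2 * (A y * d2 A y + B y * d2 B y))) y"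
        unfolding h_def
        by (rule has_pd_chain_real[OF pN]) (use N[of y] in \<open>auto intro!: derivative_eq_intros simp: field_simps\<close>)
      from has_pd_d[OF this] N0[of y] show "d1 h y = (A y * d1 A y + B y * d1 B y) / N y"
        "d2 h y = (A y * d2 A y + B y * d2 B y) / N y"
        by (auto simp: field_simps)
    qed
    have dH: "d1 H y = d1 h y" "d2 H y = d2 h y" for y
      using has_pd_d[OF has_pd_diff[OF smooth_has_pd[OF smh UNIV_I, of y] has_pd_const]] unfolding H_def by auto
    have curl: "d1 w2 y - d2 w1 y = 2 * \<delta> * (d1 A y * d2 B y - d2 A y * d1 B y) / (N y)\<^sup>2" for y
    proof -
      note pAt = smooth_has_pd[OF smooth_d1[OF sm(2)] UNIV_I] and pAx = smooth_has_pd[OF smooth_d2[OF sm(2)] UNIV_I]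
        and pBt = smooth_has_pd[OF smooth_d1[OF sm(3)] UNIV_I] and pBx = smooth_has_pd[OF smooth_d2[OF sm(3)] UNIV_I]
      have "d1 w2 y = ((d1 A y * d2 B y + A y * d1 (d2 B) y - (d1 B y * d2 A y + B y * d1 (d2 A) y)) * N y -
          (A y * d2 B y - B y * d2 A y) * (2 * (A y * d1 A y + B y * d1 B y))) / (N y)\<^sup>2"
        unfolding w2_def
        using has_pd_d[OF has_pd_divide[OF has_pd_diff[OF has_pd_mult[OF pA pBx] has_pd_mult[OF pB pAx]] pN N0]] by simp
      moreover have "d2 w1 y = ((d2 A y * d1 B y + A y * d2 (d1 B) y - (d2 B y * d1 A y + B y * d2 (d1 A) y)) * N y -
          (A y * d1 B y - B y * d1 A y) * (2 * (A y * d2 A y + B y * d2 B y))) / (N y)\<^sup>2"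
        unfolding w1_def
        using has_pd_d[OF has_pd_divide[OF has_pd_diff[OF has_pd_mult[OF pA pBt] has_pd_mult[OF pB pAt]] pN N0]] by simp
      ultimately have "d1 w2 y - d2 w1 y = (((d1 A y * d2 B y + A y * d2 (d1 B) y - (d1 B y * d2 A y + B y * d2 (d1 A) y)) * N y -
          (A y * d2 B y - B y * d2 A y) * (2 * (A y * d1 A y + B y * d1 B y))) -
          ((d2 A y * d1 B y + A y * d2 (d1 B) y - (d2 B y * d1 A y + B y * d2 (d1 A) y)) * N y -
          (A y * d1 B y - B y * d1 A y) * (2 * (A y * d2 A y + B y * d2 B y)))) / (N y)\<^sup>2"
        by (simp only: diff_divide_distrib d1_d2_commute[OF sm(2)] d1_d2_commute[OF sm(3)])
      also have "\<dots> = 2 * \<delta> * (d1 A y * d2 B y - d2 A y * d1 B y) / (N y)\<^sup>2"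
        by (rule arg_cong[of _ _ "\<lambda>x. x / (N y)\<^sup>2"]) (simp add: N_def algebra_simps power2_eq_square)
      finally show ?thesis .
    qed
    have dens: "(d1 h y)\<^sup>2 / g y + g y * (d2 h y)\<^sup>2 / 2 \<le> d1 X y + (- 1) * d2 Y y + 12 * (d2 g y)\<^sup>2 / g y" for y
    proof -
      have H: "H y \<ge> 0" "2 * \<delta> * H y \<le> (A y)\<^sup>2 + (B y)\<^sup>2"
      proof -
        have "H y = ln (1 + ((A y)\<^sup>2 + (B y)\<^sup>2) / \<delta>) / 2"
        proof -
          have "1 + ((A y)\<^sup>2 + (B y)\<^sup>2) / \<delta> = N y / \<delta>" using \<delta> by (simp add: N_def field_simps)
          then show ?thesis using N[of y] \<delta> by (simp add: H_def h_def ln_div diff_divide_distrib)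
        qed
        moreover have q0: "((A y)\<^sup>2 + (B y)\<^sup>2) / \<delta> \<ge> 0" using \<delta> by simp
        ultimately show "H y \<ge> 0"
          using ln_ge_zero[of "1 + ((A y)\<^sup>2 + (B y)\<^sup>2) / \<delta>"] by linarith
        have "2 * H y \<le> ((A y)\<^sup>2 + (B y)\<^sup>2) / \<delta>"
          using ln_add_one_self_le_self[OF q0] \<open>H y = _\<close> by simp
        then show "2 * \<delta> * H y \<le> (A y)\<^sup>2 + (B y)\<^sup>2" using \<delta> by (simp add: field_simps)
      qed
      have "d1 X y = d1 h y * w2 y + H y * d1 w2 y" "d2 Y y = d2 h y * w1 y + H y * d2 w1 y"
        using has_pd_d[OF has_pd_mult[OF smooth_has_pd[OF smH UNIV_I] smooth_has_pd[OF smw(2) UNIV_I], of y]]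
          has_pd_d[OF has_pd_mult[OF smooth_has_pd[OF smH UNIV_I] smooth_has_pd[OF smw(1) UNIV_I], of y]]
        by (simp_all add: X_def Y_def dH)
      then have "d1 X y + (- 1) * d2 Y y = d1 h y * w2 y - d2 h y * w1 y + H y * (d1 w2 y - d2 w1 y)"
        by (simp add: algebra_simps)
      then have eq: "d1 X y + (- 1) * d2 Y y = d1 h y * w2 y - d2 h y * w1 y +
          H y * (2 * \<delta> * (d1 A y * d2 B y - d2 A y * d1 B y) / (N y)\<^sup>2)"
        by (simp only: curl)
      have "N y = (A y)\<^sup>2 + (B y)\<^sup>2 + \<delta>" "w1 y = (A y * d1 B y - B y * d1 A y) / N y"
        "w2 y = (A y * d2 B y - B y * d2 A y) / N y" by (simp_all only: N_def w1_def w2_def)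
      from log_energy_density[OF g \<delta> At Bt this(1) dh(1) dh(2) this(2,3) H] show ?thesis
        by (simp only: eq)
    qed
    have pL: "has_pd hL (fst u * d1 h (L p) + snd u * d2 h (L p)) (fst v * d1 h (L p) + snd v * d2 h (L p)) p" for p
      using has_derivative_compose[OF bounded_linear_imp_has_derivative[OF L] smooth_has_pd[OF smh, unfolded has_pd_def], of p UNIV]
      by (simp add: has_pd_def hL h_def N_def L_def algebra_simps)
    have pw: "(d1 hL p)\<^sup>2 + (d2 hL p)\<^sup>2 \<le> C2 / c0 * ((d1 X (L p) + (- 1) * d2 Y (L p)) + E)"
      if p: "p \<in> {0..1} \<times> {0..1}" for p
    proof -
      define a b where "a = d1 h (L p)" and "b = d2 h (L p)"
      have gp: "g (L p) > 0" by (rule g)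
      have cs: "(x * a + y * b)\<^sup>2 \<le> (x\<^sup>2 + y\<^sup>2) * (a\<^sup>2 + b\<^sup>2)" for x y
        using zero_le_power2[of "x * b - y * a"] by (simp add: algebra_simps power2_eq_square)
      have "(d1 hL p)\<^sup>2 + (d2 hL p)\<^sup>2 \<le> C2 * (a\<^sup>2 + b\<^sup>2)"
        using cs[of "fst u" "snd u"] cs[of "fst v" "snd v"] has_pd_d[OF pL, of p]
        by (simp add: C2_def a_def b_def distrib_right)
      also have "\<dots> = C2 / c0 * (c0 * (a\<^sup>2 + b\<^sup>2))" using c0 by simp
      also have "\<dots> \<le> C2 / c0 * (a\<^sup>2 / g (L p) + g (L p) * b\<^sup>2 / 2)"
      proof (intro mult_left_mono)
        have "c0 \<le> 1 / g (L pM)" by (simp add: c0_def)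
        also have "\<dots> \<le> 1 / g (L p)" using pM[OF p] gp by (simp add: frac_le)
        finally have "c0 * a\<^sup>2 \<le> 1 / g (L p) * a\<^sup>2" by (intro mult_right_mono) auto
        moreover have "c0 \<le> g (L p) / 2" using pm[OF p] by (simp add: c0_def min_def)
        then have "c0 * b\<^sup>2 \<le> g (L p) / 2 * b\<^sup>2" by (intro mult_right_mono) auto
        ultimately show "c0 * (a\<^sup>2 + b\<^sup>2) \<le> a\<^sup>2 / g (L p) + g (L p) * b\<^sup>2 / 2" by (simp add: distrib_left)
      qed (use C2 c0 in auto)
      also have "\<dots> \<le> C2 / c0 * ((d1 X (L p) + (- 1) * d2 Y (L p)) + E)"
        using dens[of "L p"] pq[OF p] C2 c0 unfolding a_def b_def E_def by (intro mult_left_mono) auto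
      finally show ?thesis .
    qed
    have smhL: "smooth_on UNIV hL"
      using smooth_on_compose_right[OF smh L] by (simp add: hL h_def N_def)
    have cX: "continuous_on UNIV (\<lambda>p. d1 X (L p))" and cY: "continuous_on UNIV (\<lambda>p. d2 Y (L p))"
      using continuous_on_compose2[OF smooth_on_continuous[OF smooth_d1[OF smX]] contL]
        continuous_on_compose2[OF smooth_on_continuous[OF smooth_d2[OF smY]] contL] by auto
    have "square_integral (\<lambda>y. (d1 hL y)\<^sup>2 + (d2 hL y)\<^sup>2) \<le>
      square_integral (\<lambda>p. C2 / c0 * ((d1 X (L p) + (- 1) * d2 Y (L p)) + E))"
      by (rule square_integral_mono[OF _ _ pw])
         (intro continuous_intros smooth_on_continuous smooth_d1 smooth_d2 smhL cX cY)+
    also have "\<dots> = C2 / c0 * ((square_integral (\<lambda>p. d1 X (L p)) + (- 1) * square_integral (\<lambda>p. d2 Y (L p))) + E)"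
      unfolding square_integral_cmult
      by (subst square_integral_add square_integral_cmult square_integral_const;
          (intro continuous_intros cX cY)?)+ simp
    also have "\<dots> = C2 * (E / c0)"
      using square_integral_d_linear(1)[OF smX perX det] square_integral_d_linear(2)[OF smY perY det]
      by (simp add: L_def)
    finally show "square_integral (\<lambda>y. (d1 hL y)\<^sup>2 + (d2 hL y)\<^sup>2) \<le> C2 * (E / c0)" .
  qed
  then show ?thesis using pz by simp
qed

section \<open>The quartic and its critical points\<close>

text \<open>In the variable \<open>s = p\<^sub>2 g / p\<^sub>1\<close> the restriction of the integral to a unit cosphere
  is \<open>qp / (1 + s\<^sup>2)\<^sup>2\<close>, with derivative \<open>qP / (1 + s\<^sup>2)\<^sup>3\<close>; the eigenvalues of the hydrodynamic
  matrix are \<open>g s\<close> with \<open>qP s = 0\<close>.  The names starting with \<open>l\<close> are the linear parts.\<close>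

definition qp :: "'a::field \<Rightarrow> 'a \<Rightarrow> 'a \<Rightarrow> 'a \<Rightarrow> 'a \<Rightarrow> 'a" where
  "qp a0 a1 a2 a3 s = a0 + a1 * s + a2 * s ^ 2 + a3 * s ^ 3 + s ^ 4"
definition qP :: "'a::field \<Rightarrow> 'a \<Rightarrow> 'a \<Rightarrow> 'a \<Rightarrow> 'a \<Rightarrow> 'a" where
  "qP a0 a1 a2 a3 s = - a3 * s ^ 4 + (4 - 2 * a2) * s ^ 3 + (3 * a3 - 3 * a1) * s ^ 2 + (2 * a2 - 4 * a0) * s + a1"
definition qP1 :: "'a::field \<Rightarrow> 'a \<Rightarrow> 'a \<Rightarrow> 'a \<Rightarrow> 'a \<Rightarrow> 'a" where
  "qP1 a0 a1 a2 a3 s = - 4 * a3 * s ^ 3 + 3 * (4 - 2 * a2) * s ^ 2 + 2 * (3 * a3 - 3 * a1) * s + (2 * a2 - 4 * a0)"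
definition qP2 :: "'a::field \<Rightarrow> 'a \<Rightarrow> 'a \<Rightarrow> 'a \<Rightarrow> 'a \<Rightarrow> 'a" where
  "qP2 a0 a1 a2 a3 s = - 12 * a3 * s ^ 2 + 6 * (4 - 2 * a2) * s + 2 * (3 * a3 - 3 * a1)"
definition lp :: "'a::field \<Rightarrow> 'a \<Rightarrow> 'a \<Rightarrow> 'a \<Rightarrow> 'a \<Rightarrow> 'a" where
  "lp a0 a1 a2 a3 s = a0 + a1 * s + a2 * s ^ 2 + a3 * s ^ 3"
definition lp1 :: "'a::field \<Rightarrow> 'a \<Rightarrow> 'a \<Rightarrow> 'a \<Rightarrow> 'a \<Rightarrow> 'a" where
  "lp1 a0 a1 a2 a3 s = a1 + 2 * a2 * s + 3 * a3 * s ^ 2"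
definition lP :: "'a::field \<Rightarrow> 'a \<Rightarrow> 'a \<Rightarrow> 'a \<Rightarrow> 'a \<Rightarrow> 'a" where
  "lP a0 a1 a2 a3 s = - a3 * s ^ 4 - 2 * a2 * s ^ 3 + (3 * a3 - 3 * a1) * s ^ 2 + (2 * a2 - 4 * a0) * s + a1"
definition lP1 :: "'a::field \<Rightarrow> 'a \<Rightarrow> 'a \<Rightarrow> 'a \<Rightarrow> 'a \<Rightarrow> 'a" where
  "lP1 a0 a1 a2 a3 s = - 4 * a3 * s ^ 3 - 6 * a2 * s ^ 2 + 2 * (3 * a3 - 3 * a1) * s + (2 * a2 - 4 * a0)"
text \<open>The divided difference of \<open>qP\<close> in its last argument; it replaces the
  derivative in the implicit function argument.\<close>

definition qd :: "'a::field \<Rightarrow> 'a \<Rightarrow> 'a \<Rightarrow> 'a \<Rightarrow> 'a \<Rightarrow> 'a \<Rightarrow> 'a" where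
  "qd a0 a1 a2 a3 s w = - a3 * (s ^ 3 + s ^ 2 * w + s * w ^ 2 + w ^ 3) + (4 - 2 * a2) * (s ^ 2 + s * w + w ^ 2) +
     (3 * a3 - 3 * a1) * (s + w) + (2 * a2 - 4 * a0)"

lemmas q_defs = qp_def qP_def qP1_def qP2_def lp_def lp1_def lP_def lP1_def
lemmas pow_simps = algebra_simps power2_eq_square power3_eq_cube power4_eq_xxxx

lemma qP_diff: "qP a0 a1 a2 a3 s - qP a0 a1 a2 a3 w = (s - w) * qd a0 a1 a2 a3 s w"
  by (simp add: qP_def qd_def pow_simps)

lemma qd_diag: "qd a0 a1 a2 a3 s s = qP1 a0 a1 a2 a3 s"
  by (simp add: qP1_def qd_def pow_simps)

lemma lp1_lP: "lp1 a0 a1 a2 a3 s * (1 + s ^ 2) - 4 * s * lp a0 a1 a2 a3 s = lP a0 a1 a2 a3 s"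
  by (simp add: q_defs pow_simps)

context
  fixes b0 b1 b2 g b0t b1t b2t gt b0x b1x b2x gx :: "'a::field"
  assumes E: "b0t = - b1 * gx" "b1t = - g * b0x - (2 * b2 - 4 * b0) * gx"
    "b2t = - g * b1x - (3 * g - 3 * b1) * gx" "gt = - g * b2x - (4 - 2 * b2) * gx"
begin

text \<open>The four equations are the coefficients of one polynomial identity in \<open>s\<close>.
  The variants below follow from it: \<open>transport_s\<close> results from applying
  \<open>(1 + s^2) d/ds - 4 s\<close>, which is differentiation along the cosphere up to a power of
  \<open>1 + s^2\<close>, and \<open>transport_ss\<close> is a further derivative in
  \<open>s\<close>.\<close>

lemma transport:
  "lp b0t b1t b2t gt s + g * s * lp b0x b1x b2x gx s + gx * qP b0 b1 b2 g s = 0"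
  unfolding E by (simp add: q_defs pow_simps)

lemma transport_s:
  "lP b0t b1t b2t gt s + g * s * lP b0x b1x b2x gx s + g * (1 + s ^ 2) * lp b0x b1x b2x gx s +
   gx * (1 + s ^ 2) * qP1 b0 b1 b2 g s - 4 * s * gx * qP b0 b1 b2 g s = 0"
  unfolding E by (simp add: q_defs pow_simps)

lemma transport_ss:
  "lP1 b0t b1t b2t gt s + g * lP b0x b1x b2x gx s + g * s * lP1 b0x b1x b2x gx s +
   2 * s * g * lp b0x b1x b2x gx s + g * (1 + s ^ 2) * lp1 b0x b1x b2x gx s +
   gx * (1 + s ^ 2) * qP2 b0 b1 b2 g s - 2 * s * gx * qP1 b0 b1 b2 g s - 4 * gx * qP b0 b1 b2 g s = 0"
  unfolding E by (simp add: q_defs pow_simps)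

end

text \<open>The x-derivative of \<open>transport\<close>: differentiating \<open>qP\<close> in its
  coefficients drops the constant leading terms and leaves \<open>lP\<close> of the differentiated
  coefficients.\<close>

lemma transport_x:
  fixes b0 b1 b2 g b0xt b1xt b2xt gxt b0x b1x b2x gx b0xx b1xx b2xx gxx :: "'a::field"
  assumes E: "b0xt = - b1x * gx - b1 * gxx"
    "b1xt = - gx * b0x - g * b0xx - (2 * b2x - 4 * b0x) * gx - (2 * b2 - 4 * b0) * gxx"
    "b2xt = - gx * b1x - g * b1xx - (3 * gx - 3 * b1x) * gx - (3 * g - 3 * b1) * gxx"
    "gxt = - gx * b2x - g * b2xx + 2 * b2x * gx - (4 - 2 * b2) * gxx"
  shows "lp b0xt b1xt b2xt gxt s + gx * s * lp b0x b1x b2x gx s + g * s * lp b0xx b1xx b2xx gxx s +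
    gxx * qP b0 b1 b2 g s + gx * lP b0x b1x b2x gx s = 0"
  unfolding E by (simp add: q_defs pow_simps)

text \<open>If the third derivative on the cosphere also vanishes at the critical point \<open>x\<close>, the quartic
  is symmetric under the reflection \<open>\<sigma> \<mapsto> - \<sigma>\<close>, \<open>\<sigma> = (s - x) / (1 + x s)\<close>.\<close>

lemma critical_value_real_of_symmetric:
  fixes a0 a1 a2 a3 x :: real and z :: complex
  assumes P0: "qP a0 a1 a2 a3 x = 0"
    and sym: "(1 + x ^ 2) * qP2 a0 a1 a2 a3 x = 6 * x * qP1 a0 a1 a2 a3 x"
    and z: "Im z \<noteq> 0" "1 + z ^ 2 \<noteq> 0" "qP (of_real a0) (of_real a1) (of_real a2) (of_real a3) z = 0"
  shows "Im (qp (of_real a0) (of_real a1) (of_real a2) (of_real a3) z / (1 + z ^ 2) ^ 2) = 0"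
proof -
  \<comment> \<open>Coefficients in the rotated variable \<sigma> of the quartic multiplied by
    \<open>(1 - x * \<sigma>)^4\<close>. The rotation carries the critical direction
    \<open>x\<close> to \<sigma> = 0, so \<open>c1\<close> is the first derivative there.\<close>
  define c0 where "c0 = a0 + a1 * x + a2 * x^2 + a3 * x^3 + x^4"
  define c1 where "c1 = qP a0 a1 a2 a3 x"
  define c2 where "c2 = 6*a0*x^2 + a1*(3*x^3 - 3*x) + a2*(1 - 4*x^2 + x^4) + a3*(3*x - 3*x^3) + 6*x^2"
  define c3 where "c3 = - 4*a0*x^3 + a1*(3*x^2 - x^4) + a2*(2*x^3 - 2*x) + a3*(1 - 3*x^2) + 4*x"
  define c4 where "c4 = a0*x^4 - a1*x^3 + a2*x^2 - a3*x + 1"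
  note c = c0_def c1_def c2_def c3_def c4_def
  have c1: "c1 = 0" using P0 by (simp add: c1_def)
  \<comment> \<open>At a critical point this is the third derivative on the cosphere times
    \<open>(1 + x^2)^2\<close>; the hypothesis \<open>sym\<close> says that it vanishes.\<close>
  have "6 * (c3 - c1) = (1 + x^2) * ((1 + x ^ 2) * qP2 a0 a1 a2 a3 x - 6 * x * qP1 a0 a1 a2 a3 x) + 12 * x^2 * qP a0 a1 a2 a3 x"
    by (simp add: c q_defs pow_simps)
  then have c3: "c3 = 0" using sym P0 c1 by simp
  have xz: "1 + of_real x * z \<noteq> 0"
  proof
    assume 0: "1 + of_real x * z = 0"
    then have "Im (1 + of_real x * z) = 0" by simp
    then have "x = 0" using z(1) by simp
    then show False using 0 by simp
  qed
  define \<sigma> where "\<sigma> = (z - of_real x) / (1 + of_real x * z)"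
  define e where "e = 1 - of_real x * \<sigma>"
  have x2: "1 + (of_real x :: complex) ^ 2 \<noteq> 0"
  proof -
    have "1 + x ^ 2 > 0" by (simp add: add_pos_nonneg)
    then have "complex_of_real (1 + x ^ 2) \<noteq> 0" by (simp only: of_real_eq_0_iff)
    then show ?thesis by simp
  qed
  have e: "e = (1 + of_real x ^ 2) / (1 + of_real x * z)"
    unfolding e_def \<sigma>_def using xz by (simp add: field_simps power2_eq_square)
  then have e0: "e \<noteq> 0" using x2 xz by simp
  have ez: "of_real x + \<sigma> = z * e"
    unfolding e \<sigma>_def using xz by (simp add: field_simps power2_eq_square)
  have s0: "\<sigma> \<noteq> 0" using z(1) xz by (auto simp: \<sigma>_def)
  have sq: "(1 + z ^ 2) * e ^ 2 = (1 + \<sigma> ^ 2) * (1 + of_real x ^ 2)"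
  proof -
    have "(1 + z ^ 2) * e ^ 2 = e ^ 2 + (of_real x + \<sigma>) ^ 2" unfolding ez by (simp add: pow_simps)
    also have "\<dots> = (1 + \<sigma> ^ 2) * (1 + of_real x ^ 2)" unfolding e_def by (simp add: pow_simps)
    finally show ?thesis .
  qed
  have s1: "1 + \<sigma> ^ 2 \<noteq> 0" using sq z(2) e0 by auto
  let ?qp = "qp (of_real a0) (of_real a1) (of_real a2) (of_real a3) z"
  have "?qp * e ^ 4 = of_real a0 * e ^ 4 + of_real a1 * (z * e) * e ^ 3 + of_real a2 * (z * e) ^ 2 * e ^ 2 + of_real a3 * (z * e) ^ 3 * e + (z * e) ^ 4"
    by (simp add: qp_def pow_simps)
  also have "\<dots> = of_real c0 + of_real c1 * \<sigma> + of_real c2 * \<sigma>^2 + of_real c3 * \<sigma>^3 + of_real c4 * \<sigma>^4"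
    unfolding ez[symmetric] unfolding e_def by (simp add: c q_defs pow_simps)
  finally have p: "?qp * e ^ 4 = of_real c0 + of_real c2 * \<sigma>^2 + of_real c4 * (\<sigma>^2)^2"
    by (simp add: c1 c3 power_mult[symmetric])
  have "0 = qP (of_real a0) (of_real a1) (of_real a2) (of_real a3) z * e ^ 4" using z by simp
  also have "\<dots> = - of_real a3 * (z * e) ^ 4 + (4 - 2 * of_real a2) * (z * e) ^ 3 * e + (3 * of_real a3 - 3 * of_real a1) * (z * e) ^ 2 * e ^ 2 +
      (2 * of_real a2 - 4 * of_real a0) * (z * e) * e ^ 3 + of_real a1 * e ^ 4"
    by (simp add: qP_def pow_simps)
  also have "\<dots> = - of_real c3 * \<sigma>^4 + of_real (4 * c4 - 2 * c2) * \<sigma>^3 + of_real (3 * (c3 - c1)) * \<sigma>^2 + of_real (2 * c2 - 4 * c0) * \<sigma> + of_real c1"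
    unfolding ez[symmetric] unfolding e_def by (simp add: c q_defs pow_simps)
  finally have "\<sigma> * (of_real (4 * c4 - 2 * c2) * \<sigma>^2 + of_real (2 * c2 - 4 * c0)) = 0"
    by (simp add: c1 c3 pow_simps)
  then have "of_real (4 * c4 - 2 * c2) * \<sigma>^2 + of_real (2 * c2 - 4 * c0) = 0"
    using s0 by (simp only: mult_eq_0_iff simp_thms)
  \<comment> \<open>Only even powers of \<sigma> are left. Generically this makes
    \<open>\<sigma>^2\<close> real at every further critical point, and the critical value depends
    on \<sigma> only through \<open>\<sigma>^2\<close>.\<close>
  then have r: "of_real (4 * c4 - 2 * c2) * \<sigma>^2 = of_real (4 * c0 - 2 * c2)"
    by (simp add: algebra_simps add_eq_0_iff)
  have "?qp / (1 + z ^ 2) ^ 2 = (?qp * e ^ 4) / ((1 + z ^ 2) * e ^ 2) ^ 2"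
    using e0 by (simp add: power_mult_distrib power_mult[symmetric])
  also have "\<dots> = (of_real c0 + of_real c2 * \<sigma>^2 + of_real c4 * (\<sigma>^2)^2) / ((1 + \<sigma> ^ 2) * (1 + of_real x ^ 2)) ^ 2"
    unfolding p sq ..
  also have "\<dots> \<in> \<real>"
  proof (cases "4 * c4 - 2 * c2 = 0")
    case False
    have "\<sigma>^2 = of_real ((4 * c0 - 2 * c2) / (4 * c4 - 2 * c2))"
      unfolding of_real_divide r[symmetric] using False by (simp del: of_real_diff of_real_mult)
    then show ?thesis by (simp only:) (intro Reals_divide Reals_add Reals_mult Reals_power Reals_of_real Reals_1)
  next
    \<comment> \<open>The even quartic is then \<open>c0 * (1 + \<sigma>^2)^2\<close>, which is
      constant on the cosphere.\<close>
    case True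
    then have "4 * c0 - 2 * c2 = 0" using r by (metis mult_zero_left of_real_0 of_real_eq_0_iff)
    then have cc: "c2 = 2 * c0" "c4 = c0" using True by simp_all
    have "of_real c0 + of_real c2 * \<sigma>^2 + of_real c4 * (\<sigma>^2)^2 = of_real c0 * (1 + \<sigma>^2)^2"
      by (simp add: cc pow_simps)
    then have "(of_real c0 + of_real c2 * \<sigma>^2 + of_real c4 * (\<sigma>^2)^2) / ((1 + \<sigma> ^ 2) * (1 + of_real x ^ 2)) ^ 2
        = of_real c0 / (1 + of_real x ^ 2) ^ 2"
      using s1 by (simp add: power_mult_distrib)
    then show ?thesis by (simp add: Reals_divide Reals_add Reals_power)
  qed
  finally show ?thesis by (simp add: complex_is_Real_iff)
qed

subsection \<open>Roots for fixed coefficients\<close>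

definition Ppoly :: "'a::field \<Rightarrow> 'a \<Rightarrow> 'a \<Rightarrow> 'a \<Rightarrow> 'a poly" where
  "Ppoly a0 a1 a2 a3 = [:a1, 2 * a2 - 4 * a0, 3 * a3 - 3 * a1, 4 - 2 * a2, - a3:]"

lemma poly_Ppoly: "poly (Ppoly a0 a1 a2 a3) s = qP a0 a1 a2 a3 s"
  by (simp add: Ppoly_def qP_def pow_simps)

text \<open>The modulus of \<open>poly p z\<close> is that of the leading coefficient times the
  product of the distances from \<open>z\<close> to the roots, hence bounded below by a power of the
  smallest distance. This gives continuity of roots even at multiple ones.\<close>

lemma near_root:
  fixes p :: "complex poly"
  assumes "degree p = Suc n"
  shows "\<exists>w. poly p w = 0 \<and> cmod (z - w) ^ Suc n * cmod (lead_coeff p) \<le> cmod (poly p z)"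
  using assms
proof (induction n arbitrary: p)
  case 0
  then obtain w where w: "poly p w = 0" using fundamental_theorem_of_algebra_alt[of p]
    by (metis degree_pCons_0 nat.distinct(1) zero_neq_one One_nat_def pCons_0_0)
  then obtain q where q: "p = [:- w, 1:] * q" by (metis poly_eq_0_iff_dvd dvdE)
  have "q \<noteq> 0" using q 0 by auto
  then have "degree p = Suc (degree q)" unfolding q by (subst degree_mult_eq) auto
  then have "degree q = 0" using 0 by simp
  then obtain c where c: "q = [:c:]" by (metis degree_eq_zeroE)
  show ?case using w by (intro exI[of _ w]) (simp add: q c norm_mult[symmetric] algebra_simps)
next
  case (Suc n)
  then obtain w where w: "poly p w = 0" using fundamental_theorem_of_algebra_alt[of p]
    by (metis degree_pCons_0 nat.distinct(1) zero_neq_one One_nat_def pCons_0_0)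
  then obtain q where q: "p = [:- w, 1:] * q" by (metis poly_eq_0_iff_dvd dvdE)
  have q0: "q \<noteq> 0" using q Suc.prems by auto
  then have "degree p = Suc (degree q)" unfolding q by (subst degree_mult_eq) auto
  then have "degree q = Suc n" using Suc.prems by simp
  from Suc.IH[OF this] obtain w' where w': "poly q w' = 0"
    "cmod (z - w') ^ Suc n * cmod (lead_coeff q) \<le> cmod (poly q z)" by blast
  have lc: "lead_coeff p = lead_coeff q" unfolding q by (simp only: lead_coeff_mult) simp
  have pz: "cmod (poly p z) = cmod (z - w) * cmod (poly q z)"
    unfolding q by (simp add: norm_mult[symmetric] algebra_simps)
  have le: "cmod (z - w) * (cmod (z - w') ^ Suc n * cmod (lead_coeff q)) \<le> cmod (poly p z)"
    unfolding pz by (intro mult_left_mono w') simp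
  show ?case
  proof (cases "cmod (z - w) \<le> cmod (z - w')")
    case True
    have "cmod (z - w) ^ Suc (Suc n) * cmod (lead_coeff p) = cmod (z - w) * (cmod (z - w) ^ Suc n * cmod (lead_coeff q))"
      by (simp add: lc)
    also have "\<dots> \<le> cmod (z - w) * (cmod (z - w') ^ Suc n * cmod (lead_coeff q))"
      by (intro mult_left_mono mult_right_mono power_mono True) auto
    also note le
    finally show ?thesis using w by blast
  next
    case False
    have "cmod (z - w') ^ Suc (Suc n) * cmod (lead_coeff p) = cmod (z - w') * (cmod (z - w') ^ Suc n * cmod (lead_coeff q))"
      by (simp add: lc)
    also have "\<dots> \<le> cmod (z - w) * (cmod (z - w') ^ Suc n * cmod (lead_coeff q))"
      by (rule mult_right_mono) (use False in auto)
    also note le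
    finally show ?thesis using w'(1) q by (intro exI[of _ w']) simp
  qed
qed

lemma qP_near_root:
  fixes a0 a1 a2 a3 z :: complex
  assumes "a3 \<noteq> 0"
  shows "\<exists>w. qP a0 a1 a2 a3 w = 0 \<and> cmod (z - w) ^ 4 * cmod a3 \<le> cmod (qP a0 a1 a2 a3 z)"
proof -
  have "degree (Ppoly a0 a1 a2 a3) = Suc 3" "lead_coeff (Ppoly a0 a1 a2 a3) = - a3"
    using assms by (simp_all add: Ppoly_def)
  then show ?thesis using near_root[of "Ppoly a0 a1 a2 a3" 3 z] by (simp add: poly_Ppoly)
qed

lemma poly_cubic_zero:
  fixes c0 c1 c2 c3 :: "'a::field"
  assumes "distinct [z1, z2, z3, z4]" "\<forall>z\<in>{z1, z2, z3, z4}. c0 + c1 * z + c2 * z ^ 2 + c3 * z ^ 3 = 0"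
  shows "c0 = 0 \<and> c1 = 0 \<and> c2 = 0 \<and> c3 = 0"
proof -
  define p where "p = [:c0, c1, c2, c3:]"
  have "p = 0"
  proof (rule ccontr)
    assume p: "p \<noteq> 0"
    have "{z1, z2, z3, z4} \<subseteq> {x. poly p x = 0}"
      using assms(2) by (auto simp: p_def pow_simps)
    then have "card {z1, z2, z3, z4} \<le> card {x. poly p x = 0}"
      by (intro card_mono poly_roots_finite p)
    also have "\<dots> \<le> degree p" using p by (rule card_poly_roots_bound)
    also have "\<dots> \<le> 3" by (simp add: p_def)
    finally show False using assms(1) by simp
  qed
  then show ?thesis by (simp add: p_def)
qed

text \<open>The difference of the two sides is a cubic in \<open>s\<close> with four distinct zeros.
  That its coefficients vanish is Vieta's theorem, from which the derivative at a root is read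
  off.\<close>

lemma qP_four_roots:
  fixes a0 a1 a2 a3 :: complex
  assumes d: "distinct [z1, z2, z3, z4]" and r: "\<forall>z\<in>{z1, z2, z3, z4}. qP a0 a1 a2 a3 z = 0"
  shows "qP a0 a1 a2 a3 s = - a3 * ((s - z1) * (s - z2) * (s - z3) * (s - z4))"
    and "qP1 a0 a1 a2 a3 z1 = - a3 * ((z1 - z2) * (z1 - z3) * (z1 - z4))"
proof -
  define e1 e2 e3 e4 where "e1 = z1 + z2 + z3 + z4"
    and "e2 = z1 * z2 + z1 * z3 + z1 * z4 + z2 * z3 + z2 * z4 + z3 * z4"
    and "e3 = z1 * z2 * z3 + z1 * z2 * z4 + z1 * z3 * z4 + z2 * z3 * z4" and "e4 = z1 * z2 * z3 * z4"
  note e = e1_def e2_def e3_def e4_def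
  have "(a1 + a3 * e4) + (2 * a2 - 4 * a0 - a3 * e3) * s + (3 * a3 - 3 * a1 + a3 * e2) * s ^ 2 + (4 - 2 * a2 - a3 * e1) * s ^ 3
      = qP a0 a1 a2 a3 s + a3 * ((s - z1) * (s - z2) * (s - z3) * (s - z4))" for s
    by (simp add: e qP_def pow_simps)
  then have "\<forall>z\<in>{z1, z2, z3, z4}. (a1 + a3 * e4) + (2 * a2 - 4 * a0 - a3 * e3) * z + (3 * a3 - 3 * a1 + a3 * e2) * z ^ 2 + (4 - 2 * a2 - a3 * e1) * z ^ 3 = 0"
    using r by auto
  from poly_cubic_zero[OF d this]
  have c: "a1 = - a3 * e4" "2 * a2 - 4 * a0 = a3 * e3" "3 * a3 - 3 * a1 = - a3 * e2" "4 - 2 * a2 = a3 * e1"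
    by (auto simp: add_eq_0_iff)
  show "qP a0 a1 a2 a3 s = - a3 * ((s - z1) * (s - z2) * (s - z3) * (s - z4))"
    unfolding qP_def c(2-4) by (subst c(1)) (simp add: e pow_simps)
  show "qP1 a0 a1 a2 a3 z1 = - a3 * ((z1 - z2) * (z1 - z3) * (z1 - z4))"
    unfolding qP1_def c(2-4) by (simp add: e pow_simps)
qed

lemma qP_cnj:
  "qP (of_real a0) (of_real a1) (of_real a2) (of_real a3) (cnj z) =
   cnj (qP (of_real a0) (of_real a1) (of_real a2) (of_real a3) z)"
  by (simp add: qP_def)

lemma qP_of_real:
  "qP (of_real a0) (of_real a1) (of_real a2) (of_real a3) (of_real x :: complex) = of_real (qP a0 a1 a2 a3 x)"
  by (simp add: qP_def)

text \<open>The derivative on the cosphere has mean zero, hence is positive somewhere; the three equidistant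
  directions \<open>s = \<infinity>, \<plusminus> 1 / \<surd>3\<close> suffice to see this.\<close>

lemma qP_two_real_roots:
  fixes a0 a1 a2 a3 :: real
  assumes a3: "a3 > 0"
  obtains x1 x2 where "x1 < x2" "qP a0 a1 a2 a3 x1 = 0" "qP a0 a1 a2 a3 x2 = 0"
proof -
  let ?P = "qP a0 a1 a2 a3"
  define r where "r = 1 / sqrt (3::real)"
  have r2: "r ^ 2 = 1 / 3" by (simp add: r_def power_divide)
  have "r ^ 4 = (r ^ 2) ^ 2" by (simp add: power_mult[symmetric])
  then have r3: "r ^ 4 = 1 / 9" unfolding r2 by (simp add: power_divide)
  \<comment> \<open>Adding the two values removes the odd terms, and \<open>r^2 = 1 / 3\<close> is
    the choice for which \<open>a1\<close> cancels as well.\<close>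
  have "?P r + ?P (- r) = 2 * (- a3 * r ^ 4 + (3 * a3 - 3 * a1) * r ^ 2 + a1)"
    by (simp add: qP_def pow_simps)
  also have "\<dots> = 16 / 9 * a3" unfolding r2 r3 by (simp add: field_simps)
  finally have "?P r > 0 \<or> ?P (- r) > 0" using a3 by linarith
  then obtain m where m: "?P m > 0" by blast
  have cont: "continuous_on S ?P" for S unfolding qP_def by (intro continuous_intros)
  define C where "C = \<bar>4 - 2 * a2\<bar> + \<bar>3 * a3 - 3 * a1\<bar> + \<bar>2 * a2 - 4 * a0\<bar> + \<bar>a1\<bar>"
  \<comment> \<open>The leading coefficient \<open>- a3\<close> is negative, so the quartic is
    negative far out while positive at \<open>m\<close>: a sign change lies on each side of
    \<open>m\<close>.\<close>
  have neg: "?P x < 0" if x: "\<bar>x\<bar> > 1" "\<bar>x\<bar> * a3 > C" for x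
  proof -
    have le: "c * x ^ k \<le> \<bar>c\<bar> * \<bar>x\<bar> ^ 3" if "k \<le> 3" for c k
    proof -
      have "c * x ^ k \<le> \<bar>c\<bar> * \<bar>x\<bar> ^ k" by (metis abs_ge_self abs_mult power_abs)
      also have "\<dots> \<le> \<bar>c\<bar> * \<bar>x\<bar> ^ 3" using x that by (intro mult_left_mono power_increasing) auto
      finally show ?thesis .
    qed
    have "?P x \<le> - a3 * x ^ 4 + C * \<bar>x\<bar> ^ 3"
      using le[of 3 "4 - 2 * a2"] le[of 2 "3 * a3 - 3 * a1"] le[of 1 "2 * a2 - 4 * a0"] le[of 0 a1]
      by (simp add: qP_def C_def distrib_right)
    also have "\<dots> = \<bar>x\<bar> ^ 3 * (C - \<bar>x\<bar> * a3)" by (simp add: pow_simps abs_if)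
    also have "\<dots> < 0" using x by (intro mult_pos_neg) auto
    finally show ?thesis .
  qed
  define X where "X = \<bar>m\<bar> + 2 + C / a3"
  have C: "C \<ge> 0" by (simp add: C_def)
  have X: "X > \<bar>m\<bar>" "X > 1" "X * a3 > C" using a3 C
    by (simp_all add: X_def add_pos_nonneg distrib_right add_nonneg_pos)
  have nX: "?P X < 0" "?P (- X) < 0" using neg[of X] neg[of "- X"] X by auto
  have mX: "- X \<le> m" "m \<le> X" using X(1) by linarith+
  obtain x1 where x1: "- X \<le> x1" "x1 \<le> m" "?P x1 = 0"
    using IVT'[of ?P "- X" 0 m] cont nX m mX by auto
  obtain x2 where x2: "m \<le> x2" "x2 \<le> X" "?P x2 = 0"
    using IVT2'[of ?P X 0 m] cont nX m mX by auto
  have "x1 \<noteq> m" "x2 \<noteq> m" using x1(3) x2(3) m by auto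
  then have "x1 < x2" using x1(2) x2(1) by linarith
  then show ?thesis by (rule that[OF _ x1(3) x2(3)])
qed

text \<open>The two real roots, the given nonreal root and its conjugate are already four distinct
  zeros of a polynomial of degree four, so the list is complete and every root is simple.\<close>

lemma elliptic_roots:
  fixes a0 a1 a2 a3 :: real
  assumes a3: "a3 > 0" and z: "Im z \<noteq> 0" "qP (of_real a0) (of_real a1) (of_real a2) (of_real a3) z = 0"
  obtains x1 x2 :: real where
    "distinct [of_real x1, of_real x2, z, cnj z]"
    "\<And>s::complex. qP (of_real a0) (of_real a1) (of_real a2) (of_real a3) s = 0 \<longleftrightarrow> s \<in> {of_real x1, of_real x2, z, cnj z}"
    "\<And>s::complex. qP (of_real a0) (of_real a1) (of_real a2) (of_real a3) s = 0 \<Longrightarrow>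
       qP1 (of_real a0) (of_real a1) (of_real a2) (of_real a3) s \<noteq> 0"
proof -
  let ?P = "qP (of_real a0) (of_real a1) (of_real a2) (of_real a3) :: complex \<Rightarrow> complex"
  let ?P1 = "qP1 (of_real a0) (of_real a1) (of_real a2) (of_real a3) :: complex \<Rightarrow> complex"
  obtain x1 x2 where x: "x1 < x2" "qP a0 a1 a2 a3 x1 = 0" "qP a0 a1 a2 a3 x2 = 0"
    using qP_two_real_roots[OF a3] by blast
  have d: "distinct [of_real x1, of_real x2, z, cnj z]"
    using x z by (auto simp: complex_eq_iff)
  have r: "\<forall>z\<in>{of_real x1, of_real x2, z, cnj z}. ?P z = 0"
    using x z by (simp add: qP_of_real qP_cnj)
  have iff: "?P s = 0 \<longleftrightarrow> s \<in> {of_real x1, of_real x2, z, cnj z}" for s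
    unfolding qP_four_roots(1)[OF d r] using a3 by auto
  have ne: "?P1 w1 \<noteq> 0" if "distinct [w1, w2, w3, w4]" "{w1, w2, w3, w4} = {of_real x1, of_real x2, z, cnj z}"
    for w1 w2 w3 w4
  proof -
    have "\<forall>z\<in>{w1, w2, w3, w4}. ?P z = 0" unfolding that(2) by (rule r)
    from qP_four_roots(2)[OF that(1) this] show ?thesis using that(1) a3 by simp
  qed
  have perm: "distinct [b, a, c, e]" "distinct [c, a, b, e]" "distinct [e, a, b, c]"
    "{b, a, c, e} = {a, b, c, e}" "{c, a, b, e} = {a, b, c, e}" "{e, a, b, c} = {a, b, c, e}"
    if "distinct [a, b, c, e]" for a b c e :: complex
    using that by auto
  have "?P1 (of_real x1) \<noteq> 0" "?P1 (of_real x2) \<noteq> 0" "?P1 z \<noteq> 0" "?P1 (cnj z) \<noteq> 0"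
    using ne[OF d refl] ne[OF perm(1,4)[OF d]] ne[OF perm(2,5)[OF d]] ne[OF perm(3,6)[OF d]]
    by blast+
  then have "?P1 s \<noteq> 0" if "?P s = 0" for s
    using that[unfolded iff] by (elim insertE) (simp_all only: empty_iff not_False_eq_True)
  then show ?thesis using that[OF d iff] by blast
qed

section \<open>Branches of roots and Riemann invariants\<close>

text \<open>At a zero of \<open>f\<close> the term with the increment of \<open>k\<close> is of
  higher order, so continuity of \<open>k\<close> suffices. This serves to differentiate a root
  branch, written as coefficient increments times factors that involve the branch itself.\<close>

lemma has_pd_mult_zero:
  fixes f k :: "plane \<Rightarrow> 'b::real_normed_field"
  assumes f: "has_pd f A B y" "f y = 0" and k: "isCont k y"
  shows "has_pd (\<lambda>z. f z * k z) (A * k y) (B * k y) y"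
proof -
  define L where "L = (\<lambda>w::plane. fst w *\<^sub>R A + snd w *\<^sub>R B)"
  have fL: "(f has_derivative L) (at y)" using f by (simp add: has_pd_def L_def)
  then have bl: "bounded_linear L" by (rule has_derivative_bounded_linear)
  have lim: "((\<lambda>z. (f z - L (z - y)) /\<^sub>R norm (z - y)) \<longlongrightarrow> 0) (at y)"
    using fL f(2) by (simp add: has_derivative_at_within)
  obtain C where C: "\<And>w. norm (L w) \<le> norm w * C" using bounded_linear.bounded[OF bl] by blast
  have kt: "(k \<longlongrightarrow> k y) (at y)" using k by (simp add: isCont_def)
  have l1: "((\<lambda>z. (f z - L (z - y)) /\<^sub>R norm (z - y) * k z) \<longlongrightarrow> 0) (at y)"
    using tendsto_mult[OF lim kt] by simp
  have l2: "((\<lambda>z. (L (z - y) * (k z - k y)) /\<^sub>R norm (z - y)) \<longlongrightarrow> 0) (at y)"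
  proof (rule Lim_null_comparison)
    show "((\<lambda>z. \<bar>C\<bar> * norm (k z - k y)) \<longlongrightarrow> 0) (at y)"
      using tendsto_mult[OF tendsto_const tendsto_norm[OF tendsto_diff[OF kt tendsto_const]], of "\<bar>C\<bar>" "k y"] by simp
    show "\<forall>\<^sub>F z in at y. norm ((L (z - y) * (k z - k y)) /\<^sub>R norm (z - y)) \<le> \<bar>C\<bar> * norm (k z - k y)"
    proof (rule always_eventually, rule allI)
      fix z
      show "norm ((L (z - y) * (k z - k y)) /\<^sub>R norm (z - y)) \<le> \<bar>C\<bar> * norm (k z - k y)"
      proof (cases "z = y")
        case False
        have "norm (L (z - y)) \<le> norm (z - y) * \<bar>C\<bar>"
          using C[of "z - y"] by (rule order_trans) (simp add: mult_left_mono)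
        then have "norm (L (z - y)) / norm (z - y) \<le> \<bar>C\<bar>" using False by (simp add: field_simps)
        then have "norm (L (z - y)) / norm (z - y) * norm (k z - k y) \<le> \<bar>C\<bar> * norm (k z - k y)"
          by (rule mult_right_mono) simp
        then show ?thesis by (simp add: norm_mult divide_inverse mult_ac)
      qed simp
    qed
  qed
  have "((\<lambda>z. (f z * k z - L (z - y) * k y) /\<^sub>R norm (z - y)) \<longlongrightarrow> 0) (at y)"
    using tendsto_add[OF l1 l2] by (simp add: algebra_simps)
  moreover have "bounded_linear (\<lambda>w. L w * k y)"
    using bounded_linear_compose[OF bounded_linear_mult_left bl] .
  ultimately have "((\<lambda>z. f z * k z) has_derivative (\<lambda>w. L w * k y)) (at y)"
    using f(2) by (simp add: has_derivative_at_within)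
  then show ?thesis by (simp add: has_pd_def L_def algebra_simps)
qed

lemma qP_coeff_diff:
  "qP a0 a1 a2 a3 s - qP c0 c1 c2 c3 s = lP (a0 - c0) (a1 - c1) (a2 - c2) (a3 - c3) s"
  by (simp add: q_defs pow_simps)

lemma quotient_rule_sum:
  fixes X Y W :: "'a::field"
  assumes "W \<noteq> 0"
  shows "((X + a * S) / W ^ 2 - 4 * s * p * S / W ^ 3) + l * ((Y + a * T) / W ^ 2 - 4 * s * p * T / W ^ 3) =
    (X + l * Y) / W ^ 2 + (a * W - 4 * s * p) * (S + l * T) / W ^ 3"
  using assms by (simp add: field_simps power3_eq_cube power2_eq_square)

lemma lp1_qP: "(lp1 a0 a1 a2 a3 s + 4 * s ^ 3) * (1 + s ^ 2) - 4 * s * qp a0 a1 a2 a3 s = qP a0 a1 a2 a3 s"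
  by (simp add: q_defs algebra_simps power_add[symmetric] power2_eq_square power3_eq_cube power4_eq_xxxx)

context
  fixes c0 c1 c2 c3 s :: "plane \<Rightarrow> 'b::real_normed_field" and y
    and c0t c0x c1t c1x c2t c2x c3t c3x st sx :: 'b
  assumes c: "has_pd c0 c0t c0x y" "has_pd c1 c1t c1x y" "has_pd c2 c2t c2x y" "has_pd c3 c3t c3x y"
    and s: "has_pd s st sx y"
begin

lemma has_pd_lp:
  "has_pd (\<lambda>y. lp (c0 y) (c1 y) (c2 y) (c3 y) (s y))
    (lp c0t c1t c2t c3t (s y) + lp1 (c0 y) (c1 y) (c2 y) (c3 y) (s y) * st)
    (lp c0x c1x c2x c3x (s y) + lp1 (c0 y) (c1 y) (c2 y) (c3 y) (s y) * sx) y"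
  unfolding lp_def lp1_def
  by (rule has_pd_eq[OF has_pd_add[OF has_pd_add[OF has_pd_add[OF c(1) has_pd_mult[OF c(2) s]]
      has_pd_mult[OF c(3) has_pd_power[OF s]]] has_pd_mult[OF c(4) has_pd_power[OF s]]]])
     (simp_all add: algebra_simps power2_eq_square)

lemma has_pd_qp:
  "has_pd (\<lambda>y. qp (c0 y) (c1 y) (c2 y) (c3 y) (s y))
    (lp c0t c1t c2t c3t (s y) + (lp1 (c0 y) (c1 y) (c2 y) (c3 y) (s y) + 4 * s y ^ 3) * st)
    (lp c0x c1x c2x c3x (s y) + (lp1 (c0 y) (c1 y) (c2 y) (c3 y) (s y) + 4 * s y ^ 3) * sx) y"
proof -
  have "qp a0 a1 a2 a3 w = lp a0 a1 a2 a3 w + w ^ 4" for a0 a1 a2 a3 w :: 'b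
    by (simp add: qp_def lp_def)
  then show ?thesis
    by (simp only:) (rule has_pd_eq[OF has_pd_add[OF has_pd_lp has_pd_power[OF s]]], simp_all add: algebra_simps)
qed

lemma has_pd_qP1:
  "has_pd (\<lambda>y. qP1 (c0 y) (c1 y) (c2 y) (c3 y) (s y))
    (lP1 c0t c1t c2t c3t (s y) + qP2 (c0 y) (c1 y) (c2 y) (c3 y) (s y) * st)
    (lP1 c0x c1x c2x c3x (s y) + qP2 (c0 y) (c1 y) (c2 y) (c3 y) (s y) * sx) y"
  unfolding qP1_def lP1_def qP2_def
  by (rule has_pd_eq[OF has_pd_add[OF has_pd_add[OF has_pd_add[OF
      has_pd_mult[OF has_pd_mult[OF has_pd_const c(4)] has_pd_power[OF s]]
      has_pd_mult[OF has_pd_mult[OF has_pd_const has_pd_diff[OF has_pd_const has_pd_mult[OF has_pd_const c(3)]]] has_pd_power[OF s]]]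
      has_pd_mult[OF has_pd_mult[OF has_pd_const has_pd_diff[OF has_pd_mult[OF has_pd_const c(4)] has_pd_mult[OF has_pd_const c(2)]]] s]]
      has_pd_diff[OF has_pd_mult[OF has_pd_const c(3)] has_pd_mult[OF has_pd_const c(1)]]]])
     (simp_all add: algebra_simps power2_eq_square)

lemma has_pd_over_w2:
  assumes f: "has_pd f A B y" and w: "1 + s y ^ 2 \<noteq> 0"
  shows "has_pd (\<lambda>y. f y / (1 + s y ^ 2) ^ 2)
    (A / (1 + s y ^ 2) ^ 2 - 4 * s y * f y * st / (1 + s y ^ 2) ^ 3)
    (B / (1 + s y ^ 2) ^ 2 - 4 * s y * f y * sx / (1 + s y ^ 2) ^ 3) y"
proof -
  define w where "w = 1 + s y ^ 2"
  have w0: "w \<noteq> 0" "w ^ 2 \<noteq> 0" using w by (simp_all add: w_def)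
  have "has_pd (\<lambda>y. (1 + s y ^ 2) ^ 2) (2 * w * (2 * s y * st)) (2 * w * (2 * s y * sx)) y"
    unfolding w_def
    by (rule has_pd_eq[OF has_pd_power[OF has_pd_add[OF has_pd_const has_pd_power[OF s]]]]) simp_all
  from has_pd_divide[OF f this] w0(2)
  have "has_pd (\<lambda>y. f y / (1 + s y ^ 2) ^ 2)
    ((A * w ^ 2 - f y * (2 * w * (2 * s y * st))) / (w ^ 2) ^ 2)
    ((B * w ^ 2 - f y * (2 * w * (2 * s y * sx))) / (w ^ 2) ^ 2) y"
    by (simp add: w_def)
  then show ?thesis
    unfolding w_def[symmetric]
    by (rule has_pd_eq) (use w0 in \<open>simp_all add: field_simps power2_eq_square power3_eq_cube\<close>)
qed

end

lemma continuous_on_coeffs: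
  fixes c0 c1 c2 c3 h w :: "'p::topological_space \<Rightarrow> complex"
  assumes "continuous_on S c0" "continuous_on S c1" "continuous_on S c2" "continuous_on S c3" "continuous_on S h"
  shows "continuous_on S (\<lambda>p. qP (c0 p) (c1 p) (c2 p) (c3 p) (h p))"
    "continuous_on S (\<lambda>p. qP1 (c0 p) (c1 p) (c2 p) (c3 p) (h p))"
    "continuous_on S (\<lambda>p. qP2 (c0 p) (c1 p) (c2 p) (c3 p) (h p))"
    "continuous_on S (\<lambda>p. qp (c0 p) (c1 p) (c2 p) (c3 p) (h p))"
    "continuous_on S (\<lambda>p. lp (c0 p) (c1 p) (c2 p) (c3 p) (h p))"
    "continuous_on S (\<lambda>p. lP (c0 p) (c1 p) (c2 p) (c3 p) (h p))"
    "continuous_on S w \<Longrightarrow> continuous_on S (\<lambda>p. qd (c0 p) (c1 p) (c2 p) (c3 p) (h p) (w p))"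
  unfolding q_defs qd_def by (intro continuous_intros assms | assumption)+

section \<open>The periodic hydrodynamic system and its local branches of roots\<close>

locale hydro_system =
  fixes b0 b1 b2 g :: "plane \<Rightarrow> real" and u v :: plane
  assumes sm: "smooth_on UNIV b0" "smooth_on UNIV b1" "smooth_on UNIV b2" "smooth_on UNIV g"
    and gpos: "\<And>y. g y > 0"
    and E: "\<And>y. d1 b0 y = - b1 y * d2 g y"
      "\<And>y. d1 b1 y = - g y * d2 b0 y - (2 * b2 y - 4 * b0 y) * d2 g y"
      "\<And>y. d1 b2 y = - g y * d2 b1 y - (3 * g y - 3 * b1 y) * d2 g y"
      "\<And>y. d1 g y = - g y * d2 b2 y - (4 - 2 * b2 y) * d2 g y"
    and per: "\<And>y. b0 (y + u) = b0 y" "\<And>y. b1 (y + u) = b1 y" "\<And>y. b2 (y + u) = b2 y" "\<And>y. g (y + u) = g y"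
      "\<And>y. b0 (y + v) = b0 y" "\<And>y. b1 (y + v) = b1 y" "\<And>y. b2 (y + v) = b2 y" "\<And>y. g (y + v) = g y"
    and det: "fst u * snd v - snd u * fst v \<noteq> 0"
begin

abbreviation "on_coeffs Q a0 a1 a2 a3 \<equiv> (\<lambda>y s. Q (complex_of_real (a0 y)) (complex_of_real (a1 y)) (complex_of_real (a2 y)) (complex_of_real (a3 y)) s)"

definition "pp = on_coeffs qp b0 b1 b2 g"
definition "PP = on_coeffs qP b0 b1 b2 g"
definition "PP1 = on_coeffs qP1 b0 b1 b2 g"
definition "PP2 = on_coeffs qP2 b0 b1 b2 g"
definition "px = on_coeffs lp (d2 b0) (d2 b1) (d2 b2) (d2 g)"
definition "px1 = on_coeffs lp1 (d2 b0) (d2 b1) (d2 b2) (d2 g)"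
definition "Px = on_coeffs lP (d2 b0) (d2 b1) (d2 b2) (d2 g)"
definition "Pt = on_coeffs lP (d1 b0) (d1 b1) (d1 b2) (d1 g)"
text \<open>At a root of \<open>PP\<close> this is a critical value, and \<open>RR\<close> is its
  x-derivative along the branch: the variation of the root does not contribute at a critical
  point.\<close>

definition "FF y s = pp y s / (1 + s ^ 2) ^ 2"
definition "RR y s = px y s / (1 + s ^ 2) ^ 2"

lemma continuous_b:
  assumes "continuous_on S f"
  shows "continuous_on S (\<lambda>p. complex_of_real (b0 (f p)))" "continuous_on S (\<lambda>p. complex_of_real (b1 (f p)))"
    "continuous_on S (\<lambda>p. complex_of_real (b2 (f p)))" "continuous_on S (\<lambda>p. complex_of_real (g (f p)))"
    "continuous_on S (\<lambda>p. complex_of_real (d1 b0 (f p)))" "continuous_on S (\<lambda>p. complex_of_real (d1 b1 (f p)))"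
    "continuous_on S (\<lambda>p. complex_of_real (d1 b2 (f p)))" "continuous_on S (\<lambda>p. complex_of_real (d1 g (f p)))"
    "continuous_on S (\<lambda>p. complex_of_real (d2 b0 (f p)))" "continuous_on S (\<lambda>p. complex_of_real (d2 b1 (f p)))"
    "continuous_on S (\<lambda>p. complex_of_real (d2 b2 (f p)))" "continuous_on S (\<lambda>p. complex_of_real (d2 g (f p)))"
proof -
  have *: "continuous_on S (\<lambda>p. complex_of_real (b (f p)))" if "smooth_on UNIV b" for b
    by (intro continuous_on_of_real continuous_on_compose2[OF smooth_on_continuous[OF that] assms]) simp
  show "continuous_on S (\<lambda>p. complex_of_real (b0 (f p)))" "continuous_on S (\<lambda>p. complex_of_real (b1 (f p)))"
    "continuous_on S (\<lambda>p. complex_of_real (b2 (f p)))" "continuous_on S (\<lambda>p. complex_of_real (g (f p)))"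
    "continuous_on S (\<lambda>p. complex_of_real (d1 b0 (f p)))" "continuous_on S (\<lambda>p. complex_of_real (d1 b1 (f p)))"
    "continuous_on S (\<lambda>p. complex_of_real (d1 b2 (f p)))" "continuous_on S (\<lambda>p. complex_of_real (d1 g (f p)))"
    "continuous_on S (\<lambda>p. complex_of_real (d2 b0 (f p)))" "continuous_on S (\<lambda>p. complex_of_real (d2 b1 (f p)))"
    "continuous_on S (\<lambda>p. complex_of_real (d2 b2 (f p)))" "continuous_on S (\<lambda>p. complex_of_real (d2 g (f p)))"
    by (intro * sm smooth_d1 smooth_d2)+
qed

lemma continuous_q:
  assumes "continuous_on S f" "continuous_on S h"
  shows "continuous_on S (\<lambda>p. PP (f p) (h p))" "continuous_on S (\<lambda>p. PP1 (f p) (h p))"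
    "continuous_on S (\<lambda>p. PP2 (f p) (h p))" "continuous_on S (\<lambda>p. pp (f p) (h p))"
    "continuous_on S (\<lambda>p. px (f p) (h p))" "continuous_on S (\<lambda>p. Px (f p) (h p))"
    "continuous_on S (\<lambda>p. Pt (f p) (h p))"
  unfolding PP_def PP1_def PP2_def pp_def px_def Px_def Pt_def
  by (rule continuous_on_coeffs[OF continuous_b(1-4)[OF assms(1)] assms(2)]
      continuous_on_coeffs[OF continuous_b(9-12)[OF assms(1)] assms(2)]
      continuous_on_coeffs[OF continuous_b(5-8)[OF assms(1)] assms(2)])+

lemma PP_near: "\<exists>w. PP y w = 0 \<and> cmod (z - w) ^ 4 * g y \<le> cmod (PP y z)"
  using qP_near_root[of "of_real (g y)" "of_real (b0 y)" "of_real (b1 y)" "of_real (b2 y)" z] gpos[of y]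
  by (simp add: PP_def)

text \<open>A root over \<open>y0\<close> makes \<open>PP y z\<close> small for \<open>y\<close>
  near \<open>y0\<close>, and a small value forces a root close to \<open>z\<close>.\<close>

lemma root_persists:
  assumes z: "PP y0 z = 0" and e: "e > 0"
  obtains d where "d > 0" "\<And>y. y \<in> ball y0 d \<Longrightarrow> \<exists>w\<in>ball z e. PP y w = 0"
proof -
  define f where "f = (\<lambda>y. cmod (PP y z) - e ^ 4 * g y)"
  have "continuous_on UNIV f"
    unfolding f_def by (intro continuous_intros continuous_q smooth_on_continuous sm)
  then have "open {y. f y < 0}" by (intro open_Collect_less continuous_intros)
  moreover have "y0 \<in> {y. f y < 0}" using z e gpos by (simp add: f_def)
  ultimately obtain d where d: "d > 0" "ball y0 d \<subseteq> {y. f y < 0}" using open_contains_ball by blast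
  have "\<exists>w\<in>ball z e. PP y w = 0" if "y \<in> ball y0 d" for y
  proof -
    obtain w where w: "PP y w = 0" "cmod (z - w) ^ 4 * g y \<le> cmod (PP y z)" using PP_near by blast
    have "cmod (PP y z) < e ^ 4 * g y" using d(2) that by (auto simp: f_def)
    then have "cmod (z - w) ^ 4 * g y < e ^ 4 * g y" using w by simp
    then have "cmod (z - w) ^ 4 < e ^ 4" using gpos[of y] by simp
    then have "cmod (z - w) < e" using e by (simp add: power_less_imp_less_base)
    then show ?thesis using w by (auto simp: dist_norm)
  qed
  then show ?thesis using that d(1) by blast
qed

text \<open>Implicit function theorem by way of the divided difference: where it is nonzero for all
  pairs near \<open>z0\<close>, roots are unique, while persistence supplies existence and
  continuity. Uniqueness also makes a branch through a real root real, since conjugates of roots are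
  roots.\<close>

lemma root_branch:
  assumes z: "PP y0 z0 = 0" "PP1 y0 z0 \<noteq> 0"
  obtains \<rho> s where "\<rho> > 0" "s y0 = z0"
    "\<And>y. y \<in> ball y0 \<rho> \<Longrightarrow> PP y (s y) = 0" "\<And>y. y \<in> ball y0 \<rho> \<Longrightarrow> PP1 y (s y) \<noteq> 0"
    "\<And>y. y \<in> ball y0 \<rho> \<Longrightarrow> has_pd s (- Pt y (s y) / PP1 y (s y)) (- Px y (s y) / PP1 y (s y)) y"
    "z0 \<in> \<real> \<Longrightarrow> (\<And>y. y \<in> ball y0 \<rho> \<Longrightarrow> s y \<in> \<real>)"
proof -
  define QD where "QD = (\<lambda>p::plane \<times> complex \<times> complex. qd (complex_of_real (b0 (fst p))) (of_real (b1 (fst p)))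
     (of_real (b2 (fst p))) (of_real (g (fst p))) (fst (snd p)) (snd (snd p)))"
  have contQ: "continuous_on UNIV QD"
    unfolding QD_def by (rule continuous_on_coeffs(7)[OF continuous_b(1-4)]) (intro continuous_intros)+
  have QDd: "QD (y, w, w) = PP1 y w" for y w by (simp add: QD_def PP1_def qd_diag)
  have QDdiff: "PP y w - PP y w' = (w - w') * QD (y, w, w')" for y w w'
    by (simp add: QD_def PP_def qP_diff)
  have "open {p. QD p \<noteq> 0}" by (intro open_Collect_neq contQ continuous_intros)
  moreover have "(y0, z0, z0) \<in> {p. QD p \<noteq> 0}" using z QDd by simp
  ultimately obtain A B where AB: "open A" "open B" "(y0, z0, z0) \<in> A \<times> B" "A \<times> B \<subseteq> {p. QD p \<noteq> 0}"
    by (rule open_prod_elim)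
  then have "(z0, z0) \<in> B" by simp
  from open_prod_elim[OF AB(2) this] obtain C D where CD: "open C" "open D" "(z0, z0) \<in> C \<times> D" "C \<times> D \<subseteq> B" .
  have "open (C \<inter> D)" "z0 \<in> C \<inter> D" using CD by auto
  then obtain e1 where e1: "e1 > 0" "ball z0 e1 \<subseteq> C \<inter> D" using open_contains_ball by blast
  obtain e0 where e0: "e0 > 0" "ball y0 e0 \<subseteq> A" using AB open_contains_ball by (metis mem_Sigma_iff)
  have nz: "QD (y, w, w') \<noteq> 0" if "y \<in> ball y0 e0" "w \<in> ball z0 e1" "w' \<in> ball z0 e1" for y w w'
  proof -
    have "(y, w, w') \<in> A \<times> B" using that e0(2) e1(2) CD(4) by blast
    then show ?thesis using AB(4) by blast
  qed
  have uniq: "w = w'" if "y \<in> ball y0 e0" "w \<in> ball z0 e1" "w' \<in> ball z0 e1" "PP y w = 0" "PP y w' = 0" for y w w'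
    using QDdiff[of y w w'] nz[OF that(1-3)] that(4,5) by simp
  obtain d0 where d0: "d0 > 0" "\<And>y. y \<in> ball y0 d0 \<Longrightarrow> \<exists>w\<in>ball z0 e1. PP y w = 0"
    using root_persists[OF z(1) e1(1)] by blast
  define \<rho> where "\<rho> = min e0 d0"
  have \<rho>: "\<rho> > 0" "ball y0 \<rho> \<subseteq> ball y0 e0" "ball y0 \<rho> \<subseteq> ball y0 d0" using e0 d0 by (auto simp: \<rho>_def)
  define s where "s = (\<lambda>y. SOME w. w \<in> ball z0 e1 \<and> PP y w = 0)"
  have s: "s y \<in> ball z0 e1 \<and> PP y (s y) = 0" if "y \<in> ball y0 \<rho>" for y
    unfolding s_def by (rule someI_ex) (use d0(2)[of y] \<rho>(3) that in blast)
  have s_eq: "s y = w" if "y \<in> ball y0 \<rho>" "w \<in> ball z0 e1" "PP y w = 0" for y w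
    using uniq[of y "s y" w] s[OF that(1)] that \<rho>(2) by blast
  have y0: "y0 \<in> ball y0 \<rho>" using \<rho> by simp
  have s0: "s y0 = z0" by (rule s_eq[OF y0 _ z(1)]) (use e1 in simp)
  have s1: "PP1 y (s y) \<noteq> 0" if "y \<in> ball y0 \<rho>" for y
    using nz[of y "s y" "s y"] s[OF that] that \<rho>(2) by (auto simp: QDd)
  have cont: "isCont s y" if y: "y \<in> ball y0 \<rho>" for y
    unfolding continuous_at_eps_delta
  proof (intro allI impI)
    fix e :: real assume e: "e > 0"
    \<comment> \<open>Small enough that a root found near \<open>s y\<close> still lies in the ball
      of uniqueness and therefore is the value of the branch.\<close>
    define e' where "e' = min e (e1 - dist z0 (s y))"
    have e': "e' > 0" using s[OF y] e by (simp add: e'_def)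
    obtain d where d: "d > 0" "\<And>y'. y' \<in> ball y d \<Longrightarrow> \<exists>w\<in>ball (s y) e'. PP y' w = 0"
      using root_persists[OF _ e'] s[OF y] by blast
    define d' where "d' = min d (\<rho> - dist y0 y)"
    have d': "d' > 0" using d y by (simp add: d'_def)
    have "dist (s y') (s y) < e" if "dist y' y < d'" for y'
    proof -
      have yb: "y' \<in> ball y0 \<rho>" using that dist_triangle[of y0 y' y] by (simp add: d'_def dist_commute)
      have "y' \<in> ball y d" using that by (simp add: d'_def dist_commute)
      then obtain w where w: "w \<in> ball (s y) e'" "PP y' w = 0" using d(2) by blast
      have "w \<in> ball z0 e1" using w(1) dist_triangle[of z0 w "s y"] by (simp add: e'_def)
      then have "s y' = w" using s_eq[OF yb] w by blast
      then show ?thesis using w(1) by (simp add: e'_def dist_commute)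
    qed
    then show "\<exists>d>0. \<forall>x'. dist x' y < d \<longrightarrow> dist (s x') (s y) < e" using d' by blast
  qed
  have pd: "has_pd s (- Pt y (s y) / PP1 y (s y)) (- Px y (s y) / PP1 y (s y)) y" if y: "y \<in> ball y0 \<rho>" for y
  proof -
    define q where "q = (\<lambda>x. QD (y, s x, s y))"
    have qy: "q y = PP1 y (s y)" by (simp add: q_def QDd)
    have q0: "q x \<noteq> 0" if "x \<in> ball y0 \<rho>" for x
      unfolding q_def using nz[of y "s x" "s y"] s[OF that] s[OF y] y \<rho>(2) by blast
    have contq: "isCont q y"
      unfolding q_def QD_def qd_def fst_conv snd_conv by (intro continuous_intros cont y)
    define c :: "(plane \<Rightarrow> real) \<Rightarrow> plane \<Rightarrow> complex" where "c = (\<lambda>b x. of_real (b x) - of_real (b y))"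
    have pc: "has_pd (c b) (of_real (d1 b y)) (of_real (d2 b y)) y" if "smooth_on UNIV b" for b
      unfolding c_def
      using has_pd_diff[OF has_pd_of_real[OF smooth_has_pd[OF that UNIV_I]] has_pd_const] by simp
    have cy: "c b y = 0" for b by (simp add: c_def)
    \<comment> \<open>The increment of the branch is a sum of coefficient increments, which vanish
      at \<open>y\<close> and are differentiable, times factors that are merely continuous.\<close>
    have eq: "s x = s y - (c b0 x * (- 4 * s x / q x) + c b1 x * ((1 - 3 * s x ^ 2) / q x) +
        c b2 x * ((2 * s x - 2 * s x ^ 3) / q x) + c g x * ((3 * s x ^ 2 - s x ^ 4) / q x))" if x: "x \<in> ball y0 \<rho>" for x
    proof -
      have "0 = PP x (s x) - PP y (s y)" using s[OF x] s[OF y] by simp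
      also have "\<dots> = (PP x (s x) - PP y (s x)) + (PP y (s x) - PP y (s y))" by simp
      also have "\<dots> = lP (c b0 x) (c b1 x) (c b2 x) (c g x) (s x) + (s x - s y) * q x"
        by (simp add: QDdiff q_def) (simp add: PP_def qP_coeff_diff c_def)
      finally have "(s y - s x) * q x = lP (c b0 x) (c b1 x) (c b2 x) (c g x) (s x)" by (simp add: algebra_simps)
      then have "s y - s x = lP (c b0 x) (c b1 x) (c b2 x) (c g x) (s x) / q x" using q0[OF x] by (simp add: field_simps)
      also have "\<dots> = (c b0 x * (- 4 * s x / q x) + c b1 x * ((1 - 3 * s x ^ 2) / q x) +
        c b2 x * ((2 * s x - 2 * s x ^ 3) / q x) + c g x * ((3 * s x ^ 2 - s x ^ 4) / q x))"
        by (simp add: lP_def add_divide_distrib diff_divide_distrib algebra_simps)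
      finally show ?thesis by (simp add: algebra_simps)
    qed
    have "has_pd (\<lambda>x. s y - (c b0 x * (- 4 * s x / q x) + c b1 x * ((1 - 3 * s x ^ 2) / q x) +
        c b2 x * ((2 * s x - 2 * s x ^ 3) / q x) + c g x * ((3 * s x ^ 2 - s x ^ 4) / q x)))
      (0 - (of_real (d1 b0 y) * (- 4 * s y / q y) + of_real (d1 b1 y) * ((1 - 3 * s y ^ 2) / q y) +
        of_real (d1 b2 y) * ((2 * s y - 2 * s y ^ 3) / q y) + of_real (d1 g y) * ((3 * s y ^ 2 - s y ^ 4) / q y)))
      (0 - (of_real (d2 b0 y) * (- 4 * s y / q y) + of_real (d2 b1 y) * ((1 - 3 * s y ^ 2) / q y) +
        of_real (d2 b2 y) * ((2 * s y - 2 * s y ^ 3) / q y) + of_real (d2 g y) * ((3 * s y ^ 2 - s y ^ 4) / q y))) y"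
      by (intro has_pd_diff has_pd_const has_pd_add has_pd_mult_zero pc sm cy continuous_intros cont y contq q0)
    then have "has_pd s
      (0 - (of_real (d1 b0 y) * (- 4 * s y / q y) + of_real (d1 b1 y) * ((1 - 3 * s y ^ 2) / q y) +
        of_real (d1 b2 y) * ((2 * s y - 2 * s y ^ 3) / q y) + of_real (d1 g y) * ((3 * s y ^ 2 - s y ^ 4) / q y)))
      (0 - (of_real (d2 b0 y) * (- 4 * s y / q y) + of_real (d2 b1 y) * ((1 - 3 * s y ^ 2) / q y) +
        of_real (d2 b2 y) * ((2 * s y - 2 * s y ^ 3) / q y) + of_real (d2 g y) * ((3 * s y ^ 2 - s y ^ 4) / q y))) y"
      by (rule has_pd_transform[OF _ open_ball y]) (rule eq[symmetric])
    then show ?thesis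
      by (rule has_pd_eq)
         (simp_all add: qy Pt_def Px_def lP_def add_divide_distrib diff_divide_distrib algebra_simps)
  qed
  have real: "s y \<in> \<real>" if "z0 \<in> \<real>" "y \<in> ball y0 \<rho>" for y
  proof -
    have "PP y (cnj (s y)) = 0" using s[OF that(2)] qP_cnj by (simp add: PP_def)
    moreover have "cnj z0 = z0" using that(1) by (simp add: Reals_cnj_iff)
    then have "dist z0 (cnj (s y)) = dist z0 (s y)"
      by (metis complex_cnj_diff complex_mod_cnj dist_norm)
    then have "cnj (s y) \<in> ball z0 e1" using s[OF that(2)] by simp
    ultimately have "s y = cnj (s y)" using s_eq[OF that(2)] by blast
    then show ?thesis by (simp add: Reals_cnj_iff)
  qed
  show ?thesis
    by (rule that[of \<rho> s]) (use \<rho>(1) s0 s s1 pd real in blast)+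
qed

lemma continuous_on_branch:
  assumes "\<And>y. y \<in> S \<Longrightarrow> has_pd s (A y) (B y) y"
  shows "continuous_on S s"
  using assms has_pd_isCont by (blast intro: continuous_at_imp_continuous_on)

context
  fixes s y
  assumes s: "has_pd s (- Pt y (s y) / PP1 y (s y)) (- Px y (s y) / PP1 y (s y)) y"
    and P0: "PP y (s y) = 0" and J: "PP1 y (s y) \<noteq> 0" and w0: "1 + s y ^ 2 \<noteq> 0"
begin

lemmas pds = has_pd_of_real[OF smooth_has_pd[OF sm(1) UNIV_I]] has_pd_of_real[OF smooth_has_pd[OF sm(2) UNIV_I]]
    has_pd_of_real[OF smooth_has_pd[OF sm(3) UNIV_I]] has_pd_of_real[OF smooth_has_pd[OF sm(4) UNIV_I]]
lemmas pdx = has_pd_of_real[OF smooth_has_pd[OF smooth_d2[OF sm(1)] UNIV_I]] has_pd_of_real[OF smooth_has_pd[OF smooth_d2[OF sm(2)] UNIV_I]]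
    has_pd_of_real[OF smooth_has_pd[OF smooth_d2[OF sm(3)] UNIV_I]] has_pd_of_real[OF smooth_has_pd[OF smooth_d2[OF sm(4)] UNIV_I]]

lemma Ec: "complex_of_real (d1 b0 y) = - of_real (b1 y) * of_real (d2 g y)"
      "complex_of_real (d1 b1 y) = - of_real (g y) * of_real (d2 b0 y) - (2 * of_real (b2 y) - 4 * of_real (b0 y)) * of_real (d2 g y)"
      "complex_of_real (d1 b2 y) = - of_real (g y) * of_real (d2 b1 y) - (3 * of_real (g y) - 3 * of_real (b1 y)) * of_real (d2 g y)"
      "complex_of_real (d1 g y) = - of_real (g y) * of_real (d2 b2 y) - (4 - 2 * of_real (b2 y)) * of_real (d2 g y)"
  unfolding E by simp_all

text \<open>The system differentiated in x; symmetry of the mixed derivatives brings it into the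
  form required by \<open>transport_x\<close>.\<close>

lemma E_x:
  "d1 (d2 b0) y = - d2 b1 y * d2 g y - b1 y * d2 (d2 g) y"
  "d1 (d2 b1) y = - d2 g y * d2 b0 y - g y * d2 (d2 b0) y - (2 * d2 b2 y - 4 * d2 b0 y) * d2 g y - (2 * b2 y - 4 * b0 y) * d2 (d2 g) y"
  "d1 (d2 b2) y = - d2 g y * d2 b1 y - g y * d2 (d2 b1) y - (3 * d2 g y - 3 * d2 b1 y) * d2 g y - (3 * g y - 3 * b1 y) * d2 (d2 g) y"
  "d1 (d2 g) y = - d2 g y * d2 b2 y - g y * d2 (d2 b2) y + 2 * d2 b2 y * d2 g y - (4 - 2 * b2 y) * d2 (d2 g) y"
proof -
  note p = smooth_has_pd[OF sm(1) UNIV_I, of y] smooth_has_pd[OF sm(2) UNIV_I, of y]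
    smooth_has_pd[OF sm(3) UNIV_I, of y] smooth_has_pd[OF sm(4) UNIV_I, of y]
  note q = smooth_has_pd[OF smooth_d2[OF sm(1)] UNIV_I, of y] smooth_has_pd[OF smooth_d2[OF sm(2)] UNIV_I, of y]
    smooth_has_pd[OF smooth_d2[OF sm(3)] UNIV_I, of y] smooth_has_pd[OF smooth_d2[OF sm(4)] UNIV_I, of y]
  have e: "d1 b0 = (\<lambda>y. - b1 y * d2 g y)"
      "d1 b1 = (\<lambda>y. - g y * d2 b0 y - (2 * b2 y - 4 * b0 y) * d2 g y)"
      "d1 b2 = (\<lambda>y. - g y * d2 b1 y - (3 * g y - 3 * b1 y) * d2 g y)"
      "d1 g = (\<lambda>y. - g y * d2 b2 y - (4 - 2 * b2 y) * d2 g y)"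
    using E by auto
  show "d1 (d2 b0) y = - d2 b1 y * d2 g y - b1 y * d2 (d2 g) y"
    unfolding d1_d2_commute[OF sm(1)] e
    using has_pd_d[OF has_pd_mult[OF has_pd_minus[OF p(2)] q(4)]] by simp
  show "d1 (d2 b1) y = - d2 g y * d2 b0 y - g y * d2 (d2 b0) y - (2 * d2 b2 y - 4 * d2 b0 y) * d2 g y - (2 * b2 y - 4 * b0 y) * d2 (d2 g) y"
    unfolding d1_d2_commute[OF sm(2)] e
    using has_pd_d[OF has_pd_diff[OF has_pd_mult[OF has_pd_minus[OF p(4)] q(1)]
      has_pd_mult[OF has_pd_diff[OF has_pd_mult[OF has_pd_const[of 2] p(3)] has_pd_mult[OF has_pd_const[of 4] p(1)]] q(4)]]] by simp
  show "d1 (d2 b2) y = - d2 g y * d2 b1 y - g y * d2 (d2 b1) y - (3 * d2 g y - 3 * d2 b1 y) * d2 g y - (3 * g y - 3 * b1 y) * d2 (d2 g) y"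
    unfolding d1_d2_commute[OF sm(3)] e
    using has_pd_d[OF has_pd_diff[OF has_pd_mult[OF has_pd_minus[OF p(4)] q(2)]
      has_pd_mult[OF has_pd_diff[OF has_pd_mult[OF has_pd_const[of 3] p(4)] has_pd_mult[OF has_pd_const[of 3] p(2)]] q(4)]]] by simp
  show "d1 (d2 g) y = - d2 g y * d2 b2 y - g y * d2 (d2 b2) y + 2 * d2 b2 y * d2 g y - (4 - 2 * b2 y) * d2 (d2 g) y"
    unfolding d1_d2_commute[OF sm(4)] e
    using has_pd_d[OF has_pd_diff[OF has_pd_mult[OF has_pd_minus[OF p(4)] q(3)]
      has_pd_mult[OF has_pd_diff[OF has_pd_const[of 4] has_pd_mult[OF has_pd_const[of 2] p(3)]] q(4)]]] by simp
qed

lemma Ec_x: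
  "complex_of_real (d1 (d2 b0) y) = - of_real (d2 b1 y) * of_real (d2 g y) - of_real (b1 y) * of_real (d2 (d2 g) y)"
  "complex_of_real (d1 (d2 b1) y) = - of_real (d2 g y) * of_real (d2 b0 y) - of_real (g y) * of_real (d2 (d2 b0) y) - (2 * of_real (d2 b2 y) - 4 * of_real (d2 b0 y)) * of_real (d2 g y) - (2 * of_real (b2 y) - 4 * of_real (b0 y)) * of_real (d2 (d2 g) y)"
  "complex_of_real (d1 (d2 b2) y) = - of_real (d2 g y) * of_real (d2 b1 y) - of_real (g y) * of_real (d2 (d2 b1) y) - (3 * of_real (d2 g y) - 3 * of_real (d2 b1 y)) * of_real (d2 g y) - (3 * of_real (g y) - 3 * of_real (b1 y)) * of_real (d2 (d2 g) y)"
  "complex_of_real (d1 (d2 g) y) = - of_real (d2 g y) * of_real (d2 b2 y) - of_real (g y) * of_real (d2 (d2 b2) y) + 2 * of_real (d2 b2 y) * of_real (d2 g y) - (4 - 2 * of_real (b2 y)) * of_real (d2 (d2 g) y)"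
  unfolding E_x by simp_all

private abbreviation (input) "sy \<equiv> s y"
private abbreviation (input) "gy \<equiv> complex_of_real (g y)"
private abbreviation (input) "gxy \<equiv> complex_of_real (d2 g y)"
private abbreviation (input) "st \<equiv> - Pt y sy / PP1 y sy"
private abbreviation (input) "sx \<equiv> - Px y sy / PP1 y sy"
private abbreviation (input) "w \<equiv> 1 + sy ^ 2"

text \<open>This is \<open>transport_s\<close> at a root, solved for the rate of change of the root
  along the characteristic of speed \<open>g * s\<close>.\<close>

lemma branch_velocity: "st + gy * sy * sx = w * (gy * px y sy / PP1 y sy + gxy)"
proof -
  have "Pt y sy + gy * sy * Px y sy + gy * w * px y sy + gxy * w * PP1 y sy = 0"
    using transport_s[OF Ec, of sy] P0 by (simp add: Pt_def Px_def px_def PP1_def PP_def)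
  then have "(Pt y sy + gy * sy * Px y sy) + w * (gy * px y sy + gxy * PP1 y sy) = 0"
    by (simp add: algebra_simps)
  then have "- (Pt y sy + gy * sy * Px y sy) = w * (gy * px y sy + gxy * PP1 y sy)"
    by (simp only: neg_eq_iff_add_eq_0)
  moreover have "st + gy * sy * sx = - (Pt y sy + gy * sy * Px y sy) / PP1 y sy"
    by (simp add: add_divide_distrib diff_divide_distrib)
  ultimately show ?thesis using J by (simp add: field_simps)
qed

text \<open>At a critical point the contribution of \<open>s\<close> to the chain rule vanishes, so
  only the coefficients are differentiated; \<open>transport\<close> at a root then makes the
  t-derivative \<open>- g * s\<close> times the x-derivative. The critical value is thus a Riemann
  invariant of speed \<open>g * s\<close>.\<close>

lemma branch_invariant: "has_pd (\<lambda>y. FF y (s y)) (- gy * sy * RR y sy) (RR y sy) y"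
proof -
  define p' where "p' = on_coeffs lp1 b0 b1 b2 g y sy + 4 * sy ^ 3"
  have p': "p' * w = 4 * sy * pp y sy"
    using P0 lp1_qP[of _ _ _ _ sy] unfolding PP_def p'_def pp_def by (metis eq_iff_diff_eq_0)
  have "has_pd (\<lambda>y. FF y (s y))
    ((on_coeffs lp (d1 b0) (d1 b1) (d1 b2) (d1 g) y sy + p' * st) / w ^ 2 - 4 * sy * pp y sy * st / w ^ 3)
    ((px y sy + p' * sx) / w ^ 2 - 4 * sy * pp y sy * sx / w ^ 3) y"
    unfolding FF_def pp_def px_def p'_def
    by (rule has_pd_over_w2[OF pds s has_pd_qp[OF pds s] w0])
  moreover have c: "(X + p' * S) / w ^ 2 - 4 * sy * pp y sy * S / w ^ 3 = X / w ^ 2" for X S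
    unfolding p'[symmetric] using w0 by (simp add: add_divide_distrib power3_eq_cube power2_eq_square)
  moreover have "on_coeffs lp (d1 b0) (d1 b1) (d1 b2) (d1 g) y sy = - gy * sy * px y sy"
    using transport[OF Ec, of sy] P0 by (simp add: PP_def px_def eq_neg_iff_add_eq_0)
  ultimately show ?thesis by (simp only: c) (simp add: RR_def)
qed

text \<open>Formally the x-derivative of r_t + g s r_x = 0. It is computed from the explicit
  expression \<open>RR\<close>, so one derivative of the branch is enough.\<close>

lemma branch_gradient:
  obtains R1 R2 where "has_pd (\<lambda>y. RR y (s y)) R1 R2 y"
    "R1 + gy * sy * R2 = - (gxy * sy + gy * sx) * RR y sy"
proof -
  define X where "X = on_coeffs lp (d1 (d2 b0)) (d1 (d2 b1)) (d1 (d2 b2)) (d1 (d2 g)) y sy"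
  define Y where "Y = on_coeffs lp (d2 (d2 b0)) (d2 (d2 b1)) (d2 (d2 b2)) (d2 (d2 g)) y sy"
  have "has_pd (\<lambda>y. RR y (s y))
    ((X + px1 y sy * st) / w ^ 2 - 4 * sy * px y sy * st / w ^ 3)
    ((Y + px1 y sy * sx) / w ^ 2 - 4 * sy * px y sy * sx / w ^ 3) y" (is "has_pd _ ?R1 ?R2 y")
    unfolding RR_def px_def px1_def X_def Y_def
    by (rule has_pd_over_w2[OF pds s has_pd_lp[OF pdx s] w0])
  moreover have "?R1 + gy * sy * ?R2 = - (gxy * sy + gy * sx) * RR y sy"
  proof -
    have "(X + gy * sy * Y) + (gxy * sy * px y sy + gxy * Px y sy) = 0"
      using transport_x[OF Ec_x, of sy] P0 unfolding X_def Y_def px_def Px_def PP_def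
      by (simp add: algebra_simps)
    then have "X + gy * sy * Y = - (gxy * sy * px y sy + gxy * Px y sy)"
      by (simp only: eq_neg_iff_add_eq_0)
    then have XY: "X + gy * sy * Y = - gxy * sy * px y sy - gxy * Px y sy" by simp
    have S: "px1 y sy * w - 4 * sy * px y sy = Px y sy"
      unfolding px1_def px_def Px_def by (rule lp1_lP)
    have "?R1 + gy * sy * ?R2 = (X + gy * sy * Y) / w ^ 2 +
      (px1 y sy * w - 4 * sy * px y sy) * (st + gy * sy * sx) / w ^ 3"
      by (rule quotient_rule_sum[OF w0])
    also have "\<dots> = (- gxy * sy * px y sy - gxy * Px y sy) / w ^ 2 +
      Px y sy * (w * (gy * px y sy / PP1 y sy + gxy)) / w ^ 3"
      unfolding XY S branch_velocity ..
    also have "\<dots> = ((- gxy * sy * px y sy - gxy * Px y sy) + Px y sy * (gy * px y sy / PP1 y sy + gxy)) / w ^ 2"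
      using w0 by (simp add: add_divide_distrib power3_eq_cube power2_eq_square)
    also have "\<dots> = - (gxy * sy + gy * sx) * px y sy / w ^ 2"
      by (rule arg_cong[of _ _ "\<lambda>x. x / w ^ 2"]) (use J in \<open>simp add: field_simps\<close>)
    finally show ?thesis by (simp add: RR_def)
  qed
  ultimately show ?thesis using that by blast
qed

text \<open>Along the characteristic \<open>RR\<close> has logarithmic rate minus the x-derivative
  of the speed \<open>g * s\<close>, and \<open>PP1\<close> has twice that x-derivative up to a
  multiple of \<open>px\<close>. The exponents 2 and 4 cancel the speed derivative. Since
  \<open>px\<close> is \<open>RR * (1 + s^2)^2\<close>, what remains is of fifth order in
  \<open>RR\<close>, and its last factor is proportional to the third derivative on the
  cosphere.\<close>

lemma branch_riccati:
  obtains Q1 Q2 where "has_pd (\<lambda>y. (PP1 y (s y))\<^sup>2 * RR y (s y) ^ 4) Q1 Q2 y"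
    "Q1 + gy * sy * Q2 = 2 * RR y sy ^ 4 * gy * px y sy * (w * PP2 y sy - 6 * sy * PP1 y sy)"
proof -
  obtain R1 R2 where R: "has_pd (\<lambda>y. RR y (s y)) R1 R2 y"
    "R1 + gy * sy * R2 = - (gxy * sy + gy * sx) * RR y sy" by (rule branch_gradient)
  define X where "X = on_coeffs lP1 (d1 b0) (d1 b1) (d1 b2) (d1 g) y sy"
  define Y where "Y = on_coeffs lP1 (d2 b0) (d2 b1) (d2 b2) (d2 g) y sy"
  define j where "j = PP1 y sy"
  define r where "r = RR y sy"
  have PJ: "has_pd (\<lambda>y. PP1 y (s y)) (X + PP2 y sy * st) (Y + PP2 y sy * sx) y"
    unfolding PP1_def PP2_def X_def Y_def using has_pd_qP1[OF pds s[unfolded PP1_def]] .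
  have "has_pd (\<lambda>y. (PP1 y (s y))\<^sup>2 * RR y (s y) ^ 4)
    (2 * j * (X + PP2 y sy * st) * r ^ 4 + j\<^sup>2 * (4 * r ^ 3 * R1))
    (2 * j * (Y + PP2 y sy * sx) * r ^ 4 + j\<^sup>2 * (4 * r ^ 3 * R2)) y" (is "has_pd _ ?Q1 ?Q2 y")
    unfolding j_def r_def
    by (rule has_pd_eq[OF has_pd_mult[OF has_pd_power[OF PJ] has_pd_power[OF R(1)]]]) simp_all
  moreover have "?Q1 + gy * sy * ?Q2 = 2 * r ^ 4 * gy * px y sy * (w * PP2 y sy - 6 * sy * j)"
  proof -
    have S: "px1 y sy * w = Px y sy + 4 * sy * px y sy"
      using lp1_lP[of _ _ _ _ sy] unfolding px1_def px_def Px_def by (metis diff_eq_eq add.commute)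
    have "X + gy * Px y sy + gy * sy * Y + 2 * sy * gy * px y sy + gy * (px1 y sy * w) +
        gxy * w * PP2 y sy - 2 * sy * gxy * j = 0"
      using transport_ss[OF Ec, of sy] P0 unfolding X_def Y_def px_def px1_def Px_def PP_def PP2_def PP1_def j_def
      by (simp add: algebra_simps)
    then have "(X + gy * sy * Y) + (2 * gy * Px y sy + 6 * sy * gy * px y sy + gxy * w * PP2 y sy - 2 * sy * gxy * j) = 0"
      unfolding S by (simp add: algebra_simps)
    then have "X + gy * sy * Y = - (2 * gy * Px y sy + 6 * sy * gy * px y sy + gxy * w * PP2 y sy - 2 * sy * gxy * j)"
      by (simp only: eq_neg_iff_add_eq_0)
    then have XY: "X + gy * sy * Y = - 2 * gy * Px y sy - 6 * sy * gy * px y sy - gxy * w * PP2 y sy + 2 * sy * gxy * j"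
      by simp
    have "?Q1 + gy * sy * ?Q2 = 2 * j * r ^ 4 * ((X + gy * sy * Y) + PP2 y sy * (st + gy * sy * sx)) +
      4 * j\<^sup>2 * r ^ 3 * (R1 + gy * sy * R2)"
      by (simp add: algebra_simps)
    also have "\<dots> = 2 * j * r ^ 4 * ((- 2 * gy * Px y sy - 6 * sy * gy * px y sy - gxy * w * PP2 y sy + 2 * sy * gxy * j) +
       PP2 y sy * (w * (gy * px y sy / j + gxy))) - 4 * j\<^sup>2 * r ^ 3 * ((gxy * sy + gy * sx) * r)"
      unfolding XY branch_velocity R(2) unfolding j_def r_def
      by (simp only: mult_minus_left mult_minus_right diff_conv_add_uminus)
    also have "\<dots> = 2 * r ^ 4 * gy * px y sy * (w * PP2 y sy - 6 * sy * j)"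
    proof -
      have "j\<^sup>2 * sx = - j * Px y sy" using J by (simp add: j_def power2_eq_square)
      moreover have "j * (gy * px y sy / j) = gy * px y sy" using J by (simp add: j_def)
      ultimately have e: "j * (j * sx) = - j * Px y sy" "j * (gy * px y sy / j) = gy * px y sy" by (simp_all add: power2_eq_square mult.assoc)
      have gen: "2 * j * r ^ 4 * ((- 2 * gy * Px y sy - 6 * sy * gy * px y sy - gxy * w * PP2 y sy + 2 * sy * gxy * j) +
       PP2 y sy * (w * (q + gxy))) - 4 * j\<^sup>2 * r ^ 3 * ((gxy * sy + gy * S) * r)
       = 2 * r ^ 4 * (- 2 * gy * (j * Px y sy) - 6 * sy * gy * px y sy * j + PP2 y sy * w * (j * q))
         - 4 * r ^ 4 * gy * (j * (j * S))" for q S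
        by (simp add: algebra_simps power2_eq_square power3_eq_cube power4_eq_xxxx)
      show ?thesis unfolding gen[of "gy * px y sy / j" sx] e
        by (simp add: algebra_simps)
    qed
    finally show ?thesis .
  qed
  ultimately show ?thesis using that unfolding j_def r_def by blast
qed

end

end

section \<open>Maxima over the set of critical points\<close>

lemma plane_representative:
  fixes u v y :: plane
  assumes det: "fst u * snd v - snd u * fst v \<noteq> 0"
  obtains p m n where "p \<in> {0..1} \<times> {0..1}"
    "y = ((fst p *\<^sub>R u + snd p *\<^sub>R v) + of_int m *\<^sub>R u) + of_int n *\<^sub>R v"
proof -
  define D where "D = fst u * snd v - snd u * fst v"
  define a b where "a = (snd v * fst y - fst v * snd y) / D" and "b = (fst u * snd y - snd u * fst y) / D"
  have y: "y = a *\<^sub>R u + b *\<^sub>R v" using det unfolding a_def b_def D_def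
    by (simp add: prod_eq_iff divide_simps) (simp add: algebra_simps)
  have "(frac a, frac b) \<in> {0..1} \<times> {0..1}" by (auto simp: frac_ge_0 less_imp_le[OF frac_lt_1])
  moreover have "y = ((fst (frac a, frac b) *\<^sub>R u + snd (frac a, frac b) *\<^sub>R v) + of_int \<lfloor>a\<rfloor> *\<^sub>R u) + of_int \<lfloor>b\<rfloor> *\<^sub>R v"
    unfolding y frac_def by (simp add: algebra_simps)
  ultimately show ?thesis by (rule that)
qed

context hydro_system
begin

lemma periodic_q:
  "pp (y + u) = pp y" "pp (y + v) = pp y" "PP (y + u) = PP y" "PP (y + v) = PP y"
  "PP1 (y + u) = PP1 y" "PP1 (y + v) = PP1 y" "px (y + u) = px y" "px (y + v) = px y"
  "FF (y + u) = FF y" "FF (y + v) = FF y" "RR (y + u) = RR y" "RR (y + v) = RR y"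
  using per d_periodic[OF sm(1) per(1)] d_periodic[OF sm(2) per(2)] d_periodic[OF sm(3) per(3)] d_periodic[OF sm(4) per(4)]
    d_periodic[OF sm(1) per(5)] d_periodic[OF sm(2) per(6)] d_periodic[OF sm(3) per(7)] d_periodic[OF sm(4) per(8)]
  by (simp_all add: pp_def PP_def PP1_def px_def FF_def RR_def fun_eq_iff)

definition "fund = (\<lambda>p::plane. fst p *\<^sub>R u + snd p *\<^sub>R v) ` ({0..1} \<times> {0..1})"

lemma compact_fund: "compact fund"
  unfolding fund_def by (intro compact_continuous_image continuous_intros compact_Times) auto

text \<open>The quantification over \<open>f\<close> sits inside the conclusion so that one
  representative serves \<open>PP\<close> and the maximised function at the same time.\<close>

lemma fund_representative:
  obtains y' where "y' \<in> fund"
    "\<And>f :: plane \<Rightarrow> complex \<Rightarrow> complex. (\<And>y. f (y + u) = f y) \<Longrightarrow> (\<And>y. f (y + v) = f y) \<Longrightarrow> f y' = f y"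
proof -
  obtain p m n where p: "p \<in> {0..1} \<times> {0..1}"
    and y: "y = ((fst p *\<^sub>R u + snd p *\<^sub>R v) + of_int m *\<^sub>R u) + of_int n *\<^sub>R v"
    using plane_representative[OF det] .
  have "fst p *\<^sub>R u + snd p *\<^sub>R v \<in> fund" unfolding fund_def using p by (rule imageI)
  moreover have "f (fst p *\<^sub>R u + snd p *\<^sub>R v) = f y"
    if "\<And>y. f (y + u) = f y" "\<And>y. f (y + v) = f y" for f :: "plane \<Rightarrow> complex \<Rightarrow> complex"
    unfolding y using periodic_int[of f v, OF that(2)] periodic_int[of f u, OF that(1)] by simp
  ultimately show ?thesis using that by blast
qed

text \<open>Cauchy's bound for a polynomial with leading coefficient \<open>- g\<close>. It makes
  the set of roots over a compact set compact.\<close>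

lemma root_bound:
  assumes "PP y s = 0"
  shows "cmod s \<le> 1 + (\<bar>4 - 2 * b2 y\<bar> + \<bar>3 * g y - 3 * b1 y\<bar> + \<bar>2 * b2 y - 4 * b0 y\<bar> + \<bar>b1 y\<bar>) / g y" (is "_ \<le> 1 + ?C / g y")
proof (cases "cmod s \<le> 1")
  case True
  have "0 \<le> ?C / g y" using gpos[of y] by simp
  then show ?thesis using True by simp
next
  case False
  have le: "cmod (of_real c * s ^ k) \<le> \<bar>c\<bar> * cmod s ^ 3" if "k \<le> 3" for c k
    using False that by (simp add: norm_mult norm_power mult_left_mono power_increasing)
  have tri: "cmod (a + b + c + d) \<le> cmod a + cmod b + cmod c + cmod d" for a b c d
    using norm_triangle_ineq[of "a + b + c" d] norm_triangle_ineq[of "a + b" c] norm_triangle_ineq[of a b] by linarith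
  have "(of_real (4 - 2 * b2 y) * s ^ 3 + of_real (3 * g y - 3 * b1 y) * s ^ 2
      + of_real (2 * b2 y - 4 * b0 y) * s ^ 1 + of_real (b1 y) * s ^ 0) - of_real (g y) * s ^ 4 = PP y s"
    by (simp add: PP_def qP_def)
  then have "of_real (g y) * s ^ 4 = of_real (4 - 2 * b2 y) * s ^ 3 + of_real (3 * g y - 3 * b1 y) * s ^ 2
      + of_real (2 * b2 y - 4 * b0 y) * s ^ 1 + of_real (b1 y) * s ^ 0"
    unfolding assms by (simp only: right_minus_eq)
  then have "cmod (of_real (g y) * s ^ 4) \<le> cmod (of_real (4 - 2 * b2 y) * s ^ 3) + cmod (of_real (3 * g y - 3 * b1 y) * s ^ 2)
      + cmod (of_real (2 * b2 y - 4 * b0 y) * s ^ 1) + cmod (of_real (b1 y) * s ^ 0)"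
    by (simp only: tri)
  also have "\<dots> \<le> ?C * cmod s ^ 3"
    unfolding distrib_right by (intro add_mono le) auto
  finally have "cmod s ^ 3 * (cmod s * g y) \<le> cmod s ^ 3 * ?C"
    using gpos[of y] by (simp add: norm_mult norm_power power4_eq_xxxx power3_eq_cube mult_ac)
  moreover have "s \<noteq> 0" using False by auto
  then have "cmod s ^ 3 > 0" by simp
  ultimately have "cmod s * g y \<le> ?C" by (simp only: mult_le_cancel_left_pos)
  then have "cmod s \<le> ?C / g y" using gpos[of y] by (simp add: pos_le_divide_eq)
  then show ?thesis by simp
qed

lemma compact_roots:
  assumes "compact D" "closed Q"
  shows "compact {p \<in> D \<times> Q. PP (fst p) (snd p) = 0}"
proof -
  define C where "C = (\<lambda>y. 1 + (\<bar>4 - 2 * b2 y\<bar> + \<bar>3 * g y - 3 * b1 y\<bar> + \<bar>2 * b2 y - 4 * b0 y\<bar> + \<bar>b1 y\<bar>) / g y)"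
  have cs: "continuous_on D b0" "continuous_on D b1" "continuous_on D b2" "continuous_on D g"
    using sm[THEN smooth_on_continuous] by (blast intro: continuous_on_subset)+
  have "continuous_on D C"
    unfolding C_def using gpos
    by (intro continuous_intros cs) (auto simp: less_imp_neq[symmetric])
  then have "bounded (C ` D)" using assms(1) by (intro compact_imp_bounded compact_continuous_image)
  then obtain K where K: "\<And>y. y \<in> D \<Longrightarrow> \<bar>C y\<bar> \<le> K" by (auto simp: bounded_iff)
  have bd: "cmod s \<le> K" if "y \<in> D" "PP y s = 0" for y s
  proof -
    have "cmod s \<le> C y" unfolding C_def by (rule root_bound[OF that(2)])
    then show ?thesis using K[OF that(1)] by linarith
  qed
  have "{p \<in> D \<times> Q. PP (fst p) (snd p) = 0} = (D \<times> (cball 0 K \<inter> Q)) \<inter> {p. PP (fst p) (snd p) = 0}"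
    using bd by (auto simp: mem_Times_iff)
  moreover have "closed {p. PP (fst p) (snd p) = 0}"
    by (intro closed_Collect_eq continuous_q continuous_intros)
  moreover have "compact (D \<times> (cball 0 K \<inter> Q))"
    by (intro compact_Times assms compact_Int_closed) auto
  ultimately show ?thesis by (simp add: compact_Int_closed)
qed

text \<open>The roots in \<open>Q\<close> over a fundamental domain form a compact set, and by
  periodicity a maximum there is a maximum over all of the plane.\<close>

lemma max_over_roots:
  fixes f :: "plane \<Rightarrow> complex \<Rightarrow> complex"
  assumes Q: "closed Q" and f: "continuous_on {p. PP (fst p) (snd p) = 0} (\<lambda>p. f (fst p) (snd p))"
    and per_f: "\<And>y. f (y + u) = f y" "\<And>y. f (y + v) = f y" and L: "continuous_on UNIV (L :: complex \<Rightarrow> real)"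
    and ne: "PP y1 s1 = 0" "s1 \<in> Q"
  obtains y0 s0 where "PP y0 s0 = 0" "s0 \<in> Q" "\<And>y s. PP y s = 0 \<Longrightarrow> s \<in> Q \<Longrightarrow> L (f y s) \<le> L (f y0 s0)"
proof -
  define K where "K = {p \<in> fund \<times> Q. PP (fst p) (snd p) = 0}"
  have "compact K" unfolding K_def by (intro compact_roots compact_fund Q)
  moreover have "K \<noteq> {}"
  proof -
    obtain y' where "y' \<in> fund" "PP y' = PP y1" using fund_representative[of y1] periodic_q(3,4) by metis
    then have "(y', s1) \<in> K" using ne by (simp add: K_def)
    then show ?thesis by blast
  qed
  moreover have "continuous_on K (\<lambda>p. L (f (fst p) (snd p)))"
    by (rule continuous_on_compose2[OF L continuous_on_subset[OF f]]) (auto simp: K_def)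
  ultimately have "\<exists>p\<in>K. \<forall>q\<in>K. L (f (fst q) (snd q)) \<le> L (f (fst p) (snd p))"
    by (rule continuous_attains_sup)
  then obtain p where p: "p \<in> K" "\<And>q. q \<in> K \<Longrightarrow> L (f (fst q) (snd q)) \<le> L (f (fst p) (snd p))" by blast
  have "L (f y s) \<le> L (f (fst p) (snd p))" if "PP y s = 0" "s \<in> Q" for y s
  proof -
    obtain y' where y': "y' \<in> fund" "PP y' = PP y" "f y' = f y"
      using fund_representative[of y] periodic_q(3,4) per_f by metis
    then have "(y', s) \<in> K" using that by (simp add: K_def)
    from p(2)[OF this] show ?thesis using y' by simp
  qed
  then show ?thesis by (rule that[of "fst p" "snd p", rotated 2]) (use p(1) in \<open>auto simp: K_def mem_Times_iff\<close>)
qed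

lemma elliptic_simple:
  assumes "PP y z = 0" "Im z \<noteq> 0" "PP y s = 0"
  shows "PP1 y s \<noteq> 0"
proof -
  obtain x1 x2 :: real where "\<And>s. PP y s = 0 \<Longrightarrow> PP1 y s \<noteq> 0"
    using elliptic_roots[OF gpos assms(2) assms(1)[unfolded PP_def], of thesis]
    unfolding PP_def PP1_def by blast
  then show ?thesis using assms(3) by blast
qed

lemma constant_on_ball_pd:
  assumes "has_pd f A B y" "d > 0" "\<And>z. z \<in> ball y d \<Longrightarrow> f z = f y"
  shows "A = 0 \<and> B = 0"
proof -
  have "has_pd (\<lambda>z. f y) A B y"
  proof (rule has_pd_transform[OF assms(1) open_ball])
    show "y \<in> ball y d" using assms(2) by simp
    show "f z = f y" if "z \<in> ball y d" for z by (rule assms(3)[OF that])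
  qed
  then show ?thesis using has_pd_unique has_pd_const by blast
qed

text \<open>The imaginary part of a complex Riemann invariant satisfies an elliptic equation without zeroth order
  term.\<close>

lemma imaginary_invariant_max:
  assumes nz: "\<forall>y s. PP y s = 0 \<longrightarrow> 1 + s ^ 2 \<noteq> 0"
    and z0: "PP y0 z0 = 0" "Im z0 \<noteq> 0" and M: "\<forall>y s. PP y s = 0 \<longrightarrow> Im (FF y s) \<le> M" "Im (FF y0 z0) = M"
  obtains d where "d > 0" "\<And>y. y \<in> ball y0 d \<Longrightarrow> \<exists>s. PP y s = 0 \<and> Im (FF y s) = M" "RR y0 z0 = 0"
proof -
  obtain \<rho> s where \<rho>: "\<rho> > 0" and s0: "s y0 = z0" and s: "\<And>y. y \<in> ball y0 \<rho> \<Longrightarrow> PP y (s y) = 0"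
    "\<And>y. y \<in> ball y0 \<rho> \<Longrightarrow> PP1 y (s y) \<noteq> 0"
    and pds': "\<And>y. y \<in> ball y0 \<rho> \<Longrightarrow> has_pd s (- Pt y (s y) / PP1 y (s y)) (- Px y (s y) / PP1 y (s y)) y"
    using root_branch[OF z0(1) elliptic_simple[OF z0 z0(1)]] by metis
  define s1 s2 where "s1 = (\<lambda>y. - Pt y (s y) / PP1 y (s y))" and "s2 = (\<lambda>y. - Px y (s y) / PP1 y (s y))"
  have psd: "has_pd s (s1 y) (s2 y) y" if "y \<in> ball y0 \<rho>" for y using pds'[OF that] by (simp add: s1_def s2_def)
  define lam where "lam = (\<lambda>y. complex_of_real (g y) * s y)"
  define lam1 where "lam1 = (\<lambda>y. complex_of_real (d1 g y) * s y + of_real (g y) * s1 y)"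
  define lam2 where "lam2 = (\<lambda>y. complex_of_real (d2 g y) * s y + of_real (g y) * s2 y)"
  have plam: "has_pd lam (lam1 y) (lam2 y) y" if "y \<in> ball y0 \<rho>" for y
    unfolding lam_def lam1_def lam2_def
    by (rule has_pd_mult[OF has_pd_of_real[OF smooth_has_pd[OF sm(4) UNIV_I]] psd[OF that]])
  define R where "R = (\<lambda>y. RR y (s y))"
  have "\<forall>y. \<exists>R1 R2. y \<in> ball y0 \<rho> \<longrightarrow> has_pd R R1 R2 y \<and> R1 + lam y * R2 = - lam2 y * R y"
  proof
    fix y
    show "\<exists>R1 R2. y \<in> ball y0 \<rho> \<longrightarrow> has_pd R R1 R2 y \<and> R1 + lam y * R2 = - lam2 y * R y"
    proof (cases "y \<in> ball y0 \<rho>")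
      case True
      from branch_gradient[OF pds'[OF True] s(1)[OF True] s(2)[OF True] nz[rule_format, OF s(1)[OF True]]]
      show ?thesis unfolding lam_def lam2_def R_def s2_def by metis
    qed simp
  qed
  then obtain R1 R2 where R: "\<And>y. y \<in> ball y0 \<rho> \<Longrightarrow> has_pd R (R1 y) (R2 y) y"
    "\<And>y. y \<in> ball y0 \<rho> \<Longrightarrow> R1 y + lam y * R2 y = - lam2 y * R y" by metis
  have cb: "cball y0 (\<rho> / 2) \<subseteq> ball y0 \<rho>" using \<rho> by auto
  have conts: "continuous_on (ball y0 \<rho>) s" using psd by (rule continuous_on_branch)
  have contlam: "continuous_on (ball y0 \<rho>) lam" using plam by (rule continuous_on_branch)
  have contG: "continuous_on (ball y0 \<rho>) (\<lambda>y. cmod (lam1 y + cnj (lam y) * lam2 y))"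
    unfolding lam1_def lam2_def s1_def s2_def
    by (intro continuous_intros continuous_q continuous_b contlam conts) (use s(2) in auto)
  have cc: "compact (cball y0 (\<rho> / 2))" "cball y0 (\<rho> / 2) \<noteq> {}" using \<rho> by auto
  obtain A where A: "\<And>y. y \<in> cball y0 (\<rho> / 2) \<Longrightarrow> cmod (lam y) \<le> A"
    using continuous_attains_sup[OF cc continuous_on_norm[OF continuous_on_subset[OF contlam cb]]] by blast
  obtain G where G: "\<And>y. y \<in> cball y0 (\<rho> / 2) \<Longrightarrow> cmod (lam1 y + cnj (lam y) * lam2 y) \<le> G"
    using continuous_attains_sup[OF cc continuous_on_subset[OF contG cb]] by blast
  \<comment> \<open>Half of the value at \<open>y0\<close>, so that on a small ball the imaginary
    part of the speed stays away from 0; this is the uniform ellipticity of the second-order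
    equation.\<close>
  define b where "b = \<bar>Im (lam y0)\<bar> / 2"
  have b: "b > 0" using z0 gpos[of y0] s0 by (simp add: b_def lam_def)
  have "isCont lam y0" using has_pd_isCont[OF plam] \<rho> by simp
  then obtain d1' where d1: "d1' > 0" "\<And>y. dist y y0 < d1' \<Longrightarrow> dist (lam y) (lam y0) < b"
    using b unfolding continuous_at_eps_delta by blast
  define d where "d = min d1' (\<rho> / 2)"
  have d: "d > 0" "ball y0 d \<subseteq> cball y0 (\<rho> / 2)" "ball y0 d \<subseteq> ball y0 \<rho>" using d1 \<rho> by (auto simp: d_def)
  have blow: "\<bar>Im (lam y)\<bar> \<ge> b" if "y \<in> ball y0 d" for y
  proof -
    have "dist (lam y) (lam y0) < b" using d1(2)[of y] that by (simp add: d_def dist_commute)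
    then have "\<bar>Im (lam y - lam y0)\<bar> < b" using abs_Im_le_cmod[of "lam y - lam y0"] by (simp add: dist_norm)
    then show ?thesis unfolding b_def by (simp add: abs_if split: if_splits)
  qed
  define V where "V = (\<lambda>y. Im (FF y (s y)))"
  have pV: "has_pd V (- Im (lam y * R y)) (Im (R y)) y" if "y \<in> ball y0 \<rho>" for y
    unfolding V_def
    using has_pd_Im[OF branch_invariant[OF pds'[OF that] s(1)[OF that] s(2)[OF that] nz[rule_format, OF s(1)[OF that]]]]
    by (simp add: lam_def R_def)
  \<comment> \<open>The equation for \<open>R\<close> makes the x-derivative of \<open>V_t\<close>
    equal to the t-derivative of \<open>V_x\<close>, so both mixed derivatives are given by
    \<open>Im (R1 y)\<close>.\<close>
  have pV1: "has_pd (\<lambda>y. - Im (lam y * R y)) (- Im (lam1 y * R y + lam y * R1 y)) (Im (R1 y)) y"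
    if "y \<in> ball y0 \<rho>" for y
  proof -
    have "R1 y = - lam2 y * R y - lam y * R2 y" using R(2)[OF that] by (simp only: eq_diff_eq)
    then have "- (lam2 y * R y + lam y * R2 y) = R1 y" by simp
    then have "- Im (lam2 y * R y + lam y * R2 y) = Im (R1 y)" by (metis uminus_complex.sel(2))
    then show ?thesis
      using has_pd_minus[OF has_pd_Im[OF has_pd_mult[OF plam[OF that] R(1)[OF that]]]] by simp
  qed
  have vconst: "V y = M" if "y \<in> ball y0 (d / 2)" for y
  proof (rule strong_maximum_principle[where v = V and ?v1.0 = "\<lambda>y. - Im (lam y * R y)" and ?v2.0 = "\<lambda>y. Im (R y)"
      and ?v11.0 = "\<lambda>y. - Im (lam1 y * R y + lam y * R1 y)" and ?v12.0 = "\<lambda>y. Im (R1 y)" and ?v22.0 = "\<lambda>y. Im (R2 y)"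
      and \<alpha> = "\<lambda>y. Re (lam y)" and \<beta> = "\<lambda>y. Im (lam y)" and A = A and B = "b\<^sup>2" and K = "G * (1 + (1 + A) / b)"
      and \<rho> = d and ?y0.0 = y0 and M = M])
    fix y assume y: "y \<in> ball y0 d"
    then have y': "y \<in> ball y0 \<rho>" "y \<in> cball y0 (\<rho> / 2)" using d by auto
    show "has_pd V (- Im (lam y * R y)) (Im (R y)) y" by (rule pV[OF y'(1)])
    show "has_pd (\<lambda>y. - Im (lam y * R y)) (- Im (lam1 y * R y + lam y * R1 y)) (Im (R1 y)) y" by (rule pV1[OF y'(1)])
    show "has_pd (\<lambda>y. Im (R y)) (Im (R1 y)) (Im (R2 y)) y" by (rule has_pd_Im[OF R(1)[OF y'(1)]])
    show aA: "\<bar>Re (lam y)\<bar> \<le> A" "\<bar>Im (lam y)\<bar> \<le> A"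
      using A[OF y'(2)] abs_Re_le_cmod[of "lam y"] abs_Im_le_cmod[of "lam y"] by linarith+
    have bl: "b \<le> \<bar>Im (lam y)\<bar>" by (rule blow[OF y])
    have "b\<^sup>2 \<le> \<bar>Im (lam y)\<bar>\<^sup>2" using bl b by (intro power_mono) auto
    then show "b\<^sup>2 \<le> (Im (lam y))\<^sup>2" by simp
    show "V y \<le> M" unfolding V_def by (rule M(1)[rule_format, OF s(1)[OF y'(1)]])
    define r l where "r = R y" and "l = lam y"
    \<comment> \<open>Division by \<open>Im l\<close> recovers the real part of \<open>R\<close>
      from the gradient of \<open>V\<close>, whose components are \<open>- Im (l * r)\<close> and
      \<open>Im r\<close>. So \<open>R\<close> is bounded by that gradient.\<close>
    have rr: "Re r * Im l = - (- Im (l * r)) - Re l * Im r" by simp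
    have "\<bar>Re r\<bar> * b \<le> \<bar>Re r\<bar> * \<bar>Im l\<bar>" using bl unfolding l_def by (intro mult_left_mono) auto
    also have "\<dots> = \<bar>- (- Im (l * r)) - Re l * Im r\<bar>" unfolding rr[symmetric] by (simp add: abs_mult)
    also have "\<dots> \<le> \<bar>- Im (l * r)\<bar> + \<bar>Re l\<bar> * \<bar>Im r\<bar>" by (simp add: abs_mult[symmetric])
    also have "\<dots> \<le> \<bar>- Im (l * r)\<bar> + A * \<bar>Im r\<bar>" using aA(1) unfolding l_def[symmetric] by (intro add_left_mono mult_right_mono) auto
    finally have "\<bar>Re r\<bar> \<le> (\<bar>- Im (l * r)\<bar> + A * \<bar>Im r\<bar>) / b" using b by (simp add: pos_le_divide_eq)
    then have "cmod r \<le> (\<bar>- Im (l * r)\<bar> + A * \<bar>Im r\<bar>) / b + \<bar>Im r\<bar>" using cmod_le[of r] by simp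
    also have "\<dots> \<le> (1 + (1 + A) / b) * (\<bar>- Im (l * r)\<bar> + \<bar>Im r\<bar>)"
    proof -
      have A0: "A \<ge> 0" using aA(1) by linarith
      have "(\<bar>- Im (l * r)\<bar> + A * \<bar>Im r\<bar>) \<le> (1 + A) * (\<bar>- Im (l * r)\<bar> + \<bar>Im r\<bar>)"
        using A0 by (simp add: algebra_simps)
      then have "(\<bar>- Im (l * r)\<bar> + A * \<bar>Im r\<bar>) / b \<le> (1 + A) * (\<bar>- Im (l * r)\<bar> + \<bar>Im r\<bar>) / b"
        using b by (intro divide_right_mono) auto
      moreover have "(1 + (1 + A) / b) * (\<bar>- Im (l * r)\<bar> + \<bar>Im r\<bar>) =
          (\<bar>- Im (l * r)\<bar> + \<bar>Im r\<bar>) + (1 + A) * (\<bar>- Im (l * r)\<bar> + \<bar>Im r\<bar>) / b"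
        by (simp only: distrib_right mult_1 times_divide_eq_left)
      ultimately show ?thesis using abs_ge_zero[of "- Im (l * r)"] by linarith
    qed
    finally have cr: "cmod r \<le> (1 + (1 + A) / b) * (\<bar>- Im (l * r)\<bar> + \<bar>Im r\<bar>)" .
    have R1: "R1 y = - lam2 y * r - l * R2 y" using R(2)[OF y'(1)] by (simp only: r_def l_def eq_diff_eq)
    \<comment> \<open>The left side is V_tt + 2 Re l V_tx + |l|^2 V_xx. It arises by applying the
      transport operator of speed \<open>cnj l\<close> to the transport equation of speed
      \<open>l\<close>; the second-order part cancels and only derivatives of the speed
      survive.\<close>
    have "- Im (lam1 y * r + l * R1 y) + 2 * Re l * Im (R1 y) + ((Re l)\<^sup>2 + (Im l)\<^sup>2) * Im (R2 y)
       = - Im ((lam1 y + cnj l * lam2 y) * r)"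
      unfolding R1 by (simp add: algebra_simps power2_eq_square)
    then have "\<bar>- Im (lam1 y * r + l * R1 y) + 2 * Re l * Im (R1 y) + ((Re l)\<^sup>2 + (Im l)\<^sup>2) * Im (R2 y)\<bar>
       \<le> cmod (lam1 y + cnj l * lam2 y) * cmod r"
      using abs_Im_le_cmod[of "(lam1 y + cnj l * lam2 y) * r"] by (simp add: norm_mult)
    also have "\<dots> \<le> G * ((1 + (1 + A) / b) * (\<bar>- Im (l * r)\<bar> + \<bar>Im r\<bar>))"
      using G[OF y'(2)] cr unfolding l_def by (intro mult_mono) (auto intro: order_trans[OF norm_ge_zero])
    finally show "\<bar>- Im (lam1 y * R y + lam y * R1 y) + 2 * Re (lam y) * Im (R1 y) + ((Re (lam y))\<^sup>2 + (Im (lam y))\<^sup>2) * Im (R2 y)\<bar>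
       \<le> G * (1 + (1 + A) / b) * (\<bar>- Im (lam y * R y)\<bar> + \<bar>Im (R y)\<bar>)"
      by (simp add: r_def l_def mult.assoc)
  qed (use d b M(2) s0 that in \<open>auto simp: V_def\<close>)
  have "- Im (lam y0 * R y0) = 0 \<and> Im (R y0) = 0"
    by (rule constant_on_ball_pd[OF pV, of _ "d / 2"]) (use \<rho> d vconst in auto)
  then have "Im (R y0) = 0" "Re (R y0) * Im (lam y0) = 0" by auto
  then have "R y0 = 0" using b by (auto simp: complex_eq_iff b_def)
  then have "RR y0 z0 = 0" by (simp add: R_def s0)
  moreover have "\<exists>s. PP y s = 0 \<and> Im (FF y s) = M" if "y \<in> ball y0 (d / 2)" for y
  proof -
    have "y \<in> ball y0 d" using that d(1) by simp
    then have "y \<in> ball y0 \<rho>" using d(3) by blast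
    then show ?thesis using s(1) vconst[OF that] unfolding V_def by blast
  qed
  ultimately show ?thesis using that[of "d / 2"] d(1) by simp
qed

text \<open>The denominators vanish only at \<open>s = \<plusminus>\<i>\<close>, which the
  hypothesis keeps away from the roots; hence continuity is claimed on the root set.\<close>

lemma continuous_FF:
  assumes nz: "\<forall>y s. PP y s = 0 \<longrightarrow> 1 + s ^ 2 \<noteq> 0"
  shows "continuous_on {p. PP (fst p) (snd p) = 0} (\<lambda>p. FF (fst p) (snd p))"
    "continuous_on {p. PP (fst p) (snd p) = 0} (\<lambda>p. RR (fst p) (snd p))"
proof -
  have "(1 + snd p ^ 2)\<^sup>2 \<noteq> 0" if "p \<in> {p. PP (fst p) (snd p) = 0}" for p
    using nz[rule_format, of "fst p" "snd p"] that by simp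
  then show "continuous_on {p. PP (fst p) (snd p) = 0} (\<lambda>p. FF (fst p) (snd p))"
    "continuous_on {p. PP (fst p) (snd p) = 0} (\<lambda>p. RR (fst p) (snd p))"
    unfolding FF_def RR_def by (intro continuous_on_divide continuous_q continuous_intros; blast)+
qed

lemma FF_cnj: "FF y (cnj s) = cnj (FF y s)" and PP_cnj: "PP y (cnj s) = cnj (PP y s)"
  by (simp_all add: FF_def pp_def PP_def qp_def qP_def)

text \<open>At a maximum of \<open>PP1\<^sup>2 RR\<^sup>4\<close> over the real roots the Riccati equation forces \<open>RR = 0\<close>.\<close>

lemma real_invariants_constant:
  assumes nz: "\<forall>y s. PP y s = 0 \<longrightarrow> 1 + s ^ 2 \<noteq> 0"
    and ell: "\<And>y. \<exists>z. PP y z = 0 \<and> Im (FF y z) \<noteq> 0"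
    and s: "PP y s = 0" "s \<in> \<real>"
  shows "RR y s = 0"
proof -
  define Q where "Q = (\<lambda>y s. (PP1 y s)\<^sup>2 * RR y s ^ 4)"
  have nonreal: "\<exists>z. PP y z = 0 \<and> Im z \<noteq> 0 \<and> Im (FF y z) \<noteq> 0" for y
  proof -
    obtain z where z: "PP y z = 0" "Im (FF y z) \<noteq> 0" using ell by blast
    have "Im z \<noteq> 0"
    proof
      assume "Im z = 0"
      then have "cnj z = z" by (simp add: complex_eq_iff)
      then have "FF y z = cnj (FF y z)" using FF_cnj[of y z] by simp
      then show False using z(2) by (simp add: complex_eq_iff)
    qed
    then show ?thesis using z by blast
  qed
  have simple: "PP1 y s \<noteq> 0" if "PP y s = 0" for y s
    using nonreal[of y] elliptic_simple that by blast
  have contQ: "continuous_on {p. PP (fst p) (snd p) = 0} (\<lambda>p. Q (fst p) (snd p))"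
    unfolding Q_def by (intro continuous_intros continuous_q continuous_FF(2)[OF nz])
  have perQ: "Q (y + u) = Q y" "Q (y + v) = Q y" for y
    by (simp_all add: Q_def periodic_q fun_eq_iff)
  have cL: "continuous_on UNIV Re" by (intro continuous_intros)
  obtain y0 s0 where y0: "PP y0 s0 = 0" "s0 \<in> \<real>" "\<And>y s. PP y s = 0 \<Longrightarrow> s \<in> \<real> \<Longrightarrow> Re (Q y s) \<le> Re (Q y0 s0)"
    using max_over_roots[OF closed_complex_Reals contQ perQ cL s] by blast
  obtain \<rho> t where \<rho>: "\<rho> > 0" and t0: "t y0 = s0" and t: "\<And>y. y \<in> ball y0 \<rho> \<Longrightarrow> PP y (t y) = 0"
    "\<And>y. y \<in> ball y0 \<rho> \<Longrightarrow> has_pd t (- Pt y (t y) / PP1 y (t y)) (- Px y (t y) / PP1 y (t y)) y"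
    "\<And>y. y \<in> ball y0 \<rho> \<Longrightarrow> t y \<in> \<real>"
    using root_branch[OF y0(1) simple[OF y0(1)]] y0(2) by metis
  have yb: "y0 \<in> ball y0 \<rho>" using \<rho> by simp
  obtain Q1 Q2 where Q12: "has_pd (\<lambda>y. Q y (t y)) Q1 Q2 y0"
    "Q1 + complex_of_real (g y0) * s0 * Q2 = 2 * RR y0 s0 ^ 4 * complex_of_real (g y0) * px y0 s0 *
       ((1 + s0 ^ 2) * PP2 y0 s0 - 6 * s0 * PP1 y0 s0)"
  proof (rule branch_riccati[OF t(2)[OF yb] t(1)[OF yb] simple[OF t(1)[OF yb]] nz[rule_format, OF t(1)[OF yb]]])
    fix Q1 Q2
    assume "has_pd (\<lambda>y. (PP1 y (t y))\<^sup>2 * RR y (t y) ^ 4) Q1 Q2 y0"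
      "Q1 + complex_of_real (g y0) * t y0 * Q2 = 2 * RR y0 (t y0) ^ 4 * complex_of_real (g y0) * px y0 (t y0) *
         ((1 + t y0 ^ 2) * PP2 y0 (t y0) - 6 * t y0 * PP1 y0 (t y0))"
    then show ?thesis by (intro that[of Q1 Q2]) (simp_all only: Q_def t0)
  qed
  have q0: "Re Q1 = 0" "Re Q2 = 0"
  proof -
    have h: "((\<lambda>y. Re (Q y (t y))) has_derivative (\<lambda>w. fst w *\<^sub>R Re Q1 + snd w *\<^sub>R Re Q2)) (at y0)"
      using has_pd_Re[OF Q12(1)] by (simp add: has_pd_def)
    have "(\<lambda>w. fst w *\<^sub>R Re Q1 + snd w *\<^sub>R Re Q2) = (\<lambda>w. 0)"
      by (rule differential_zero_maxmin[OF yb open_ball h]) (use t y0(3) t0 in auto)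
    from fun_cong[OF this, of "(1,0)"] fun_cong[OF this, of "(0,1)"] show "Re Q1 = 0" "Re Q2 = 0" by simp_all
  qed
  obtain x where x: "s0 = of_real x" using y0(2) by (metis Reals_cases)
  have re: "RR y0 s0 \<in> \<real>" "px y0 s0 \<in> \<real>" "PP1 y0 s0 \<in> \<real>" "PP2 y0 s0 \<in> \<real>"
    unfolding x RR_def px_def PP1_def PP2_def q_defs by (auto intro!: Reals_add Reals_mult Reals_divide Reals_power Reals_diff)
  define W where "W = 2 * RR y0 s0 ^ 4 * complex_of_real (g y0) * px y0 s0 *
       ((1 + s0 ^ 2) * PP2 y0 s0 - 6 * s0 * PP1 y0 s0)"
  have "Re W = 0"
    unfolding W_def Q12(2)[symmetric] using q0 by (simp add: x)
  moreover have "W \<in> \<real>"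
    unfolding W_def by (intro Reals_mult Reals_diff Reals_add Reals_power re) (auto simp: x)
  ultimately have W0: "W = 0" by (auto simp: complex_eq_iff complex_is_Real_iff)
  have "(1 + s0 ^ 2) * PP2 y0 s0 - 6 * s0 * PP1 y0 s0 \<noteq> 0"
  proof
    assume "(1 + s0 ^ 2) * PP2 y0 s0 - 6 * s0 * PP1 y0 s0 = 0"
    then have "complex_of_real ((1 + x ^ 2) * qP2 (b0 y0) (b1 y0) (b2 y0) (g y0) x) = of_real (6 * x * qP1 (b0 y0) (b1 y0) (b2 y0) (g y0) x)"
      unfolding x PP2_def PP1_def by (simp add: qP2_def qP1_def)
    then have sym: "(1 + x ^ 2) * qP2 (b0 y0) (b1 y0) (b2 y0) (g y0) x = 6 * x * qP1 (b0 y0) (b1 y0) (b2 y0) (g y0) x"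
      by (simp only: of_real_eq_iff)
    have P0: "qP (b0 y0) (b1 y0) (b2 y0) (g y0) x = 0" using y0(1) unfolding x PP_def by (simp add: qP_of_real)
    obtain z where z: "PP y0 z = 0" "Im z \<noteq> 0" "Im (FF y0 z) \<noteq> 0" using nonreal by blast
    from critical_value_real_of_symmetric[OF P0 sym z(2) nz[rule_format, OF z(1)] z(1)[unfolded PP_def]] z(3)
    show False by (simp add: FF_def pp_def)
  qed
  then have "RR y0 s0 = 0" using W0 gpos[of y0] nz[rule_format, OF y0(1)] unfolding W_def RR_def by auto
  \<comment> \<open>At real roots \<open>Q\<close> is nonnegative, so a maximal value of 0 makes it
    vanish at all of them; simplicity of the roots then leaves \<open>RR = 0\<close>.\<close>
  then have max0: "Re (Q y0 s0) = 0" by (simp add: Q_def)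
  obtain x' where x': "s = of_real x'" using s(2) by (metis Reals_cases)
  have "PP1 y s \<in> \<real>" "RR y s \<in> \<real>"
    unfolding x' RR_def px_def PP1_def q_defs by (auto intro!: Reals_add Reals_mult Reals_divide Reals_power Reals_diff)
  then obtain j r where jr: "PP1 y s = of_real j" "RR y s = of_real r" by (metis Reals_cases)
  have "Re (Q y s) \<le> 0" using y0(3)[OF s] max0 by simp
  then have "j\<^sup>2 * r ^ 4 \<le> 0" unfolding Q_def jr of_real_power[symmetric] of_real_mult[symmetric] Re_complex_of_real .
  moreover have "j \<noteq> 0" using simple[OF s(1)] jr by auto
  ultimately have "r ^ 4 \<le> 0" by (simp add: mult_le_0_iff)
  then have "r = 0" by (metis even_numeral not_le power_eq_0_iff zero_le_even_power order_antisym)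
  then show ?thesis using jr by simp
qed

theorem dichotomy:
  assumes nz: "\<forall>y s. PP y s = 0 \<longrightarrow> 1 + s ^ 2 \<noteq> 0"
  shows "(\<forall>y s. PP y s = 0 \<longrightarrow> Im (FF y s) = 0) \<or> (\<forall>y. d1 g y = 0 \<and> d2 g y = 0)"
proof (cases "\<forall>y s. PP y s = 0 \<longrightarrow> Im (FF y s) = 0")
  case False
  then obtain y1 z1 where 1: "PP y1 z1 = 0" "Im (FF y1 z1) \<noteq> 0" by blast
  have cL: "continuous_on UNIV Im" by (intro continuous_intros)
  obtain y0 z0 where y0: "PP y0 z0 = 0" "\<And>y s. PP y s = 0 \<Longrightarrow> Im (FF y s) \<le> Im (FF y0 z0)"
    using max_over_roots[OF closed_UNIV continuous_FF(1)[OF nz] periodic_q(9,10) cL 1(1) UNIV_I] by auto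
  define M where "M = Im (FF y0 z0)"
  have max: "\<forall>y s. PP y s = 0 \<longrightarrow> Im (FF y s) \<le> M" using y0(2) by (simp add: M_def)
  \<comment> \<open>Conjugating a root changes the sign of the imaginary part of its value, so one
    nonzero imaginary part makes the maximum positive.\<close>
  have M: "M > 0"
  proof -
    have "PP y1 (cnj z1) = 0" using 1 by (simp add: PP_cnj)
    from max[rule_format, OF 1(1)] max[rule_format, OF this] 1(2) show ?thesis by (simp add: FF_cnj)
  qed
  have nonreal: "Im z \<noteq> 0" if "Im (FF y z) = M" for y z
  proof
    assume "Im z = 0"
    then have "cnj z = z" by (simp add: complex_eq_iff)
    then have "FF y z = cnj (FF y z)" using FF_cnj[of y z] by simp
    then show False using that M by (simp add: complex_eq_iff)
  qed
  \<comment> \<open>The points over which the maximum is attained: an open set by the maximum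
    principle, closed by compactness of the root set, hence the whole plane.\<close>
  define S where "S = {y. \<exists>s. PP y s = 0 \<and> Im (FF y s) = M}"
  have "open S"
    unfolding open_contains_ball
  proof
    fix y assume "y \<in> S"
    then obtain s where s: "PP y s = 0" "Im (FF y s) = M" by (auto simp: S_def)
    from imaginary_invariant_max[OF nz s(1) nonreal[OF s(2)] max s(2)]
    obtain d where "d > 0" "\<And>y'. y' \<in> ball y d \<Longrightarrow> \<exists>s. PP y' s = 0 \<and> Im (FF y' s) = M" by metis
    then show "\<exists>e>0. ball y e \<subseteq> S" by (auto simp: S_def)
  qed
  moreover have "closed S"
    unfolding closed_sequential_limits
  proof (intro allI impI, elim conjE)
    fix x l assume x: "\<forall>n. x n \<in> S" "x \<longlonglongrightarrow> l"
    have "bounded (range x)" using x(2) by (metis convergent_def convergent_imp_bounded)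
    then obtain K where K: "\<And>n. x n \<in> cball 0 K" by (auto simp: bounded_iff)
    define T where "T = {p \<in> cball 0 K \<times> UNIV. PP (fst p) (snd p) = 0}"
    have T: "compact T" unfolding T_def by (intro compact_roots) auto
    define T' where "T' = {p \<in> T. Im (FF (fst p) (snd p)) = M}"
    have "closed T'" unfolding T'_def
      by (intro continuous_closed_preimage_constant continuous_on_Im continuous_on_subset[OF continuous_FF(1)[OF nz]] compact_imp_closed T)
         (auto simp: T_def)
    then have "compact (T \<inter> T')" by (rule compact_Int_closed[OF T])
    moreover have "T \<inter> T' = T'" by (auto simp: T'_def)
    ultimately have "compact T'" by simp
    then have "closed (fst ` T')" by (intro compact_imp_closed compact_continuous_image continuous_intros)
    moreover have "x n \<in> fst ` T'" for n
    proof -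
      obtain s where "PP (x n) s = 0" "Im (FF (x n) s) = M" using x(1) by (auto simp: S_def)
      then have "(x n, s) \<in> T'" using K[of n] by (simp add: T'_def T_def)
      then show ?thesis by force
    qed
    ultimately have "l \<in> fst ` T'" using x(2) unfolding closed_sequential_limits by blast
    then show "l \<in> S" by (auto simp: T'_def T_def S_def)
  qed
  moreover have "y0 \<in> S" using y0(1) by (auto simp: S_def M_def)
  ultimately have S: "S = UNIV" using clopen[of S] by blast
  have all: "\<exists>z. PP y z = 0 \<and> Im (FF y z) = M" for y using S by (auto simp: S_def)
  have "d1 g y = 0 \<and> d2 g y = 0" for y
  proof -
    obtain z where z: "PP y z = 0" "Im (FF y z) = M" using all by blast
    have Rz: "RR y z = 0" using imaginary_invariant_max[OF nz z(1) nonreal[OF z(2)] max z(2)] by metis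
    have Rr: "RR y s = 0" if "PP y s = 0" "s \<in> \<real>" for s
    proof (rule real_invariants_constant[OF nz _ that])
      fix y' show "\<exists>z. PP y' z = 0 \<and> Im (FF y' z) \<noteq> 0" using all[of y'] M by force
    qed
    obtain x1 x2 :: real where d: "distinct [of_real x1, of_real x2, z, cnj z]"
      and iff: "\<And>s. PP y s = 0 \<longleftrightarrow> s \<in> {of_real x1, of_real x2, z, cnj z}"
      using elliptic_roots[OF gpos nonreal[OF z(2)] z(1)[unfolded PP_def], of thesis] unfolding PP_def by blast
    have "RR y (cnj z) = cnj (RR y z)" by (simp add: RR_def px_def lp_def)
    then have "RR y s = 0" if "s \<in> {of_real x1, of_real x2, z, cnj z}" for s
      using that Rz Rr[of "of_real x1"] Rr[of "of_real x2"] iff by auto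
    then have "px y s = 0" if "s \<in> {of_real x1, of_real x2, z, cnj z}" for s
      using that iff[of s] nz[rule_format, of y s] unfolding RR_def by auto
    then have "\<forall>s\<in>{of_real x1, of_real x2, z, cnj z}. complex_of_real (d2 b0 y) + of_real (d2 b1 y) * s + of_real (d2 b2 y) * s ^ 2 + of_real (d2 g y) * s ^ 3 = 0"
      by (simp add: px_def lp_def)
    \<comment> \<open>\<open>px\<close> is a cubic in \<open>s\<close> with four distinct zeros, so
      none of the coefficients depends on x; the fourth equation of the system then removes the
      t-derivative of \<open>g\<close>.\<close>
    from poly_cubic_zero[OF d this] have "d2 g y = 0" "d2 b2 y = 0" by simp_all
    then show ?thesis using E(4)[of y] by simp
  qed
  then show ?thesis by blast
qed simp

text \<open>At \<open>s = \<plusminus>\<i>\<close> the equation \<open>PP = 0\<close> says that both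
  real functions vanish at \<open>y0\<close>. Together they solve the system of Cauchy-Riemann type,
  so the zero spreads to the whole plane.\<close>

lemma infinite_critical_value:
  assumes "PP y0 s0 = 0" "1 + s0 ^ 2 = 0"
  shows "b0 y - b2 y + 1 = 0 \<and> b1 y - g y = 0"
proof (rule cauchy_riemann_zero_free[where g = g and u = u and v = v and ?z0.0 = y0])
  show "smooth_on UNIV (\<lambda>y. b0 y - b2 y + 1)" "smooth_on UNIV (\<lambda>y. b1 y - g y)" "smooth_on UNIV g"
    by (intro smooth_on_add smooth_on_diff smooth_on_const sm open_UNIV)+
  have A: "d1 (\<lambda>y. b0 y - b2 y + 1) y = d1 b0 y - d1 b2 y" "d2 (\<lambda>y. b0 y - b2 y + 1) y = d2 b0 y - d2 b2 y" for y
    using has_pd_d[OF has_pd_add[OF has_pd_diff[OF smooth_has_pd[OF sm(1) UNIV_I] smooth_has_pd[OF sm(3) UNIV_I]] has_pd_const]] by auto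
  have B: "d1 (\<lambda>y. b1 y - g y) y = d1 b1 y - d1 g y" "d2 (\<lambda>y. b1 y - g y) y = d2 b1 y - d2 g y" for y
    using has_pd_d[OF has_pd_diff[OF smooth_has_pd[OF sm(2) UNIV_I] smooth_has_pd[OF sm(4) UNIV_I]]] by auto
  show "d1 (\<lambda>y. b0 y - b2 y + 1) y = g y * d2 (\<lambda>y. b1 y - g y) y - 4 * d2 g y * (b1 y - g y)" for y
    unfolding A B E by (simp add: algebra_simps)
  show "d1 (\<lambda>y. b1 y - g y) y = - g y * d2 (\<lambda>y. b0 y - b2 y + 1) y + 4 * d2 g y * (b0 y - b2 y + 1)" for y
    unfolding A B E by (simp add: algebra_simps)
  have s2: "s0 ^ 2 = -1" using assms(2) by (simp only: eq_neg_iff_add_eq_0 add.commute)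
  have s3: "s0 ^ 3 = - s0" "s0 ^ 4 = 1"
    using s2 by (simp_all add: power3_eq_cube power4_eq_xxxx power2_eq_square)
  have si: "s0 = \<i> \<or> s0 = - \<i>"
    using s2 by (simp add: power2_eq_iff[of s0 \<i>, simplified])
  have "PP y0 s0 = 4 * (of_real (b1 y0 - g y0) - s0 * of_real (b0 y0 - b2 y0 + 1))"
    unfolding PP_def qP_def s2 s3 by (simp add: algebra_simps)
  then have "complex_of_real (b1 y0 - g y0) - s0 * of_real (b0 y0 - b2 y0 + 1) = 0"
    unfolding assms(1) by (metis mult_eq_0_iff zero_neq_numeral)
  then have "complex_of_real (b1 y0 - g y0) = s0 * of_real (b0 y0 - b2 y0 + 1)" by (simp only: right_minus_eq)
  then show "b0 y0 - b2 y0 + 1 = 0" "b1 y0 - g y0 = 0" using si by (auto simp: complex_eq_iff)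
qed (use gpos per det in auto)

end

section \<open>Local constancy of real critical values at nonreal points\<close>

context hydro_system
begin

text \<open>If the invariant is real near a point, its partial derivatives \<open>RR\<close> and
  \<open>- g * s * RR\<close> are both real, which for nonreal \<open>s\<close> is possible only
  with \<open>RR = 0\<close>.\<close>

lemma real_invariant_locally_constant:
  assumes nz: "\<forall>y s. PP y s = 0 \<longrightarrow> 1 + s ^ 2 \<noteq> 0"
    and re: "\<forall>y s. PP y s = 0 \<longrightarrow> Im (FF y s) = 0"
    and z0: "PP y0 z0 = 0" "Im z0 \<noteq> 0"
  obtains d where "d > 0" "\<And>y. y \<in> ball y0 d \<Longrightarrow> \<exists>z. PP y z = 0 \<and> Im z \<noteq> 0 \<and> FF y z = FF y0 z0"
proof -
  obtain \<rho> s where \<rho>: "\<rho> > 0" and s0: "s y0 = z0" and s: "\<And>y. y \<in> ball y0 \<rho> \<Longrightarrow> PP y (s y) = 0"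
    "\<And>y. y \<in> ball y0 \<rho> \<Longrightarrow> PP1 y (s y) \<noteq> 0"
    and pds': "\<And>y. y \<in> ball y0 \<rho> \<Longrightarrow> has_pd s (- Pt y (s y) / PP1 y (s y)) (- Px y (s y) / PP1 y (s y)) y"
    using root_branch[OF z0(1) elliptic_simple[OF z0 z0(1)]] by metis
  have conts: "continuous_on (ball y0 \<rho>) (\<lambda>y. Im (s y))"
    by (intro continuous_on_Im continuous_on_branch[OF pds'])
  have "open (ball y0 \<rho> \<inter> (\<lambda>y. Im (s y)) -` (- {0}))"
    by (intro continuous_open_preimage conts) auto
  moreover have "y0 \<in> ball y0 \<rho> \<inter> (\<lambda>y. Im (s y)) -` (- {0})" using \<rho> z0 s0 by simp
  ultimately obtain d where d: "d > 0" "ball y0 d \<subseteq> ball y0 \<rho> \<inter> (\<lambda>y. Im (s y)) -` (- {0})"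
    using open_contains_ball by blast
  have pF: "has_pd (\<lambda>y. FF y (s y)) 0 0 y" if y: "y \<in> ball y0 d" for y
  proof -
    have y': "y \<in> ball y0 \<rho>" "Im (s y) \<noteq> 0" using d(2) y by auto
    note pd = branch_invariant[OF pds'[OF y'(1)] s(1)[OF y'(1)] s(2)[OF y'(1)] nz[rule_format, OF s(1)[OF y'(1)]]]
    obtain e where e: "e > 0" "ball y e \<subseteq> ball y0 \<rho>" using y'(1) open_contains_ball[of "ball y0 \<rho>"] by blast
    have "Im (- complex_of_real (g y) * s y * RR y (s y)) = 0 \<and> Im (RR y (s y)) = 0"
    proof (rule constant_on_ball_pd[OF has_pd_Im[OF pd] e(1)])
      fix z assume "z \<in> ball y e"
      then have "z \<in> ball y0 \<rho>" using e(2) by blast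
      then show "Im (FF z (s z)) = Im (FF y (s y))"
        using re[rule_format, OF s(1)] re[rule_format, OF s(1)[OF y'(1)]] by simp
    qed
    then have "Im (RR y (s y)) = 0" "g y * Im (s y) * Re (RR y (s y)) = 0" by auto
    then have "RR y (s y) = 0" using y'(2) gpos[of y] by (simp add: complex_eq_iff)
    then show ?thesis using pd by simp
  qed
  have "FF y (s y) = FF y0 (s y0)" if y: "y \<in> ball y0 d" for y
  proof (rule has_derivative_zero_unique[OF convex_ball _ y])
    show "((\<lambda>y. FF y (s y)) has_derivative (\<lambda>h. 0)) (at x within ball y0 d)" if "x \<in> ball y0 d" for x
      using pF[OF that] unfolding has_pd_def by (auto intro: has_derivative_at_withinI)
    show "y0 \<in> ball y0 d" using d by simp
  qed
  note const = this
  have "\<exists>z. PP y z = 0 \<and> Im z \<noteq> 0 \<and> FF y z = FF y0 z0" if y: "y \<in> ball y0 d" for y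
  proof (intro exI[of _ "s y"] conjI)
    have y': "y \<in> ball y0 \<rho>" "Im (s y) \<noteq> 0" using d(2) y by auto
    show "PP y (s y) = 0" by (rule s(1)[OF y'(1)])
    show "Im (s y) \<noteq> 0" by (rule y'(2))
    show "FF y (s y) = FF y0 z0" using const[OF y] s0 by simp
  qed
  then show ?thesis using that d(1) by blast
qed

text \<open>The nonreal roots over a point form one conjugate pair, and a real value is common to
  both. The value is therefore a function of the point alone, which allows values on different
  branches to be compared.\<close>

lemma FF_nonreal_unique:
  assumes re: "\<forall>y s. PP y s = 0 \<longrightarrow> Im (FF y s) = 0"
    and z: "PP y z = 0" "Im z \<noteq> 0" and z': "PP y z' = 0" "Im z' \<noteq> 0"
  shows "FF y z = FF y z'"
proof -
  obtain x1 x2 :: real where iff: "\<And>s. PP y s = 0 \<longleftrightarrow> s \<in> {of_real x1, of_real x2, z, cnj z}"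
    using elliptic_roots[OF gpos z(2) z(1)[unfolded PP_def], of thesis] unfolding PP_def by blast
  have "z' = z \<or> z' = cnj z" using iff[of z'] z' by auto
  moreover have "FF y (cnj z) = FF y z" using re[rule_format, OF z(1)] by (simp add: FF_cnj complex_eq_iff)
  ultimately show ?thesis by auto
qed

end

text \<open>A critical value that is attained at two complex conjugate points makes the quartic a square up to
  a multiple of \<open>(1 + s\<^sup>2)\<^sup>2\<close>.\<close>

lemma quartic_square:
  fixes a0 a1 a2 a3 c :: real and z :: complex
  assumes a3: "a3 > 0" and z: "Im z \<noteq> 0" "1 + z ^ 2 \<noteq> 0"
    and P: "qP (of_real a0) (of_real a1) (of_real a2) (of_real a3) z = 0"
    and F: "qp (of_real a0) (of_real a1) (of_real a2) (of_real a3) z / (1 + z ^ 2) ^ 2 = of_real c"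
  shows "c \<noteq> 1"
    and "a0 * m ^ 4 + a1 * m ^ 3 * n + a2 * m ^ 2 * n ^ 2 + a3 * m * n ^ 3 + n ^ 4 - c * (m ^ 2 + n ^ 2) ^ 2 =
      (1 - c) * (n ^ 2 - 2 * Re z * m * n + ((Re z)\<^sup>2 + (Im z)\<^sup>2) * m ^ 2) ^ 2"
proof -
  define S T where "S = 2 * Re z" and "T = (Re z)\<^sup>2 + (Im z)\<^sup>2"
  \<comment> \<open>Coefficients of the quartic minus \<open>c * (1 + s^2)^2\<close> minus
    \<open>(1 - c)\<close> times the square of the real quadratic with roots \<open>z\<close> and
    \<open>cnj z\<close>. The leading terms cancel, leaving a cubic with double zeros at both
    points.\<close>
  define c0 where "c0 = a0 - c - (1 - c) * T ^ 2"
  define c1 where "c1 = a1 + 2 * (1 - c) * S * T"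
  define c2 where "c2 = a2 - 2 * c - (1 - c) * (S ^ 2 + 2 * T)"
  define c3 where "c3 = a3 + 2 * (1 - c) * S"
  note cs = c0_def c1_def c2_def c3_def
  let ?p = "qp (of_real a0) (of_real a1) (of_real a2) (of_real a3) :: complex \<Rightarrow> complex"
  let ?q = "\<lambda>s :: complex. of_real c0 + of_real c1 * s + of_real c2 * s ^ 2 + of_real c3 * s ^ 3"
  let ?q' = "\<lambda>s :: complex. of_real c1 + 2 * of_real c2 * s + 3 * of_real c3 * s ^ 2"
  have m: "z ^ 2 - of_real S * z + of_real T = 0"
    by (simp add: S_def T_def complex_eq_iff power2_eq_square algebra_simps)
  have F': "?p z = of_real c * (1 + z ^ 2) ^ 2" using F z(2) by (simp add: divide_eq_eq)
  have "?q z = ?p z - of_real c * (1 + z ^ 2) ^ 2 - of_real (1 - c) * (z ^ 2 - of_real S * z + of_real T) ^ 2"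
    by (simp add: cs qp_def pow_simps)
  then have q: "?q z = 0" unfolding m F' by simp
  let ?p' = "lp1 (of_real a0) (of_real a1) (of_real a2) (of_real a3) z + 4 * z ^ 3"
  have "?p' * (1 + z ^ 2) = 4 * z * ?p z"
    using lp1_qP[of "of_real a0" "of_real a1" "of_real a2" "of_real a3" z] P by simp
  also have "\<dots> = (4 * of_real c * z * (1 + z ^ 2)) * (1 + z ^ 2)" unfolding F' by (simp add: power2_eq_square)
  finally have p': "?p' = 4 * of_real c * z * (1 + z ^ 2)" using z(2) by simp
  have "?q' z = ?p' - 4 * of_real c * z * (1 + z ^ 2) - of_real (1 - c) * (2 * (z ^ 2 - of_real S * z + of_real T) * (2 * z - of_real S))"
    by (simp add: cs lp1_def pow_simps)
  then have q': "?q' z = 0" unfolding m p' by simp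
  define w where "w = cnj z"
  have "?q w = cnj (?q z)" "?q' w = cnj (?q' z)" by (simp_all add: w_def)
  then have qw: "?q w = 0" "?q' w = 0" unfolding q q' by simp_all
  \<comment> \<open>Values and first derivatives at two distinct points determine a cubic; the two
    Taylor differences below carry this out.\<close>
  define \<delta> where "\<delta> = w - z"
  have \<delta>: "\<delta> \<noteq> 0" using z(1) by (simp add: \<delta>_def w_def complex_eq_iff)
  define B where "B = of_real c2 + 3 * of_real c3 * z"
  have "?q w - ?q z - ?q' z * \<delta> = \<delta> ^ 2 * (B + of_real c3 * \<delta>)"
    by (simp add: B_def \<delta>_def pow_simps)
  then have 1: "B + of_real c3 * \<delta> = 0" using q q' qw \<delta> by simp
  have "?q' w - ?q' z = \<delta> * (2 * B + 3 * of_real c3 * \<delta>)"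
    by (simp add: B_def \<delta>_def pow_simps)
  then have 2: "2 * B + 3 * of_real c3 * \<delta> = 0" using q' qw \<delta> by simp
  have "of_real c3 * \<delta> = (2 * B + 3 * of_real c3 * \<delta>) - 2 * (B + of_real c3 * \<delta>)" by simp
  also have "\<dots> = 0" unfolding 1 2 by simp
  finally have c3: "c3 = 0" using \<delta> by simp
  then have c2: "c2 = 0" using 1 by (simp add: B_def)
  then have c1: "c1 = 0" using q' c3 by simp
  then have c0: "c0 = 0" using q c2 c3 by simp
  show "c \<noteq> 1" using c3 a3 by (auto simp: c3_def)
  have a: "a0 = c + (1 - c) * T ^ 2" "a1 = - 2 * (1 - c) * S * T" "a2 = 2 * c + (1 - c) * (S ^ 2 + 2 * T)" "a3 = - 2 * (1 - c) * S"
    using c0 c1 c2 c3 unfolding cs by (simp_all add: algebra_simps)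
  show "a0 * m ^ 4 + a1 * m ^ 3 * n + a2 * m ^ 2 * n ^ 2 + a3 * m * n ^ 3 + n ^ 4 - c * (m ^ 2 + n ^ 2) ^ 2 =
      (1 - c) * (n ^ 2 - 2 * Re z * m * n + ((Re z)\<^sup>2 + (Im z)\<^sup>2) * m ^ 2) ^ 2"
    unfolding S_def[symmetric] T_def[symmetric] a by (simp add: pow_simps)
qed

section \<open>Eigenvalues of the hydrodynamic matrix\<close>

text \<open>The last component of an eigenvector cannot vanish, since the lower rows would then
  annihilate the others one after another. Normalised to 1, it determines the remaining components
  from the lower three rows by Horner's scheme, and the first row becomes
  \<open>qP = 0\<close>.\<close>

lemma eigenvalue_hydro_matrix:
  fixes U :: "nat \<Rightarrow> real"
  assumes U3: "U 3 \<noteq> 0" and U4: "U 4 = 1"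
  shows "eigenvalue (hydro_matrix U) (of_real (U 3) * s) \<longleftrightarrow> qP (of_real (U 0)) (of_real (U 1)) (of_real (U 2)) (of_real (U 3)) s = 0"
proof -
  let ?A = "hydro_matrix U"
  define u0 u1 u2 u3 where "u0 = complex_of_real (U 0)" and "u1 = complex_of_real (U 1)"
    and "u2 = complex_of_real (U 2)" and "u3 = complex_of_real (U 3)"
  note us = u0_def u1_def u2_def u3_def
  have u3: "u3 \<noteq> 0" using U3 by (simp add: us)
  have dim: "dim_row ?A = 4" "dim_col ?A = 4"
    by (simp_all add: hydro_matrix_def mat_of_rows_list_def)
  have mult: "?A *\<^sub>v x = vec_of_list [u1 * x $ 3, u3 * x $ 0 + (2 * u2 - 4 * u0) * x $ 3,
      u3 * x $ 1 + (3 * u3 - 3 * u1) * x $ 3, u3 * x $ 2 + (4 - 2 * u2) * x $ 3]" if x: "x \<in> carrier_vec 4" for x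
  proof (rule eq_vecI)
    fix i assume "i < dim_vec (vec_of_list [u1 * x $ 3, u3 * x $ 0 + (2 * u2 - 4 * u0) * x $ 3,
      u3 * x $ 1 + (3 * u3 - 3 * u1) * x $ 3, u3 * x $ 2 + (4 - 2 * u2) * x $ 3])"
    then have "i \<in> {0, 1, 2, 3}" by auto
    then show "(?A *\<^sub>v x) $ i = vec_of_list [u1 * x $ 3, u3 * x $ 0 + (2 * u2 - 4 * u0) * x $ 3,
      u3 * x $ 1 + (3 * u3 - 3 * u1) * x $ 3, u3 * x $ 2 + (4 - 2 * u2) * x $ 3] $ i"
      using x U4
      by (auto simp: hydro_matrix_def mat_of_rows_list_def scalar_prod_def us numeral_eq_Suc algebra_simps)
  qed (simp add: dim)
  have "eigenvalue ?A (u3 * s) \<longleftrightarrow> (\<exists>x\<in>carrier_vec 4. x \<noteq> 0\<^sub>v 4 \<and> ?A *\<^sub>v x = (u3 * s) \<cdot>\<^sub>v x)"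
    unfolding eigenvalue_def eigenvector_def dim by blast
  also have "\<dots> \<longleftrightarrow> qP u0 u1 u2 u3 s = 0"
  proof
    assume "\<exists>x\<in>carrier_vec 4. x \<noteq> 0\<^sub>v 4 \<and> ?A *\<^sub>v x = (u3 * s) \<cdot>\<^sub>v x"
    then obtain x where x: "x \<in> carrier_vec 4" "x \<noteq> 0\<^sub>v 4" "?A *\<^sub>v x = (u3 * s) \<cdot>\<^sub>v x" by blast
    have i: "(?A *\<^sub>v x) $ i = u3 * s * x $ i" if "i < 4" for i
      unfolding x(3) using x(1) that by simp
    have e: "u1 * x $ 3 = u3 * s * x $ 0" "u3 * x $ 0 + (2 * u2 - 4 * u0) * x $ 3 = u3 * s * x $ 1"
      "u3 * x $ 1 + (3 * u3 - 3 * u1) * x $ 3 = u3 * s * x $ 2" "u3 * x $ 2 + (4 - 2 * u2) * x $ 3 = u3 * s * x $ 3"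
      using i[of 0] i[of 1] i[of 2] i[of 3] unfolding mult[OF x(1)] by (simp_all add: numeral_eq_Suc)
    have "x $ 3 \<noteq> 0"
    proof
      assume 3: "x $ 3 = 0"
      then have 2: "x $ 2 = 0" using e(4) u3 by simp
      then have 1: "x $ 1 = 0" using e(3) u3 3 by simp
      then have 0: "x $ 0 = 0" using e(2) u3 3 by simp
      have "x = 0\<^sub>v 4"
      proof (rule eq_vecI)
        fix i assume "i < dim_vec (0\<^sub>v 4 :: complex vec)"
        then have "i \<in> {0, 1, 2, 3}" by auto
        then show "x $ i = (0\<^sub>v 4) $ i" using 0 1 2 3 by auto
      qed (use x in simp)
      then show False using x(2) by simp
    qed
    moreover have "x $ 3 * qP u0 u1 u2 u3 s =
       (u1 * x $ 3 - u3 * s * x $ 0) + s * (u3 * x $ 0 + (2 * u2 - 4 * u0) * x $ 3 - u3 * s * x $ 1) +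
       s ^ 2 * (u3 * x $ 1 + (3 * u3 - 3 * u1) * x $ 3 - u3 * s * x $ 2) +
       s ^ 3 * (u3 * x $ 2 + (4 - 2 * u2) * x $ 3 - u3 * s * x $ 3)"
      by (simp add: qP_def pow_simps)
    ultimately show "qP u0 u1 u2 u3 s = 0" unfolding e by simp
  next
    assume q: "qP u0 u1 u2 u3 s = 0"
    define x2 where "x2 = s - (4 - 2 * u2) / u3"
    define x1 where "x1 = s * x2 - (3 * u3 - 3 * u1) / u3"
    define x0 where "x0 = s * x1 - (2 * u2 - 4 * u0) / u3"
    have e: "u3 * x2 + (4 - 2 * u2) = u3 * s" "u3 * x1 + (3 * u3 - 3 * u1) = u3 * s * x2"
      "u3 * x0 + (2 * u2 - 4 * u0) = u3 * s * x1"
    proof -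
      have m: "u3 * (X / u3) = X" for X using u3 by simp
      show "u3 * x2 + (4 - 2 * u2) = u3 * s" unfolding x2_def right_diff_distrib[of u3] m by simp
      show "u3 * x1 + (3 * u3 - 3 * u1) = u3 * s * x2" unfolding x1_def right_diff_distrib[of u3 "s * x2"] m by simp
      show "u3 * x0 + (2 * u2 - 4 * u0) = u3 * s * x1" unfolding x0_def right_diff_distrib[of u3 "s * x1"] m by simp
    qed
    have "qP u0 u1 u2 u3 s = (u1 - u3 * s * x0) + s * (u3 * x0 + (2 * u2 - 4 * u0) - u3 * s * x1) +
       s ^ 2 * (u3 * x1 + (3 * u3 - 3 * u1) - u3 * s * x2) + s ^ 3 * (u3 * x2 + (4 - 2 * u2) - u3 * s)"
      by (simp add: qP_def pow_simps)
    then have e0: "u1 = u3 * s * x0" using q unfolding e by simp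
    define x where "x = vec_of_list [x0, x1, x2, 1]"
    have dimx: "dim_vec x = 4" by (simp add: x_def)
    then have x: "x \<in> carrier_vec 4" by (rule carrier_vecI)
    have xi: "x $ 0 = x0" "x $ 1 = x1" "x $ 2 = x2" "x $ 3 = 1"
      by (simp_all add: x_def vec_of_list_index numeral_eq_Suc)
    have "x $ 3 \<noteq> (0\<^sub>v 4) $ 3" unfolding xi by simp
    then have "x \<noteq> 0\<^sub>v 4" by blast
    moreover have "?A *\<^sub>v x = (u3 * s) \<cdot>\<^sub>v x"
      unfolding mult[OF x]
    proof (rule eq_vecI)
      fix i assume "i < dim_vec ((u3 * s) \<cdot>\<^sub>v x)"
      then have "i < 4" "i \<in> {0, 1, 2, 3}" by (auto simp: dimx)
      then show "vec_of_list [u1 * x $ 3, u3 * x $ 0 + (2 * u2 - 4 * u0) * x $ 3,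
        u3 * x $ 1 + (3 * u3 - 3 * u1) * x $ 3, u3 * x $ 2 + (4 - 2 * u2) * x $ 3] $ i = ((u3 * s) \<cdot>\<^sub>v x) $ i"
        using e e0 by (auto simp: dimx xi vec_of_list_index numeral_2_eq_2 numeral_3_eq_3 xi[unfolded numeral_2_eq_2 numeral_3_eq_3 One_nat_def])
    qed (simp add: dimx)
    ultimately show "\<exists>x\<in>carrier_vec 4. x \<noteq> 0\<^sub>v 4 \<and> ?A *\<^sub>v x = (u3 * s) \<cdot>\<^sub>v x" using x by blast
  qed
  finally show ?thesis by (simp add: us)
qed

text \<open>A nonreal root comes with its conjugate and two real roots, four in all, which meets the
  counting condition; multiplication by \<open>U 3\<close> carries roots of \<open>qP\<close> to
  eigenvalues.\<close>

lemma elliptic_matrix_iff: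
  fixes U :: "nat \<Rightarrow> real"
  assumes U3: "U 3 > 0" and U4: "U 4 = 1"
  shows "elliptic_matrix (hydro_matrix U) \<longleftrightarrow>
    (\<exists>z. Im z \<noteq> 0 \<and> qP (of_real (U 0)) (of_real (U 1)) (of_real (U 2)) (of_real (U 3)) z = 0)"
proof
  let ?P = "qP (of_real (U 0)) (of_real (U 1)) (of_real (U 2)) (of_real (U 3)) :: complex \<Rightarrow> complex"
  have U3': "U 3 \<noteq> 0" using U3 by simp
  note ev = eigenvalue_hydro_matrix[OF U3' U4]
  show "\<exists>z. Im z \<noteq> 0 \<and> ?P z = 0" if e: "elliptic_matrix (hydro_matrix U)"
  proof -
    obtain l where l: "l \<notin> \<real>" "eigenvalue (hydro_matrix U) l" using e unfolding elliptic_matrix_def by blast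
    define z where "z = l / of_real (U 3)"
    have "l = of_real (U 3) * z" using U3 by (simp add: z_def)
    then have "?P z = 0" using ev l(2) by simp
    moreover have "Im z \<noteq> 0" using l(1) U3 by (simp add: z_def complex_is_Real_iff)
    ultimately show ?thesis by blast
  qed
  show "elliptic_matrix (hydro_matrix U)" if e: "\<exists>z. Im z \<noteq> 0 \<and> ?P z = 0"
  proof -
    obtain z where z: "Im z \<noteq> 0" "?P z = 0" using e by blast
    obtain x1 x2 :: real where d: "distinct [of_real x1, of_real x2, z, cnj z]"
      and iff: "\<And>s. ?P s = 0 \<longleftrightarrow> s \<in> {of_real x1, of_real x2, z, cnj z}"
      using elliptic_roots[OF U3 z, of thesis] by blast
    have "{l. eigenvalue (hydro_matrix U) l} = (\<lambda>s. of_real (U 3) * s) ` {s. ?P s = 0}"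
    proof (intro equalityI subsetI)
      fix l assume "l \<in> {l. eigenvalue (hydro_matrix U) l}"
      moreover have "l = of_real (U 3) * (l / of_real (U 3))" using U3 by simp
      ultimately show "l \<in> (\<lambda>s. of_real (U 3) * s) ` {s. ?P s = 0}"
        using ev[of "l / of_real (U 3)"] by (intro image_eqI[of _ _ "l / of_real (U 3)"]) auto
    qed (auto simp: ev)
    moreover have "inj_on (\<lambda>s. complex_of_real (U 3) * s) X" for X using U3 by (simp add: inj_on_def)
    ultimately have "card {l. eigenvalue (hydro_matrix U) l} = card {s. ?P s = 0}" by (simp add: card_image)
    also have "{s. ?P s = 0} = set [of_real x1, of_real x2, z, cnj z]" using iff by auto
    also have "card \<dots> = length [of_real x1, of_real x2, z, cnj z]" by (rule distinct_card[OF d])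
    also have "\<dots> = dim_row (hydro_matrix U)" by (simp add: hydro_matrix_def mat_of_rows_list_def)
    finally have c: "card {l. eigenvalue (hydro_matrix U) l} = dim_row (hydro_matrix U)" .
    have "of_real (U 3) * z \<notin> \<real>" using z(1) U3 by (simp add: complex_is_Real_iff)
    moreover have "eigenvalue (hydro_matrix U) (of_real (U 3) * z)" using ev z(2) by simp
    moreover have "eigenvalue (hydro_matrix U) (cnj (of_real (U 3) * z))" using ev[of "cnj z"] iff by simp
    ultimately show ?thesis using c unfolding elliptic_matrix_def by blast
  qed
qed

section \<open>The Hamiltonian of a metric\<close>

lemma inner_plane: "inner (p :: plane) v = fst p * fst v + snd p * snd v"
  by (cases p; cases v) simp

lemma bilinear_plane:
  assumes "bilinear (B :: plane \<Rightarrow> plane \<Rightarrow> real)"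
  shows "B v w = fst v * fst w * B (1,0) (1,0) + fst v * snd w * B (1,0) (0,1) +
    snd v * fst w * B (0,1) (1,0) + snd v * snd w * B (0,1) (0,1)"
proof -
  have v: "v = fst v *\<^sub>R (1,0) + snd v *\<^sub>R (0,1)" and w: "w = fst w *\<^sub>R (1,0) + snd w *\<^sub>R (0,1)"
    by (simp_all add: prod_eq_iff)
  have "B v w = B (fst v *\<^sub>R (1,0) + snd v *\<^sub>R (0,1)) (fst w *\<^sub>R (1,0) + snd w *\<^sub>R (0,1))"
    using v w by simp
  also have "\<dots> = fst v * fst w * B (1,0) (1,0) + fst v * snd w * B (1,0) (0,1) +
    snd v * fst w * B (0,1) (1,0) + snd v * snd w * B (0,1) (0,1)"
    by (simp only: bilinear_ladd[OF assms] bilinear_radd[OF assms] bilinear_lmul[OF assms] bilinear_rmul[OF assms]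
        real_scaleR_def) (simp add: algebra_simps)
  finally show ?thesis .
qed

context
  fixes \<rho> :: "plane \<Rightarrow> plane \<Rightarrow> plane \<Rightarrow> real"
  assumes rm: "riemannian_metric \<rho>"
begin

lemma metric_bilinear: "bilinear (\<rho> q)"
  and metric_sym: "\<rho> q v w = \<rho> q w v"
  and metric_pos: "v \<noteq> 0 \<Longrightarrow> 0 < \<rho> q v v"
  and metric_smooth: "smooth_on UNIV (\<lambda>q. \<rho> q v w)"
  using rm unfolding riemannian_metric_def by blast+

lemma sharp_eq:
  assumes "\<And>v. \<rho> q w v = inner p v"
  shows "sharp \<rho> q p = w"
  unfolding sharp_def
proof (rule the_equality)
  show "\<forall>v. \<rho> q w v = inner p v" using assms by blast
  fix w' assume w': "\<forall>v. \<rho> q w' v = inner p v"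
  have "\<rho> q (w' - w) (w' - w) = 0"
    unfolding bilinear_lsub[OF metric_bilinear] assms spec[OF w'] by simp
  then show "w' = w" using metric_pos[of "w' - w" q] by force
qed

lemma metric_det_pos: "\<rho> q (1,0) (1,0) * \<rho> q (0,1) (0,1) - (\<rho> q (1,0) (0,1))\<^sup>2 > 0"
proof -
  let ?E = "\<rho> q (1,0) (1,0)" and ?B = "\<rho> q (1,0) (0,1)" and ?G = "\<rho> q (0,1) (0,1)"
  \<comment> \<open>The test vector is orthogonal to \<open>(1, 0)\<close>, and its squared length
    is \<open>?E\<close> times the determinant.\<close>
  have "0 < \<rho> q (- ?B, ?E) (- ?B, ?E)"
    by (rule metric_pos) (use metric_pos[of "(1,0)" q] in \<open>auto simp: zero_prod_def\<close>)
  also have "\<dots> = ?E * (?E * ?G - ?B\<^sup>2)"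
    unfolding bilinear_plane[OF metric_bilinear, of q "(- ?B, ?E)"] metric_sym[of q "(0,1)" "(1,0)"]
    by (simp add: algebra_simps power2_eq_square)
  finally show ?thesis using metric_pos[of "(1,0)" q] by (simp add: zero_less_mult_iff zero_prod_def)
qed

lemma sharp_metric: "\<rho> q (sharp \<rho> q p) v = inner p v"
proof -
  let ?E = "\<rho> q (1,0) (1,0)" and ?B = "\<rho> q (1,0) (0,1)" and ?G = "\<rho> q (0,1) (0,1)"
  define D where "D = ?E * ?G - ?B\<^sup>2"
  have D: "D > 0" unfolding D_def by (rule metric_det_pos)
  define w where "w = ((?G * fst p - ?B * snd p) / D, (?E * snd p - ?B * fst p) / D)"
  have "\<rho> q w v = inner p v" for v
  proof -
    have "\<rho> q w v = (fst v * ((?G * fst p - ?B * snd p) * ?E + (?E * snd p - ?B * fst p) * ?B) +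
       snd v * ((?G * fst p - ?B * snd p) * ?B + (?E * snd p - ?B * fst p) * ?G)) / D"
      unfolding bilinear_plane[OF metric_bilinear, of q w] metric_sym[of q "(0,1)" "(1,0)"]
      unfolding w_def fst_conv snd_conv
      by (simp add: add_divide_distrib diff_divide_distrib algebra_simps)
    also have "\<dots> = (inner p v * D) / D"
      by (rule arg_cong[of _ _ "\<lambda>x. x / D"]) (simp add: D_def inner_plane algebra_simps power2_eq_square)
    finally show ?thesis using D by simp
  qed
  then show ?thesis using sharp_eq[of q w p] by simp
qed

text \<open>\<open>hamE\<close>, \<open>hamB\<close> and \<open>hamG\<close> are the entries of the
  inverse matrix of the metric, so they are the coefficients of \<open>2 * H\<close> as a quadratic
  form in the momenta.\<close>

definition "hamE = (\<lambda>q. \<rho> q (0,1) (0,1) / (\<rho> q (1,0) (1,0) * \<rho> q (0,1) (0,1) - (\<rho> q (1,0) (0,1))\<^sup>2))"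
definition "hamB = (\<lambda>q. - \<rho> q (1,0) (0,1) / (\<rho> q (1,0) (1,0) * \<rho> q (0,1) (0,1) - (\<rho> q (1,0) (0,1))\<^sup>2))"
definition "hamG = (\<lambda>q. \<rho> q (1,0) (1,0) / (\<rho> q (1,0) (1,0) * \<rho> q (0,1) (0,1) - (\<rho> q (1,0) (0,1))\<^sup>2))"

lemma hamiltonian_inner: "hamiltonian \<rho> (q, p) = inner p (sharp \<rho> q p) / 2"
  by (simp add: hamiltonian_def sharp_metric)

lemma hamiltonian_quadratic:
  "2 * hamiltonian \<rho> (q, p) = hamE q * (fst p)\<^sup>2 + 2 * hamB q * fst p * snd p + hamG q * (snd p)\<^sup>2"
proof -
  let ?E = "\<rho> q (1,0) (1,0)" and ?B = "\<rho> q (1,0) (0,1)" and ?G = "\<rho> q (0,1) (0,1)"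
  define D where "D = ?E * ?G - ?B\<^sup>2"
  have D: "D > 0" unfolding D_def by (rule metric_det_pos)
  define w where "w = sharp \<rho> q p"
  have e: "\<rho> q w (1,0) = fst p" "\<rho> q w (0,1) = snd p" by (simp_all add: w_def sharp_metric inner_plane)
  have l: "fst w * ?E + snd w * ?B = fst p" "fst w * ?B + snd w * ?G = snd p"
    using e unfolding bilinear_plane[OF metric_bilinear, of q w] metric_sym[of q "(0,1)" "(1,0)"] by simp_all
  have "D * fst w = ?G * (fst w * ?E + snd w * ?B) - ?B * (fst w * ?B + snd w * ?G)"
    "D * snd w = ?E * (fst w * ?B + snd w * ?G) - ?B * (fst w * ?E + snd w * ?B)"
    by (simp_all add: D_def algebra_simps power2_eq_square)
  then have "fst w = (?G * fst p - ?B * snd p) / D" "snd w = (?E * snd p - ?B * fst p) / D"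
    unfolding l using D by (simp_all add: eq_divide_eq mult.commute)
  note fw = this
  have "2 * hamiltonian \<rho> (q, p) = fst p * fst w + snd p * snd w"
    by (simp add: hamiltonian_inner inner_plane w_def)
  also have "\<dots> = fst p * ((?G * fst p - ?B * snd p) / D) + snd p * ((?E * snd p - ?B * fst p) / D)"
    by (simp only: fw)
  also have "\<dots> = ?G / D * (fst p)\<^sup>2 + 2 * (- ?B / D) * fst p * snd p + ?E / D * (snd p)\<^sup>2"
    by (simp add: add_divide_distrib diff_divide_distrib algebra_simps power2_eq_square)
  finally show ?thesis by (simp add: hamE_def hamB_def hamG_def D_def)
qed

lemma hamE_pos: "hamE q > 0"
  unfolding hamE_def using metric_pos[of "(0,1)" q] metric_det_pos[of q]
  by (simp add: zero_prod_def)

lemma ham_smooth: "smooth_on UNIV hamE" "smooth_on UNIV hamB" "smooth_on UNIV hamG"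
proof -
  have ne: "\<rho> q (1,0) (1,0) * \<rho> q (0,1) (0,1) - (\<rho> q (1,0) (0,1))\<^sup>2 \<noteq> 0" for q
    using metric_det_pos[of q] by simp
  have "smooth_on UNIV (\<lambda>q. (0 - \<rho> q (1,0) (0,1)) / (\<rho> q (1,0) (1,0) * \<rho> q (0,1) (0,1) - (\<rho> q (1,0) (0,1))\<^sup>2))"
    by (intro smooth_on_divide smooth_on_diff smooth_on_mult smooth_on_power smooth_on_const metric_smooth open_UNIV ne)
  then show "smooth_on UNIV hamB" by (simp add: hamB_def)
  show "smooth_on UNIV hamE" "smooth_on UNIV hamG" unfolding hamE_def hamG_def
    by (intro smooth_on_divide smooth_on_diff smooth_on_mult smooth_on_power metric_smooth open_UNIV ne)+
qed

lemma hamiltonian_pos: "p \<noteq> 0 \<Longrightarrow> hamiltonian \<rho> (q, p) > 0"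
proof -
  assume p: "p \<noteq> 0"
  have "sharp \<rho> q p \<noteq> 0"
  proof
    assume "sharp \<rho> q p = 0"
    then have "inner p p = 0" using sharp_metric[of q p p] bilinear_lzero[OF metric_bilinear] by simp
    then show False using p by simp
  qed
  then show ?thesis using metric_pos by (simp add: hamiltonian_def)
qed

end

lemma smooth_on_quadratic_form:
  assumes S: "open S" and c: "smooth_on S A" "smooth_on S B" "smooth_on S C"
  shows "smooth_on (S \<times> UNIV) (\<lambda>z :: plane \<times> plane. A (fst z) * (fst (snd z))\<^sup>2 + B (fst z) * fst (snd z) * snd (snd z) + C (fst z) * (snd (snd z))\<^sup>2 :: real)"
proof -
  have o: "open (S \<times> (UNIV :: plane set))" using S by (intro open_Times) auto
  have l: "smooth_on (S \<times> (UNIV :: plane set)) (\<lambda>z. fst (snd z))" "smooth_on (S \<times> (UNIV :: plane set)) (\<lambda>z. snd (snd z))"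
    by (intro smooth_on_linear o bounded_linear_compose[OF bounded_linear_fst bounded_linear_snd]
        bounded_linear_compose[OF bounded_linear_snd bounded_linear_snd])+
  show ?thesis
    by (intro smooth_on_add smooth_on_mult smooth_on_power o l smooth_on_fst[OF S c(1)] smooth_on_fst[OF S c(2)] smooth_on_fst[OF S c(3)])
qed

lemma hamiltonian_smooth:
  assumes "riemannian_metric \<rho>"
  shows "smooth_on UNIV (hamiltonian \<rho>)"
proof -
  have e: "hamiltonian \<rho> = (\<lambda>z. (1/2) * (hamE \<rho> (fst z) * (fst (snd z))\<^sup>2 + (2 * hamB \<rho> (fst z)) * fst (snd z) * snd (snd z) + hamG \<rho> (fst z) * (snd (snd z))\<^sup>2))"
  proof
    fix z :: "plane \<times> plane"
    show "hamiltonian \<rho> z = (1/2) * (hamE \<rho> (fst z) * (fst (snd z))\<^sup>2 + (2 * hamB \<rho> (fst z)) * fst (snd z) * snd (snd z) + hamG \<rho> (fst z) * (snd (snd z))\<^sup>2)"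
      using hamiltonian_quadratic[OF assms, of "fst z" "snd z"] by simp
  qed
  have "smooth_on (UNIV \<times> UNIV) (\<lambda>z. hamE \<rho> (fst z) * (fst (snd z))\<^sup>2 + (2 * hamB \<rho> (fst z)) * fst (snd z) * snd (snd z) + hamG \<rho> (fst z) * (snd (snd z))\<^sup>2)"
    by (intro smooth_on_quadratic_form ham_smooth[OF assms] smooth_on_mult smooth_on_const open_UNIV)
  then show ?thesis unfolding e by (intro smooth_on_mult smooth_on_const open_UNIV) simp_all
qed

section \<open>Poisson brackets\<close>

lemma Basis_plane: "(Basis :: plane set) = {(1, 0), (0, 1)}"
  by (auto simp: Basis_prod_def)

lemma poisson_plane:
  "poisson F G z = frechet_derivative F (at z) ((1,0), 0) * frechet_derivative G (at z) (0, (1,0)) -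
     frechet_derivative F (at z) (0, (1,0)) * frechet_derivative G (at z) ((1,0), 0) +
     (frechet_derivative F (at z) ((0,1), 0) * frechet_derivative G (at z) (0, (0,1)) -
     frechet_derivative F (at z) (0, (0,1)) * frechet_derivative G (at z) ((0,1), 0))"
  unfolding poisson_def Basis_plane by simp

text \<open>Along the zero section \<open>F\<close> is constantly 0, and in the momenta it vanishes
  to order at least two. This settles brackets at \<open>p = 0\<close>, and it also excludes regular
  Liouville tori of zero energy.\<close>

lemma homogeneous_derivative_zero:
  fixes F :: "plane \<times> plane \<Rightarrow> real"
  assumes F: "F differentiable (at (q, 0))" and n: "n \<ge> 2" and S: "open S" "q \<in> S"
    and hom: "\<And>q' t p. q' \<in> S \<Longrightarrow> F (q', t *\<^sub>R p) = t ^ n * F (q', p)"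
  shows "frechet_derivative F (at (q, 0)) w = 0"
proof -
  define F' where "F' = frechet_derivative F (at (q, 0))"
  have F': "(F has_derivative F') (at (q, 0))" unfolding F'_def using F by (simp add: frechet_derivative_works)
  have zero: "F (q', 0) = 0" if "q' \<in> S" for q' using hom[OF that, of 0 0] n by (simp add: power_0_left)
  obtain r where r: "r > 0" "ball q r \<subseteq> S" using S open_contains_ball by blast
  obtain v p where w: "w = (v, p)" by (cases w)
  have split: "F' (v, p) = F' (v, 0) + F' (0, p)" for v p
    using linear_add[OF has_derivative_linear[OF F'], of "(v, 0)" "(0, p)"] by simp
  have dv: "((\<lambda>t. F (q + t *\<^sub>R v, t *\<^sub>R p)) has_real_derivative F' (v, p)) (at 0)" for v p
  proof -
    have h: "((\<lambda>t::real. (q + t *\<^sub>R v, t *\<^sub>R p)) has_derivative (\<lambda>h. (h *\<^sub>R v, h *\<^sub>R p))) (at 0)"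
      by (auto intro!: derivative_eq_intros)
    have "((\<lambda>t. F (q + t *\<^sub>R v, t *\<^sub>R p)) has_derivative (\<lambda>h. F' (h *\<^sub>R v, h *\<^sub>R p))) (at 0)"
      using has_derivative_compose[OF h, of F F'] F' by simp
    moreover have "F' (h *\<^sub>R v, h *\<^sub>R p) = F' (v, p) * h" for h
      using linear_scale[OF has_derivative_linear[OF F'], of h "(v, p)"] by simp
    ultimately show ?thesis by (simp add: has_field_derivative_def)
  qed
  have "F' (v, 0) = 0"
  proof -
    define e where "e = r / (norm v + 1)"
    have e: "e > 0" using r by (simp add: e_def add_nonneg_pos)
    have "F (q + t *\<^sub>R v, t *\<^sub>R 0) = 0" if "\<bar>t\<bar> < e" for t
    proof -
      have "\<bar>t\<bar> * norm v \<le> \<bar>t\<bar> * (norm v + 1)" by (simp add: mult_left_mono)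
      also have "\<dots> < r" using that by (simp add: e_def pos_less_divide_eq add_nonneg_pos)
      finally have "q + t *\<^sub>R v \<in> S" using r(2) by (auto simp: dist_norm)
      then show ?thesis using zero by simp
    qed
    then have "((\<lambda>t. F (q + t *\<^sub>R v, t *\<^sub>R 0)) has_real_derivative 0) (at 0)"
      by (intro DERIV_cong_ev[THEN iffD2, OF refl _ refl DERIV_const[of 0]])
         (use e in \<open>auto simp: eventually_at dist_real_def eventually_nhds_metric\<close>)
    then show ?thesis using DERIV_unique dv by blast
  qed
  moreover have "F' (0, p) = 0"
  proof -
    have "((\<lambda>t. t ^ n * F (q, p)) has_real_derivative 0) (at 0)"
      using n by (auto intro!: derivative_eq_intros)
    moreover have "(\<lambda>t. F (q + t *\<^sub>R 0, t *\<^sub>R p)) = (\<lambda>t. t ^ n * F (q, p))" using hom[OF S(2)] by simp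
    ultimately show ?thesis using DERIV_unique dv[of 0 p] by metis
  qed
  ultimately show ?thesis using split[of v p] by (simp add: w F'_def)
qed

text \<open>A cotangent lift is symplectic: the second derivatives of the coordinates enter the
  \<open>q\<close>-derivatives through a symmetric matrix \<open>S\<close>, which cancels from the bracket.\<close>

lemma cotangent_lift_derivatives:
  fixes F :: "plane \<times> plane \<Rightarrow> real" and t x :: "plane \<Rightarrow> real"
  assumes sm: "smooth_on UNIV t" "smooth_on UNIV x"
    and F: "F differentiable (at (q, (P1 * d1 t q + P2 * d1 x q, P1 * d2 t q + P2 * d2 x q)))"
    and eq: "\<And>q P1 P2. F (q, (P1 * d1 t q + P2 * d1 x q, P1 * d2 t q + P2 * d2 x q)) = f (t q, x q) (P1, P2)"
    and f1: "has_pd (\<lambda>y. f y (P1, P2)) ft fx (t q, x q)" and f2: "has_pd (f (t q, x q)) fP1 fP2 (P1, P2)"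
  defines "F' \<equiv> frechet_derivative F (at (q, (P1 * d1 t q + P2 * d1 x q, P1 * d2 t q + P2 * d2 x q)))"
  defines "S11 \<equiv> P1 * d1 (d1 t) q + P2 * d1 (d1 x) q" and "S12 \<equiv> P1 * d2 (d1 t) q + P2 * d2 (d1 x) q"
    and "S22 \<equiv> P1 * d2 (d2 t) q + P2 * d2 (d2 x) q"
  shows "F' ((1,0), 0) + F' (0, (1,0)) * S11 + F' (0, (0,1)) * S12 = ft * d1 t q + fx * d1 x q"
    and "F' ((0,1), 0) + F' (0, (1,0)) * S12 + F' (0, (0,1)) * S22 = ft * d2 t q + fx * d2 x q"
    and "F' (0, (1,0)) * d1 t q + F' (0, (0,1)) * d2 t q = fP1"
    and "F' (0, (1,0)) * d1 x q + F' (0, (0,1)) * d2 x q = fP2"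
proof -
  define p where "p = (P1 * d1 t q + P2 * d1 x q, P1 * d2 t q + P2 * d2 x q)"
  have F': "(F has_derivative F') (at (q, p))" unfolding F'_def p_def using F by (simp add: frechet_derivative_works)
  have l: "linear F'" by (rule has_derivative_linear[OF F'])
  have lin: "F' (v, w) = fst v * F' ((1,0), 0) + snd v * F' ((0,1), 0) + fst w * F' (0, (1,0)) + snd w * F' (0, (0,1))" for v w
  proof -
    have "(v, w) = fst v *\<^sub>R ((1,0), 0) + snd v *\<^sub>R ((0,1), 0) + fst w *\<^sub>R (0, (1,0)) + snd w *\<^sub>R (0, (0,1))"
      by (simp add: prod_eq_iff)
    then show ?thesis by (simp only: linear_add[OF l] linear_scale[OF l] real_scaleR_def)
  qed
  have pt: "has_pd t (d1 t q) (d2 t q) q" "has_pd x (d1 x q) (d2 x q) q"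
    "has_pd (d1 t) (d1 (d1 t) q) (d2 (d1 t) q) q" "has_pd (d1 x) (d1 (d1 x) q) (d2 (d1 x) q) q"
    "has_pd (d2 t) (d1 (d2 t) q) (d2 (d2 t) q) q" "has_pd (d2 x) (d1 (d2 x) q) (d2 (d2 x) q) q"
    by (intro smooth_has_pd[where S = UNIV] sm smooth_d1 smooth_d2 UNIV_I)+
  have "has_pd (\<lambda>q. P1 * d1 t q + P2 * d1 x q) S11 S12 q"
    by (rule has_pd_eq[OF has_pd_add[OF has_pd_mult[OF has_pd_const pt(3)] has_pd_mult[OF has_pd_const pt(4)]]])
       (simp_all add: S11_def S12_def)
  moreover have "has_pd (\<lambda>q. P1 * d2 t q + P2 * d2 x q) S12 S22 q"
    by (rule has_pd_eq[OF has_pd_add[OF has_pd_mult[OF has_pd_const pt(5)] has_pd_mult[OF has_pd_const pt(6)]]])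
       (simp_all add: S22_def S12_def d1_d2_commute[OF sm(1)] d1_d2_commute[OF sm(2)])
  ultimately have "((\<lambda>q. (q, (P1 * d1 t q + P2 * d1 x q, P1 * d2 t q + P2 * d2 x q))) has_derivative
      (\<lambda>v. (v, (fst v *\<^sub>R S11 + snd v *\<^sub>R S12, fst v *\<^sub>R S12 + snd v *\<^sub>R S22)))) (at q)"
    unfolding has_pd_def by (intro has_derivative_Pair has_derivative_ident)
  from has_derivative_compose[OF this, of F F'] F'
  have 1: "((\<lambda>q. f (t q, x q) (P1, P2)) has_derivative
      (\<lambda>v. F' (v, (fst v *\<^sub>R S11 + snd v *\<^sub>R S12, fst v *\<^sub>R S12 + snd v *\<^sub>R S22)))) (at q)"
    by (simp only: p_def eq)
  have "((\<lambda>q. (t q, x q)) has_derivative (\<lambda>v. (fst v *\<^sub>R d1 t q + snd v *\<^sub>R d2 t q, fst v *\<^sub>R d1 x q + snd v *\<^sub>R d2 x q))) (at q)"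
    using pt(1,2) unfolding has_pd_def by (intro has_derivative_Pair)
  from has_derivative_compose[OF this f1[unfolded has_pd_def]]
  have 2: "((\<lambda>q. f (t q, x q) (P1, P2)) has_derivative
      (\<lambda>v. (fst v *\<^sub>R d1 t q + snd v *\<^sub>R d2 t q) *\<^sub>R ft + (fst v *\<^sub>R d1 x q + snd v *\<^sub>R d2 x q) *\<^sub>R fx)) (at q)"
    by simp
  have 3: "F' (v, (fst v *\<^sub>R S11 + snd v *\<^sub>R S12, fst v *\<^sub>R S12 + snd v *\<^sub>R S22)) =
     (fst v *\<^sub>R d1 t q + snd v *\<^sub>R d2 t q) *\<^sub>R ft + (fst v *\<^sub>R d1 x q + snd v *\<^sub>R d2 x q) *\<^sub>R fx" for v
    using fun_cong[OF has_derivative_unique[OF 1 2]] .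
  show "F' ((1,0), 0) + F' (0, (1,0)) * S11 + F' (0, (0,1)) * S12 = ft * d1 t q + fx * d1 x q"
    using 3[of "(1,0)"] lin[of "(1,0)" "(S11, S12)"] by (simp add: mult.commute)
  show "F' ((0,1), 0) + F' (0, (1,0)) * S12 + F' (0, (0,1)) * S22 = ft * d2 t q + fx * d2 x q"
    using 3[of "(0,1)"] lin[of "(0,1)" "(S12, S22)"] by (simp add: mult.commute)
  have "((\<lambda>P. (q, (fst P * d1 t q + snd P * d1 x q, fst P * d2 t q + snd P * d2 x q))) has_derivative
      (\<lambda>W. (0, (fst W * d1 t q + snd W * d1 x q, fst W * d2 t q + snd W * d2 x q)))) (at (P1, P2))"
    by (auto intro!: derivative_eq_intros)
  from has_derivative_compose[OF this, of F F'] F'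
  have 4: "((\<lambda>P. F (q, (fst P * d1 t q + snd P * d1 x q, fst P * d2 t q + snd P * d2 x q))) has_derivative
      (\<lambda>W. F' (0, (fst W * d1 t q + snd W * d1 x q, fst W * d2 t q + snd W * d2 x q)))) (at (P1, P2))"
    by (simp add: p_def)
  have "(\<lambda>P. F (q, (fst P * d1 t q + snd P * d1 x q, fst P * d2 t q + snd P * d2 x q))) = f (t q, x q)"
    by (rule ext) (simp only: eq prod.collapse)
  then have 5: "F' (0, (fst W * d1 t q + snd W * d1 x q, fst W * d2 t q + snd W * d2 x q)) = fst W *\<^sub>R fP1 + snd W *\<^sub>R fP2" for W
    using fun_cong[OF has_derivative_unique[OF 4, of "\<lambda>w. fst w *\<^sub>R fP1 + snd w *\<^sub>R fP2"]] f2
    unfolding has_pd_def by simp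
  show "F' (0, (1,0)) * d1 t q + F' (0, (0,1)) * d2 t q = fP1"
    using 5[of "(1,0)"] lin[of 0 "(d1 t q, d2 t q)"] by (simp add: mult.commute)
  show "F' (0, (1,0)) * d1 x q + F' (0, (0,1)) * d2 x q = fP2"
    using 5[of "(0,1)"] lin[of 0 "(d1 x q, d2 x q)"] by (simp add: mult.commute)
qed

lemma symplectic_cancellation:
  fixes Fp1 Fp2 Hp1 Hp2 :: real
  assumes "Fq1 + Fp1 * S11 + Fp2 * S12 = ft * t1 + fx * x1" "Fq2 + Fp1 * S12 + Fp2 * S22 = ft * t2 + fx * x2"
    "Fp1 * t1 + Fp2 * t2 = fP1" "Fp1 * x1 + Fp2 * x2 = fP2"
    "Hq1 + Hp1 * S11 + Hp2 * S12 = ht * t1 + hx * x1" "Hq2 + Hp1 * S12 + Hp2 * S22 = ht * t2 + hx * x2"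
    "Hp1 * t1 + Hp2 * t2 = hP1" "Hp1 * x1 + Hp2 * x2 = hP2"
  shows "Fq1 * Hp1 - Fp1 * Hq1 + (Fq2 * Hp2 - Fp2 * Hq2) = ft * hP1 + fx * hP2 - ht * fP1 - hx * fP2"
proof -
  have e: "Fq1 = ft * t1 + fx * x1 - Fp1 * S11 - Fp2 * S12" "Fq2 = ft * t2 + fx * x2 - Fp1 * S12 - Fp2 * S22"
    "Hq1 = ht * t1 + hx * x1 - Hp1 * S11 - Hp2 * S12" "Hq2 = ht * t2 + hx * x2 - Hp1 * S12 - Hp2 * S22"
    using assms by linarith+
  show ?thesis unfolding e assms(3,4,7,8)[symmetric] by (simp add: algebra_simps)
qed

text \<open>Off the zero section the coefficient of \<open>{F\<^sub>2, H}\<close> in \<open>{F\<^sub>4, H}\<close> does not vanish.\<close>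

lemma first_integral_of_reduction:
  assumes rm: "riemannian_metric \<rho>" and F4: "first_integral_on \<rho> UNIV F4"
    and S: "open S" and c: "smooth_on S A" "smooth_on S B" "smooth_on S C"
    and F2: "\<And>q p. q \<in> S \<Longrightarrow> F2 (q, p) = A q * (fst p)\<^sup>2 + B q * fst p * snd p + C q * (snd p)\<^sup>2"
    and red: "\<And>z. z \<in> S \<times> UNIV \<Longrightarrow> F4 z = k1 * (F2 z)\<^sup>2 + 2 * k2 * hamiltonian \<rho> z * F2 z + 4 * k3 * (hamiltonian \<rho> z)\<^sup>2"
    and ne: "\<And>q p. q \<in> S \<Longrightarrow> p \<noteq> 0 \<Longrightarrow> k1 * F2 (q, p) + k2 * hamiltonian \<rho> (q, p) \<noteq> 0"
  shows "hom_poly_on 2 S F2" "first_integral_on \<rho> S F2"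
proof -
  show "hom_poly_on 2 S F2"
    unfolding hom_poly_on_def
  proof (intro exI[of _ "\<lambda>k::nat. if k = 0 then A else if k = 1 then B else C"] conjI allI impI ballI)
    fix q p1 p2 assume "q \<in> S"
    then show "F2 (q, (p1, p2)) = (\<Sum>k\<le>2. (if k = 0 then A else if k = 1 then B else C) q * p1 ^ (2 - k) * p2 ^ k)"
      by (simp add: F2 numeral_2_eq_2)
  qed (use c in simp)
  have o: "open (S \<times> (UNIV :: plane set))" using S by (intro open_Times) auto
  have sm: "smooth_on (S \<times> UNIV) F2"
    by (rule smooth_on_cong[OF o _ smooth_on_quadratic_form[OF S c]]) (auto simp: F2)
  have "poisson F2 (hamiltonian \<rho>) z = 0" if z: "z \<in> S \<times> UNIV" for z
  proof -
    obtain q p where qp: "z = (q, p)" "q \<in> S" using z by auto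
    define H where "H = hamiltonian \<rho>"
    have dH: "(H has_derivative frechet_derivative H (at z)) (at z)"
      unfolding H_def by (rule smooth_on_has_derivative[OF hamiltonian_smooth[OF rm] UNIV_I])
    have dF2: "(F2 has_derivative frechet_derivative F2 (at z)) (at z)"
      by (rule smooth_on_has_derivative[OF sm z])
    show ?thesis
    proof (cases "p = 0")
      case True
      have "frechet_derivative F2 (at (q, 0)) w = 0" for w
      proof (rule homogeneous_derivative_zero[where n = 2 and S = S])
        show "F2 differentiable at (q, 0)" using dF2 qp True by (auto simp: differentiable_def)
        show "F2 (q', t *\<^sub>R p) = t ^ 2 * F2 (q', p)" if "q' \<in> S" for q' t p
          using that by (simp add: F2 algebra_simps power2_eq_square)
      qed (use S qp in auto)
      then show ?thesis using qp True by (simp add: poisson_def)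
    next
      case False
      \<comment> \<open>The differential of \<open>F4\<close> is \<open>c'\<close> times that of
        \<open>F2\<close> plus \<open>e'\<close> times that of \<open>H\<close>, and the second part
        drops out of the bracket with \<open>H\<close>.\<close>
      define c' where "c' = 2 * (k1 * F2 z + k2 * H z)"
      define e' where "e' = 2 * k2 * F2 z + 8 * k3 * H z"
      have "((\<lambda>z. k1 * (F2 z)\<^sup>2 + 2 * k2 * H z * F2 z + 4 * k3 * (H z)\<^sup>2) has_derivative
          (\<lambda>w. c' * frechet_derivative F2 (at z) w + e' * frechet_derivative H (at z) w)) (at z)"
        unfolding c'_def e'_def
        by (rule derivative_eq_intros dF2 dH | simp)+ (auto simp: fun_eq_iff algebra_simps power2_eq_square)
      then have "(F4 has_derivative (\<lambda>w. c' * frechet_derivative F2 (at z) w + e' * frechet_derivative H (at z) w)) (at z)"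
        by (rule has_derivative_transform_within_open[OF _ o z]) (simp add: red H_def)
      then have fd: "frechet_derivative F4 (at z) = (\<lambda>w. c' * frechet_derivative F2 (at z) w + e' * frechet_derivative H (at z) w)"
        by (rule frechet_derivative_at[symmetric])
      have "poisson F4 H z = 0" using bspec[OF conjunct2[OF F4[unfolded first_integral_on_def]], of z] by (simp add: H_def)
      then have "c' * poisson F2 H z = 0"
        unfolding poisson_plane fd by (simp add: algebra_simps)
      moreover have "c' \<noteq> 0" using ne[OF qp(2) False] qp by (simp add: c'_def H_def)
      ultimately show ?thesis by (simp add: H_def)
    qed
  qed
  then show "first_integral_on \<rho> S F2" unfolding first_integral_on_def using sm by blast
qed

section \<open>Reduction to the hydrodynamic system\<close>

lemma zero_pd_constant:
  assumes "\<And>y. has_pd f 0 0 y"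
  shows "f y = f z"
  by (rule has_derivative_zero_unique[OF convex_UNIV])
     (use assms in \<open>auto simp: has_pd_def intro: has_derivative_at_withinI\<close>)

lemma real_cubic_zero:
  fixes c0 c1 c2 c3 :: real
  assumes "\<And>s. c0 + c1 * s + c2 * s ^ 2 + c3 * s ^ 3 = 0"
  shows "c0 = 0 \<and> c1 = 0 \<and> c2 = 0 \<and> c3 = 0"
  by (rule poly_cubic_zero[of 0 1 2 3]) (use assms in auto)

lemma real_quartic_zero:
  fixes c0 c1 c2 c3 c4 :: real
  assumes "\<And>s. c0 + c1 * s + c2 * s ^ 2 + c3 * s ^ 3 + c4 * s ^ 4 = 0"
  shows "c0 = 0 \<and> c1 = 0 \<and> c2 = 0 \<and> c3 = 0 \<and> c4 = 0"
proof -
  have "poly [:c0, c1, c2, c3, c4:] s = 0" for s using assms[of s] by (simp add: pow_simps)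
  then have "[:c0, c1, c2, c3, c4:] = 0" using poly_all_0_iff_0 by blast
  then show ?thesis by simp
qed

section \<open>The integral in normalized semi-geodesic coordinates\<close>

locale quartic_integral =
  fixes \<Gamma> :: "plane set" and \<rho> :: "plane \<Rightarrow> plane \<Rightarrow> plane \<Rightarrow> real" and F :: "plane \<times> plane \<Rightarrow> real"
    and \<Phi> :: "plane \<Rightarrow> plane" and g :: "plane \<Rightarrow> real" and a :: "nat \<Rightarrow> plane \<Rightarrow> real"
  assumes lattice: "is_lattice \<Gamma>" and rm: "riemannian_metric \<rho>" and pm: "periodic_metric \<Gamma> \<rho>"
    and hp: "hom_poly_on 4 UNIV F" and pF: "periodic_on \<Gamma> UNIV F" and fi: "first_integral_on \<rho> UNIV F"
    and nsg: "normalized_semigeodesic \<Gamma> \<rho> 4 F \<Phi> g a"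
begin

definition "t q = fst (\<Phi> q)"
definition "x q = snd (\<Phi> q)"
text \<open>\<open>tau\<close> and \<open>chi\<close> are the differentials dt and dx at
  \<open>q\<close>, and \<open>lift\<close> sends conjugate momenta \<open>(P1, P2)\<close> to the
  covector P1 dt + P2 dx.\<close>

definition "tau q v = fst v * d1 t q + snd v * d2 t q"
definition "chi q v = fst v * d1 x q + snd v * d2 x q"
definition "lift q P = (fst P * d1 t q + snd P * d1 x q, fst P * d2 t q + snd P * d2 x q)"
text \<open>The normalisation of the last two coefficients is built in: \<open>a 3 = g\<close>
  cancels the denominator, so \<open>P1 * P2^3\<close> has coefficient 1.\<close>

definition "ff y P = a 0 y * (fst P / g y) ^ 4 + a 1 y * (fst P / g y) ^ 3 * snd P +
  a 2 y * (fst P / g y) ^ 2 * snd P ^ 2 + fst P * snd P ^ 3 + snd P ^ 4"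
definition "hh y P = ((fst P / g y)\<^sup>2 + (snd P)\<^sup>2) / 2"

lemma \<Phi>_eq: "\<Phi> q = (t q, x q)" by (simp add: t_def x_def)

lemma bij_\<Phi>: "bij \<Phi>" and smooth_\<Phi>: "smooth_on UNIV \<Phi>" and smooth_g: "smooth_on UNIV g"
  and smooth_a: "k \<le> 4 \<Longrightarrow> smooth_on UNIV (a k)" and g_pos: "0 < g y" and a4: "a 4 y = 1"
  using nsg unfolding normalized_semigeodesic_def diffeo_plane_def by blast+

lemma a3: "a 3 = g"
proof
  fix y
  have "a (4 - 1) y = g y" using nsg unfolding normalized_semigeodesic_def by blast
  then show "a 3 y = g y" by simp
qed

lemma smooth_t: "smooth_on UNIV t" and smooth_x: "smooth_on UNIV x"
  unfolding t_def[abs_def] x_def[abs_def]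
  by (rule smooth_on_compose_linear[OF open_UNIV smooth_\<Phi> bounded_linear_fst]
      smooth_on_compose_linear[OF open_UNIV smooth_\<Phi> bounded_linear_snd])+

lemma pd_t: "has_pd t (d1 t q) (d2 t q) q" and pd_x: "has_pd x (d1 x q) (d2 x q) q"
  using smooth_has_pd[OF smooth_t] smooth_has_pd[OF smooth_x] by auto

lemma frechet_\<Phi>: "frechet_derivative \<Phi> (at q) = (\<lambda>v. (tau q v, chi q v))"
proof -
  have "((\<lambda>q. (t q, x q)) has_derivative (\<lambda>v. (fst v *\<^sub>R d1 t q + snd v *\<^sub>R d2 t q, fst v *\<^sub>R d1 x q + snd v *\<^sub>R d2 x q))) (at q)"
    using pd_t pd_x unfolding has_pd_def by (intro has_derivative_Pair)
  then have "(\<Phi> has_derivative (\<lambda>v. (tau q v, chi q v))) (at q)"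
    by (simp add: \<Phi>_eq[symmetric] tau_def chi_def)
  then show ?thesis by (rule frechet_derivative_at[symmetric])
qed

lemma adjoint_\<Phi>: "adjoint (frechet_derivative \<Phi> (at q)) = lift q"
  unfolding frechet_\<Phi>
  by (rule adjoint_unique) (simp add: inner_plane lift_def tau_def chi_def algebra_simps)

lemma metric_coords: "\<rho> q v w = (g (\<Phi> q))\<^sup>2 * tau q v * tau q w + chi q v * chi q w"
proof -
  have "\<forall>q v w. let d = frechet_derivative \<Phi> (at q) in
        \<rho> q v w = (g (\<Phi> q))\<^sup>2 * fst (d v) * fst (d w) + snd (d v) * snd (d w)"
    using nsg unfolding normalized_semigeodesic_def by blast
  then show ?thesis unfolding Let_def frechet_\<Phi> fst_conv snd_conv by blast
qed

lemma F_coords: "F (q, lift q P) = ff (\<Phi> q) P"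
proof -
  have "\<forall>q p1 p2. F (q, adjoint (frechet_derivative \<Phi> (at q)) (p1, p2)) =
        (\<Sum>k\<le>4. a k (\<Phi> q) * (p1 ^ (4 - k) / g (\<Phi> q) ^ (4 - k)) * p2 ^ k)"
    using nsg unfolding normalized_semigeodesic_def by blast
  then have "F (q, lift q (fst P, snd P)) = (\<Sum>k\<le>4. a k (\<Phi> q) * (fst P ^ (4 - k) / g (\<Phi> q) ^ (4 - k)) * snd P ^ k)"
    unfolding adjoint_\<Phi> by blast
  moreover have "{..4::nat} = {0, 1, 2, 3, 4}" by auto
  ultimately show ?thesis
    using g_pos[of "\<Phi> q"] by (simp add: ff_def a3 a4 power_divide)
qed

text \<open>A nonzero common kernel vector of dt and dx would have length zero in the
  metric.\<close>

lemma jacobian_nonzero: "d1 t q * d2 x q - d2 t q * d1 x q \<noteq> 0"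
proof
  assume 0: "d1 t q * d2 x q - d2 t q * d1 x q = 0"
  have ex: "\<exists>v::plane. v \<noteq> 0 \<and> tau q v = 0 \<and> chi q v = 0"
  proof (cases "d1 t q = 0 \<and> d2 t q = 0")
    case False
    then show ?thesis using 0
      by (intro exI[of _ "(d2 t q, - d1 t q)"]) (auto simp: tau_def chi_def zero_prod_def algebra_simps)
  next
    case True
    show ?thesis
    proof (cases "d1 x q = 0 \<and> d2 x q = 0")
      case False
      then show ?thesis using True
        by (intro exI[of _ "(d2 x q, - d1 x q)"]) (auto simp: tau_def chi_def zero_prod_def)
    next
      case True': True
      then show ?thesis using True
        by (intro exI[of _ "(1, 0)"]) (auto simp: tau_def chi_def zero_prod_def)
    qed
  qed
  then obtain v :: plane where "v \<noteq> 0" "tau q v = 0" "chi q v = 0" by blast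
  then show False using metric_pos[OF rm, of v q] by (simp add: metric_coords)
qed

lemma frame_vector:
  obtains v where "tau q v = A" "chi q v = B"
proof -
  define D where "D = d1 t q * d2 x q - d2 t q * d1 x q"
  have D: "D \<noteq> 0" unfolding D_def by (rule jacobian_nonzero)
  have "tau q ((A * d2 x q - B * d2 t q) / D, (B * d1 t q - A * d1 x q) / D) = A * D / D"
    "chi q ((A * d2 x q - B * d2 t q) / D, (B * d1 t q - A * d1 x q) / D) = B * D / D"
    unfolding tau_def chi_def fst_conv snd_conv times_divide_eq_left add_divide_distrib[symmetric]
    by (rule arg_cong[of _ _ "\<lambda>x. x / D"], simp add: D_def algebra_simps)+
  then show ?thesis using that D by simp
qed

lemma ham_coords: "hamiltonian \<rho> (q, lift q P) = hh (\<Phi> q) P"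
proof -
  define w where "w = sharp \<rho> q (lift q P)"
  have e: "\<rho> q w v = fst P * tau q v + snd P * chi q v" for v
    unfolding w_def sharp_metric[OF rm] by (simp add: inner_plane lift_def tau_def chi_def algebra_simps)
  obtain v1 where v1: "tau q v1 = 1" "chi q v1 = 0" by (rule frame_vector)
  obtain v2 where v2: "tau q v2 = 0" "chi q v2 = 1" by (rule frame_vector)
  have 1: "(g (\<Phi> q))\<^sup>2 * tau q w = fst P" using e[of v1] v1 by (simp add: metric_coords)
  have 2: "chi q w = snd P" using e[of v2] v2 by (simp add: metric_coords)
  have "hamiltonian \<rho> (q, lift q P) = (fst P * tau q w + snd P * chi q w) / 2"
    unfolding e[symmetric] by (simp add: hamiltonian_def w_def)
  also have "tau q w = fst P / (g (\<Phi> q))\<^sup>2" using 1 g_pos[of "\<Phi> q"] by (simp add: field_simps)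
  finally show ?thesis unfolding 2 by (simp add: hh_def power2_eq_square)
qed

lemma surj_point: obtains q where "\<Phi> q = y"
  using bij_\<Phi> by (metis bij_pointE)

text \<open>At \<open>P1 = g y\<close> the ratio \<open>P1 / g\<close> is 1 and everything becomes a
  polynomial in \<open>s = P2\<close>. In the position derivatives the momentum stays fixed while
  the denominator moves, whence the quotient \<open>g y / g z\<close>.\<close>

lemma ff_pd:
  fixes s :: real and y :: plane
  shows "has_pd (\<lambda>z. ff z (g y, s))
      (d1 (a 0) y - 4 * a 0 y * (d1 g y / g y) + (d1 (a 1) y - 3 * a 1 y * (d1 g y / g y)) * s + (d1 (a 2) y - 2 * a 2 y * (d1 g y / g y)) * s ^ 2)
      (d2 (a 0) y - 4 * a 0 y * (d2 g y / g y) + (d2 (a 1) y - 3 * a 1 y * (d2 g y / g y)) * s + (d2 (a 2) y - 2 * a 2 y * (d2 g y / g y)) * s ^ 2) y"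
    and "has_pd (ff y) (4 * a 0 y / g y + 3 * a 1 y / g y * s + 2 * a 2 y / g y * s ^ 2 + s ^ 3)
      (a 1 y + 2 * a 2 y * s + 3 * g y * s ^ 2 + 4 * s ^ 3) (g y, s)"
    and "has_pd (\<lambda>z. hh z (g y, s)) (- d1 g y / g y) (- d2 g y / g y) y"
    and "has_pd (hh y) (1 / g y) s (g y, s)"
proof -
  have g: "g y \<noteq> 0" using g_pos[of y] by simp
  note pa = smooth_has_pd[OF smooth_a[of 0] UNIV_I, of y] smooth_has_pd[OF smooth_a[of 1] UNIV_I, of y] smooth_has_pd[OF smooth_a[of 2] UNIV_I, of y]
  have r: "has_pd (\<lambda>z. g y / g z) (- d1 g y / g y) (- d2 g y / g y) y"
    by (rule has_pd_eq[OF has_pd_divide[OF has_pd_const smooth_has_pd[OF smooth_g UNIV_I] g]])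
       (use g in \<open>simp_all add: power2_eq_square\<close>)
  show "has_pd (\<lambda>z. ff z (g y, s))
      (d1 (a 0) y - 4 * a 0 y * (d1 g y / g y) + (d1 (a 1) y - 3 * a 1 y * (d1 g y / g y)) * s + (d1 (a 2) y - 2 * a 2 y * (d1 g y / g y)) * s ^ 2)
      (d2 (a 0) y - 4 * a 0 y * (d2 g y / g y) + (d2 (a 1) y - 3 * a 1 y * (d2 g y / g y)) * s + (d2 (a 2) y - 2 * a 2 y * (d2 g y / g y)) * s ^ 2) y"
    unfolding ff_def fst_conv snd_conv
    by (rule has_pd_eq[OF has_pd_add[OF has_pd_add[OF has_pd_add[OF has_pd_add[OF
          has_pd_mult[OF pa(1) has_pd_power[OF r]] has_pd_mult[OF has_pd_mult[OF pa(2) has_pd_power[OF r]] has_pd_const]]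
          has_pd_mult[OF has_pd_mult[OF pa(3) has_pd_power[OF r]] has_pd_const]] has_pd_const] has_pd_const]])
       (use g in \<open>simp_all add: algebra_simps\<close>)
  have P: "has_pd fst 1 0 (g y, s)" "has_pd snd 0 1 (g y, s)"
    unfolding has_pd_def by (auto intro!: derivative_eq_intros)
  have m: "has_pd (\<lambda>P. fst P / g y) (1 / g y) 0 (g y, s)"
    by (rule has_pd_eq[OF has_pd_divide[OF P(1) has_pd_const g]]) (use g in \<open>simp_all add: power2_eq_square\<close>)
  show "has_pd (ff y) (4 * a 0 y / g y + 3 * a 1 y / g y * s + 2 * a 2 y / g y * s ^ 2 + s ^ 3)
      (a 1 y + 2 * a 2 y * s + 3 * g y * s ^ 2 + 4 * s ^ 3) (g y, s)"
    unfolding ff_def[abs_def]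
    by (rule has_pd_eq[OF has_pd_add[OF has_pd_add[OF has_pd_add[OF has_pd_add[OF
          has_pd_mult[OF has_pd_const has_pd_power[OF m]]
          has_pd_mult[OF has_pd_mult[OF has_pd_const has_pd_power[OF m]] P(2)]]
          has_pd_mult[OF has_pd_mult[OF has_pd_const has_pd_power[OF m]] has_pd_power[OF P(2)]]]
          has_pd_mult[OF P(1) has_pd_power[OF P(2)]]] has_pd_power[OF P(2)]]])
       (use g in \<open>simp_all add: algebra_simps\<close>)
  show "has_pd (\<lambda>z. hh z (g y, s)) (- d1 g y / g y) (- d2 g y / g y) y"
    unfolding hh_def fst_conv snd_conv
    by (rule has_pd_eq[OF has_pd_divide[OF has_pd_add[OF has_pd_power[OF r] has_pd_const] has_pd_const[of 2]]])
       (use g in simp_all)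
  show "has_pd (hh y) (1 / g y) s (g y, s)"
    unfolding hh_def[abs_def]
    by (rule has_pd_eq[OF has_pd_divide[OF has_pd_add[OF has_pd_power[OF m] has_pd_power[OF P(2)]] has_pd_const[of 2]]])
       (use g in simp_all)
qed

text \<open>At momentum \<open>(g y, s)\<close> the vanishing bracket, multiplied by
  \<open>g\<close>, is a cubic in \<open>s\<close> whose four coefficients are the four equations.
  No higher powers occur because the coefficients of \<open>P1 * P2^3\<close> and
  \<open>P2^4\<close> are constant.\<close>

lemma hydro_equations:
  "d1 (a 0) y = - a 1 y * d2 g y"
  "d1 (a 1) y = - g y * d2 (a 0) y - (2 * a 2 y - 4 * a 0 y) * d2 g y"
  "d1 (a 2) y = - g y * d2 (a 1) y - (3 * g y - 3 * a 1 y) * d2 g y"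
  "d1 g y = - g y * d2 (a 2) y - (4 - 2 * a 2 y) * d2 g y"
proof -
  have g: "g y \<noteq> 0" using g_pos[of y] by simp
  obtain q where q: "\<Phi> q = y" by (rule surj_point)
  then have q': "(t q, x q) = y" by (simp add: \<Phi>_eq[symmetric])
  have "(d1 (a 0) y + a 1 y * d2 g y) + (d1 (a 1) y + g y * d2 (a 0) y + (2 * a 2 y - 4 * a 0 y) * d2 g y) * s +
     (d1 (a 2) y + g y * d2 (a 1) y + (3 * g y - 3 * a 1 y) * d2 g y) * s ^ 2 +
     (d1 g y + g y * d2 (a 2) y + (4 - 2 * a 2 y) * d2 g y) * s ^ 3 = 0" for s
  proof -
    have dF: "F differentiable (at z)" for z
      using fi unfolding first_integral_on_def by (auto intro: smooth_on_differentiable)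
    have dH: "hamiltonian \<rho> differentiable (at z)" for z
      by (rule smooth_on_differentiable[OF hamiltonian_smooth[OF rm] UNIV_I])
    have eF: "F (q, (P1 * d1 t q + P2 * d1 x q, P1 * d2 t q + P2 * d2 x q)) = ff (t q, x q) (P1, P2)" for q P1 P2
      using F_coords[of q "(P1, P2)"] by (simp add: lift_def \<Phi>_eq)
    have eH: "hamiltonian \<rho> (q, (P1 * d1 t q + P2 * d1 x q, P1 * d2 t q + P2 * d2 x q)) = hh (t q, x q) (P1, P2)" for q P1 P2
      using ham_coords[of q "(P1, P2)"] by (simp add: lift_def \<Phi>_eq)
    note pds = ff_pd[of y s, folded q']
    note cF = cotangent_lift_derivatives[OF smooth_t smooth_x dF eF pds(1,2)]
    note cH = cotangent_lift_derivatives[OF smooth_t smooth_x dH eH pds(3,4)]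
    have "poisson F (hamiltonian \<rho>) (q, (g y * d1 t q + s * d1 x q, g y * d2 t q + s * d2 x q)) = 0"
      using fi unfolding first_integral_on_def by blast
    then have "(d1 (a 0) y - 4 * a 0 y * (d1 g y / g y) + (d1 (a 1) y - 3 * a 1 y * (d1 g y / g y)) * s + (d1 (a 2) y - 2 * a 2 y * (d1 g y / g y)) * s ^ 2) * (1 / g y)
      + (d2 (a 0) y - 4 * a 0 y * (d2 g y / g y) + (d2 (a 1) y - 3 * a 1 y * (d2 g y / g y)) * s + (d2 (a 2) y - 2 * a 2 y * (d2 g y / g y)) * s ^ 2) * s
      - (- d1 g y / g y) * (4 * a 0 y / g y + 3 * a 1 y / g y * s + 2 * a 2 y / g y * s ^ 2 + s ^ 3)
      - (- d2 g y / g y) * (a 1 y + 2 * a 2 y * s + 3 * g y * s ^ 2 + 4 * s ^ 3) = 0" (is "?lhs = 0")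
      unfolding poisson_plane using symplectic_cancellation[OF cF cH] by (simp add: q')
    then have "g y * ?lhs = 0" by simp
    also have "g y * ?lhs = (d1 (a 0) y + a 1 y * d2 g y) + (d1 (a 1) y + g y * d2 (a 0) y + (2 * a 2 y - 4 * a 0 y) * d2 g y) * s +
     (d1 (a 2) y + g y * d2 (a 1) y + (3 * g y - 3 * a 1 y) * d2 g y) * s ^ 2 +
     (d1 g y + g y * d2 (a 2) y + (4 - 2 * a 2 y) * d2 g y) * s ^ 3"
      using g by (simp add: field_simps power2_eq_square power3_eq_cube)
    finally show ?thesis .
  qed
  from real_cubic_zero[OF this]
  show "d1 (a 0) y = - a 1 y * d2 g y"
  "d1 (a 1) y = - g y * d2 (a 0) y - (2 * a 2 y - 4 * a 0 y) * d2 g y"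
  "d1 (a 2) y = - g y * d2 (a 1) y - (3 * g y - 3 * a 1 y) * d2 g y"
  "d1 g y = - g y * d2 (a 2) y - (4 - 2 * a 2 y) * d2 g y"
    by simp_all
qed

lemma F_homogeneous: "F (q, c *\<^sub>R p) = c ^ 4 * F (q, p)"
proof -
  obtain c' where c': "\<And>q p1 p2. F (q, (p1, p2)) = (\<Sum>k\<le>4. c' k q * p1 ^ (4 - k) * p2 ^ k)"
    using hp unfolding hom_poly_on_def by blast
  have "F (q, (c * fst p, c * snd p)) = c ^ 4 * F (q, (fst p, snd p))"
    unfolding c' sum_distrib_left
  proof (rule sum.cong)
    fix k :: nat assume "k \<in> {..4}"
    then have "c ^ 4 = c ^ (4 - k) * c ^ k" by (simp add: power_add[symmetric])
    then show "c' k q * (c * fst p) ^ (4 - k) * (c * snd p) ^ k = c ^ 4 * (c' k q * fst p ^ (4 - k) * snd p ^ k)"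
      by (simp add: power_mult_distrib)
  qed simp
  moreover have "(c * fst p, c * snd p) = c *\<^sub>R p" by (simp add: prod_eq_iff)
  ultimately show ?thesis by simp
qed

text \<open>The Liouville torus is the graph of a multiple of \<open>dx\<close>, so translations preserve the coframe
  \<open>(g dt, dx)\<close> up to signs; the normalization \<open>a\<^sub>3 = g > 0\<close> couples the two signs.\<close>

lemma translation_signs:
  assumes \<gamma>: "\<gamma> \<in> \<Gamma>"
  obtains \<epsilon> :: real where "\<epsilon> = 1 \<or> \<epsilon> = - 1"
    "\<And>v. tau (q + \<gamma>) v = \<epsilon> * tau q v" "\<And>v. chi (q + \<gamma>) v = \<epsilon> * chi q v"
    "g (\<Phi> (q + \<gamma>)) = g (\<Phi> q)" "a 0 (\<Phi> (q + \<gamma>)) = a 0 (\<Phi> q)" "a 1 (\<Phi> (q + \<gamma>)) = a 1 (\<Phi> q)" "a 2 (\<Phi> (q + \<gamma>)) = a 2 (\<Phi> q)"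
proof -
  obtain \<xi> where lg: "liouville_graph \<Gamma> \<rho> F \<xi>"
    and dir: "\<And>q. fst (frechet_derivative \<Phi> (at q) (sharp \<rho> q (\<xi> q))) = 0"
    using nsg unfolding normalized_semigeodesic_def by blast
  obtain h where h: "\<And>q. hamiltonian \<rho> (q, \<xi> q) = h" using lg unfolding liouville_graph_def by blast
  define q' where "q' = q + \<gamma>"
  define w where "w = sharp \<rho> q (\<xi> q)"
  have \<rho>': "\<rho> q' = \<rho> q" using pm \<gamma> unfolding periodic_metric_def q'_def by blast
  have \<xi>': "\<xi> q' = \<xi> q" using lg \<gamma> unfolding liouville_graph_def q'_def by blast
  have w': "sharp \<rho> q' (\<xi> q') = w" by (simp add: sharp_def \<rho>' \<xi>' w_def)
  have w2: "sharp \<rho> q' (\<xi> q) = w" using w' by (simp only: \<xi>')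
  have tw: "tau q w = 0" "tau q' w = 0" using dir[of q] dir[of q'] unfolding frechet_\<Phi> w' by (simp_all add: w_def)
  \<comment> \<open>Since dt vanishes on the velocity \<open>w\<close>, the covector
    \<open>\<xi> q\<close> is a multiple of dx taken at \<open>q\<close> and also of dx taken at
    \<open>q'\<close>; this compares the two values of dx.\<close>
  have inn: "inner (\<xi> q) v = chi q w * chi q v" "inner (\<xi> q) v = chi q' w * chi q' v" for v
    using sharp_metric[OF rm, of q "\<xi> q" v] sharp_metric[OF rm, of q' "\<xi> q" v] tw
    by (simp_all add: w_def[symmetric] w2 metric_coords)
  have hc: "2 * h = (chi q w)\<^sup>2" "2 * h = (chi q' w)\<^sup>2"
    using h[of q] h[of q'] tw unfolding hamiltonian_def \<xi>'
    by (simp_all add: w_def[symmetric] w2 metric_coords power2_eq_square)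
  \<comment> \<open>Zero energy would put the torus on the zero section, where the differential of a
    quartic form vanishes, against regularity.\<close>
  have h0: "h \<noteq> 0"
  proof
    assume "h = 0"
    then have "inner (\<xi> q) (\<xi> q) = 0" using inn(1) hc(1) by simp
    then have \<xi>0: "\<xi> q = 0" by simp
    have "frechet_derivative F (at (q, 0)) z = 0" for z
    proof (rule homogeneous_derivative_zero[where n = 4 and S = UNIV])
      show "F differentiable at (q, 0)"
        using fi unfolding first_integral_on_def by (auto intro: smooth_on_differentiable)
    qed (auto simp: F_homogeneous)
    then have "\<forall>z. 1 * frechet_derivative F (at (q, \<xi> q)) z + 0 * frechet_derivative (hamiltonian \<rho>) (at (q, \<xi> q)) z = 0"
      by (simp add: \<xi>0)
    then have "(1::real) = 0 \<and> (0::real) = 0" using lg unfolding liouville_graph_def by blast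
    then show False by simp
  qed
  define \<epsilon> where "\<epsilon> = chi q w / chi q' w"
  have c0: "chi q w \<noteq> 0" "chi q' w \<noteq> 0" using h0 hc by auto
  have "(chi q w)\<^sup>2 = (chi q' w)\<^sup>2" using hc by simp
  then have "\<epsilon>\<^sup>2 = 1" using c0 by (simp add: \<epsilon>_def power_divide)
  then have \<epsilon>: "\<epsilon> = 1 \<or> \<epsilon> = - 1" by (simp add: power2_eq_1_iff)
  have chi': "chi q' v = \<epsilon> * chi q v" for v
  proof -
    have "chi q' w * chi q' v = chi q w * chi q v" using inn by metis
    then show ?thesis using c0 by (simp add: \<epsilon>_def field_simps)
  qed
  define G G' where "G = g (\<Phi> q)" and "G' = g (\<Phi> q')"
  have Gp: "G > 0" "G' > 0" by (simp_all add: G_def G'_def g_pos)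
  have tt: "G'\<^sup>2 * tau q' v * tau q' v' = G\<^sup>2 * tau q v * tau q v'" for v v'
  proof -
    have "\<rho> q' v v' = \<rho> q v v'" by (simp add: \<rho>')
    moreover have "chi q' v * chi q' v' = (\<epsilon> * \<epsilon>) * (chi q v * chi q v')" unfolding chi' by (simp add: mult_ac)
    moreover have "\<epsilon> * \<epsilon> = 1" using \<epsilon> by auto
    ultimately show ?thesis unfolding metric_coords G_def G'_def by simp
  qed
  obtain v1 where v1: "tau q v1 = 1" "chi q v1 = 0" by (rule frame_vector)
  define k where "k = G' * tau q' v1"
  have k2: "k\<^sup>2 = G\<^sup>2" using tt[of v1 v1] v1 by (simp add: k_def power2_eq_square mult_ac)
  define \<epsilon>' where "\<epsilon>' = k / G"
  have "\<epsilon>'\<^sup>2 = 1" using k2 Gp by (simp add: \<epsilon>'_def power_divide)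
  then have \<epsilon>': "\<epsilon>' = 1 \<or> \<epsilon>' = - 1" by (simp add: power2_eq_1_iff)
  have tau': "G' * tau q' v = \<epsilon>' * (G * tau q v)" for v
  proof -
    have "(G' * tau q' v) * k = G\<^sup>2 * tau q v" using tt[of v v1] v1 by (simp add: k_def power2_eq_square mult_ac)
    also have "\<dots> = (k * tau q v) * k" unfolding k2[symmetric] by (simp add: power2_eq_square mult_ac)
    finally have "G' * tau q' v = k * tau q v" using k2 Gp by auto
    then show ?thesis using Gp by (simp add: \<epsilon>'_def)
  qed
  have lift_eq: "lift q P = (fst P * tau q (1,0) + snd P * chi q (1,0), fst P * tau q (0,1) + snd P * chi q (0,1))" for q P
    by (simp add: lift_def tau_def chi_def)
  \<comment> \<open>The same covector has momenta \<open>(G, s)\<close> at \<open>q\<close> and the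
    sign-changed momenta at \<open>q'\<close>. Comparing the quartic in both descriptions gives a
    polynomial identity in \<open>s\<close>.\<close>
  have "(a 0 (\<Phi> q') - a 0 (\<Phi> q)) + (\<epsilon>' * \<epsilon> * a 1 (\<Phi> q') - a 1 (\<Phi> q)) * s + (a 2 (\<Phi> q') - a 2 (\<Phi> q)) * s ^ 2
      + (\<epsilon>' * \<epsilon> * G' - G) * s ^ 3 = 0" for s
  proof -
    have e2: "\<epsilon> ^ 2 = 1" "\<epsilon>' ^ 2 = 1" "\<epsilon>' ^ 3 = \<epsilon>'" "\<epsilon> ^ 3 = \<epsilon>" "\<epsilon> ^ 4 = 1" "\<epsilon>' ^ 4 = 1" using \<epsilon> \<epsilon>' by auto
    have "\<epsilon>' * G' * tau q' v + \<epsilon> * s * chi q' v = G * tau q v + s * chi q v" for v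
    proof -
      have "\<epsilon>' * G' * tau q' v = (\<epsilon>' * \<epsilon>') * (G * tau q v)" using tau'[of v] by (simp add: mult.assoc)
      moreover have "\<epsilon> * s * chi q' v = (\<epsilon> * \<epsilon>) * (s * chi q v)" unfolding chi' by (simp add: mult_ac)
      moreover have "\<epsilon>' * \<epsilon>' = 1" "\<epsilon> * \<epsilon> = 1" using \<epsilon> \<epsilon>' by auto
      ultimately show ?thesis by simp
    qed
    then have "lift q' (\<epsilon>' * G', \<epsilon> * s) = lift q (G, s)" unfolding lift_eq by simp
    moreover have "F (q', p) = F (q, p)" for p using pF \<gamma> unfolding periodic_on_def q'_def by blast
    ultimately have "ff (\<Phi> q') (\<epsilon>' * G', \<epsilon> * s) = ff (\<Phi> q) (G, s)" using F_coords by metis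
    moreover have "\<epsilon>' * G' / G' = \<epsilon>'" "G / G = 1" using Gp by simp_all
    ultimately show ?thesis
      unfolding ff_def fst_conv snd_conv G_def[symmetric] G'_def[symmetric]
      by (simp add: e2 power_mult_distrib algebra_simps)
  qed
  from real_cubic_zero[OF this]
  have c: "a 0 (\<Phi> q') = a 0 (\<Phi> q)" "\<epsilon>' * \<epsilon> * a 1 (\<Phi> q') = a 1 (\<Phi> q)" "a 2 (\<Phi> q') = a 2 (\<Phi> q)" "\<epsilon>' * \<epsilon> * G' = G" by simp_all
  have ee: "\<epsilon>' * \<epsilon> = 1"
  proof (rule ccontr)
    assume "\<epsilon>' * \<epsilon> \<noteq> 1"
    then have "\<epsilon>' * \<epsilon> = - 1" using \<epsilon> \<epsilon>' by auto
    then have "- G' = G" using c(4) by simp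
    then show False using Gp by simp
  qed
  then have "\<epsilon>' = \<epsilon>" using \<epsilon> \<epsilon>' by auto
  moreover have GG: "G' = G" using c(4) ee by simp
  ultimately have "tau q' v = \<epsilon> * tau q v" for v using tau'[of v] Gp by simp
  then show ?thesis
    using that[of \<epsilon>] \<epsilon> chi' c ee GG unfolding q'_def G_def G'_def by simp
qed

text \<open>The sign is constant in \<open>q\<close>, because the continuous nonvanishing function
  \<open>N\<close> carries it. A sign -1 would turn the lattice translation into a point reflection
  in the coordinates; its centre \<open>q0\<close> would be fixed, and there \<open>N\<close> is
  positive.\<close>

lemma translation:
  assumes \<gamma>: "\<gamma> \<in> \<Gamma>"
  obtains c where "\<And>q. \<Phi> (q + \<gamma>) = \<Phi> q + c"
proof -
  define N where "N = (\<lambda>q. d1 t (q + \<gamma>) * d1 t q + d2 t (q + \<gamma>) * d2 t q)"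
  have contN: "continuous_on UNIV N"
    unfolding N_def using smooth_t
    by (intro continuous_intros continuous_on_compose2[OF smooth_on_continuous[OF smooth_d1]]
        continuous_on_compose2[OF smooth_on_continuous[OF smooth_d2]] smooth_on_continuous smooth_d1 smooth_d2) auto
  have sgn: "\<exists>\<epsilon>. (\<epsilon> = 1 \<and> N q > 0 \<or> \<epsilon> = - 1 \<and> N q < 0) \<and> d1 t (q + \<gamma>) = \<epsilon> * d1 t q \<and> d2 t (q + \<gamma>) = \<epsilon> * d2 t q \<and>
     d1 x (q + \<gamma>) = \<epsilon> * d1 x q \<and> d2 x (q + \<gamma>) = \<epsilon> * d2 x q" for q
  proof -
    obtain \<epsilon> :: real where \<epsilon>: "\<epsilon> = 1 \<or> \<epsilon> = - 1" and tc: "\<And>v. tau (q + \<gamma>) v = \<epsilon> * tau q v" "\<And>v. chi (q + \<gamma>) v = \<epsilon> * chi q v"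
    proof (rule translation_signs[OF \<gamma>, of q])
      fix \<epsilon> :: real
      assume "\<epsilon> = 1 \<or> \<epsilon> = - 1" "\<And>v. tau (q + \<gamma>) v = \<epsilon> * tau q v" "\<And>v. chi (q + \<gamma>) v = \<epsilon> * chi q v"
      then show ?thesis by (rule that)
    qed
    have d: "d1 t (q + \<gamma>) = \<epsilon> * d1 t q" "d2 t (q + \<gamma>) = \<epsilon> * d2 t q" "d1 x (q + \<gamma>) = \<epsilon> * d1 x q" "d2 x (q + \<gamma>) = \<epsilon> * d2 x q"
      using tc(1)[of "(1,0)"] tc(1)[of "(0,1)"] tc(2)[of "(1,0)"] tc(2)[of "(0,1)"] by (simp_all add: tau_def chi_def)
    have "d1 t q \<noteq> 0 \<or> d2 t q \<noteq> 0" using jacobian_nonzero[of q] by auto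
    then have "(d1 t q)\<^sup>2 + (d2 t q)\<^sup>2 > 0" by (simp add: sum_power2_gt_zero_iff)
    moreover have "N q = \<epsilon> * ((d1 t q)\<^sup>2 + (d2 t q)\<^sup>2)" unfolding N_def d by (simp add: distrib_left power2_eq_square)
    ultimately have "\<epsilon> = 1 \<and> N q > 0 \<or> \<epsilon> = - 1 \<and> N q < 0" using \<epsilon> by auto
    then show ?thesis using d by blast
  qed
  have sum_pd: "has_pd (\<lambda>q. f (q + \<gamma>) - e * f q) (d1 f (q + \<gamma>) - e * d1 f q) (d2 f (q + \<gamma>) - e * d2 f q) q"
    if "smooth_on UNIV f" for f and e :: real and q
  proof -
    have "((\<lambda>q. q + \<gamma>) has_derivative (\<lambda>h. h)) (at q)" by (auto intro!: derivative_eq_intros)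
    from has_derivative_compose[OF this smooth_has_pd[OF that UNIV_I, unfolded has_pd_def]]
    have "has_pd (\<lambda>q. f (q + \<gamma>)) (d1 f (q + \<gamma>)) (d2 f (q + \<gamma>)) q" by (simp add: has_pd_def)
    from has_pd_diff[OF this has_pd_mult[OF has_pd_const[of e] smooth_has_pd[OF that UNIV_I]]]
    show ?thesis by simp
  qed
  have op: "open {q. N q > 0}" "open {q. N q < 0}"
    by (intro open_Collect_less contN continuous_intros)+
  have di: "{q. N q > 0} \<inter> {q. N q < 0} \<inter> UNIV = {}" by (rule equals0I) (auto dest: less_asym)
  have un: "UNIV \<subseteq> {q. N q > 0} \<union> {q. N q < 0}"
  proof
    fix q show "q \<in> {q. N q > 0} \<union> {q. N q < 0}" using sgn[of q] by auto
  qed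
  have "{q. N q > 0} = {} \<or> {q. N q < 0} = {}"
    using connectedD[OF connected_UNIV op di un] by (simp only: Int_UNIV_right)
  then show ?thesis
  proof
    assume "{q. N q < 0} = {}"
    then have np: "\<not> N q < 0" for q by blast
    have e1: "d1 t (q + \<gamma>) = d1 t q" "d2 t (q + \<gamma>) = d2 t q" "d1 x (q + \<gamma>) = d1 x q" "d2 x (q + \<gamma>) = d2 x q" for q
      using sgn[of q] np[of q] by auto
    have "has_pd (\<lambda>q. t (q + \<gamma>) - 1 * t q) 0 0 q" "has_pd (\<lambda>q. x (q + \<gamma>) - 1 * x q) 0 0 q" for q
      using sum_pd[OF smooth_t, of 1 q] sum_pd[OF smooth_x, of 1 q] e1 by simp_all
    note c = zero_pd_constant[OF this(1), of _ 0] zero_pd_constant[OF this(2), of _ 0]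
    show ?thesis
    proof (rule that[of "(t (0 + \<gamma>) - t 0, x (0 + \<gamma>) - x 0)"])
      fix q show "\<Phi> (q + \<gamma>) = \<Phi> q + (t (0 + \<gamma>) - t 0, x (0 + \<gamma>) - x 0)"
        using c[of q] by (simp add: \<Phi>_eq)
    qed
  next
    assume "{q. N q > 0} = {}"
    then have neg: "\<not> N q > 0" for q by blast
    have e1: "d1 t (q + \<gamma>) = - d1 t q" "d2 t (q + \<gamma>) = - d2 t q" "d1 x (q + \<gamma>) = - d1 x q" "d2 x (q + \<gamma>) = - d2 x q"
for q
      using sgn[of q] neg[of q] by auto
    have "has_pd (\<lambda>q. t (q + \<gamma>) - (- 1) * t q) 0 0 q" "has_pd (\<lambda>q. x (q + \<gamma>) - (- 1) * x q) 0 0 q" for q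
      using sum_pd[OF smooth_t, of "- 1" q] sum_pd[OF smooth_x, of "- 1" q] e1 by simp_all
    note c = zero_pd_constant[OF this(1), of _ 0] zero_pd_constant[OF this(2), of _ 0]
    obtain q0 where q0: "\<Phi> q0 = ((t (0 + \<gamma>) + t 0) / 2, (x (0 + \<gamma>) + x 0) / 2)" by (rule surj_point)
    have "\<Phi> (q0 + \<gamma>) = \<Phi> q0"
      using c[of q0] q0 by (simp add: \<Phi>_eq)
    then have "q0 + \<gamma> = q0" using bij_\<Phi> by (metis bij_is_inj injD)
    then have "N q0 = (d1 t q0)\<^sup>2 + (d2 t q0)\<^sup>2" by (simp add: N_def power2_eq_square)
    moreover have "d1 t q0 \<noteq> 0 \<or> d2 t q0 \<noteq> 0" using jacobian_nonzero[of q0] by auto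
    ultimately show ?thesis using neg[of q0] by (simp add: sum_power2_gt_zero_iff)
  qed
qed

lemma lattice_basis:
  obtains u v where "u \<in> \<Gamma>" "v \<in> \<Gamma>" "fst u * snd v - snd u * fst v \<noteq> 0"
proof -
  obtain u v where uv: "u \<noteq> v" "independent {u, v}" "\<Gamma> = {of_int m *\<^sub>R u + of_int n *\<^sub>R v |m n. True}"
    using lattice unfolding is_lattice_def by blast
  have "u \<in> \<Gamma>" unfolding uv(3) by (rule CollectI) (intro exI[of _ 1] exI[of _ 0], simp)
  moreover have "v \<in> \<Gamma>" unfolding uv(3) by (rule CollectI) (intro exI[of _ 0] exI[of _ 1], simp)
  moreover have "fst u * snd v - snd u * fst v \<noteq> 0"
  proof
    assume 0: "fst u * snd v - snd u * fst v = 0"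
    have dep: "r = 0 \<and> s = 0" if "r *\<^sub>R u + s *\<^sub>R v = 0" for r s
    proof -
      have "\<forall>X\<subseteq>{u, v}. finite X \<longrightarrow> (\<forall>f. (\<Sum>z\<in>X. f z *\<^sub>R z) = 0 \<longrightarrow> (\<forall>z\<in>X. f z = 0))"
        using uv(2) unfolding independent_explicit_finite_subsets by blast
      note ind = this[rule_format, of "{u, v}" "\<lambda>z. if z = u then r else s"]
      have "(\<Sum>z\<in>{u, v}. (if z = u then r else s) *\<^sub>R z) = 0" using uv(1) that by simp
      then show ?thesis using ind[of u] ind[of v] uv(1) by simp
    qed
    have "fst v *\<^sub>R u + (- fst u) *\<^sub>R v = 0" "snd v *\<^sub>R u + (- snd u) *\<^sub>R v = 0"
      using 0 by (simp_all add: prod_eq_iff algebra_simps)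
    from dep[OF this(1)] dep[OF this(2)] have "u = 0" by (simp add: prod_eq_iff)
    then show False using dep[of 1 0] by simp
  qed
  ultimately show ?thesis by (rule that)
qed

lemma coeffs_periodic:
  assumes "\<gamma> \<in> \<Gamma>"
  shows "g (\<Phi> (q + \<gamma>)) = g (\<Phi> q)" "a 0 (\<Phi> (q + \<gamma>)) = a 0 (\<Phi> q)" "a 1 (\<Phi> (q + \<gamma>)) = a 1 (\<Phi> q)" "a 2 (\<Phi> (q + \<gamma>)) = a 2 (\<Phi> q)"
  by (rule translation_signs[OF assms, of q], assumption)+

text \<open>The main point is that the two coordinate periods are independent. Were they parallel,
  the linear function of \<Phi> annihilating their direction would be lattice periodic, hence
  bounded, although \<Phi> is onto the plane.\<close>

lemma hydro:
  obtains u v where "hydro_system (a 0) (a 1) (a 2) g u v"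
proof -
  obtain u v where uv: "u \<in> \<Gamma>" "v \<in> \<Gamma>" "fst u * snd v - snd u * fst v \<noteq> 0" by (rule lattice_basis)
  obtain cu where cu: "\<And>q. \<Phi> (q + u) = \<Phi> q + cu" using translation[OF uv(1)] by blast
  obtain cv where cv: "\<And>q. \<Phi> (q + v) = \<Phi> q + cv" using translation[OF uv(2)] by blast
  have per: "f (y + cu) = f y" if "\<And>q. f (\<Phi> (q + u)) = f (\<Phi> q)" for f :: "plane \<Rightarrow> real" and y
  proof -
    obtain q where "\<Phi> q = y" by (rule surj_point)
    then show ?thesis using that[of q] cu[of q] by simp
  qed
  have per': "f (y + cv) = f y" if "\<And>q. f (\<Phi> (q + v)) = f (\<Phi> q)" for f :: "plane \<Rightarrow> real" and y
  proof -
    obtain q where "\<Phi> q = y" by (rule surj_point)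
    then show ?thesis using that[of q] cv[of q] by simp
  qed
  have "hydro_system (a 0) (a 1) (a 2) g cu cv"
  proof
    show "fst cu * snd cv - snd cu * fst cv \<noteq> 0"
    proof
      assume 0: "fst cu * snd cv - snd cu * fst cv = 0"
      have "cu \<noteq> 0"
      proof
        assume "cu = 0"
        then have "\<Phi> (0 + u) = \<Phi> 0" using cu[of 0] by simp
        then have "u = 0" using bij_\<Phi> by (metis add_0 bij_is_inj injD)
        then show False using uv(3) by simp
      qed
      define f where "f = (\<lambda>q. fst cu * snd (\<Phi> q) - snd cu * fst (\<Phi> q))"
      have fp: "f (q + u) = f q" "f (q + v) = f q" for q
        using 0 by (simp_all add: f_def cu cv algebra_simps)
      have contf: "continuous_on UNIV f" unfolding f_def
        by (intro continuous_intros smooth_on_continuous[OF smooth_\<Phi>])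
      have "compact ((\<lambda>p. fst p *\<^sub>R u + snd p *\<^sub>R v) ` ({0..1::real} \<times> {0..1::real}))"
        by (intro compact_continuous_image continuous_intros compact_Times) auto
      then have "compact (f ` (\<lambda>p. fst p *\<^sub>R u + snd p *\<^sub>R v) ` ({0..1} \<times> {0..1}))"
        by (rule compact_continuous_image[OF continuous_on_subset[OF contf subset_UNIV]])
      from compact_imp_bounded[OF this] obtain K
        where "\<forall>y\<in>f ` (\<lambda>p. fst p *\<^sub>R u + snd p *\<^sub>R v) ` ({0..1} \<times> {0..1}). norm y \<le> K"
        unfolding bounded_iff by blast
      then have K: "\<bar>f (fst p *\<^sub>R u + snd p *\<^sub>R v)\<bar> \<le> K" if "p \<in> {0..1} \<times> {0..1}" for p
        using that unfolding real_norm_def by blast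
      have fK: "\<bar>f q\<bar> \<le> K" for q
      proof -
        obtain p m n where p: "p \<in> {0..1} \<times> {0..1}"
          and q: "q = ((fst p *\<^sub>R u + snd p *\<^sub>R v) + of_int m *\<^sub>R u) + of_int n *\<^sub>R v"
          by (rule plane_representative[OF uv(3)])
        have "f q = f (fst p *\<^sub>R u + snd p *\<^sub>R v)"
          unfolding q periodic_int[of f v, OF fp(2)] periodic_int[of f u, OF fp(1)] ..
        then show ?thesis using K[OF p] by simp
      qed
      define l where "l = (fst cu)\<^sup>2 + (snd cu)\<^sup>2"
      have l: "l > 0" using \<open>cu \<noteq> 0\<close> by (auto simp: l_def sum_power2_gt_zero_iff prod_eq_iff)
      define k where "k = (\<bar>K\<bar> + 1) / l"
      obtain q where q: "\<Phi> q = (- snd cu * k, fst cu * k)" by (rule surj_point)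
      have "f q = l * k" unfolding f_def q l_def
        by (simp add: algebra_simps power2_eq_square)
      then have "f q = \<bar>K\<bar> + 1" using l by (simp add: k_def)
      then show False using fK[of q] by simp
    qed
  qed (use smooth_a smooth_g g_pos hydro_equations per per' coeffs_periodic[OF uv(1)] coeffs_periodic[OF uv(2)] in simp_all)
  then show ?thesis by (rule that)
qed

end

section \<open>Elliptic regions\<close>

text \<open>A nonreal root persists inside the disc of radius \<open>\<bar>Im z\<bar>\<close> about
  it, and that open disc misses the real axis.\<close>

lemma (in hydro_system) open_elliptic: "open {y. \<exists>z. Im z \<noteq> 0 \<and> PP y z = 0}"
  unfolding open_contains_ball
proof
  fix y assume "y \<in> {y. \<exists>z. Im z \<noteq> 0 \<and> PP y z = 0}"
  then obtain z where z: "Im z \<noteq> 0" "PP y z = 0" by blast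
  obtain d where d: "d > 0" "\<And>y'. y' \<in> ball y d \<Longrightarrow> \<exists>w\<in>ball z \<bar>Im z\<bar>. PP y' w = 0"
    using root_persists[OF z(2), of "\<bar>Im z\<bar>"] z(1) by auto
  have "\<exists>w. Im w \<noteq> 0 \<and> PP y' w = 0" if y': "y' \<in> ball y d" for y'
  proof -
    obtain w where w: "cmod (z - w) < \<bar>Im z\<bar>" "PP y' w = 0" using d(2)[OF y'] by (auto simp: dist_norm)
    have "\<bar>Im z - Im w\<bar> < \<bar>Im z\<bar>" using abs_Im_le_cmod[of "z - w"] w(1) by simp
    then have "Im w \<noteq> 0" by auto
    then show ?thesis using w by blast
  qed
  then show "\<exists>e>0. ball y e \<subseteq> {y. \<exists>z. Im z \<noteq> 0 \<and> PP y z = 0}" using d(1) by blast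
qed

text \<open>Solving from the lowest coefficient upwards expresses the quotient through smooth data;
  a factorisation found separately at each point thereby depends smoothly on the point.\<close>

lemma quartic_division:
  fixes c0 c1 c2 c3 c4 E B G \<alpha> \<beta> \<gamma> :: real
  assumes E: "E \<noteq> 0"
    and eq: "\<And>s. c0 + c1 * s + c2 * s ^ 2 + c3 * s ^ 3 + c4 * s ^ 4 = (E + 2 * B * s + G * s ^ 2) * (\<alpha> + \<beta> * s + \<gamma> * s ^ 2)"
  shows "\<alpha> = c0 / E" "\<beta> = (c1 - 2 * B * (c0 / E)) / E"
    "\<gamma> = (c2 - 2 * B * ((c1 - 2 * B * (c0 / E)) / E) - G * (c0 / E)) / E"
proof -
  have "(c0 - E * \<alpha>) + (c1 - (E * \<beta> + 2 * B * \<alpha>)) * s + (c2 - (E * \<gamma> + 2 * B * \<beta> + G * \<alpha>)) * s ^ 2 +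
     (c3 - (2 * B * \<gamma> + G * \<beta>)) * s ^ 3 + (c4 - G * \<gamma>) * s ^ 4 = 0" for s
    using eq[of s] by (simp add: pow_simps)
  from real_quartic_zero[OF this]
  have c: "c0 = E * \<alpha>" "c1 = E * \<beta> + 2 * B * \<alpha>" "c2 = E * \<gamma> + 2 * B * \<beta> + G * \<alpha>" by simp_all
  show 1: "\<alpha> = c0 / E" using E by (simp add: c)
  show 2: "\<beta> = (c1 - 2 * B * (c0 / E)) / E" unfolding 1[symmetric] c(2) using E by simp
  show "\<gamma> = (c2 - 2 * B * ((c1 - 2 * B * (c0 / E)) / E) - G * (c0 / E)) / E"
    unfolding 2[symmetric] unfolding 1[symmetric] c(3) using E by simp
qed

text \<open>The analogue of \<open>quartic_division\<close> for square roots. The condition \<alpha>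
  > 0 fixes the sign, so the coefficients of the root become smooth functions of the given
  ones.\<close>

lemma quartic_square_root:
  fixes c0 c1 c2 c3 c4 E B G \<alpha> \<beta> \<gamma> c :: real
  assumes c: "c \<noteq> 1" and \<alpha>: "\<alpha> > 0"
    and eq: "\<And>s. c0 + c1 * s + c2 * s ^ 2 + c3 * s ^ 3 + c4 * s ^ 4 - c * (E + 2 * B * s + G * s ^ 2) ^ 2 = (1 - c) * (\<alpha> + \<beta> * s + \<gamma> * s ^ 2) ^ 2"
  shows "(c0 - c * E ^ 2) / (1 - c) = \<alpha> ^ 2" "\<alpha> = sqrt ((c0 - c * E ^ 2) / (1 - c))"
    "\<beta> = (c1 - 4 * c * E * B) / (2 * (1 - c) * \<alpha>)"
    "\<gamma> = ((c2 - c * (4 * B ^ 2 + 2 * E * G)) / (1 - c) - \<beta> ^ 2) / (2 * \<alpha>)"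
proof -
  have "(c0 - c * E ^ 2 - (1 - c) * \<alpha> ^ 2) + (c1 - 4 * c * E * B - (1 - c) * (2 * \<alpha> * \<beta>)) * s +
     (c2 - c * (4 * B ^ 2 + 2 * E * G) - (1 - c) * (\<beta> ^ 2 + 2 * \<alpha> * \<gamma>)) * s ^ 2 +
     (c3 - 4 * c * B * G - (1 - c) * (2 * \<beta> * \<gamma>)) * s ^ 3 + (c4 - c * G ^ 2 - (1 - c) * \<gamma> ^ 2) * s ^ 4 = 0" for s
    using eq[of s] by (simp add: pow_simps)
  from real_quartic_zero[OF this]
  have e: "c0 - c * E ^ 2 = (1 - c) * \<alpha> ^ 2" "c1 - 4 * c * E * B = (1 - c) * (2 * \<alpha> * \<beta>)"
    "c2 - c * (4 * B ^ 2 + 2 * E * G) = (1 - c) * (\<beta> ^ 2 + 2 * \<alpha> * \<gamma>)" by simp_all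
  have c': "1 - c \<noteq> 0" using c by simp
  show 1: "(c0 - c * E ^ 2) / (1 - c) = \<alpha> ^ 2" unfolding e using c' by simp
  show "\<alpha> = sqrt ((c0 - c * E ^ 2) / (1 - c))" unfolding 1 using \<alpha> by simp
  show "\<beta> = (c1 - 4 * c * E * B) / (2 * (1 - c) * \<alpha>)"
  proof -
    have "(1 - c) * (2 * \<alpha> * \<beta>) = \<beta> * (2 * (1 - c) * \<alpha>)" by simp
    moreover have "2 * (1 - c) * \<alpha> \<noteq> 0" using c' \<alpha> by simp
    ultimately show ?thesis unfolding e by (metis nonzero_mult_div_cancel_right)
  qed
  show "\<gamma> = ((c2 - c * (4 * B ^ 2 + 2 * E * G)) / (1 - c) - \<beta> ^ 2) / (2 * \<alpha>)" unfolding e using c' \<alpha> by simp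
qed

context quartic_integral
begin

text \<open>The two linear forms in \<open>p\<close> are \<open>P1 / g\<close> and \<open>P2\<close>
  for the conjugate momenta of \<open>p\<close>, found by inverting \<open>lift\<close>.\<close>

lemma coframe:
  obtains m1 m2 n1 n2 where
    "\<And>p. F (q, p) = a 0 (\<Phi> q) * (m1 * fst p + m2 * snd p) ^ 4 + a 1 (\<Phi> q) * (m1 * fst p + m2 * snd p) ^ 3 * (n1 * fst p + n2 * snd p) +
       a 2 (\<Phi> q) * (m1 * fst p + m2 * snd p) ^ 2 * (n1 * fst p + n2 * snd p) ^ 2 +
       g (\<Phi> q) * (m1 * fst p + m2 * snd p) * (n1 * fst p + n2 * snd p) ^ 3 + (n1 * fst p + n2 * snd p) ^ 4"
    "\<And>p. 2 * hamiltonian \<rho> (q, p) = (m1 * fst p + m2 * snd p) ^ 2 + (n1 * fst p + n2 * snd p) ^ 2"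
proof -
  define D where "D = d1 t q * d2 x q - d2 t q * d1 x q"
  have D: "D \<noteq> 0" unfolding D_def by (rule jacobian_nonzero)
  have g: "g (\<Phi> q) \<noteq> 0" using g_pos[of "\<Phi> q"] by simp
  define m1 m2 n1 n2 where "m1 = d2 x q / D / g (\<Phi> q)" and "m2 = - d1 x q / D / g (\<Phi> q)"
    and "n1 = - d2 t q / D" and "n2 = d1 t q / D"
  define P where "P = (\<lambda>p. (g (\<Phi> q) * (m1 * fst p + m2 * snd p), n1 * fst p + n2 * snd p))"
  have lift: "lift q (P p) = p" for p
  proof -
    have "g (\<Phi> q) * (m1 * fst p + m2 * snd p) = (fst p * d2 x q - snd p * d1 x q) / D"
    proof -
      have "g (\<Phi> q) * (x / D / g (\<Phi> q)) = x / D" for x using g by simp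
      moreover have "g (\<Phi> q) * (m1 * fst p + m2 * snd p)
          = g (\<Phi> q) * (d2 x q / D / g (\<Phi> q)) * fst p - g (\<Phi> q) * (d1 x q / D / g (\<Phi> q)) * snd p"
        by (simp add: m1_def m2_def algebra_simps)
      ultimately show ?thesis by (simp add: diff_divide_distrib mult.commute)
    qed
    moreover have "n1 * fst p + n2 * snd p = (snd p * d1 t q - fst p * d2 t q) / D"
      by (simp add: n1_def n2_def diff_divide_distrib mult.commute)
    moreover have "(fst p * d2 x q - snd p * d1 x q) / D * d1 t q + (snd p * d1 t q - fst p * d2 t q) / D * d1 x q = fst p * D / D"
      "(fst p * d2 x q - snd p * d1 x q) / D * d2 t q + (snd p * d1 t q - fst p * d2 t q) / D * d2 x q = snd p * D / D"
      unfolding times_divide_eq_left add_divide_distrib[symmetric]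
      by (rule arg_cong[of _ _ "\<lambda>x. x / D"], simp add: D_def algebra_simps)+
    ultimately show ?thesis using D unfolding lift_def P_def by (simp add: prod_eq_iff)
  qed
  have "F (q, p) = a 0 (\<Phi> q) * (m1 * fst p + m2 * snd p) ^ 4 + a 1 (\<Phi> q) * (m1 * fst p + m2 * snd p) ^ 3 * (n1 * fst p + n2 * snd p) +
       a 2 (\<Phi> q) * (m1 * fst p + m2 * snd p) ^ 2 * (n1 * fst p + n2 * snd p) ^ 2 +
       g (\<Phi> q) * (m1 * fst p + m2 * snd p) * (n1 * fst p + n2 * snd p) ^ 3 + (n1 * fst p + n2 * snd p) ^ 4" for p
    using F_coords[of q "P p"] g unfolding lift by (simp add: ff_def P_def)
  moreover have "2 * hamiltonian \<rho> (q, p) = (m1 * fst p + m2 * snd p) ^ 2 + (n1 * fst p + n2 * snd p) ^ 2" for p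
    using ham_coords[of q "P p"] g unfolding lift by (simp add: hh_def P_def)
  ultimately show ?thesis by (rule that)
qed

definition "ell q \<longleftrightarrow> elliptic_matrix (hydro_matrix (\<lambda>k. a k (\<Phi> q)))"

lemma ell_iff: "ell q \<longleftrightarrow> (\<exists>z. Im z \<noteq> 0 \<and> qP (of_real (a 0 (\<Phi> q))) (of_real (a 1 (\<Phi> q))) (of_real (a 2 (\<Phi> q))) (of_real (g (\<Phi> q))) z = 0)"
  unfolding ell_def
  by (subst elliptic_matrix_iff) (simp_all add: a3 a4 g_pos)

lemma ell_periodic: "\<gamma> \<in> \<Gamma> \<Longrightarrow> ell (q + \<gamma>) \<longleftrightarrow> ell q"
  unfolding ell_iff coeffs_periodic ..

lemma open_ell: "open {q. ell q}"
proof -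
  obtain u v where "hydro_system (a 0) (a 1) (a 2) g u v" by (rule hydro)
  then interpret hydro_system "a 0" "a 1" "a 2" g u v .
  have "open (\<Phi> -` {y. \<exists>z. Im z \<noteq> 0 \<and> PP y z = 0})"
    using smooth_on_continuous[OF smooth_\<Phi>] open_elliptic unfolding continuous_on_open_vimage[OF open_UNIV] Int_UNIV_right by blast
  moreover have "\<Phi> -` {y. \<exists>z. Im z \<noteq> 0 \<and> PP y z = 0} = {q. ell q}"
    unfolding vimage_def ell_iff PP_def by simp
  ultimately show ?thesis by simp
qed

lemma zero_in_lattice: "0 \<in> \<Gamma>"
proof -
  obtain u v where uv: "\<Gamma> = {of_int m *\<^sub>R u + of_int n *\<^sub>R v |m n. True}"
    using lattice unfolding is_lattice_def by blast
  show ?thesis unfolding uv by (rule CollectI) (intro exI[of _ 0], simp)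
qed

lemma torus_proj_eqD: "torus_proj \<Gamma> q = torus_proj \<Gamma> q' \<Longrightarrow> \<exists>\<gamma>\<in>\<Gamma>. q = q' + \<gamma>"
proof -
  assume e: "torus_proj \<Gamma> q = torus_proj \<Gamma> q'"
  have "q + 0 \<in> torus_proj \<Gamma> q" unfolding torus_proj_def using zero_in_lattice by blast
  then have "q \<in> torus_proj \<Gamma> q'" using e by simp
  then show ?thesis unfolding torus_proj_def by blast
qed

lemma hamiltonian_periodic: "\<gamma> \<in> \<Gamma> \<Longrightarrow> hamiltonian \<rho> (q + \<gamma>, p) = hamiltonian \<rho> (q, p)"
  using pm[unfolded periodic_metric_def, THEN spec, of q] by (simp add: hamiltonian_def sharp_def)

lemma F_periodic: "\<gamma> \<in> \<Gamma> \<Longrightarrow> F (q + \<gamma>, p) = F (q, p)"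
  using pF unfolding periodic_on_def by blast

lemma F_coefficients:
  obtains c0 c1 c2 c3 c4 where "smooth_on UNIV c0" "smooth_on UNIV c1" "smooth_on UNIV c2"
    "\<And>q p. F (q, p) = c0 q * fst p ^ 4 + c1 q * fst p ^ 3 * snd p + c2 q * fst p ^ 2 * snd p ^ 2 + c3 q * fst p * snd p ^ 3 + c4 q * snd p ^ 4"
proof -
  obtain c where sm: "\<And>k. k \<le> 4 \<Longrightarrow> smooth_on UNIV (c k)"
    and c: "\<And>q p1 p2. F (q, (p1, p2)) = (\<Sum>k\<le>4. c k q * p1 ^ (4 - k) * p2 ^ k)"
    using hp unfolding hom_poly_on_def by blast
  have "{..4::nat} = {0, 1, 2, 3, 4}" by auto
  then have "F (q, (fst p, snd p)) = c 0 q * fst p ^ 4 + c 1 q * fst p ^ 3 * snd p + c 2 q * fst p ^ 2 * snd p ^ 2 + c 3 q * fst p * snd p ^ 3 + c 4 q * snd p ^ 4" for q p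
    unfolding c by simp
  then show ?thesis using that[of "c 0" "c 1" "c 2" "c 3" "c 4"] sm by simp
qed

section \<open>Construction of the quadratic integral and of the flat chart\<close>

definition "reducible_on S \<longleftrightarrow> (\<exists>F2 k1 k2 k3. hom_poly_on 2 S F2 \<and> periodic_on \<Gamma> S F2 \<and> first_integral_on \<rho> S F2 \<and>
   (\<forall>z\<in>S \<times> UNIV. F z = k1 * (F2 z)\<^sup>2 + 2 * k2 * hamiltonian \<rho> z * F2 z + 4 * k3 * (hamiltonian \<rho> z)\<^sup>2))"

text \<open>The hypothesis says that the quartic vanishes at \<open>s = \<plusminus>\<i>\<close>, so
  \<open>1 + s^2\<close> divides it, and in the momenta this factor is \<open>2 * H\<close>.\<close>

lemma reducible_of_divisible:
  assumes S: "open S"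
    and Z: "\<And>y. a 0 y - a 2 y + 1 = 0 \<and> a 1 y - g y = 0"
  shows "reducible_on S"
proof -
  obtain c0 c1 c2 c3 c4 where sm: "smooth_on UNIV c0" "smooth_on UNIV c1" "smooth_on UNIV c2"
    and Fc: "\<And>q p. F (q, p) = c0 q * fst p ^ 4 + c1 q * fst p ^ 3 * snd p + c2 q * fst p ^ 2 * snd p ^ 2 + c3 q * fst p * snd p ^ 3 + c4 q * snd p ^ 4"
    using F_coefficients by blast
  let ?E = "hamE \<rho>" and ?B = "hamB \<rho>" and ?G = "hamG \<rho>" and ?H = "hamiltonian \<rho>"
  have E0: "?E q \<noteq> 0" for q using hamE_pos[OF rm, of q] by simp
  define A where "A = (\<lambda>q. c0 q / ?E q)"
  define B where "B = (\<lambda>q. (c1 q - 2 * ?B q * A q) / ?E q)"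
  define C where "C = (\<lambda>q. (c2 q - 2 * ?B q * B q - ?G q * A q) / ?E q)"
  have smA: "smooth_on UNIV A" unfolding A_def
    by (intro smooth_on_divide sm ham_smooth[OF rm] E0 open_UNIV)
  have smB: "smooth_on UNIV B" unfolding B_def
    by (intro smooth_on_divide smooth_on_diff smooth_on_mult smooth_on_const smA sm ham_smooth[OF rm] E0 open_UNIV)
  have smC: "smooth_on UNIV C" unfolding C_def
    by (intro smooth_on_divide smooth_on_diff smooth_on_mult smooth_on_const smA smB sm ham_smooth[OF rm] E0 open_UNIV)
  have FQ: "F (q, p) = 2 * ?H (q, p) * (A q * (fst p)\<^sup>2 + B q * fst p * snd p + C q * (snd p)\<^sup>2)" for q p
  proof -
    obtain m1 m2 n1 n2 where FM: "\<And>p. F (q, p) = a 0 (\<Phi> q) * (m1 * fst p + m2 * snd p) ^ 4 + a 1 (\<Phi> q) * (m1 * fst p + m2 * snd p) ^ 3 * (n1 * fst p + n2 * snd p) +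
       a 2 (\<Phi> q) * (m1 * fst p + m2 * snd p) ^ 2 * (n1 * fst p + n2 * snd p) ^ 2 +
       g (\<Phi> q) * (m1 * fst p + m2 * snd p) * (n1 * fst p + n2 * snd p) ^ 3 + (n1 * fst p + n2 * snd p) ^ 4"
      and HM: "\<And>p. 2 * ?H (q, p) = (m1 * fst p + m2 * snd p) ^ 2 + (n1 * fst p + n2 * snd p) ^ 2"
      using coframe[of q] by blast
    define \<alpha> where "\<alpha> = a 0 (\<Phi> q) * m1 ^ 2 + a 1 (\<Phi> q) * m1 * n1 + n1 ^ 2"
    define \<beta> where "\<beta> = 2 * a 0 (\<Phi> q) * m1 * m2 + a 1 (\<Phi> q) * (m1 * n2 + m2 * n1) + 2 * n1 * n2"
    define \<gamma> where "\<gamma> = a 0 (\<Phi> q) * m2 ^ 2 + a 1 (\<Phi> q) * m2 * n2 + n2 ^ 2"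
    have a: "a 2 (\<Phi> q) = a 0 (\<Phi> q) + 1" "g (\<Phi> q) = a 1 (\<Phi> q)" using Z[of "\<Phi> q"] by simp_all
    have fac: "a0 * m ^ 4 + a1 * m ^ 3 * n + (a0 + 1) * m ^ 2 * n ^ 2 + a1 * m * n ^ 3 + n ^ 4
       = (m ^ 2 + n ^ 2) * (a0 * m ^ 2 + a1 * m * n + n ^ 2)" for a0 a1 m n :: real
      by (simp add: pow_simps)
    have qf: "a 0 (\<Phi> q) * (m1 * fst p + m2 * snd p) ^ 2 + a 1 (\<Phi> q) * (m1 * fst p + m2 * snd p) * (n1 * fst p + n2 * snd p) + (n1 * fst p + n2 * snd p) ^ 2
       = \<alpha> * (fst p)\<^sup>2 + \<beta> * fst p * snd p + \<gamma> * (snd p)\<^sup>2" for p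
      by (simp add: \<alpha>_def \<beta>_def \<gamma>_def pow_simps)
    have Fq: "F (q, p) = 2 * ?H (q, p) * (\<alpha> * (fst p)\<^sup>2 + \<beta> * fst p * snd p + \<gamma> * (snd p)\<^sup>2)" for p
      unfolding FM HM a fac qf ..
    have "c0 q + c1 q * s + c2 q * s ^ 2 + c3 q * s ^ 3 + c4 q * s ^ 4 = (?E q + 2 * ?B q * s + ?G q * s ^ 2) * (\<alpha> + \<beta> * s + \<gamma> * s ^ 2)" for s
      using Fq[of "(1, s)"] unfolding hamiltonian_quadratic[OF rm] Fc by simp
    from quartic_division[OF E0 this] have "\<alpha> = A q" "\<beta> = B q" "\<gamma> = C q"
      by (simp_all add: A_def B_def C_def)
    then show ?thesis using Fq by simp
  qed
  \<comment> \<open>As a quotient of periodic functions it is visibly periodic; on the zero section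
    the default \<open>x / 0 = 0\<close> agrees with the quadratic form.\<close>
  define F2 where "F2 = (\<lambda>z. F z / (2 * ?H z))"
  have F2: "F2 (q, p) = A q * (fst p)\<^sup>2 + B q * fst p * snd p + C q * (snd p)\<^sup>2" for q p
  proof (cases "p = 0")
    case True
    have "2 * ?H (q, 0) = 0" unfolding hamiltonian_quadratic[OF rm] by simp
    then show ?thesis using True by (simp add: F2_def)
  next
    case False
    then show ?thesis using hamiltonian_pos[OF rm, of p q] by (simp add: F2_def FQ)
  qed
  have red: "F z = 0 * (F2 z)\<^sup>2 + 2 * 1 * ?H z * F2 z + 4 * 0 * (?H z)\<^sup>2" for z
  proof -
    have "F (fst z, snd z) = 2 * ?H (fst z, snd z) * F2 (fst z, snd z)" unfolding F2 FQ ..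
    then show ?thesis by simp
  qed
  note fr = first_integral_of_reduction[OF rm fi S smooth_on_subset[OF smA subset_UNIV] smooth_on_subset[OF smB subset_UNIV]
    smooth_on_subset[OF smC subset_UNIV] F2 red]
  have ne: "0 * F2 (q, p) + 1 * ?H (q, p) \<noteq> 0" if "p \<noteq> 0" for q p
    using hamiltonian_pos[OF rm that, of q] by simp
  have "hom_poly_on 2 S F2" "first_integral_on \<rho> S F2" using fr ne by blast+
  moreover have "periodic_on \<Gamma> S F2"
    unfolding periodic_on_def F2_def using hamiltonian_periodic F_periodic by simp
  ultimately show ?thesis unfolding reducible_on_def using red by blast
qed

text \<open>Because \<open>z\<close> is not real the quadratic form is positive definite. It is
  therefore the nonnegative square root of \<open>(F - 4 * c * H^2) / (1 - c)\<close>, which is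
  periodic, and it does not vanish off the zero section, as the bracket argument requires.\<close>

lemma reducible_of_real_invariant:
  assumes S: "open S" and c1: "c \<noteq> 1"
    and sq: "\<And>q. q \<in> S \<Longrightarrow> \<exists>z. Im z \<noteq> 0 \<and> (\<forall>m n. a 0 (\<Phi> q) * m ^ 4 + a 1 (\<Phi> q) * m ^ 3 * n + a 2 (\<Phi> q) * m ^ 2 * n ^ 2 +
       g (\<Phi> q) * m * n ^ 3 + n ^ 4 - c * (m ^ 2 + n ^ 2) ^ 2 = (1 - c) * (n ^ 2 - 2 * Re z * m * n + ((Re z)\<^sup>2 + (Im z)\<^sup>2) * m ^ 2) ^ 2)"
  shows "reducible_on S"
proof -
  obtain c0 c1' c2 c3 c4 where sm: "smooth_on UNIV c0" "smooth_on UNIV c1'" "smooth_on UNIV c2"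
    and Fc: "\<And>q p. F (q, p) = c0 q * fst p ^ 4 + c1' q * fst p ^ 3 * snd p + c2 q * fst p ^ 2 * snd p ^ 2 + c3 q * fst p * snd p ^ 3 + c4 q * snd p ^ 4"
    using F_coefficients by blast
  let ?E = "hamE \<rho>" and ?B = "hamB \<rho>" and ?G = "hamG \<rho>" and ?H = "hamiltonian \<rho>"
  define A2 where "A2 = (\<lambda>q. (c0 q - c * ?E q ^ 2) / (1 - c))"
  define A where "A = (\<lambda>q. sqrt (A2 q))"
  define B where "B = (\<lambda>q. (c1' q - 4 * c * ?E q * ?B q) / (2 * (1 - c) * A q))"
  define C where "C = (\<lambda>q. ((c2 q - c * (4 * ?B q ^ 2 + 2 * ?E q * ?G q)) / (1 - c) - B q ^ 2) / (2 * A q))"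
  have key: "A2 q > 0 \<and> (\<forall>p. F (q, p) - c * (2 * ?H (q, p)) ^ 2 = (1 - c) * (A q * (fst p)\<^sup>2 + B q * fst p * snd p + C q * (snd p)\<^sup>2) ^ 2) \<and>
      (\<forall>p. p \<noteq> 0 \<longrightarrow> A q * (fst p)\<^sup>2 + B q * fst p * snd p + C q * (snd p)\<^sup>2 > 0)" if q: "q \<in> S" for q
  proof -
    obtain m1 m2 n1 n2 where FM: "\<And>p. F (q, p) = a 0 (\<Phi> q) * (m1 * fst p + m2 * snd p) ^ 4 + a 1 (\<Phi> q) * (m1 * fst p + m2 * snd p) ^ 3 * (n1 * fst p + n2 * snd p) +
       a 2 (\<Phi> q) * (m1 * fst p + m2 * snd p) ^ 2 * (n1 * fst p + n2 * snd p) ^ 2 +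
       g (\<Phi> q) * (m1 * fst p + m2 * snd p) * (n1 * fst p + n2 * snd p) ^ 3 + (n1 * fst p + n2 * snd p) ^ 4"
      and HM: "\<And>p. 2 * ?H (q, p) = (m1 * fst p + m2 * snd p) ^ 2 + (n1 * fst p + n2 * snd p) ^ 2"
      using coframe[of q] by blast
    obtain z where z: "Im z \<noteq> 0" and zq: "\<And>m n. a 0 (\<Phi> q) * m ^ 4 + a 1 (\<Phi> q) * m ^ 3 * n + a 2 (\<Phi> q) * m ^ 2 * n ^ 2 +
       g (\<Phi> q) * m * n ^ 3 + n ^ 4 - c * (m ^ 2 + n ^ 2) ^ 2 = (1 - c) * (n ^ 2 - 2 * Re z * m * n + ((Re z)\<^sup>2 + (Im z)\<^sup>2) * m ^ 2) ^ 2"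
      using sq[OF q] by blast
    define r s where "r = Re z" and "s = (Im z)\<^sup>2"
    have s: "s > 0" using z by (simp add: s_def)
    define \<alpha> where "\<alpha> = n1 ^ 2 - 2 * r * m1 * n1 + (r ^ 2 + s) * m1 ^ 2"
    define \<beta> where "\<beta> = 2 * n1 * n2 - 2 * r * (m1 * n2 + m2 * n1) + 2 * (r ^ 2 + s) * m1 * m2"
    define \<gamma> where "\<gamma> = n2 ^ 2 - 2 * r * m2 * n2 + (r ^ 2 + s) * m2 ^ 2"
    have qf: "(n1 * fst p + n2 * snd p) ^ 2 - 2 * r * (m1 * fst p + m2 * snd p) * (n1 * fst p + n2 * snd p) + (r ^ 2 + s) * (m1 * fst p + m2 * snd p) ^ 2
       = \<alpha> * (fst p)\<^sup>2 + \<beta> * fst p * snd p + \<gamma> * (snd p)\<^sup>2" for p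
      by (simp add: \<alpha>_def \<beta>_def \<gamma>_def pow_simps)
    have Fq: "F (q, p) - c * (2 * ?H (q, p)) ^ 2 = (1 - c) * (\<alpha> * (fst p)\<^sup>2 + \<beta> * fst p * snd p + \<gamma> * (snd p)\<^sup>2) ^ 2" for p
      unfolding FM HM zq r_def[symmetric] s_def[symmetric] qf ..
    have pos: "\<alpha> * (fst p)\<^sup>2 + \<beta> * fst p * snd p + \<gamma> * (snd p)\<^sup>2 > 0" if p: "p \<noteq> 0" for p
    proof -
      define m n where "m = m1 * fst p + m2 * snd p" and "n = n1 * fst p + n2 * snd p"
      have "m ^ 2 + n ^ 2 > 0" using HM[of p] hamiltonian_pos[OF rm p, of q] by (simp add: m_def n_def)
      then have "m \<noteq> 0 \<or> n \<noteq> 0" by auto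
      moreover have "n ^ 2 - 2 * r * m * n + (r ^ 2 + s) * m ^ 2 = (n - r * m) ^ 2 + s * m ^ 2" by (simp add: pow_simps)
      moreover have "(n - r * m) ^ 2 + s * m ^ 2 > 0" if "m \<noteq> 0 \<or> n \<noteq> 0"
      proof (cases "m = 0")
        case True then show ?thesis using that by simp
      next
        case False then show ?thesis using s by (simp add: add_nonneg_pos)
      qed
      ultimately show ?thesis unfolding qf[symmetric] m_def[symmetric] n_def[symmetric] by simp
    qed
    have \<alpha>: "\<alpha> > 0" using pos[of "(1, 0)"] by (simp add: zero_prod_def)
    have eqs: "c0 q + c1' q * s + c2 q * s ^ 2 + c3 q * s ^ 3 + c4 q * s ^ 4 - c * (?E q + 2 * ?B q * s + ?G q * s ^ 2) ^ 2
        = (1 - c) * (\<alpha> + \<beta> * s + \<gamma> * s ^ 2) ^ 2" for s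
      using Fq[of "(1, s)"] unfolding hamiltonian_quadratic[OF rm] Fc by simp
    note qs = quartic_square_root[OF c1 \<alpha> eqs]
    have "A2 q = \<alpha> ^ 2" unfolding A2_def by (rule qs(1))
    moreover have A: "A q = \<alpha>" unfolding A_def A2_def by (rule qs(2)[symmetric])
    moreover have B: "B q = \<beta>" unfolding B_def A by (rule qs(3)[symmetric])
    moreover have "C q = \<gamma>" unfolding C_def A B by (rule qs(4)[symmetric])
    ultimately show ?thesis using \<alpha> Fq pos by simp
  qed
  have c1': "1 - c \<noteq> 0" using c1 by simp
  have A0: "A q > 0" if "q \<in> S" for q using key[OF that] by (simp add: A_def)
  note smS = smooth_on_subset[OF sm(1) subset_UNIV] smooth_on_subset[OF sm(2) subset_UNIV] smooth_on_subset[OF sm(3) subset_UNIV]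
    smooth_on_subset[OF ham_smooth(1)[OF rm] subset_UNIV] smooth_on_subset[OF ham_smooth(2)[OF rm] subset_UNIV] smooth_on_subset[OF ham_smooth(3)[OF rm] subset_UNIV]
  have "smooth_on S A2" unfolding A2_def
    by (intro smooth_on_divide smooth_on_diff smooth_on_mult smooth_on_power smooth_on_const smS S c1')
  then have smA: "smooth_on S A" unfolding A_def using key by (intro smooth_on_sqrt S) auto
  have smB: "smooth_on S B" unfolding B_def
    by (intro smooth_on_divide smooth_on_diff smooth_on_mult smooth_on_power smooth_on_const smS smA S)
       (use A0 c1' in \<open>force\<close>)
  have smC: "smooth_on S C" unfolding C_def
    by (intro smooth_on_divide smooth_on_diff smooth_on_add smooth_on_mult smooth_on_power smooth_on_const smS smA smB S c1')
       (use A0 in \<open>force\<close>)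
  define F2 where "F2 = (\<lambda>z. sqrt ((F z - c * (2 * ?H z) ^ 2) / (1 - c)))"
  have Q0: "A q * (fst p)\<^sup>2 + B q * fst p * snd p + C q * (snd p)\<^sup>2 \<ge> 0" if "q \<in> S" for q p
    using key[OF that] by (cases "p = 0") (auto intro: less_imp_le)
  have F2: "F2 (q, p) = A q * (fst p)\<^sup>2 + B q * fst p * snd p + C q * (snd p)\<^sup>2" if q: "q \<in> S" for q p
  proof -
    have "F (q, p) - c * (2 * ?H (q, p)) ^ 2 = (1 - c) * (A q * (fst p)\<^sup>2 + B q * fst p * snd p + C q * (snd p)\<^sup>2) ^ 2"
      using key[OF q] by blast
    then show ?thesis unfolding F2_def using Q0[OF q, of p] c1' by simp
  qed
  have red: "F z = (1 - c) * (F2 z)\<^sup>2 + 2 * 0 * ?H z * F2 z + 4 * c * (?H z)\<^sup>2" if z: "z \<in> S \<times> UNIV" for z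
  proof -
    obtain q p where qp: "z = (q, p)" "q \<in> S" using z by auto
    have "F (q, p) - c * (2 * ?H (q, p)) ^ 2 = (1 - c) * (F2 (q, p)) ^ 2"
      unfolding F2[OF qp(2)] using key[OF qp(2)] by blast
    then show ?thesis unfolding qp(1) by (simp add: power_mult_distrib)
  qed
  have ne: "(1 - c) * F2 (q, p) + 0 * ?H (q, p) \<noteq> 0" if "q \<in> S" "p \<noteq> 0" for q p
  proof -
    have "F2 (q, p) > 0" unfolding F2[OF that(1)] using key[OF that(1)] that(2) by blast
    then show ?thesis using c1' by simp
  qed
  note fr = first_integral_of_reduction[OF rm fi S smA smB smC F2 red ne]
  have "hom_poly_on 2 S F2" "first_integral_on \<rho> S F2" using fr by blast+
  moreover have "periodic_on \<Gamma> S F2"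
    unfolding periodic_on_def F2_def using hamiltonian_periodic F_periodic by simp
  ultimately show ?thesis unfolding reducible_on_def using red by blast
qed

text \<open>With \<open>g\<close> constant the map \<open>(g * t, x)\<close> pulls the Euclidean
  metric back to \<rho>, so it is a single isometric chart on all of \<open>S\<close>.\<close>

lemma flat_of_constant:
  assumes S: "open S" and g: "\<And>y. d1 g y = 0 \<and> d2 g y = 0"
  shows "flat_on \<rho> S"
  unfolding flat_on_def
proof
  fix q assume q: "q \<in> S"
  have "has_pd g 0 0 y" for y using smooth_has_pd[OF smooth_g UNIV_I, of y] g[of y] by simp
  then have gc: "g y = g 0" for y by (rule zero_pd_constant)
  define L where "L = (\<lambda>y::plane. (g 0 * fst y, snd y))"
  have L: "bounded_linear L"
    unfolding L_def by (intro bounded_linear_Pair bounded_linear_const_mult bounded_linear_fst bounded_linear_snd)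
  have inj: "inj_on (\<lambda>q. L (\<Phi> q)) S"
  proof (rule inj_onI)
    fix q q' assume "L (\<Phi> q) = L (\<Phi> q')"
    then have "\<Phi> q = \<Phi> q'" using g_pos[of 0] by (simp add: L_def prod_eq_iff)
    then show "q = q'" using bij_\<Phi> by (metis bij_is_inj injD)
  qed
  have "frechet_derivative (\<lambda>q. L (\<Phi> q)) (at z) = (\<lambda>v. L (frechet_derivative \<Phi> (at z) v))" for z
    by (rule frechet_derivative_at[symmetric], rule bounded_linear.has_derivative[OF L smooth_on_has_derivative[OF smooth_\<Phi> UNIV_I]])
  then have "inner (frechet_derivative (\<lambda>q. L (\<Phi> q)) (at z) v) (frechet_derivative (\<lambda>q. L (\<Phi> q)) (at z) w) = \<rho> z v w" for z v w
    unfolding metric_coords gc[of "\<Phi> z"] by (simp add: frechet_\<Phi> L_def inner_plane power2_eq_square mult_ac)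
  moreover have "smooth_on S (\<lambda>q. L (\<Phi> q))"
    by (rule smooth_on_compose_linear[OF S smooth_on_subset[OF smooth_\<Phi> subset_UNIV] L])
  ultimately show "\<exists>V (\<psi> :: plane \<Rightarrow> plane). open V \<and> q \<in> V \<and> V \<subseteq> S \<and> smooth_on V \<psi> \<and> inj_on \<psi> V \<and>
       (\<forall>z\<in>V. \<forall>v w. inner (frechet_derivative \<psi> (at z) v) (frechet_derivative \<psi> (at z) w) = \<rho> z v w)"
    by (intro exI[of _ S] exI[of _ "\<lambda>q. L (\<Phi> q)"] conjI ballI allI S q inj subset_refl)
qed

section \<open>Topology of the elliptic region and the final alternative\<close>

context
  fixes \<Omega> :: "plane set set"
  assumes \<Omega>: "elliptic_region \<Gamma> \<Phi> a \<Omega>"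
begin

lemma region_component: "\<Omega> \<in> connected_components_of (subtopology (torus \<Gamma>) (elliptic_set \<Gamma> \<Phi> a))"
  using \<Omega> unfolding elliptic_region_def .

lemma region_ell: "torus_proj \<Gamma> q \<in> \<Omega> \<Longrightarrow> ell q"
proof -
  assume "torus_proj \<Gamma> q \<in> \<Omega>"
  then have "torus_proj \<Gamma> q \<in> elliptic_set \<Gamma> \<Phi> a"
    using connected_components_of_subset[OF region_component] unfolding topspace_subtopology by blast
  then obtain q' where q': "torus_proj \<Gamma> q = torus_proj \<Gamma> q'" "ell q'"
    unfolding elliptic_set_def ell_def[symmetric] by blast
  then show "ell q" using torus_proj_eqD[OF q'(1)] ell_periodic by blast
qed

text \<open>A ball inside the open elliptic set projects to a connected set, and a connected
  component contains every such set that it meets.\<close>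

lemma region_open: "open (torus_proj \<Gamma> -` \<Omega>)"
  unfolding open_contains_ball
proof
  fix q assume q: "q \<in> torus_proj \<Gamma> -` \<Omega>"
  then have "q \<in> {q. ell q}" using region_ell by blast
  then obtain d where d: "d > 0" "ball q d \<subseteq> {q. ell q}" using open_ell open_contains_ball by blast
  have cm: "continuous_map euclidean (torus \<Gamma>) (torus_proj \<Gamma>)"
    by (rule quotient_imp_continuous_map[OF quotient_map_torus_proj])
  have "connectedin (torus \<Gamma>) (torus_proj \<Gamma> ` ball q d)"
    by (rule connectedin_continuous_map_image[OF cm]) simp
  moreover have "torus_proj \<Gamma> ` ball q d \<subseteq> elliptic_set \<Gamma> \<Phi> a"
    unfolding elliptic_set_def ell_def[symmetric] using d(2) by (rule image_mono)
  ultimately have c: "connectedin (subtopology (torus \<Gamma>) (elliptic_set \<Gamma> \<Phi> a)) (torus_proj \<Gamma> ` ball q d)"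
    unfolding connectedin_subtopology by blast
  have "torus_proj \<Gamma> q \<in> torus_proj \<Gamma> ` ball q d" using d(1) by (intro imageI) simp
  then have "\<not> disjnt \<Omega> (torus_proj \<Gamma> ` ball q d)" using q unfolding disjnt_def by blast
  then have "torus_proj \<Gamma> ` ball q d \<subseteq> \<Omega>"
    using connected_components_of_maximal[OF region_component c] by blast
  then show "\<exists>e>0. ball q e \<subseteq> torus_proj \<Gamma> -` \<Omega>" using d(1) by blast
qed

text \<open>The component is connected in the quotient, while its preimage in the plane may fall
  into many pieces. Invariance of \<open>R\<close> under the lattice lets the two alternatives
  descend to disjoint open sets of the torus.\<close>

lemma region_connected:
  assumes loc: "\<And>q. q \<in> torus_proj \<Gamma> -` \<Omega> \<Longrightarrow> \<exists>d>0. \<forall>q'\<in>ball q d. R q' \<longleftrightarrow> R q"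
    and inv: "\<And>q \<gamma>. \<gamma> \<in> \<Gamma> \<Longrightarrow> R (q + \<gamma>) \<longleftrightarrow> R q"
    and q0: "q0 \<in> torus_proj \<Gamma> -` \<Omega>" "R q0" and q1: "q1 \<in> torus_proj \<Gamma> -` \<Omega>"
  shows "R q1"
proof (rule ccontr)
  assume n: "\<not> R q1"
  have op: "openin (torus \<Gamma>) (torus_proj \<Gamma> ` {q \<in> torus_proj \<Gamma> -` \<Omega>. R q = b})" for b
  proof -
    have "torus_proj \<Gamma> -` (torus_proj \<Gamma> ` {q \<in> torus_proj \<Gamma> -` \<Omega>. R q = b}) = {q \<in> torus_proj \<Gamma> -` \<Omega>. R q = b}"
    proof (intro equalityI subsetI)
      fix q assume "q \<in> torus_proj \<Gamma> -` (torus_proj \<Gamma> ` {q \<in> torus_proj \<Gamma> -` \<Omega>. R q = b})"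
      then obtain q' where q': "torus_proj \<Gamma> q = torus_proj \<Gamma> q'" "torus_proj \<Gamma> q' \<in> \<Omega>" "R q' = b" by auto
      then obtain \<gamma> where "\<gamma> \<in> \<Gamma>" "q = q' + \<gamma>" using torus_proj_eqD by blast
      then show "q \<in> {q \<in> torus_proj \<Gamma> -` \<Omega>. R q = b}" using q' inv by simp
    qed blast
    moreover have "open {q \<in> torus_proj \<Gamma> -` \<Omega>. R q = b}"
      unfolding open_contains_ball
    proof
      fix q assume q: "q \<in> {q \<in> torus_proj \<Gamma> -` \<Omega>. R q = b}"
      then obtain d where d: "d > 0" "\<forall>q'\<in>ball q d. R q' \<longleftrightarrow> R q" using loc by blast
      obtain e where e: "e > 0" "ball q e \<subseteq> torus_proj \<Gamma> -` \<Omega>" using q region_open open_contains_ball by blast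
      have "ball q (min d e) \<subseteq> {q \<in> torus_proj \<Gamma> -` \<Omega>. R q = b}"
      proof
        fix q' assume "q' \<in> ball q (min d e)"
        then have "q' \<in> ball q d" "q' \<in> ball q e" by simp_all
        then show "q' \<in> {q \<in> torus_proj \<Gamma> -` \<Omega>. R q = b}" using d(2) e(2) q by blast
      qed
      then show "\<exists>r>0. ball q r \<subseteq> {q \<in> torus_proj \<Gamma> -` \<Omega>. R q = b}" using d(1) e(1) by (metis min_less_iff_conj)
    qed
    ultimately show ?thesis unfolding openin_torus by auto
  qed
  have con: "connectedin (torus \<Gamma>) \<Omega>"
    using connectedin_connected_components_of[OF region_component] unfolding connectedin_subtopology by blast
  have rng: "\<Omega> \<subseteq> range (torus_proj \<Gamma>)"
    using connected_components_of_subset[OF region_component] unfolding topspace_subtopology topspace_torus by blast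
  let ?E = "\<lambda>b. torus_proj \<Gamma> ` {q \<in> torus_proj \<Gamma> -` \<Omega>. R q = b}"
  have "\<Omega> \<subseteq> ?E True \<union> ?E False"
  proof
    fix W assume W: "W \<in> \<Omega>"
    then obtain q where "W = torus_proj \<Gamma> q" using rng by blast
    then show "W \<in> ?E True \<union> ?E False" using W by (cases "R q") auto
  qed
  moreover have "?E True \<inter> ?E False \<inter> \<Omega> = {}"
  proof (rule equals0I)
    fix W assume "W \<in> ?E True \<inter> ?E False \<inter> \<Omega>"
    then obtain q q' where "R q" "\<not> R q'" "torus_proj \<Gamma> q = torus_proj \<Gamma> q'" by auto
    then show False using torus_proj_eqD inv by blast
  qed
  moreover have "?E True \<inter> \<Omega> \<noteq> {}" using q0 by blast
  moreover have "?E False \<inter> \<Omega> \<noteq> {}" using q1 n by blast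
  ultimately show False using con op[of True] op[of False] unfolding connectedin by blast
qed

lemma region_nonempty: obtains q where "q \<in> torus_proj \<Gamma> -` \<Omega>"
proof -
  have "\<Omega> \<noteq> {}" using nonempty_connected_components_of[OF region_component] .
  moreover have "\<Omega> \<subseteq> range (torus_proj \<Gamma>)"
    using connected_components_of_subset[OF region_component] unfolding topspace_subtopology topspace_torus by blast
  ultimately show ?thesis using that by blast
qed

lemma flat_or_reducible: "flat_on \<rho> (torus_proj \<Gamma> -` \<Omega>) \<or> reducible_on (torus_proj \<Gamma> -` \<Omega>)"
proof -
  let ?S = "torus_proj \<Gamma> -` \<Omega>"
  obtain u v where "hydro_system (a 0) (a 1) (a 2) g u v" by (rule hydro)
  then interpret h: hydro_system "a 0" "a 1" "a 2" g u v .
  show ?thesis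
  proof (cases "\<exists>y s. h.PP y s = 0 \<and> 1 + s ^ 2 = 0")
    case True
    then have "a 0 y - a 2 y + 1 = 0 \<and> a 1 y - g y = 0" for y using h.infinite_critical_value by blast
    then show ?thesis using reducible_of_divisible[OF region_open] by blast
  next
    case False
    then have nz: "\<forall>y s. h.PP y s = 0 \<longrightarrow> 1 + s ^ 2 \<noteq> 0" by blast
    from h.dichotomy[OF nz] show ?thesis
    proof
      assume "\<forall>y. d1 g y = 0 \<and> d2 g y = 0"
      then show ?thesis using flat_of_constant[OF region_open] by blast
    next
      assume re: "\<forall>y s. h.PP y s = 0 \<longrightarrow> Im (h.FF y s) = 0"
      have root: "\<exists>z. Im z \<noteq> 0 \<and> h.PP (\<Phi> q) z = 0" if "q \<in> ?S" for q
      proof -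
        have "ell q" using region_ell that by simp
        then show ?thesis unfolding ell_iff h.PP_def .
      qed
      obtain q0 where q0: "q0 \<in> ?S" by (rule region_nonempty)
      obtain z0 where z0: "Im z0 \<noteq> 0" "h.PP (\<Phi> q0) z0 = 0" using root[OF q0] by blast
      define c where "c = Re (h.FF (\<Phi> q0) z0)"
      \<comment> \<open>The nonreal critical value over \<open>q\<close> is \<open>c\<close>. As
        that value does not depend on the choice of the nonreal root, both the truth and the falsity
        of \<open>R\<close> persist nearby, and connectedness spreads it over the region.\<close>
      define R where "R = (\<lambda>q. \<exists>z. h.PP (\<Phi> q) z = 0 \<and> Im z \<noteq> 0 \<and> h.FF (\<Phi> q) z = of_real c)"
      have R0: "R q0"
        unfolding R_def using z0 re[rule_format, OF z0(2)] by (intro exI[of _ z0] conjI) (simp_all add: c_def complex_eq_iff)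
      have inv: "R (q + \<gamma>) \<longleftrightarrow> R q" if "\<gamma> \<in> \<Gamma>" for q \<gamma>
        unfolding R_def h.PP_def h.FF_def h.pp_def coeffs_periodic[OF that] ..
      have loc: "\<exists>d>0. \<forall>q'\<in>ball q d. R q' \<longleftrightarrow> R q" if q: "q \<in> ?S" for q
      proof -
        obtain z where z: "Im z \<noteq> 0" "h.PP (\<Phi> q) z = 0" using root[OF q] by blast
        obtain e where e: "e > 0" "\<And>y. y \<in> ball (\<Phi> q) e \<Longrightarrow> \<exists>w. h.PP y w = 0 \<and> Im w \<noteq> 0 \<and> h.FF y w = h.FF (\<Phi> q) z"
          using h.real_invariant_locally_constant[OF nz re z(2,1)] by blast
        have "isCont \<Phi> q" using smooth_on_continuous[OF smooth_\<Phi>] by (metis UNIV_I continuous_on_eq_continuous_at open_UNIV)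
        then obtain d where d: "d > 0" "\<And>q'. dist q' q < d \<Longrightarrow> dist (\<Phi> q') (\<Phi> q) < e"
          using e(1) unfolding continuous_at_eps_delta by blast
        have iff: "R q' \<longleftrightarrow> h.FF (\<Phi> q) z = of_real c" if q': "q' \<in> ball q d" for q'
        proof -
          have "\<Phi> q' \<in> ball (\<Phi> q) e" using d(2)[of q'] q' by (simp add: dist_commute)
          then obtain w where w: "h.PP (\<Phi> q') w = 0" "Im w \<noteq> 0" "h.FF (\<Phi> q') w = h.FF (\<Phi> q) z" using e(2) by blast
          then show ?thesis unfolding R_def using h.FF_nonreal_unique[OF re w(1,2)] by metis
        qed
        have "q \<in> ball q d" using d(1) by simp
        then show ?thesis using iff d(1) by blast
      qed
      have all: "R q" if "q \<in> ?S" for q by (rule region_connected[OF loc inv q0 R0 that])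
      have quart: "\<exists>z. Im z \<noteq> 0 \<and> c \<noteq> 1 \<and> (\<forall>m n. a 0 (\<Phi> q) * m ^ 4 + a 1 (\<Phi> q) * m ^ 3 * n + a 2 (\<Phi> q) * m ^ 2 * n ^ 2 +
          g (\<Phi> q) * m * n ^ 3 + n ^ 4 - c * (m ^ 2 + n ^ 2) ^ 2 = (1 - c) * (n ^ 2 - 2 * Re z * m * n + ((Re z)\<^sup>2 + (Im z)\<^sup>2) * m ^ 2) ^ 2)"
        if q: "q \<in> ?S" for q
      proof -
        obtain z where z: "h.PP (\<Phi> q) z = 0" "Im z \<noteq> 0" "h.FF (\<Phi> q) z = of_real c"
          using all[OF q] unfolding R_def by blast
        note s = quartic_square[OF g_pos z(2) nz[rule_format, OF z(1)] z(1)[unfolded h.PP_def] z(3)[unfolded h.FF_def h.pp_def]]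
        show ?thesis using z(2) s by blast
      qed
      have "c \<noteq> 1" using quart[OF q0] by blast
      then show ?thesis using reducible_of_real_invariant[OF region_open, of c] quart by blast
    qed
  qed
qed

end

end

theorem theorem2:
  fixes \<Gamma> :: "plane set"
    and \<rho> :: "plane \<Rightarrow> plane \<Rightarrow> plane \<Rightarrow> real"
    and F4 :: "plane \<times> plane \<Rightarrow> real"
    and \<Phi> :: "plane \<Rightarrow> plane"
    and g :: "plane \<Rightarrow> real"
    and a :: "nat \<Rightarrow> plane \<Rightarrow> real"
    and \<Omega>e :: "plane set set"
  assumes "is_lattice \<Gamma>"
    and "riemannian_metric \<rho>" and "periodic_metric \<Gamma> \<rho>"
    and "hom_poly_on 4 UNIV F4" and "periodic_on \<Gamma> UNIV F4"
    and "first_integral_on \<rho> UNIV F4"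
    and "normalized_semigeodesic \<Gamma> \<rho> 4 F4 \<Phi> g a"
    and "elliptic_region \<Gamma> \<Phi> a \<Omega>e"
  shows "flat_on \<rho> (torus_proj \<Gamma> -` \<Omega>e) \<or>
    (\<exists>F2 k1 k2 k3.
       hom_poly_on 2 (torus_proj \<Gamma> -` \<Omega>e) F2 \<and>
       periodic_on \<Gamma> (torus_proj \<Gamma> -` \<Omega>e) F2 \<and>
       first_integral_on \<rho> (torus_proj \<Gamma> -` \<Omega>e) F2 \<and>
       (\<forall>z\<in>(torus_proj \<Gamma> -` \<Omega>e) \<times> UNIV.
          F4 z = k1 * (F2 z)\<^sup>2 + 2 * k2 * hamiltonian \<rho> z * F2 z + 4 * k3 * (hamiltonian \<rho> z)\<^sup>2))"
proof -
  interpret quartic_integral \<Gamma> \<rho> F4 \<Phi> g a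
    by (rule quartic_integral.intro) (rule assms)+
  show ?thesis using flat_or_reducible[OF assms(8)] unfolding reducible_on_def .
qed

end
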